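(* Let $S$ be the Riemann sphere. All algebraic functions with branching of type $(n,n)$, $(2,2,n)$ (with $n\geq 2$ an integer), $(2,3,3)$, $(2,3,4)$, $(2,3,6)$, $(3,3,3)$, $(2,4,4)$ or $(2,2,2,2)$ are representable by radicals. Algebraic functions with branching of type $(2,3,5)$ are representable in terms of (radicals and) solutions of equations of degree $5$. That is: let $X$ be a compact connected Riemann surface and $f:X\to S$ a non-constant holomorphic map whose branching datum has one of the types listed. If the type is one of $(n,n)$, $(2,2,n)$, $(2,3,3)$, $(2,3,4)$, $(2,3,6)$, $(3,3,3)$, $(2,4,4)$, $(2,2,2,2)$, then the extension $\mathbf{C}(X)/\mathbf{C}(S)$ induced by $f$ is contained in a field obtained from $\mathbf{C}(S)$ by a finite chain of adjunctions of radicals; if the type is $(2,3,5)$, it is contained in a field obtained from $\mathbf{C}(S)$ by a finite chain of extensions each of which adjoins a radical or a root of an equation of degree $5$.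
   Context: An algebraic function of one complex variable corresponds to a branched covering $f:X\to S$ of its (compact connected) Riemann surface $X$ over the Riemann sphere, and is an element generating $\mathbf{C}(X)$ over $\mathbf{C}(S)$, where $\mathbf{C}(\cdot)$ denotes the field of meromorphic functions and $\mathbf{C}(S)$ is embedded in $\mathbf{C}(X)$ by $f^*$. The order of branching of $f$ at $x_0$ is the integer $k\ge1$ such that in suitable local coordinates around $x_0$ and $f(x_0)$ the map is $x\mapsto x^k$. The branching datum of $f$ is the collection of its critical values $p_1,\ldots,p_b\in S$, each $p_i$ taken with the least common multiple $n_i\ge 2$ of the branching orders of $f$ at all preimages of $p_i$ (equivalently the order of the local monodromy permutation around $p_i$). It has type $(n_1,\ldots,n_b)$ (order of entries irrelevant, location of the points arbitrary). A radical over a field $K$ is an element $u$ of an extension of $K$ with $u^m\in K$ for some integer $m\ge1$. *)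

theory Defs
  imports
    "HOL-Complex_Analysis.Complex_Analysis"
    "HOL-Algebra.Algebra"
    "HOL-Library.Multiset"
begin

section \<open>Riemann surfaces\<close>

record 'a surface =
  surface_top :: "'a topology"
  surface_atlas :: "('a set \<times> ('a \<Rightarrow> complex)) set"

abbreviation surface_points :: "'a surface \<Rightarrow> 'a set" where
  "surface_points M \<equiv> topspace (surface_top M)"

text \<open>A chart is a homeomorphism from an open set onto an open subset of the plane; the values
  of \<open>\<phi>\<close> outside \<open>U\<close> are irrelevant.\<close>

definition complex_chart :: "'a topology \<Rightarrow> 'a set \<Rightarrow> ('a \<Rightarrow> complex) \<Rightarrow> bool" where
  "complex_chart T U \<phi> \<longleftrightarrow> openin T U \<and> open (\<phi> ` U) \<and>
     homeomorphic_map (subtopology T U) (top_of_set (\<phi> ` U)) \<phi>"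

definition holomorphic_transition ::
    "'a set \<Rightarrow> ('a \<Rightarrow> complex) \<Rightarrow> 'a set \<Rightarrow> ('a \<Rightarrow> complex) \<Rightarrow> bool" where
  "holomorphic_transition U \<phi> V \<psi> \<longleftrightarrow> (\<psi> \<circ> inv_into U \<phi>) holomorphic_on \<phi> ` (U \<inter> V)"

text \<open>Connectedness and compactness are stated separately where they are needed.\<close>

definition riemann_surface :: "'a surface \<Rightarrow> bool" where
  "riemann_surface M \<longleftrightarrow>
     Hausdorff_space (surface_top M) \<and>
     surface_points M = \<Union> (fst ` surface_atlas M) \<and>
     (\<forall>(U, \<phi>) \<in> surface_atlas M. complex_chart (surface_top M) U \<phi>) \<and>
     (\<forall>(U, \<phi>) \<in> surface_atlas M. \<forall>(V, \<psi>) \<in> surface_atlas M. holomorphic_transition U \<phi> V \<psi>)"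

text \<open>Local coordinates centred at a point may be taken from the maximal atlas.\<close>

definition local_coordinate :: "'a surface \<Rightarrow> 'a \<Rightarrow> 'a set \<Rightarrow> ('a \<Rightarrow> complex) \<Rightarrow> bool" where
  "local_coordinate M x U \<phi> \<longleftrightarrow>
     complex_chart (surface_top M) U \<phi> \<and> x \<in> U \<and> \<phi> x = 0 \<and>
     (\<forall>(V, \<psi>) \<in> surface_atlas M. holomorphic_transition U \<phi> V \<psi> \<and> holomorphic_transition V \<psi> U \<phi>)"

definition holomorphic_map :: "'a surface \<Rightarrow> 'b surface \<Rightarrow> ('a \<Rightarrow> 'b) \<Rightarrow> bool" where
  "holomorphic_map M N f \<longleftrightarrow>
     continuous_map (surface_top M) (surface_top N) f \<and>
     (\<forall>(U, \<phi>) \<in> surface_atlas M. \<forall>(V, \<psi>) \<in> surface_atlas N.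
        (\<psi> \<circ> f \<circ> inv_into U \<phi>) holomorphic_on \<phi> ` (U \<inter> f -` V))"

text \<open>The Riemann sphere is the one-point compactification of the plane, with \<open>None\<close> as the
  point at infinity and the coordinates \<open>z\<close> and \<open>1 / z\<close>.\<close>

definition riemann_sphere :: "complex option surface" where
  "riemann_sphere =
     \<lparr> surface_top = Alexandroff_compactification euclidean,
       surface_atlas =
         {(range Some, the),
          (- {Some 0}, \<lambda>p. case p of None \<Rightarrow> 0 | Some z \<Rightarrow> 1 / z)} \<rparr>"


section \<open>The field of meromorphic functions\<close>

text \<open>As in \<^const>\<open>nicely_meromorphic_on\<close>, a meromorphic function is represented by a
  complex-valued function that takes the value \<open>0\<close> at its poles and has no removable
  singularities; hence it is determined by its values off any closed discrete set. Outside the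
  surface it is \<^const>\<open>undefined\<close>, so that equal meromorphic functions are equal in HOL.\<close>

definition meromorphic_functions :: "'a surface \<Rightarrow> ('a \<Rightarrow> complex) set" where
  "meromorphic_functions M =
     {g \<in> extensional (surface_points M).
        \<forall>(U, \<phi>) \<in> surface_atlas M. (g \<circ> inv_into U \<phi>) nicely_meromorphic_on \<phi> ` U}"

definition eq_off_discrete :: "'a surface \<Rightarrow> ('a \<Rightarrow> complex) \<Rightarrow> ('a \<Rightarrow> complex) \<Rightarrow> bool" where
  "eq_off_discrete M g h \<longleftrightarrow>
     surface_top M derived_set_of {x \<in> surface_points M. g x \<noteq> h x} = {}"

text \<open>Sums and products are formed pointwise away from the poles and then extended
  meromorphically.\<close>

definition meromorphic_field :: "'a surface \<Rightarrow> ('a \<Rightarrow> complex) ring" where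
  "meromorphic_field M =
     \<lparr> carrier = meromorphic_functions M,
       mult = (\<lambda>g h. THE k. k \<in> meromorphic_functions M \<and> eq_off_discrete M k (\<lambda>x. g x * h x)),
       one = (\<lambda>x \<in> surface_points M. 1),
       ring.zero = (\<lambda>x \<in> surface_points M. 0),
       add = (\<lambda>g h. THE k. k \<in> meromorphic_functions M \<and> eq_off_discrete M k (\<lambda>x. g x + h x)) \<rparr>"

text \<open>The image of \<open>f\<^sup>*\<close>, where \<open>f\<^sup>* g = g \<circ> f\<close>.\<close>

definition pullback_field :: "'a surface \<Rightarrow> 'b surface \<Rightarrow> ('a \<Rightarrow> 'b) \<Rightarrow> ('a \<Rightarrow> complex) set" where
  "pullback_field M N f =
     (\<lambda>g. compose (surface_points M) g f) ` carrier (meromorphic_field N)"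


section \<open>Branching\<close>

definition has_branching_order :: "'a surface \<Rightarrow> 'b surface \<Rightarrow> ('a \<Rightarrow> 'b) \<Rightarrow> 'a \<Rightarrow> nat \<Rightarrow> bool" where
  "has_branching_order M N f x k \<longleftrightarrow> 1 \<le> k \<and>
     (\<exists>U \<phi> V \<psi>. local_coordinate M x U \<phi> \<and> local_coordinate N (f x) V \<psi> \<and>
        f ` U \<subseteq> V \<and> (\<forall>y \<in> U. \<psi> (f y) = \<phi> y ^ k))"

definition branching_order :: "'a surface \<Rightarrow> 'b surface \<Rightarrow> ('a \<Rightarrow> 'b) \<Rightarrow> 'a \<Rightarrow> nat" where
  "branching_order M N f x = (THE k. has_branching_order M N f x k)"

definition critical_values :: "'a surface \<Rightarrow> 'b surface \<Rightarrow> ('a \<Rightarrow> 'b) \<Rightarrow> 'b set" where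
  "critical_values M N f = f ` {x \<in> surface_points M. 2 \<le> branching_order M N f x}"

definition branching_index :: "'a surface \<Rightarrow> 'b surface \<Rightarrow> ('a \<Rightarrow> 'b) \<Rightarrow> 'b \<Rightarrow> nat" where
  "branching_index M N f p = Lcm (branching_order M N f ` {x \<in> surface_points M. f x = p})"

text \<open>For a non-constant map on a compact connected surface there are only finitely many
  critical values, so \<^const>\<open>mset_set\<close> loses nothing.\<close>

definition branching_type :: "'a surface \<Rightarrow> 'b surface \<Rightarrow> ('a \<Rightarrow> 'b) \<Rightarrow> nat multiset" where
  "branching_type M N f = image_mset (branching_index M N f) (mset_set (critical_values M N f))"


section \<open>Towers of adjunctions\<close>

definition radical_over :: "'l ring \<Rightarrow> 'l set \<Rightarrow> 'l \<Rightarrow> bool" where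
  "radical_over L F u \<longleftrightarrow> u \<in> carrier L \<and> (\<exists>m::nat. 1 \<le> m \<and> u [^]\<^bsub>L\<^esub> m \<in> F)"

definition quintic_root_over :: "'l ring \<Rightarrow> 'l set \<Rightarrow> 'l \<Rightarrow> bool" where
  "quintic_root_over L F u \<longleftrightarrow> u \<in> carrier L \<and>
     (\<exists>q \<in> carrier (univ_poly L F). Polynomials.degree q = 5 \<and> ring.eval L q u = \<zero>\<^bsub>L\<^esub>)"

text \<open>\<open>adjunction_tower L P K F\<close>: inside \<open>L\<close>, the field \<open>F\<close> arises from \<open>K\<close> by finitely many
  adjunctions, each of an element satisfying \<open>P\<close> over the field reached so far.\<close>

inductive adjunction_tower ::
    "'l ring \<Rightarrow> ('l set \<Rightarrow> 'l \<Rightarrow> bool) \<Rightarrow> 'l set \<Rightarrow> 'l set \<Rightarrow> bool"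
  for L P K where
  base: "adjunction_tower L P K K"
| adjoin: "adjunction_tower L P K F \<Longrightarrow> P F u \<Longrightarrow>
     adjunction_tower L P K (generate_field L (insert u F))"

text \<open>The type of the overfield \<open>L\<close> is that of the algebraic closure constructed in
  \<^theory>\<open>HOL-Algebra.Algebraic_Closure\<close>, which is large enough to hold every algebraic
  extension of \<open>\<complex>(M)\<close>. The map \<open>\<iota>\<close> embeds \<open>\<complex>(M)\<close> into \<open>L\<close>; it is injective since its
  domain is a field.\<close>

definition contained_in_tower ::
    "(((('a \<Rightarrow> complex) list \<times> nat) multiset \<Rightarrow> ('a \<Rightarrow> complex)) ring \<Rightarrow>
      ((('a \<Rightarrow> complex) list \<times> nat) multiset \<Rightarrow> ('a \<Rightarrow> complex)) set \<Rightarrow>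
      ((('a \<Rightarrow> complex) list \<times> nat) multiset \<Rightarrow> ('a \<Rightarrow> complex)) \<Rightarrow> bool) \<Rightarrow>
     'a surface \<Rightarrow> 'b surface \<Rightarrow> ('a \<Rightarrow> 'b) \<Rightarrow> bool" where
  "contained_in_tower P M N f \<longleftrightarrow>
     (\<exists>L \<iota> F. field L \<and> \<iota> \<in> ring_hom (meromorphic_field M) L \<and>
        adjunction_tower L (P L) (\<iota> ` pullback_field M N f) F \<and>
        \<iota> ` carrier (meromorphic_field M) \<subseteq> F)"

definition representable_by_radicals :: "'a surface \<Rightarrow> 'b surface \<Rightarrow> ('a \<Rightarrow> 'b) \<Rightarrow> bool" where
  "representable_by_radicals = contained_in_tower radical_over"

definition representable_by_radicals_and_quintics ::
    "'a surface \<Rightarrow> 'b surface \<Rightarrow> ('a \<Rightarrow> 'b) \<Rightarrow> bool" where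
  "representable_by_radicals_and_quintics =
     contained_in_tower (\<lambda>L F u. radical_over L F u \<or> quintic_root_over L F u)"

end

theory Submission
  imports Defs
begin

text \<open>For each of the listed types there is a map \<open>h\<close> of the plane (or of the sphere) onto \<open>S\<close> whose order at
  every point over \<open>p\<close> is a multiple of the branching index of \<open>p\<close>: the quotient by a finite rotation group
  in the spherical cases and by a crystallographic group in the Euclidean ones. The plane being simply
  connected, \<open>h\<close> lifts through \<open>f\<close> to a map \<open>c\<close> with \<open>f \<circ> c = h\<close>, and \<open>u \<mapsto> u \<circ> c\<close> embeds \<open>\<complex>(X)\<close> into the
  meromorphic functions on the plane. In the spherical cases the image consists of rational functions of
  \<open>z\<close>, and \<open>z\<close> is reached from \<open>h\<close> by radicals, together with a quintic for the icosahedron. In the Euclidean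
  cases the image is invariant under a subgroup of finite index of the lattice of periods of \<open>h\<close>, and
  Kummer theory yields the radicals, first for the rotations and then for the translations.\<close>


section \<open>Towers inside a field\<close>

text \<open>Both \<open>h\<close> and \<open>f\<close> branch, so the lift is found by continuation
  over discs: near a point \<open>h\<close> is an \<open>n\<close>-th power \<open>\<eta>^n\<close>,
  \<open>f\<close> is \<open>\<zeta>^k\<close> with \<open>k\<close> dividing \<open>n\<close>, and
  the maps \<open>\<zeta> = \<omega> * \<eta>^(n/k)\<close> with \<open>\<omega>^k = 1\<close> are
  the local lifts. Since a multiple of the branching index is enough, there is freedom in the choice
  of \<open>h\<close>. In the spherical cases it is spent on the normalisation
  \<open>h (1 / t) = h t\<close>, which turns the behaviour of the lift at infinity into that of a
  lift at \<open>0\<close>, so that the plane suffices as a domain and \<open>u \<circ> c\<close>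
  becomes rational. In the Euclidean cases one differential equation takes the place of elliptic
  functions and treats the four types at once, for any position of the branch points; two points of
  a fibre of \<open>h\<close> are related by an isometry \<open>z \<mapsto> \<omega> * z + b\<close>
  that preserves \<open>h\<close>, and these isometries are the automorphisms of Kummer theory. All
  fields are computed in one type \<open>mero\<close> of class \<open>field\<close>. As the theorem
  prescribes the type of the overfield in terms of the points of the surface, the result is finally
  carried there by an injection, which exists because the surface has at least as many points as the
  plane.\<close>

definition field_closed :: "'l::field set \<Rightarrow> bool" where
  "field_closed S \<longleftrightarrow> 0 \<in> S \<and> 1 \<in> S \<and> (\<forall>a\<in>S. \<forall>b\<in>S. a + b \<in> S \<and> a * b \<in> S) \<and>
     (\<forall>a\<in>S. - a \<in> S \<and> inverse a \<in> S)"

lemma field_closedD: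
  assumes "field_closed S"
  shows "0 \<in> S" "1 \<in> S" "a \<in> S \<Longrightarrow> b \<in> S \<Longrightarrow> a + b \<in> S" "a \<in> S \<Longrightarrow> b \<in> S \<Longrightarrow> a * b \<in> S"
    "a \<in> S \<Longrightarrow> - a \<in> S" "a \<in> S \<Longrightarrow> inverse a \<in> S"
    "a \<in> S \<Longrightarrow> b \<in> S \<Longrightarrow> a - b \<in> S" "a \<in> S \<Longrightarrow> b \<in> S \<Longrightarrow> a / b \<in> S"
  using assms unfolding field_closed_def diff_conv_add_uminus divide_inverse by blast+

lemma field_closed_power: "field_closed S \<Longrightarrow> a \<in> S \<Longrightarrow> a ^ n \<in> S"
  by (induction n) (auto intro: field_closedD)

lemma field_closed_sum:
  "field_closed S \<Longrightarrow> (\<And>i. i \<in> I \<Longrightarrow> g i \<in> S) \<Longrightarrow> sum g I \<in> S"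
  by (induction I rule: infinite_finite_induct) (auto intro: field_closedD)

definition field_hull :: "'l::field set \<Rightarrow> 'l set" where
  "field_hull A = \<Inter> {S. field_closed S \<and> A \<subseteq> S}"

lemma field_closed_hull: "field_closed (field_hull A)"
  unfolding field_hull_def field_closed_def by auto

lemma field_hull_incl: "a \<in> A \<Longrightarrow> a \<in> field_hull A"
  unfolding field_hull_def by auto

lemma field_hull_least: "field_closed S \<Longrightarrow> A \<subseteq> S \<Longrightarrow> field_hull A \<subseteq> S"
  unfolding field_hull_def by auto

text \<open>The flag \<open>q\<close> permits quintic steps, so that the two kinds of tower in the
  theorem share one relation and one transport lemma. The quintic is monic with its coefficients
  listed, the shape in which Klein's resolvent appears.\<close>

inductive root_tower :: "bool \<Rightarrow> 'l::field set \<Rightarrow> 'l set \<Rightarrow> bool" for q K where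
  tower_refl: "root_tower q K K"
| tower_radical: "root_tower q K S \<Longrightarrow> 1 \<le> m \<Longrightarrow> u ^ m \<in> S \<Longrightarrow> root_tower q K (field_hull (insert u S))"
| tower_quintic: "root_tower q K S \<Longrightarrow> q \<Longrightarrow> {c0, c1, c2, c3, c4} \<subseteq> S \<Longrightarrow>
     u ^ 5 + c4 * u ^ 4 + c3 * u ^ 3 + c2 * u ^ 2 + c1 * u + c0 = 0 \<Longrightarrow>
     root_tower q K (field_hull (insert u S))"

lemma root_tower_trans:
  assumes "root_tower q S T" "root_tower q K S"
  shows "root_tower q K T"
  using assms by (induction) (auto intro: root_tower.intros)

lemma root_tower_mono: "root_tower q K S \<Longrightarrow> K \<subseteq> S"
  by (induction rule: root_tower.induct) (auto intro: field_hull_incl)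

lemma adjoin_radical:
  assumes "root_tower q K S" "1 \<le> m" "u ^ m \<in> S"
  obtains T where "root_tower q K T" "field_closed T" "S \<subseteq> T" "u \<in> T"
  by (rule that[of "field_hull (insert u S)"])
     (use assms in \<open>auto intro: root_tower.tower_radical field_closed_hull field_hull_incl\<close>)

lemma adjoin_radicals:
  assumes "root_tower q K S" "field_closed S" "finite I" "\<And>i. i \<in> I \<Longrightarrow> 1 \<le> m i \<and> u i ^ m i \<in> S"
  obtains T where "root_tower q K T" "field_closed T" "S \<subseteq> T" "u ` I \<subseteq> T"
proof -
  have "\<exists>T. root_tower q K T \<and> field_closed T \<and> S \<subseteq> T \<and> u ` I \<subseteq> T"
    using assms(3,4)
  proof (induction I rule: finite_induct)
    case empty
    then show ?case using assms by auto
  next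
    case (insert i I)
    then obtain T where T: "root_tower q K T" "field_closed T" "S \<subseteq> T" "u ` I \<subseteq> T" by auto
    from insert.prems[of i] have "1 \<le> m i" "u i ^ m i \<in> T" using T by auto
    from adjoin_radical[OF T(1) this] obtain T' where
      "root_tower q K T'" "field_closed T'" "T \<subseteq> T'" "u i \<in> T'" by blast
    with T show ?case by (intro exI[of _ T']) auto
  qed
  with that show thesis by blast
qed

subsection \<open>Transport along an injection\<close>

text \<open>The theorem speaks of \<open>ring\<close> records on a prescribed type, while the
  calculations take place in a type of class \<open>field\<close>. An injection \<open>j\<close>
  turns the one into the other, with \<open>range j\<close> as carrier.\<close>

definition transport_ring :: "('l::field \<Rightarrow> 'x) \<Rightarrow> 'x ring" where
  "transport_ring j =
     \<lparr> carrier = range j, mult = (\<lambda>a b. j (inv_into UNIV j a * inv_into UNIV j b)), one = j 1,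
       ring.zero = j 0, add = (\<lambda>a b. j (inv_into UNIV j a + inv_into UNIV j b)) \<rparr>"

context
  fixes j :: "'l::field \<Rightarrow> 'x"
  assumes j: "inj j"
begin

lemma transport_simps:
  "carrier (transport_ring j) = range j"
  "j a \<otimes>\<^bsub>transport_ring j\<^esub> j b = j (a * b)"
  "j a \<oplus>\<^bsub>transport_ring j\<^esub> j b = j (a + b)"
  "\<one>\<^bsub>transport_ring j\<^esub> = j 1" "\<zero>\<^bsub>transport_ring j\<^esub> = j 0"
  using j by (auto simp: transport_ring_def)

lemma field_transport: "field (transport_ring j)"
proof (rule cring.cring_fieldI2)
  show "cring (transport_ring j)"
  proof (rule cringI)
    show "abelian_group (transport_ring j)"
    proof (rule abelian_groupI)
      fix x assume "x \<in> carrier (transport_ring j)"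
      then obtain a where "x = j a" by (auto simp: transport_simps)
      then show "\<exists>y\<in>carrier (transport_ring j). y \<oplus>\<^bsub>transport_ring j\<^esub> x = \<zero>\<^bsub>transport_ring j\<^esub>"
        by (intro bexI[of _ "j (- a)"]) (auto simp: transport_simps)
    qed (auto simp: transport_simps add.assoc, simp add: add.commute)
    show "Group.comm_monoid (transport_ring j)"
      by (rule comm_monoidI) (auto simp: transport_simps mult.assoc, simp add: mult.commute)
  qed (auto simp: transport_simps distrib_right)
  show "\<zero>\<^bsub>transport_ring j\<^esub> \<noteq> \<one>\<^bsub>transport_ring j\<^esub>"
    using j by (auto simp: transport_simps inj_eq)
  fix x assume "x \<in> carrier (transport_ring j)" "x \<noteq> \<zero>\<^bsub>transport_ring j\<^esub>"
  then obtain a where "x = j a" "a \<noteq> 0" by (auto simp: transport_simps)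
  then show "\<exists>b\<in>carrier (transport_ring j). x \<otimes>\<^bsub>transport_ring j\<^esub> b = \<one>\<^bsub>transport_ring j\<^esub>"
    by (intro bexI[of _ "j (inverse a)"]) (auto simp: transport_simps)
qed

interpretation T: field "transport_ring j"
  by (rule field_transport)

lemma transport_a_inv: "\<ominus>\<^bsub>transport_ring j\<^esub> j a = j (- a)"
  by (rule T.sum_zero_eq_neg[symmetric]) (auto simp: transport_simps)

lemma transport_m_inv: "a \<noteq> 0 \<Longrightarrow> inv\<^bsub>transport_ring j\<^esub> j a = j (inverse a)"
  by (rule T.comm_inv_char) (auto simp: transport_simps)

lemma transport_pow: "j a [^]\<^bsub>transport_ring j\<^esub> (n::nat) = j (a ^ n)"
  by (induction n) (auto simp: transport_simps mult.commute)

text \<open>Both sides are least among the subfields that contain the generators: one inclusion is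
  the induction over \<open>generate_field\<close>, the other holds because the preimage of the
  generated field under \<open>j\<close> is \<open>field_closed\<close>.\<close>

lemma generate_field_transport:
  "generate_field (transport_ring j) (j ` A) = j ` field_hull A"
proof
  note hull = field_closedD[OF field_closed_hull[of A]]
  have "x \<in> j ` field_hull A" if "x \<in> generate_field (transport_ring j) (j ` A)" for x
    using that
  proof induction
    case one
    then show ?case using hull(2) by (simp add: transport_simps)
  next
    case (incl h)
    then show ?case using field_hull_incl by blast
  next
    case (a_inv h)
    then obtain a where "h = j a" "a \<in> field_hull A" by blast
    then show ?case using hull(5)[of a] by (simp add: transport_a_inv)
  next
    case (m_inv h)
    then obtain a where a: "h = j a" "a \<in> field_hull A" by blast
    with m_inv(2) have "a \<noteq> 0" by (auto simp: transport_simps)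
    with a show ?case using hull(6)[of a] by (simp add: transport_m_inv)
  next
    case (eng_add h1 h2)
    then obtain a b where "h1 = j a" "a \<in> field_hull A" "h2 = j b" "b \<in> field_hull A" by blast
    then show ?case using hull(3)[of a b] by (simp add: transport_simps)
  next
    case (eng_mult h1 h2)
    then obtain a b where "h1 = j a" "a \<in> field_hull A" "h2 = j b" "b \<in> field_hull A" by blast
    then show ?case using hull(4)[of a b] by (simp add: transport_simps)
  qed
  then show "generate_field (transport_ring j) (j ` A) \<subseteq> j ` field_hull A" by blast
  let ?S = "{a. j a \<in> generate_field (transport_ring j) (j ` A)}"
  have "0 \<in> ?S"
    using T.zero_in_generate[of "j ` A"] by (simp add: transport_simps)
  moreover have "- a \<in> ?S" if "a \<in> ?S" for a
    using generate_field.a_inv[of "j a" "transport_ring j"] that by (simp add: transport_a_inv)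
  moreover have "a + b \<in> ?S" if "a \<in> ?S" "b \<in> ?S" for a b
    using generate_field.eng_add[of "j a" "transport_ring j" _ "j b"] that by (simp add: transport_simps)
  moreover have "a * b \<in> ?S" if "a \<in> ?S" "b \<in> ?S" for a b
    using generate_field.eng_mult[of "j a" "transport_ring j" _ "j b"] that by (simp add: transport_simps)
  \<comment> \<open>The rule \<open>m_inv\<close> excludes zero; for \<open>a = 0\<close> the value
    \<open>inverse 0 = 0\<close> is already known to lie in the set.\<close>
  moreover have "inverse a \<in> ?S" if "a \<in> ?S" for a
    using generate_field.m_inv[of "j a" "transport_ring j"] that j \<open>0 \<in> ?S\<close>
    by (cases "a = 0") (auto simp: transport_m_inv transport_simps inj_eq)
  moreover have "1 \<in> ?S"
    using generate_field.one[of "transport_ring j"] by (simp add: transport_simps)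
  ultimately have "field_closed ?S" by (simp add: field_closed_def)
  moreover have "A \<subseteq> ?S" by (auto intro: generate_field.incl)
  ultimately have "field_hull A \<subseteq> ?S" by (rule field_hull_least)
  then show "j ` field_hull A \<subseteq> generate_field (transport_ring j) (j ` A)" by blast
qed

lemma radical_over_transport:
  "1 \<le> m \<Longrightarrow> u ^ m \<in> S \<Longrightarrow> radical_over (transport_ring j) (j ` S) (j u)"
  unfolding radical_over_def by (auto simp: transport_simps transport_pow intro!: exI[of _ m])

lemma quintic_root_over_transport:
  assumes "1 \<in> S" "{c0, c1, c2, c3, c4} \<subseteq> S"
    and "u ^ 5 + c4 * u ^ 4 + c3 * u ^ 3 + c2 * u ^ 2 + c1 * u + c0 = 0"
  shows "quintic_root_over (transport_ring j) (j ` S) (j u)"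
  unfolding quintic_root_over_def
proof (intro conjI bexI)
  \<comment> \<open>A polynomial of \<open>univ_poly\<close> is the list of its coefficients with
    the leading one first.\<close>
  let ?q = "map j [1, c4, c3, c2, c1, c0]"
  show "j u \<in> carrier (transport_ring j)" by (simp add: transport_simps)
  show "?q \<in> carrier (univ_poly (transport_ring j) (j ` S))"
    using assms(1,2) j by (auto simp: univ_poly_def polynomial_def transport_simps inj_eq)
  show "Polynomials.degree ?q = 5" by simp
  show "ring.eval (transport_ring j) ?q (j u) = \<zero>\<^bsub>transport_ring j\<^esub>"
    using assms(3) by (simp add: T.eval.simps transport_simps transport_pow algebra_simps
        eval_nat_numeral)
qed

text \<open>The clause \<open>1 \<in> S\<close> travels with the induction because a quintic step
  needs the leading coefficient \<open>1\<close> of its monic polynomial in the field reached so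
  far.\<close>

lemma adjunction_tower_transport:
  assumes "root_tower q K S" "1 \<in> K"
    and rad: "\<And>F u. radical_over (transport_ring j) F u \<Longrightarrow> P F u"
    and quint: "\<And>F u. q \<Longrightarrow> quintic_root_over (transport_ring j) F u \<Longrightarrow> P F u"
  shows "adjunction_tower (transport_ring j) P (j ` K) (j ` S) \<and> 1 \<in> S"
  using assms(1)
proof induction
  case tower_refl
  then show ?case using assms(2) by (auto intro: adjunction_tower.base)
next
  case (tower_radical S m u)
  have "generate_field (transport_ring j) (insert (j u) (j ` S)) = j ` field_hull (insert u S)"
    using generate_field_transport[of "insert u S"] by simp
  with tower_radical show ?case
    using adjunction_tower.adjoin[of "transport_ring j" P "j ` K" "j ` S" "j u"]
      rad[OF radical_over_transport[of m u S]] field_closedD(2)[OF field_closed_hull] by auto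
next
  case (tower_quintic S c0 c1 c2 c3 c4 u)
  have gen: "generate_field (transport_ring j) (insert (j u) (j ` S)) = j ` field_hull (insert u S)"
    using generate_field_transport[of "insert u S"] by simp
  have "P (j ` S) (j u)"
    using tower_quintic.hyps tower_quintic.IH by (intro quint quintic_root_over_transport) blast+
  then have "adjunction_tower (transport_ring j) P (j ` K) (generate_field (transport_ring j) (insert (j u) (j ` S)))"
    using tower_quintic.IH by (intro adjunction_tower.adjoin) blast+
  then show ?case
    unfolding gen using field_closedD(2)[OF field_closed_hull] by blast
qed

end

section \<open>The field of meromorphic functions on the plane\<close>

text \<open>Comparison on punctured neighbourhoods ignores the values on a discrete set. Sums,
  products and quotients can therefore be formed pointwise, whatever values arise at the poles, and
  the quotient is a field.\<close>

definition mero_eq :: "(complex \<Rightarrow> complex) \<Rightarrow> (complex \<Rightarrow> complex) \<Rightarrow> bool" where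
  "mero_eq f g \<longleftrightarrow> f meromorphic_on UNIV \<and> g meromorphic_on UNIV \<and>
     (\<forall>z. eventually (\<lambda>w. f w = g w) (at z))"

lemma mero_eq_refl: "f meromorphic_on UNIV \<Longrightarrow> mero_eq f f"
  by (auto simp: mero_eq_def)

lemma mero_eqI: "f meromorphic_on UNIV \<Longrightarrow> (\<And>z. f z = g z) \<Longrightarrow> mero_eq f g"
  by (metis ext mero_eq_refl)

quotient_type mero = "complex \<Rightarrow> complex" / partial: mero_eq
proof (rule part_equivpI)
  show "\<exists>f. mero_eq f f" by (intro exI[of _ "\<lambda>_. 0"] mero_eq_refl) auto
  show "symp mero_eq" by (auto simp: symp_def mero_eq_def eq_commute)
  show "transp mero_eq"
  proof (rule transpI)
    fix f g h assume "mero_eq f g" "mero_eq g h"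
    then have "eventually (\<lambda>w. f w = h w) (at z)" for z
      unfolding mero_eq_def using eventually_elim2[of "\<lambda>w. f w = g w" "at z" "\<lambda>w. g w = h w"] by simp
    with \<open>mero_eq f g\<close> \<open>mero_eq g h\<close> show "mero_eq f h" by (auto simp: mero_eq_def)
  qed
qed

lemma mero_eq_lift2:
  assumes "mero_eq f f'" "mero_eq g g'"
    and "(\<lambda>z. F (f z) (g z)) meromorphic_on UNIV" "(\<lambda>z. F (f' z) (g' z)) meromorphic_on UNIV"
  shows "mero_eq (\<lambda>z. F (f z) (g z)) (\<lambda>z. F (f' z) (g' z))"
proof -
  have "eventually (\<lambda>w. F (f w) (g w) = F (f' w) (g' w)) (at z)" for z
    using eventually_elim2[of "\<lambda>w. f w = f' w" "at z" "\<lambda>w. g w = g' w"] assms(1,2)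
    by (simp add: mero_eq_def)
  with assms(3,4) show ?thesis by (simp add: mero_eq_def)
qed

text \<open>Identity theorem on the connected plane: a meromorphic function is either constantly
  zero or different from zero off a sparse set. This provides the inverses in
  \<open>mero\<close>.\<close>

lemma mero_pole_or_nonzero:
  assumes "f meromorphic_on UNIV" "\<not> mero_eq f (\<lambda>_. 0)"
  shows "eventually (\<lambda>w. f w \<noteq> 0) (at z)"
  using meromorphic_imp_constant_or_avoid[OF assms(1), of 0] assms
  by (auto simp: mero_eq_def eventually_cosparse_open_eq)

instantiation mero :: field
begin

lift_definition zero_mero :: mero is "\<lambda>_. 0" by (auto intro: mero_eq_refl)
lift_definition one_mero :: mero is "\<lambda>_. 1" by (auto intro: mero_eq_refl)
lift_definition plus_mero :: "mero \<Rightarrow> mero \<Rightarrow> mero" is "\<lambda>f g z. f z + g z"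
  by (rule mero_eq_lift2[where F = "(+)"]) (auto simp: mero_eq_def intro!: meromorphic_intros)
lift_definition minus_mero :: "mero \<Rightarrow> mero \<Rightarrow> mero" is "\<lambda>f g z. f z - g z"
  by (rule mero_eq_lift2[where F = "(-)"]) (auto simp: mero_eq_def intro!: meromorphic_intros)
lift_definition uminus_mero :: "mero \<Rightarrow> mero" is "\<lambda>f z. - f z"
  by (auto simp: mero_eq_def intro!: meromorphic_intros)
lift_definition times_mero :: "mero \<Rightarrow> mero \<Rightarrow> mero" is "\<lambda>f g z. f z * g z"
  by (rule mero_eq_lift2[where F = "(*)"]) (auto simp: mero_eq_def intro!: meromorphic_intros)
lift_definition divide_mero :: "mero \<Rightarrow> mero \<Rightarrow> mero" is "\<lambda>f g z. f z / g z"
  by (rule mero_eq_lift2[where F = "(/)"]) (auto simp: mero_eq_def intro!: meromorphic_intros)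
lift_definition inverse_mero :: "mero \<Rightarrow> mero" is "\<lambda>f z. inverse (f z)"
  by (auto simp: mero_eq_def intro!: meromorphic_intros)

instance
proof
  fix a b c :: mero
  show "a + b + c = a + (b + c)"
    by (transfer, rule mero_eqI) (auto simp: mero_eq_def algebra_simps intro: meromorphic_on_add meromorphic_on_mult meromorphic_on_diff meromorphic_on_uminus)
  show "a * b * c = a * (b * c)"
    by (transfer, rule mero_eqI) (auto simp: mero_eq_def algebra_simps intro: meromorphic_on_add meromorphic_on_mult meromorphic_on_diff meromorphic_on_uminus)
  show "(a + b) * c = a * c + b * c"
    by (transfer, rule mero_eqI) (auto simp: mero_eq_def algebra_simps intro: meromorphic_on_add meromorphic_on_mult meromorphic_on_diff meromorphic_on_uminus)
  show "a + b = b + a"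
    by (transfer, rule mero_eqI) (auto simp: mero_eq_def algebra_simps intro: meromorphic_on_add meromorphic_on_mult meromorphic_on_diff meromorphic_on_uminus)
  show "a * b = b * a"
    by (transfer, rule mero_eqI) (auto simp: mero_eq_def algebra_simps intro: meromorphic_on_add meromorphic_on_mult meromorphic_on_diff meromorphic_on_uminus)
  show "0 + a = a"
    by (transfer, rule mero_eqI) (auto simp: mero_eq_def algebra_simps intro: meromorphic_on_add meromorphic_on_mult meromorphic_on_diff meromorphic_on_uminus)
  show "- a + a = 0"
    by (transfer, rule mero_eqI) (auto simp: mero_eq_def algebra_simps intro: meromorphic_on_add meromorphic_on_mult meromorphic_on_diff meromorphic_on_uminus)
  show "a - b = a + - b"
    by (transfer, rule mero_eqI) (auto simp: mero_eq_def algebra_simps intro: meromorphic_on_add meromorphic_on_mult meromorphic_on_diff meromorphic_on_uminus)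
  show "1 * a = a"
    by (transfer, rule mero_eqI) (auto simp: mero_eq_def algebra_simps intro: meromorphic_on_add meromorphic_on_mult meromorphic_on_diff meromorphic_on_uminus)
  show "(0::mero) \<noteq> 1"
    by transfer (auto simp: mero_eq_def)
  show "inverse (0::mero) = 0"
    by transfer (auto simp: mero_eq_def)
  show "a div b = a * inverse b"
  proof transfer
    fix f g assume "mero_eq f f" "mero_eq g g"
    then have "(\<lambda>z. f z * inverse (g z)) meromorphic_on UNIV"
      by (auto simp: mero_eq_def intro!: meromorphic_on_mult meromorphic_on_inverse)
    then show "mero_eq (\<lambda>z. f z / g z) (\<lambda>z. f z * inverse (g z))"
      unfolding divide_inverse by (rule mero_eq_refl)
  qed
  show "inverse a * a = 1" if "a \<noteq> 0"
    using that
  proof transfer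
    fix f assume "mero_eq f f" "\<not> mero_eq f (\<lambda>_. 0)"
    then have f: "f meromorphic_on UNIV" "\<And>z. eventually (\<lambda>w. f w \<noteq> 0) (at z)"
      using mero_pole_or_nonzero by (auto simp: mero_eq_def)
    have "eventually (\<lambda>w. inverse (f w) * f w = 1) (at z)" for z
      using f(2)[of z] by eventually_elim simp
    with f(1) show "mero_eq (\<lambda>z. inverse (f z) * f z) (\<lambda>_. 1)"
      by (auto simp: mero_eq_def intro!: meromorphic_intros)
  qed
qed

end

definition mero_of :: "(complex \<Rightarrow> complex) \<Rightarrow> mero" where
  "mero_of f = abs_mero f"

lemma mero_of_eq_iff:
  "f meromorphic_on UNIV \<Longrightarrow> g meromorphic_on UNIV \<Longrightarrow>
     mero_of f = mero_of g \<longleftrightarrow> (\<forall>z. eventually (\<lambda>w. f w = g w) (at z))"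
  unfolding mero_of_def
  using Quotient3_rel[OF Quotient3_mero, of f g] by (auto simp: mero_eq_def)

lemma mero_of_cases:
  obtains f where "f meromorphic_on UNIV" "a = mero_of f"
proof (rule that)
  have "mero_eq (rep_mero a) (rep_mero a)" by (rule Quotient3_rep_reflp[OF Quotient3_mero])
  then show "rep_mero a meromorphic_on UNIV" by (simp add: mero_eq_def)
  show "a = mero_of (rep_mero a)"
    unfolding mero_of_def by (rule Quotient3_abs_rep[OF Quotient3_mero, symmetric])
qed

section \<open>Continuation along the plane\<close>

text \<open>Two discs of equal radius \<open>\<epsilon>\<close> centred in a disc \<open>B\<close> that meet share the midpoint of their
  centres, which lies in \<open>B\<close>; so local continuations of a solution on \<open>B\<close> agree on overlaps.\<close>

lemma continuation_step:
  fixes Q :: "complex \<Rightarrow> (complex \<Rightarrow> 'b) \<Rightarrow> bool"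
  assumes local: "\<And>y c c'. Q y c \<Longrightarrow> eventually (\<lambda>z. c z = c' z) (nhds y) \<Longrightarrow> Q y c'"
    and ident: "\<And>D c1 c2 a. open D \<Longrightarrow> convex D \<Longrightarrow> a \<in> D \<Longrightarrow> (\<And>y. y \<in> D \<Longrightarrow> Q y c1) \<Longrightarrow>
        (\<And>y. y \<in> D \<Longrightarrow> Q y c2) \<Longrightarrow> eventually (\<lambda>z. c1 z = c2 z) (nhds a) \<Longrightarrow> \<forall>y\<in>D. c1 y = c2 y"
    and ext: "\<And>y c. y \<in> ball (0::complex) r \<Longrightarrow> eventually (\<lambda>z. Q z c) (nhds y) \<Longrightarrow>
        \<exists>c'. (\<forall>z\<in>ball y \<epsilon>. Q z c') \<and> eventually (\<lambda>z. c z = c' z) (nhds y)"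
    and "0 < \<epsilon>" "0 < r" and c: "\<And>z. z \<in> ball (0::complex) r \<Longrightarrow> Q z c"
  shows "\<exists>c'. (\<forall>z\<in>ball (0::complex) (r + \<epsilon> / 2). Q z c') \<and> (\<forall>z\<in>ball (0::complex) r. c' z = c z)"
proof -
  have ev: "eventually (\<lambda>z. Q z c) (nhds y)" if "y \<in> ball (0::complex) r" for y
    using eventually_nhds_in_open[OF open_ball that] by eventually_elim (rule c)
  then have "\<forall>y\<in>ball (0::complex) r. \<exists>c'. (\<forall>z\<in>ball y \<epsilon>. Q z c') \<and> eventually (\<lambda>z. c z = c' z) (nhds y)"
    using ext by blast
  then obtain g where g: "\<And>y z. y \<in> ball (0::complex) r \<Longrightarrow> z \<in> ball y \<epsilon> \<Longrightarrow> Q z (g y)"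
    and g_ev: "\<And>y. y \<in> ball (0::complex) r \<Longrightarrow> eventually (\<lambda>z. c z = g y z) (nhds y)"
    by metis
  have gc: "g y z = c z" if "y \<in> ball (0::complex) r" "z \<in> ball (0::complex) r" "z \<in> ball y \<epsilon>" for y z
  proof -
    have "\<forall>z\<in>ball (0::complex) r \<inter> ball y \<epsilon>. c z = g y z"
      by (rule ident[of _ y]) (use that c g g_ev \<open>0 < \<epsilon>\<close> in \<open>auto intro: convex_Int\<close>)
    with that show ?thesis by auto
  qed
  have gg: "g y1 z = g y2 z"
    if y: "y1 \<in> ball (0::complex) r" "y2 \<in> ball (0::complex) r" and z: "z \<in> ball y1 \<epsilon>" "z \<in> ball y2 \<epsilon>" for y1 y2 z
  proof -
    let ?m = "midpoint y1 y2"
    have "dist y1 y2 < 2 * \<epsilon>"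
      using z dist_triangle[of y1 y2 z] by (simp add: dist_commute)
    then have m: "?m \<in> ball y1 \<epsilon>" "?m \<in> ball y2 \<epsilon>"
      by (auto simp: dist_midpoint)
    have "?m \<in> ball (0::complex) r"
      using y convexD_alt[OF convex_ball[of 0 r], of y1 y2 "1/2"]
      by (simp add: midpoint_def scaleR_add_right)
    then have "?m \<in> ball (0::complex) r \<inter> ball y1 \<epsilon> \<inter> ball y2 \<epsilon>" using m by auto
    then have "eventually (\<lambda>z. z \<in> ball (0::complex) r \<inter> ball y1 \<epsilon> \<inter> ball y2 \<epsilon>) (nhds ?m)"
      by (intro eventually_nhds_in_open) auto
    then have ev: "eventually (\<lambda>z. g y1 z = g y2 z) (nhds ?m)"
      by eventually_elim (use y gc in auto)
    have "\<forall>z\<in>ball y1 \<epsilon> \<inter> ball y2 \<epsilon>. g y1 z = g y2 z"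
      by (rule ident[of _ ?m]) (use y g m ev in \<open>auto intro: convex_Int\<close>)
    with z show ?thesis by auto
  qed
  have ex: "\<exists>y\<in>ball (0::complex) r. z \<in> ball y \<epsilon>" if "z \<in> ball (0::complex) (r + \<epsilon> / 2)" for z :: complex
  proof (cases "z \<in> ball (0::complex) r")
    case True
    then show ?thesis using \<open>0 < \<epsilon>\<close> by (intro bexI[of _ z]) auto
  next
    case False
    \<comment> \<open>A point outside the disc of radius \<open>r\<close> is moved towards the
      origin by \<open>3 * \<epsilon> / 4\<close>: more than \<open>\<epsilon> / 2\<close>, so it
      enters the disc, and less than \<open>\<epsilon>\<close>, so \<open>z\<close> stays within
      reach. The maximum with \<open>0\<close> covers points closer to the origin than that.\<close>
    define t where "t = max 0 (1 - \<epsilon> * 3 / (4 * norm z))"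
    have nz: "norm z \<ge> r" "norm z < r + \<epsilon> / 2" "norm z > 0" using False that \<open>0 < r\<close> by auto
    have "norm (t *\<^sub>R z) < r \<and> dist (t *\<^sub>R z) z < \<epsilon>"
    proof -
      have "0 \<le> t" "t \<le> 1" using nz \<open>0 < \<epsilon>\<close> by (auto simp: t_def)
      have "dist (t *\<^sub>R z) z = (1 - t) * norm z"
      proof -
        have "t *\<^sub>R z - z = (t - 1) *\<^sub>R z" by (simp add: scaleR_left_diff_distrib)
        then show ?thesis using \<open>t \<le> 1\<close> by (simp add: dist_norm)
      qed
      moreover have "norm (t *\<^sub>R z) = t * norm z" using \<open>0 \<le> t\<close> by simp
      moreover have "(1 - t) * norm z < \<epsilon> \<and> t * norm z < r"
      proof (cases "1 - \<epsilon> * 3 / (4 * norm z) \<ge> 0")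
        case True
        then have "t * norm z = norm z - \<epsilon> * 3 / 4"
          using nz by (simp add: t_def field_simps)
        then show ?thesis using nz \<open>0 < \<epsilon>\<close> by (simp add: algebra_simps)
      next
        case False
        then have "t = 0" by (simp add: t_def)
        moreover have "norm z < \<epsilon> * 3 / 4" using False nz by (simp add: field_simps)
        ultimately show ?thesis using \<open>0 < r\<close> \<open>0 < \<epsilon>\<close> by simp
      qed
      ultimately show ?thesis using \<open>0 \<le> t\<close> by simp
    qed
    then show ?thesis by (intro bexI[of _ "t *\<^sub>R z"]) auto
  qed
  define y where "y = (\<lambda>z. SOME y. y \<in> ball (0::complex) r \<and> z \<in> ball y \<epsilon>)"
  have y: "y z \<in> ball (0::complex) r" "z \<in> ball (y z) \<epsilon>" if "z \<in> ball (0::complex) (r + \<epsilon> / 2)" for z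
    using someI_ex[of "\<lambda>y. y \<in> ball (0::complex) r \<and> z \<in> ball y \<epsilon>"] ex[OF that] unfolding y_def by blast+
  define c' where "c' = (\<lambda>z. g (y z) z)"
  have "Q z0 c'" if z0: "z0 \<in> ball (0::complex) (r + \<epsilon> / 2)" for z0
  proof (rule local)
    show "Q z0 (g (y z0))" using y[OF z0] g by blast
    have "eventually (\<lambda>z. z \<in> ball (0::complex) (r + \<epsilon> / 2) \<inter> ball (y z0) \<epsilon>) (nhds z0)"
      using z0 y[OF z0] by (intro eventually_nhds_in_open) auto
    then show "eventually (\<lambda>z. g (y z0) z = c' z) (nhds z0)"
    proof eventually_elim
      case (elim z)
      then show ?case unfolding c'_def by (intro gg y[OF z0] y) auto
    qed
  qed
  moreover have "c' z = c z" if "z \<in> ball (0::complex) r" for z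
    unfolding c'_def by (rule gc) (use y[of z] that \<open>0 < \<epsilon>\<close> in auto)
  ultimately show ?thesis by blast
qed

text \<open>On a compact disc of radius \<open>R\<close> the local extension radii have a common
  lower bound \<open>\<epsilon>\<close>, so the radius of a solution grows by
  \<open>\<epsilon> / 2\<close> in each step and reaches \<open>R\<close> after finitely many. The
  solutions on the discs of radius \<open>n + 1\<close> agree by \<open>ident\<close>, since they
  have the same germ at \<open>0\<close>, and are glued. This is how the simple connectedness of the
  plane enters.\<close>

lemma continuation_on_plane:
  fixes Q :: "complex \<Rightarrow> (complex \<Rightarrow> 'b) \<Rightarrow> bool"
  assumes local: "\<And>y c c'. Q y c \<Longrightarrow> eventually (\<lambda>z. c z = c' z) (nhds y) \<Longrightarrow> Q y c'"
    and ident: "\<And>D c1 c2 a. open D \<Longrightarrow> convex D \<Longrightarrow> a \<in> D \<Longrightarrow> (\<And>y. y \<in> D \<Longrightarrow> Q y c1) \<Longrightarrow>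
        (\<And>y. y \<in> D \<Longrightarrow> Q y c2) \<Longrightarrow> eventually (\<lambda>z. c1 z = c2 z) (nhds a) \<Longrightarrow> \<forall>y\<in>D. c1 y = c2 y"
    and ext: "\<And>y0. \<exists>\<delta>>0. \<forall>y\<in>ball y0 \<delta>. \<forall>c. eventually (\<lambda>z. Q z c) (nhds y) \<longrightarrow>
        (\<exists>c'. (\<forall>z\<in>ball y0 \<delta>. Q z c') \<and> eventually (\<lambda>z. c z = c' z) (nhds y))"
    and start: "eventually (\<lambda>z. Q z c0) (nhds 0)"
  shows "\<exists>c. (\<forall>y. Q y c) \<and> eventually (\<lambda>z. c z = c0 z) (nhds 0)"
proof -
  obtain r0 where r0: "0 < r0" "\<And>z. z \<in> ball (0::complex) r0 \<Longrightarrow> Q z c0"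
    using start unfolding eventually_nhds_metric by (auto simp: dist_commute)
  have near0: "eventually (\<lambda>z. z \<in> ball (0::complex) r) (nhds 0)" if "0 < r" for r :: real
    using that by (intro eventually_nhds_in_open) auto
  have ex: "\<exists>c. (\<forall>z\<in>ball (0::complex) R. Q z c) \<and> eventually (\<lambda>z. c z = c0 z) (nhds 0)" if "0 < R" for R
  proof -
    obtain \<delta> where \<delta>: "\<And>y0. \<delta> y0 > 0"
      and ext': "\<And>y0 y c. y \<in> ball y0 (\<delta> y0) \<Longrightarrow> eventually (\<lambda>z. Q z c) (nhds y) \<Longrightarrow>
        \<exists>c'. (\<forall>z\<in>ball y0 (\<delta> y0). Q z c') \<and> eventually (\<lambda>z. c z = c' z) (nhds y)"
      using ext by metis
    have "cball (0::complex) R \<subseteq> \<Union> (range (\<lambda>y0. ball y0 (\<delta> y0)))"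
      using \<delta> by (auto intro: centre_in_ball[THEN iffD2])
    \<comment> \<open>A Lebesgue number of the covering by the extension discs.\<close>
    then obtain \<epsilon> where \<epsilon>: "0 < \<epsilon>"
      "\<And>y. y \<in> cball (0::complex) R \<Longrightarrow> \<exists>G\<in>range (\<lambda>y0. ball y0 (\<delta> y0)). ball y \<epsilon> \<subseteq> G"
      using Heine_Borel_lemma[OF compact_cball[of "0::complex" R], of "range (\<lambda>y0. ball y0 (\<delta> y0))"]
      by (metis (no_types, lifting) imageE open_ball)
    have ext'': "\<exists>c'. (\<forall>z\<in>ball y \<epsilon>. Q z c') \<and> eventually (\<lambda>z. c z = c' z) (nhds y)"
      if y: "y \<in> cball (0::complex) R" and c: "eventually (\<lambda>z. Q z c) (nhds y)" for y c
    proof -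
      from \<epsilon>(2)[OF y] obtain y0 where y0: "ball y \<epsilon> \<subseteq> ball y0 (\<delta> y0)" by auto
      then have "y \<in> ball y0 (\<delta> y0)" using \<open>0 < \<epsilon>\<close> by (meson centre_in_ball subsetD)
      from ext'[OF this c] y0 show ?thesis by blast
    qed
    have "\<exists>c. (\<forall>z\<in>ball (0::complex) (min R (r0 + real n * (\<epsilon> / 2))). Q z c) \<and> eventually (\<lambda>z. c z = c0 z) (nhds 0)" for n
    proof (induction n)
      case 0
      then show ?case using r0(2) by (intro exI[of _ c0]) auto
    next
      case (Suc n)
      let ?r = "min R (r0 + real n * (\<epsilon> / 2))"
      from Suc obtain c where c: "\<And>z. z \<in> ball (0::complex) ?r \<Longrightarrow> Q z c" "eventually (\<lambda>z. c z = c0 z) (nhds 0)"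
        by blast
      have "?r > 0" using \<open>0 < R\<close> r0 \<epsilon> by (auto intro: add_pos_nonneg)
      have "\<exists>c'. (\<forall>z\<in>ball (0::complex) (?r + \<epsilon> / 2). Q z c') \<and> (\<forall>z\<in>ball (0::complex) ?r. c' z = c z)"
      proof (rule continuation_step[of Q ?r \<epsilon> c])
        show "Q y c2" if "Q y c1" "eventually (\<lambda>z. c1 z = c2 z) (nhds y)" for y c1 c2
          using that by (rule local)
        show "\<forall>y\<in>D. c1 y = c2 y"
          if "open D" "convex D" "a \<in> D" "\<And>y. y \<in> D \<Longrightarrow> Q y c1" "\<And>y. y \<in> D \<Longrightarrow> Q y c2"
            "eventually (\<lambda>z. c1 z = c2 z) (nhds a)" for D c1 c2 a
          using that by (rule ident)
        show "\<exists>c'. (\<forall>z\<in>ball y \<epsilon>. Q z c') \<and> eventually (\<lambda>z. c z = c' z) (nhds y)"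
          if "y \<in> ball 0 ?r" "eventually (\<lambda>z. Q z c) (nhds y)" for y c
          using that(2) by (rule ext''[rotated]) (use that(1) in auto)
      qed (use c \<epsilon> \<open>?r > 0\<close> in auto)
      then obtain c' where c': "\<And>z. z \<in> ball (0::complex) (?r + \<epsilon> / 2) \<Longrightarrow> Q z c'" "\<And>z. z \<in> ball (0::complex) ?r \<Longrightarrow> c' z = c z"
        by blast
      have "eventually (\<lambda>z. c' z = c0 z) (nhds 0)"
        using c(2) near0[OF \<open>?r > 0\<close>] by eventually_elim (use c' in auto)
      moreover have "ball (0::complex) (min R (r0 + real (Suc n) * (\<epsilon> / 2))) \<subseteq> ball (0::complex) (?r + \<epsilon> / 2)"
        using \<epsilon> by (intro subset_ball) (auto simp: min_def algebra_simps add_divide_distrib)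
      ultimately show ?case using c'(1) by blast
    qed
    moreover obtain n :: nat where "R < real n * (\<epsilon> / 2)"
      using reals_Archimedean3[of "\<epsilon> / 2"] \<open>0 < \<epsilon>\<close> by (meson half_gt_zero)
    then have "min R (r0 + real n * (\<epsilon> / 2)) = R" using r0 by auto
    ultimately show ?thesis by metis
  qed
  have "\<exists>c. (\<forall>z\<in>ball (0::complex) (real n + 1). Q z c) \<and> eventually (\<lambda>z. c z = c0 z) (nhds 0)" for n
    by (rule ex) auto
  then obtain C where C: "\<And>n z. z \<in> ball (0::complex) (real n + 1) \<Longrightarrow> Q z (C n)"
    "\<And>n. eventually (\<lambda>z. C n z = c0 z) (nhds 0)"
    by metis
  have CC: "C n z = C m z" if "z \<in> ball (0::complex) (real n + 1)" "n \<le> m" for n m z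
  proof -
    have "eventually (\<lambda>z. C n z = C m z) (nhds 0)"
      using C(2)[of n] C(2)[of m] by eventually_elim simp
    then have "\<forall>z\<in>ball (0::complex) (real n + 1). C n z = C m z"
      by (intro ident[of _ 0]) (use C that in auto)
    with that show ?thesis by blast
  qed
  define N where "N = (\<lambda>z::complex. nat \<lceil>norm z\<rceil>)"
  have N: "z \<in> ball (0::complex) (real (N z) + 1)" for z
    unfolding N_def by (auto, linarith)
  define c where "c = (\<lambda>z. C (N z) z)"
  have c_eq: "c z = C n z" if "z \<in> ball (0::complex) (real n + 1)" for z n
  proof (cases "N z \<le> n")
    case True
    then show ?thesis unfolding c_def by (rule CC[OF N])
  next
    case False
    then show ?thesis unfolding c_def by (intro CC[OF that, symmetric]) simp
  qed
  have "Q y c" for y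
  proof (rule local)
    show "Q y (C (N y))" using C(1) N by blast
    have "eventually (\<lambda>z. z \<in> ball (0::complex) (real (N y) + 1)) (nhds y)"
      using N by (intro eventually_nhds_in_open) auto
    then show "eventually (\<lambda>z. C (N y) z = c z) (nhds y)"
      by eventually_elim (rule c_eq[symmetric])
  qed
  moreover have "eventually (\<lambda>z. c z = c0 z) (nhds 0)"
    using near0[OF zero_less_one] C(2)[of 0]
  proof eventually_elim
    case (elim z)
    then show ?case using c_eq[of z 0] by simp
  qed
  ultimately show ?thesis by blast
qed

section \<open>Local complex analysis\<close>

lemma holomorphic_nth_root:
  assumes "convex A" "open A" "f holomorphic_on A" "\<And>x. x \<in> A \<Longrightarrow> f x \<noteq> 0" "0 < (n::nat)"
  obtains g where "g holomorphic_on A" "\<And>x. x \<in> A \<Longrightarrow> g x ^ n = f x"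
proof (cases "A = {}")
  case True
  then show ?thesis by (intro that[of "\<lambda>_. 0"]) auto
next
  case False
  then obtain z0 where "z0 \<in> A" by blast
  from holomorphic_logarithm_exists[OF assms(1-4) this] obtain g
    where g: "g holomorphic_on A" "\<And>x. x \<in> A \<Longrightarrow> exp (g x) = f x" by blast
  show ?thesis
  proof (rule that)
    show "(\<lambda>x. exp (g x / n)) holomorphic_on A"
      using g(1) \<open>0 < n\<close> by (intro holomorphic_intros) auto
    show "exp (g x / n) ^ n = f x" if "x \<in> A" for x
      using g(2)[OF that] \<open>0 < n\<close> by (simp flip: exp_of_nat_mult)
  qed
qed

text \<open>Write \<open>s w = (w - y)^n * g w\<close> with \<open>g\<close> free of zeros and take
  an \<open>n\<close>-th root \<open>h\<close> of \<open>g\<close>. Then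
  \<open>\<eta> w = (w - y) * h w\<close> has derivative \<open>h y \<noteq> 0\<close> at
  \<open>y\<close>, hence is injective nearby.\<close>

lemma local_power_form:
  assumes "s holomorphic_on S" "open S" "connected S" "y \<in> S" "s y = 0" "\<not> s constant_on S"
  obtains k r \<eta> where "0 < k" "0 < r" "ball y r \<subseteq> S" "\<eta> holomorphic_on ball y r" "\<eta> y = 0"
    "deriv \<eta> y \<noteq> 0" "inj_on \<eta> (ball y r)" "\<And>w. w \<in> ball y r \<Longrightarrow> s w = \<eta> w ^ k"
proof -
  obtain g r n where gr: "0 < n" "0 < r" "ball y r \<subseteq> S" "g holomorphic_on ball y r"
    "\<And>w. w \<in> ball y r \<Longrightarrow> s w = (w - y) ^ n * g w" "\<And>w. w \<in> ball y r \<Longrightarrow> g w \<noteq> 0"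
    using holomorphic_factor_zero_nonconstant[OF assms] by metis
  obtain h where h: "h holomorphic_on ball y r" "\<And>x. x \<in> ball y r \<Longrightarrow> h x ^ n = g x"
    using holomorphic_nth_root[OF convex_ball open_ball gr(4,6,1)] by metis
  define \<eta> where "\<eta> = (\<lambda>w. (w - y) * h w)"
  have \<eta>: "\<eta> holomorphic_on ball y r"
    unfolding \<eta>_def by (intro holomorphic_intros h)
  have "h y \<noteq> 0" using h(2)[of y] gr(6)[of y] gr(1,2) by (auto simp: power_0_left)
  have "(h has_field_derivative deriv h y) (at y)"
    using h(1) gr(2) by (meson centre_in_ball holomorphic_derivI open_ball)
  then have "(\<eta> has_field_derivative h y) (at y)"
    unfolding \<eta>_def by (auto intro!: derivative_eq_intros)
  then have d: "deriv \<eta> y \<noteq> 0" using \<open>h y \<noteq> 0\<close> by (simp add: DERIV_imp_deriv)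
  obtain r' where r': "0 < r'" "ball y r' \<subseteq> ball y r" "inj_on \<eta> (ball y r')"
    using has_complex_derivative_locally_injective[OF \<eta> _ open_ball d] gr(2) by auto
  show ?thesis
  proof (rule that[of n r' \<eta>])
    show "s w = \<eta> w ^ n" if "w \<in> ball y r'" for w
      using that r' gr(5)[of w] h(2)[of w] by (auto simp: \<eta>_def power_mult_distrib)
  qed (use gr r' \<eta> d in \<open>auto simp: \<eta>_def intro: holomorphic_on_subset\<close>)
qed

lemma local_inverse:
  assumes "\<eta> holomorphic_on ball y r" "inj_on \<eta> (ball y r)" "0 < r" "\<eta> y = 0"
  obtains \<rho> \<sigma> where "0 < \<rho>" "\<sigma> holomorphic_on ball 0 \<rho>" "\<sigma> ` ball 0 \<rho> \<subseteq> ball y r" "inj_on \<sigma> (ball 0 \<rho>)"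
    "\<sigma> 0 = y" "\<And>\<zeta>. \<zeta> \<in> ball 0 \<rho> \<Longrightarrow> \<eta> (\<sigma> \<zeta>) = \<zeta>"
    "\<And>w. w \<in> ball y r \<Longrightarrow> \<eta> w \<in> ball 0 \<rho> \<Longrightarrow> \<sigma> (\<eta> w) = w"
proof -
  obtain g where g: "g holomorphic_on \<eta> ` ball y r" "\<And>z. z \<in> ball y r \<Longrightarrow> g (\<eta> z) = z"
    using holomorphic_has_inverse[OF assms(1) open_ball assms(2)] by metis
  have "open (\<eta> ` ball y r)" by (rule open_mapping_thm3[OF assms(1) open_ball assms(2)])
  moreover have "0 \<in> \<eta> ` ball y r" using assms(3,4) by (metis centre_in_ball imageI)
  ultimately obtain \<rho> where \<rho>: "0 < \<rho>" "ball 0 \<rho> \<subseteq> \<eta> ` ball y r"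
    using openE by blast
  show ?thesis
  proof (rule that[of \<rho> g])
    show "g holomorphic_on ball 0 \<rho>" using g(1) \<rho>(2) holomorphic_on_subset by blast
    show "g ` ball 0 \<rho> \<subseteq> ball y r" using \<rho>(2) g(2) by fastforce
    show inv: "\<eta> (g \<zeta>) = \<zeta>" if "\<zeta> \<in> ball 0 \<rho>" for \<zeta> using that \<rho>(2) g(2) by fastforce
    show "inj_on g (ball 0 \<rho>)" using inv by (rule inj_on_inverseI)
    show "g 0 = y" using g(2)[of y] assms(3,4) by simp
  qed (use \<rho> g in auto)
qed

text \<open>Where \<open>g\<close> does not vanish, \<open>f / g\<close> is continuous with values
  in the finite set of \<open>k\<close>-th roots of unity, hence constant on a disc; the identity
  theorem spreads the relation over \<open>D\<close>.\<close>

lemma holomorphic_power_eq_imp_multiple: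
  assumes "f holomorphic_on D" "g holomorphic_on D" "open D" "connected D" "0 < (k::nat)"
    and eq: "\<And>z. z \<in> D \<Longrightarrow> f z ^ k = g z ^ k"
  obtains \<omega> where "\<omega> ^ k = 1" "\<And>z. z \<in> D \<Longrightarrow> f z = \<omega> * g z"
proof (cases "\<forall>z\<in>D. g z = 0")
  case True
  then have "f z = 1 * g z" if "z \<in> D" for z
    using eq[OF that] that \<open>0 < k\<close> by (simp add: power_0_left)
  then show ?thesis by (intro that[of 1]) auto
next
  case False
  then obtain z0 where z0: "z0 \<in> D" "g z0 \<noteq> 0" by blast
  have "continuous_on D g" using assms(2) holomorphic_on_imp_continuous_on by blast
  then have "open (D \<inter> g -` (- {0}))"
    using \<open>open D\<close> by (intro continuous_open_preimage) auto
  moreover have "z0 \<in> D \<inter> g -` (- {0})" using z0 by auto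
  ultimately obtain r where r: "0 < r" "ball z0 r \<subseteq> D \<inter> g -` (- {0})"
    using openE by blast
  have "(\<lambda>z. f z / g z) constant_on ball z0 r"
  proof (rule continuous_finite_range_constant)
    show "continuous_on (ball z0 r) (\<lambda>z. f z / g z)"
      using assms(1,2) r by (intro continuous_intros holomorphic_on_imp_continuous_on) (auto intro: holomorphic_on_subset)
    have "(\<lambda>z. f z / g z) ` ball z0 r \<subseteq> {w. w ^ k = 1}"
    proof safe
      fix z assume "z \<in> ball z0 r"
      then have "z \<in> D" "g z \<noteq> 0" using r by auto
      then show "(f z / g z) ^ k = 1" using eq[of z] by (simp add: power_divide)
    qed
    then show "finite ((\<lambda>z. f z / g z) ` ball z0 r)"
      using finite_subset finite_roots_unity[of k, where ?'a = complex] \<open>0 < k\<close> by blast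
  qed simp
  then obtain \<omega> where \<omega>: "\<And>z. z \<in> ball z0 r \<Longrightarrow> f z / g z = \<omega>"
    by (auto simp: constant_on_def)
  have "f z0 / g z0 = \<omega>" using \<omega> r(1) by auto
  then have "\<omega> ^ k = 1" using eq[OF z0(1)] z0(2) by (auto simp: power_divide)
  moreover have "f z = \<omega> * g z" if "z \<in> D" for z
  proof (rule analytic_continuation_open[of "ball z0 r" D f "\<lambda>z. \<omega> * g z"])
    show "f z = \<omega> * g z" if "z \<in> ball z0 r" for z
    proof -
      have "g z \<noteq> 0" using that r by auto
      then show ?thesis using \<omega>[OF that] by (simp add: field_simps)
    qed
  qed (use assms r that in \<open>auto intro!: holomorphic_intros\<close>)
  ultimately show ?thesis by (rule that)
qed

section \<open>Charts and holomorphic discs\<close>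

lemma complex_chartD:
  assumes "complex_chart T U \<phi>"
  shows "openin T U" "open (\<phi> ` U)" "inj_on \<phi> U" "U \<subseteq> topspace T"
    "open V \<Longrightarrow> openin T {x \<in> U. \<phi> x \<in> V}"
    "openin T W \<Longrightarrow> W \<subseteq> U \<Longrightarrow> open (\<phi> ` W)"
proof -
  have U: "openin T U" "open (\<phi> ` U)"
    and h: "homeomorphic_map (subtopology T U) (top_of_set (\<phi> ` U)) \<phi>"
    using assms by (auto simp: complex_chart_def)
  show "openin T U" "open (\<phi> ` U)" by fact+
  show sub: "U \<subseteq> topspace T" using U(1) openin_subset by blast
  then have top: "topspace (subtopology T U) = U" by auto
  show "inj_on \<phi> U" using homeomorphic_imp_injective_map[OF h] top by simp
  have open_map: "open_map (subtopology T U) (top_of_set (\<phi> ` U)) \<phi>"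
    and cont: "continuous_map (subtopology T U) (top_of_set (\<phi> ` U)) \<phi>"
    using h homeomorphic_imp_open_map homeomorphic_imp_continuous_map by blast+
  show "openin T {x \<in> U. \<phi> x \<in> V}" if "open V"
  proof -
    have "openin (top_of_set (\<phi> ` U)) (\<phi> ` U \<inter> V)" using that by (rule openin_open_Int)
    from openin_continuous_map_preimage[OF cont this]
    have "openin (subtopology T U) {x \<in> U. \<phi> x \<in> V}"
      unfolding top by (rule back_subst[of "openin _"]) auto
    with U(1) show ?thesis using openin_trans_full by blast
  qed
  show "open (\<phi> ` W)" if "openin T W" "W \<subseteq> U"
  proof -
    have "openin (subtopology T U) W" using that by (simp add: openin_subset_topspace_eq U(1) openin_open_subtopology)
    then have "openin (top_of_set (\<phi> ` U)) (\<phi> ` W)" using open_map by (auto simp: open_map_def)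
    with U(2) show ?thesis using openin_open_trans by blast
  qed
qed

lemma complex_chartI:
  assumes "openin T U" "open (\<phi> ` U)" "inj_on \<phi> U" "\<And>V. open V \<Longrightarrow> openin T {x \<in> U. \<phi> x \<in> V}"
    "\<And>W. openin T W \<Longrightarrow> W \<subseteq> U \<Longrightarrow> open (\<phi> ` W)"
  shows "complex_chart T U \<phi>"
  unfolding complex_chart_def
proof (intro conjI assms(1,2))
  have top: "topspace (subtopology T U) = U" using openin_subset[OF assms(1)] by auto
  show "homeomorphic_map (subtopology T U) (top_of_set (\<phi> ` U)) \<phi>"
  proof (rule bijective_open_imp_homeomorphic_map)
    show "continuous_map (subtopology T U) (top_of_set (\<phi> ` U)) \<phi>"
      unfolding continuous_map top
    proof (intro conjI allI impI)
      fix W assume "openin (top_of_set (\<phi> ` U)) W"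
      then obtain V where V: "open V" "W = \<phi> ` U \<inter> V" by (auto simp: openin_open)
      have "openin (subtopology T U) {x \<in> U. \<phi> x \<in> V}"
        using assms(4)[OF V(1)] by (simp add: openin_open_subtopology[OF assms(1)])
      then show "openin (subtopology T U) {x \<in> U. \<phi> x \<in> W}"
        unfolding V(2) by (rule back_subst[of "openin _"]) auto
    qed auto
    show "open_map (subtopology T U) (top_of_set (\<phi> ` U)) \<phi>"
      unfolding open_map_def
    proof (intro allI impI)
      fix W assume "openin (subtopology T U) W"
      then have "openin T W" "W \<subseteq> U" by (simp_all add: openin_open_subtopology[OF assms(1)])
      with assms(5) show "openin (top_of_set (\<phi> ` U)) (\<phi> ` W)"
        by (intro open_subset) auto
    qed
  qed (use assms(3) top in auto)
qed

text \<open>Membership in the maximal atlas. The coordinates in which \<open>f\<close> becomes a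
  power are of this kind, and seldom belong to the given atlas.\<close>

definition compatible_chart :: "'a surface \<Rightarrow> 'a set \<Rightarrow> ('a \<Rightarrow> complex) \<Rightarrow> bool" where
  "compatible_chart M U \<phi> \<longleftrightarrow> complex_chart (surface_top M) U \<phi> \<and>
     (\<forall>(V, \<psi>) \<in> surface_atlas M. holomorphic_transition U \<phi> V \<psi> \<and> holomorphic_transition V \<psi> U \<phi>)"

lemma compatible_chart_atlas:
  "riemann_surface M \<Longrightarrow> (U, \<phi>) \<in> surface_atlas M \<Longrightarrow> compatible_chart M U \<phi>"
  unfolding riemann_surface_def compatible_chart_def by blast

lemma local_coordinate_iff:
  "local_coordinate M x U \<phi> \<longleftrightarrow> compatible_chart M U \<phi> \<and> x \<in> U \<and> \<phi> x = 0"
  unfolding local_coordinate_def compatible_chart_def by blast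

lemma ex_chart:
  assumes "riemann_surface M" "x \<in> surface_points M"
  obtains U \<phi> where "(U, \<phi>) \<in> surface_atlas M" "x \<in> U"
  using assms unfolding riemann_surface_def by fastforce

text \<open>One chart of the atlas is asked for, which makes the property easy to establish;
  \<open>hol_at_in_chart\<close> shows that every compatible chart around the image point then
  serves.\<close>

definition hol_at :: "'a surface \<Rightarrow> (complex \<Rightarrow> 'a) \<Rightarrow> complex \<Rightarrow> bool" where
  "hol_at M c y \<longleftrightarrow> (\<exists>(U, \<phi>) \<in> surface_atlas M. \<exists>r>0. c ` ball y r \<subseteq> U \<and> (\<phi> \<circ> c) holomorphic_on ball y r)"

lemma hol_atE:
  assumes "hol_at M c y"
  obtains U \<phi> r where "(U, \<phi>) \<in> surface_atlas M" "0 < r" "c ` ball y r \<subseteq> U" "(\<phi> \<circ> c) holomorphic_on ball y r"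
  using assms unfolding hol_at_def by blast

lemma hol_atI:
  assumes "(U, \<phi>) \<in> surface_atlas M" "0 < r" "\<And>z. z \<in> ball y r \<Longrightarrow> c z \<in> U" "(\<phi> \<circ> c) holomorphic_on ball y r"
  shows "hol_at M c y"
  using assms unfolding hol_at_def by (intro bexI[of _ "(U, \<phi>)"]) auto

lemma eventually_hol_at:
  assumes "hol_at M c y"
  shows "eventually (hol_at M c) (nhds y)"
proof -
  from assms obtain U \<phi> r where *: "(U, \<phi>) \<in> surface_atlas M" "0 < r" "c ` ball y r \<subseteq> U"
    "(\<phi> \<circ> c) holomorphic_on ball y r" by (rule hol_atE)
  have "eventually (\<lambda>z. z \<in> ball y r) (nhds y)" using * by (intro eventually_nhds_in_open) auto
  then show ?thesis
  proof eventually_elim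
    case (elim z)
    then obtain e where "e > 0" "ball z e \<subseteq> ball y r" using openE[OF open_ball] by blast
    with * show ?case unfolding hol_at_def
      by (intro bexI[of _ "(U, \<phi>)"]) (auto intro!: exI[of _ e] intro: holomorphic_on_subset)
  qed
qed

lemma hol_at_cong:
  assumes "hol_at M c y" "eventually (\<lambda>z. c z = c' z) (nhds y)"
  shows "hol_at M c' y"
proof -
  from assms(1) obtain U \<phi> r where *: "(U, \<phi>) \<in> surface_atlas M" "0 < r" "c ` ball y r \<subseteq> U"
    "(\<phi> \<circ> c) holomorphic_on ball y r" by (rule hol_atE)
  obtain e where e: "e > 0" "\<And>z. z \<in> ball y e \<Longrightarrow> c z = c' z"
    using assms(2) unfolding eventually_nhds_metric by (auto simp: dist_commute)
  have "(\<phi> \<circ> c') holomorphic_on ball y (min e r)"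
    by (rule holomorphic_transform[of "\<phi> \<circ> c"]) (use * e in \<open>auto intro: holomorphic_on_subset\<close>)
  then show ?thesis
    by (rule hol_atI[rotated 3]) (use * e in \<open>auto simp flip: e(2)\<close>)
qed

section \<open>Maps from the plane into a Riemann surface: continuity, change of chart, identity
  theorem\<close>

context
  fixes M :: "'a surface"
  assumes M: "riemann_surface M"
begin

lemma hol_at_preimage:
  assumes "hol_at M c y" "openin (surface_top M) W" "c y \<in> W"
  shows "\<exists>r>0. c ` ball y r \<subseteq> W"
proof -
  from assms(1) obtain U \<phi> r where *: "(U, \<phi>) \<in> surface_atlas M" "0 < r" "c ` ball y r \<subseteq> U"
    "(\<phi> \<circ> c) holomorphic_on ball y r" by (rule hol_atE)
  have chart: "complex_chart (surface_top M) U \<phi>"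
    using compatible_chart_atlas[OF M *(1)] by (simp add: compatible_chart_def)
  note ch = complex_chartD[OF chart]
  have "open (\<phi> ` (U \<inter> W))" using ch(1) assms(2) by (intro ch(6)) auto
  moreover have "continuous_on (ball y r) (\<phi> \<circ> c)" using *(4) by (rule holomorphic_on_imp_continuous_on)
  ultimately have "open (ball y r \<inter> (\<phi> \<circ> c) -` (\<phi> ` (U \<inter> W)))"
    by (intro continuous_open_preimage) auto
  moreover have "c y \<in> U" using * by (auto simp: image_subset_iff)
  then have "y \<in> ball y r \<inter> (\<phi> \<circ> c) -` (\<phi> ` (U \<inter> W))" using assms(3) * by auto
  ultimately obtain e where e: "e > 0" "ball y e \<subseteq> ball y r \<inter> (\<phi> \<circ> c) -` (\<phi> ` (U \<inter> W))"
    using openE by blast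
  have "c z \<in> W" if "z \<in> ball y e" for z
  proof -
    have "\<phi> (c z) \<in> \<phi> ` (U \<inter> W)" "z \<in> ball y r" using e(2) that by auto
    moreover from this(2) have "c z \<in> U" using *(3) by auto
    ultimately show ?thesis using ch(3) by (metis IntD1 IntD2 imageE inj_onD)
  qed
  with e(1) show ?thesis by blast
qed

lemma hol_at_in_chart:
  assumes "hol_at M c y" "compatible_chart M V \<psi>" "c y \<in> V"
  obtains r where "0 < r" "c ` ball y r \<subseteq> V" "(\<psi> \<circ> c) holomorphic_on ball y r"
proof -
  from assms(1) obtain U \<phi> r where *: "(U, \<phi>) \<in> surface_atlas M" "0 < r" "c ` ball y r \<subseteq> U"
    "(\<phi> \<circ> c) holomorphic_on ball y r" by (rule hol_atE)
  note V = complex_chartD[OF assms(2)[unfolded compatible_chart_def, THEN conjunct1]]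
  have chart: "complex_chart (surface_top M) U \<phi>"
    using compatible_chart_atlas[OF M *(1)] by (simp add: compatible_chart_def)
  note U = complex_chartD[OF chart]
  have tr: "(\<psi> \<circ> inv_into U \<phi>) holomorphic_on \<phi> ` (U \<inter> V)"
    using assms(2) *(1) unfolding compatible_chart_def holomorphic_transition_def by blast
  obtain e where e: "e > 0" "c ` ball y e \<subseteq> V"
    using hol_at_preimage[OF assms(1) V(1) assms(3)] by blast
  have "((\<psi> \<circ> inv_into U \<phi>) \<circ> (\<phi> \<circ> c)) holomorphic_on ball y (min e r)"
  proof (rule holomorphic_on_compose_gen[OF _ tr])
    show "(\<phi> \<circ> c) holomorphic_on ball y (min e r)" using *(4) by (rule holomorphic_on_subset) auto
    show "(\<phi> \<circ> c) ` ball y (min e r) \<subseteq> \<phi> ` (U \<inter> V)" using e *(3) by fastforce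
  qed
  then have "(\<psi> \<circ> c) holomorphic_on ball y (min e r)"
  proof (rule holomorphic_transform)
    fix z assume "z \<in> ball y (min e r)"
    then have "c z \<in> U" using *(3) by auto
    then show "((\<psi> \<circ> inv_into U \<phi>) \<circ> (\<phi> \<circ> c)) z = (\<psi> \<circ> c) z" using U(3) by simp
  qed
  with e * show ?thesis by (intro that[of "min e r"]) auto
qed

lemma hol_at_point:
  assumes "hol_at M c y"
  shows "c y \<in> surface_points M"
proof -
  from assms obtain U \<phi> r where *: "(U, \<phi>) \<in> surface_atlas M" "0 < r" "c ` ball y r \<subseteq> U" by (rule hol_atE)
  have "complex_chart (surface_top M) U \<phi>"
    using compatible_chart_atlas[OF M *(1)] by (simp add: compatible_chart_def)
  then have "U \<subseteq> surface_points M" by (rule complex_chartD(4))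
  moreover have "c y \<in> U" using *(2,3) by (simp add: image_subset_iff)
  ultimately show ?thesis by blast
qed

lemma hol_at_inv_chart:
  assumes "compatible_chart M U \<phi>" "z \<in> \<phi> ` U"
  shows "hol_at M (inv_into U \<phi>) z"
proof -
  note ch = complex_chartD[OF assms(1)[unfolded compatible_chart_def, THEN conjunct1]]
  define x where "x = inv_into U \<phi> z"
  have x: "x \<in> U" "\<phi> x = z" unfolding x_def using assms(2) by (auto simp: inv_into_into f_inv_into_f)
  then obtain V \<psi> where V: "(V, \<psi>) \<in> surface_atlas M" "x \<in> V"
    using ex_chart[OF M, of x] ch(4) by blast
  have chV: "complex_chart (surface_top M) V \<psi>"
    using compatible_chart_atlas[OF M V(1)] by (simp add: compatible_chart_def)
  have tr: "(\<psi> \<circ> inv_into U \<phi>) holomorphic_on \<phi> ` (U \<inter> V)"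
    using assms(1) V(1) unfolding compatible_chart_def holomorphic_transition_def by blast
  have "open (\<phi> ` (U \<inter> V))" using complex_chartD(1)[OF chV] ch(1) by (intro ch(6)) auto
  moreover have "z \<in> \<phi> ` (U \<inter> V)" using x V by auto
  ultimately obtain r where r: "r > 0" "ball z r \<subseteq> \<phi> ` (U \<inter> V)" using openE by blast
  have "inv_into U \<phi> ` ball z r \<subseteq> V"
    using r(2) ch(3) by (force simp: subset_iff)
  then show ?thesis unfolding hol_at_def using V r tr
    by (intro bexI[of _ "(V, \<psi>)"]) (auto intro!: exI[of _ r] intro: holomorphic_on_subset)
qed

lemma hol_at_compose:
  assumes "hol_at M c (g y)" "g analytic_on {y}"
  shows "hol_at M (\<lambda>z. c (g z)) y"
proof -
  from assms(1) obtain U \<phi> r where *: "(U, \<phi>) \<in> surface_atlas M" "0 < r" "c ` ball (g y) r \<subseteq> U"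
    "(\<phi> \<circ> c) holomorphic_on ball (g y) r" by (rule hol_atE)
  obtain e where e: "e > 0" "g holomorphic_on ball y e"
    using assms(2) by (auto simp: analytic_on_def)
  have "open (ball y e \<inter> g -` ball (g y) r)"
    using e by (intro continuous_open_preimage holomorphic_on_imp_continuous_on) auto
  moreover have "y \<in> ball y e \<inter> g -` ball (g y) r" using e * by auto
  ultimately obtain d where d: "d > 0" "ball y d \<subseteq> ball y e \<inter> g -` ball (g y) r" using openE by blast
  have "((\<phi> \<circ> c) \<circ> g) holomorphic_on ball y d"
    by (rule holomorphic_on_compose_gen[OF _ *(4)]) (use e d in \<open>auto intro: holomorphic_on_subset\<close>)
  with * d show ?thesis unfolding hol_at_def
    by (intro bexI[of _ "(U, \<phi>)"]) (auto intro!: exI[of _ d] simp: o_def image_subset_iff subset_iff)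
qed

lemma hol_at_map:
  assumes "hol_at M c y" "holomorphic_map M N f" "riemann_surface N"
  shows "hol_at N (\<lambda>z. f (c z)) y"
proof -
  from assms(1) obtain U \<phi> r where *: "(U, \<phi>) \<in> surface_atlas M" "0 < r" "c ` ball y r \<subseteq> U"
    "(\<phi> \<circ> c) holomorphic_on ball y r" by (rule hol_atE)
  have chart: "complex_chart (surface_top M) U \<phi>"
    using compatible_chart_atlas[OF M *(1)] by (simp add: compatible_chart_def)
  note U = complex_chartD[OF chart]
  have cont: "continuous_map (surface_top M) (surface_top N) f"
    using assms(2) by (simp add: holomorphic_map_def)
  have cy: "c y \<in> surface_points M" by (rule hol_at_point[OF assms(1)])
  then have "f (c y) \<in> surface_points N" using cont by (auto simp: continuous_map_def)
  then obtain V \<psi> where V: "(V, \<psi>) \<in> surface_atlas N" "f (c y) \<in> V" using ex_chart[OF assms(3)] by blast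
  have chV: "complex_chart (surface_top N) V \<psi>"
    using compatible_chart_atlas[OF assms(3) V(1)] by (simp add: compatible_chart_def)
  have "openin (surface_top M) {x \<in> surface_points M. f x \<in> V}"
    using openin_continuous_map_preimage[OF cont complex_chartD(1)[OF chV]] .
  then obtain e where e: "e > 0" "c ` ball y e \<subseteq> {x \<in> surface_points M. f x \<in> V}"
    using hol_at_preimage[OF assms(1)] cy V by blast
  have tr: "(\<psi> \<circ> f \<circ> inv_into U \<phi>) holomorphic_on \<phi> ` (U \<inter> f -` V)"
    using assms(2) *(1) V(1) unfolding holomorphic_map_def by blast
  have "((\<psi> \<circ> f \<circ> inv_into U \<phi>) \<circ> (\<phi> \<circ> c)) holomorphic_on ball y (min e r)"
  proof (rule holomorphic_on_compose_gen[OF _ tr])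
    show "(\<phi> \<circ> c) holomorphic_on ball y (min e r)" using *(4) by (rule holomorphic_on_subset) auto
    show "(\<phi> \<circ> c) ` ball y (min e r) \<subseteq> \<phi> ` (U \<inter> f -` V)" using e *(3) by fastforce
  qed
  then have "(\<psi> \<circ> (\<lambda>z. f (c z))) holomorphic_on ball y (min e r)"
  proof (rule holomorphic_transform)
    fix z assume "z \<in> ball y (min e r)"
    then have "c z \<in> U" using *(3) by auto
    then show "((\<psi> \<circ> f \<circ> inv_into U \<phi>) \<circ> (\<phi> \<circ> c)) z = (\<psi> \<circ> (\<lambda>z. f (c z))) z" using U(3) by simp
  qed
  moreover have "f (c z) \<in> V" if "z \<in> ball y (min e r)" for z using e(2) that by fastforce
  ultimately show ?thesis
    by (intro hol_atI[of V \<psi> N "min e r"]) (use e * V in auto)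
qed

text \<open>At every point of \<open>D\<close> the two maps either agree in a neighbourhood or
  differ in a punctured one: if their values differ there, the Hausdorff property separates them,
  and otherwise the classical identity theorem applies in a chart. So the set of local agreement is
  open with open complement in the connected set \<open>D\<close>.\<close>

lemma hol_at_identity:
  assumes "open D" "connected D" "a \<in> D" "\<And>y. y \<in> D \<Longrightarrow> hol_at M c1 y" "\<And>y. y \<in> D \<Longrightarrow> hol_at M c2 y"
    and "\<exists>\<^sub>F z in at a. c1 z = c2 z"
  shows "\<forall>y\<in>D. c1 y = c2 y"
proof -
  have H: "Hausdorff_space (surface_top M)" using M by (simp add: riemann_surface_def)
  have loc: "eventually (\<lambda>z. c1 z = c2 z) (nhds y) \<or> eventually (\<lambda>z. c1 z \<noteq> c2 z) (at y)" if y: "y \<in> D" for y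
  proof (cases "c1 y = c2 y")
    case False
    with H obtain W1 W2 where W: "openin (surface_top M) W1" "openin (surface_top M) W2"
      "c1 y \<in> W1" "c2 y \<in> W2" "disjnt W1 W2"
      unfolding Hausdorff_space_def using hol_at_point assms(4,5) y by meson
    obtain r1 r2 where r: "r1 > 0" "c1 ` ball y r1 \<subseteq> W1" "r2 > 0" "c2 ` ball y r2 \<subseteq> W2"
      using hol_at_preimage assms(4,5) W y by meson
    have "eventually (\<lambda>z. z \<in> ball y (min r1 r2)) (at y)"
      using r by (intro eventually_at_in_open') auto
    then have "eventually (\<lambda>z. c1 z \<noteq> c2 z) (at y)"
    proof eventually_elim
      case (elim z)
      then have "c1 z \<in> W1" "c2 z \<in> W2" using r by auto
      then show ?case using W(5) by (auto simp: disjnt_iff)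
    qed
    then show ?thesis ..
  next
    case True
    obtain U \<phi> where U: "(U, \<phi>) \<in> surface_atlas M" "c1 y \<in> U"
      using ex_chart[OF M hol_at_point[OF assms(4)[OF y]]] by blast
    have cc: "compatible_chart M U \<phi>" using compatible_chart_atlas[OF M U(1)] .
    obtain r1 where r1: "r1 > 0" "c1 ` ball y r1 \<subseteq> U" "(\<phi> \<circ> c1) holomorphic_on ball y r1"
      using hol_at_in_chart[OF assms(4)[OF y] cc] U by blast
    obtain r2 where r2: "r2 > 0" "c2 ` ball y r2 \<subseteq> U" "(\<phi> \<circ> c2) holomorphic_on ball y r2"
      using hol_at_in_chart[OF assms(5)[OF y] cc] U True by metis
    let ?r = "min r1 r2"
    have inj: "inj_on \<phi> U" using cc complex_chartD(3) unfolding compatible_chart_def by blast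
    have an: "(\<lambda>z. \<phi> (c1 z) - \<phi> (c2 z)) holomorphic_on ball y ?r"
      using r1(3) r2(3) unfolding o_def by (intro holomorphic_on_diff) (auto elim: holomorphic_on_subset)
    have iff: "\<phi> (c1 z) - \<phi> (c2 z) = 0 \<longleftrightarrow> c1 z = c2 z" if "z \<in> ball y ?r" for z
      using that r1(2) r2(2) inj by (auto simp: inj_on_eq_iff image_subset_iff)
    have inball: "eventually (\<lambda>z. z \<in> ball y ?r) (at y)" "eventually (\<lambda>z. z \<in> ball y ?r) (nhds y)"
      using r1(1) r2(1) by (simp_all add: eventually_at_in_open' eventually_nhds_in_open del: mem_ball)
    show ?thesis
    proof (cases "\<exists>\<^sub>F z in at y. \<phi> (c1 z) - \<phi> (c2 z) = 0")
      case True
      have 0: "\<phi> (c1 z) - \<phi> (c2 z) = 0" if "z \<in> ball y ?r" for z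
      proof (rule analytic_continuation[OF an open_ball connected_ball])
        show "y islimpt {z \<in> ball y ?r. \<phi> (c1 z) - \<phi> (c2 z) = 0}"
          unfolding islimpt_conv_frequently_at
          by (rule frequently_rev_mp[OF True]) (use inball(1) in \<open>auto elim: eventually_mono\<close>)
      qed (use that r1 r2 in auto)
      from inball(2) have "eventually (\<lambda>z. c1 z = c2 z) (nhds y)"
        by eventually_elim (use 0 iff in blast)
      then show ?thesis ..
    next
      case False
      then have "eventually (\<lambda>z. \<phi> (c1 z) - \<phi> (c2 z) \<noteq> 0) (at y)" by (simp add: not_frequently)
      then have "eventually (\<lambda>z. c1 z \<noteq> c2 z) (at y)" by eventually_elim auto
      then show ?thesis ..
    qed
  qed
  define A where "A = {y \<in> D. eventually (\<lambda>z. c1 z = c2 z) (nhds y)}"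
  have "open A"
    unfolding open_subopen[of A]
  proof
    fix y assume "y \<in> A"
    then have "eventually (\<lambda>z. c1 z = c2 z) (nhds y)" "y \<in> D" by (auto simp: A_def)
    then obtain S where S: "open S" "y \<in> S" "\<And>z. z \<in> S \<Longrightarrow> c1 z = c2 z"
      unfolding eventually_nhds by blast
    have "S \<inter> D \<subseteq> A"
    proof
      fix z assume z: "z \<in> S \<inter> D"
      then have "eventually (\<lambda>z. z \<in> S) (nhds z)" using S by (intro eventually_nhds_in_open) auto
      then have "eventually (\<lambda>z. c1 z = c2 z) (nhds z)" by eventually_elim (rule S(3))
      then show "z \<in> A" using z by (simp add: A_def)
    qed
    then show "\<exists>T. open T \<and> y \<in> T \<and> T \<subseteq> A" using S \<open>open D\<close> \<open>y \<in> D\<close> by (intro exI[of _ "S \<inter> D"]) auto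
  qed
  moreover have "open (D - A)"
    unfolding open_subopen[of "D - A"]
  proof
    fix y assume y: "y \<in> D - A"
    then have "eventually (\<lambda>z. c1 z \<noteq> c2 z) (at y)" using loc[of y] by (auto simp: A_def)
    then obtain S where S: "open S" "y \<in> S" "\<And>z. z \<in> S \<Longrightarrow> z \<noteq> y \<Longrightarrow> c1 z \<noteq> c2 z"
      unfolding eventually_at_topological by blast
    have "S \<inter> D \<subseteq> D - A"
      using S y by (auto simp: A_def dest: eventually_nhds_x_imp_x)
    then show "\<exists>T. open T \<and> y \<in> T \<and> T \<subseteq> D - A" using S \<open>open D\<close> y by (intro exI[of _ "S \<inter> D"]) auto
  qed
  moreover have "a \<in> A"
    using loc[OF assms(3)] assms(6) assms(3) unfolding frequently_def A_def by blast
  moreover have "A \<inter> (D - A) \<inter> D = {}" "D \<subseteq> A \<union> (D - A)" by auto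
  ultimately have "A \<inter> D = {} \<or> (D - A) \<inter> D = {}"
    using connectedD[OF assms(2)] by blast
  then have "D - A = {}" using \<open>a \<in> A\<close> assms(3) by auto
  then show ?thesis unfolding A_def by (auto dest: eventually_nhds_x_imp_x)
qed

end

section \<open>The Riemann sphere\<close>

text \<open>The inverse of a standard coordinate of the sphere centred at \<open>p\<close>, so
  \<open>sph p 0 = p\<close>: a translation at finite points, \<open>1 / s\<close> at infinity. With
  it, every statement about the behaviour over \<open>p\<close> is uniform in
  \<open>p\<close>.\<close>

definition sph :: "complex option \<Rightarrow> complex \<Rightarrow> complex option" where
  "sph p s = (case p of Some a \<Rightarrow> Some (a + s) | None \<Rightarrow> if s = 0 then None else Some (1 / s))"

text \<open>An inverse of \<open>sph p\<close> on the range of \<open>sph p\<close> only: outside,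
  \<open>sph_inv None (Some 0) = 0\<close> because \<open>1 / 0 = 0\<close>, and for finite
  \<open>p\<close> the value at \<open>None\<close> is unspecified.\<close>

definition sph_inv :: "complex option \<Rightarrow> complex option \<Rightarrow> complex" where
  "sph_inv p q = (case p of Some a \<Rightarrow> the q - a | None \<Rightarrow> (case q of None \<Rightarrow> 0 | Some z \<Rightarrow> 1 / z))"

lemma sph_simps [simp]:
  "sph (Some a) s = Some (a + s)" "sph p 0 = p" "sph_inv p (sph p s) = s" "sph_inv p p = 0"
  "sph_inv (Some a) (Some z) = z - a" "sph_inv None (Some z) = 1 / z"
  by (auto simp: sph_def sph_inv_def split: option.splits)

lemma sph_None: "sph None s = (if s = 0 then None else Some (1 / s))"
  by (simp add: sph_def)

lemma range_sph: "range (sph (Some a)) = range Some" "range (sph None) = - {Some 0}"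
proof -
  have "Some z \<in> range (sph (Some a))" for z by (rule range_eqI[of _ _ "z - a"]) simp
  then show "range (sph (Some a)) = range Some" by auto
  have "q \<in> range (sph None)" if "q \<noteq> Some 0" for q
  proof (cases q)
    case None
    then show ?thesis by (intro range_eqI[of _ _ 0]) simp
  next
    case (Some z)
    with that show ?thesis by (intro range_eqI[of _ _ "1 / z"]) (simp add: sph_None)
  qed
  then show "range (sph None) = - {Some 0}" by (auto simp: sph_None)
qed

lemma sph_sph_inv [simp]: "q \<in> range (sph p) \<Longrightarrow> sph p (sph_inv p q) = q"
  by auto

lemma inj_sph: "inj (sph p)"
  by (rule inj_on_inverseI[of _ "sph_inv p"]) simp

lemma sph_eq_iff [simp]: "sph p s = sph p t \<longleftrightarrow> s = t"
  using inj_sph by (auto dest: injD)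

lemma self_in_range_sph [simp, intro]: "p \<in> range (sph p)"
  by (metis rangeI sph_simps(2))

lemma surface_points_sphere [simp]: "surface_points riemann_sphere = UNIV"
  by (auto simp: riemann_sphere_def) (metis option.exhaust rangeI)

lemma sphere_atlas:
  "surface_atlas riemann_sphere = {(range (sph (Some 0)), sph_inv (Some 0)), (range (sph None), sph_inv None)}"
proof -
  have "sph_inv (Some 0) = the" by (auto simp: sph_inv_def)
  moreover have "sph_inv None = (\<lambda>q. case q of None \<Rightarrow> 0 | Some z \<Rightarrow> 1 / z)"
    by (auto simp: sph_inv_def)
  ultimately show ?thesis by (simp add: riemann_sphere_def range_sph)
qed

lemma open_inverse_image:
  assumes "open V"
  shows "open {z. z \<noteq> 0 \<and> 1 / z + b \<in> (V :: complex set)}"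
proof -
  have "open ((- {0}) \<inter> (\<lambda>z. 1 / z + b) -` V)"
    by (intro continuous_open_preimage continuous_intros) (use assms in auto)
  then show ?thesis by (rule back_subst[of "open"]) auto
qed

text \<open>The topology of the one-point compactification is the one glued from the two
  coordinates. A compact set is bounded by some \<open>B\<close>, so in the coordinate at infinity
  it misses the disc of radius \<open>1 / B\<close>; conversely a disc around \<open>0\<close> in
  that coordinate bounds the complement of \<open>W\<close> in the plane, which is closed and thus
  compact.\<close>

lemma openin_sphere_iff:
  "openin (surface_top riemann_sphere) W \<longleftrightarrow> open (Some -` W) \<and> open (sph None -` W)"
proof
  assume "openin (surface_top riemann_sphere) W"
  then consider U where "open U" "W = Some ` U"
    | C where "compact C" "W = insert None (Some ` (- C))"
    by (auto simp: riemann_sphere_def openin_Alexandroff_compactification Compl_eq_Diff_UNIV)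
  then show "open (Some -` W) \<and> open (sph None -` W)"
  proof cases
    case 1
    have "sph None -` W = {z. z \<noteq> 0 \<and> 1 / z + 0 \<in> U}" by (auto simp: 1 sph_None split: if_splits)
    moreover have "Some -` W = U" by (auto simp: 1)
    ultimately show ?thesis using 1(1) open_inverse_image[of U 0] by simp
  next
    case 2
    have "Some -` W = - C" by (auto simp: 2)
    then have *: "open (Some -` W)" using compact_imp_closed[OF 2(1)] by (simp add: open_Compl)
    obtain B where B: "B > 0" "\<And>z. z \<in> C \<Longrightarrow> norm z \<le> B"
      using compact_imp_bounded[OF 2(1)] bounded_pos by blast
    have "sph None -` W = {z. z \<noteq> 0 \<and> 1 / z + 0 \<in> - C} \<union> ball 0 (1 / B)"
    proof -
      have "1 / z \<notin> C" if "norm z < 1 / B" "z \<noteq> 0" for z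
      proof
        assume "1 / z \<in> C"
        then have "1 / norm z \<le> B" using B(2)[of "1 / z"] by (simp add: norm_divide)
        then show False using that B(1) by (simp add: field_simps)
      qed
      then show ?thesis using B(1) by (auto simp: 2 sph_None split: if_splits)
    qed
    with * show ?thesis
      using open_inverse_image[of "- C" 0] compact_imp_closed[OF 2(1)] by (simp add: open_Un open_Compl)
  qed
next
  assume W: "open (Some -` W) \<and> open (sph None -` W)"
  show "openin (surface_top riemann_sphere) W"
  proof (cases "None \<in> W")
    case False
    then have "W = Some ` (Some -` W)" by (auto simp: image_iff; metis option.exhaust)
    with W show ?thesis
      by (auto simp: riemann_sphere_def openin_Alexandroff_compactification)
  next
    case True
    let ?C = "- (Some -` W)"
    have "W = insert None (Some ` (- ?C))" using True by (auto simp: image_iff; metis option.exhaust)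
    moreover have "compact ?C"
    proof -
      have "0 \<in> sph None -` W" using True by simp
      then obtain e where e: "e > 0" "ball 0 e \<subseteq> sph None -` W" using W openE by blast
      have "norm z \<le> 1 / e" if "z \<in> ?C" for z
      proof (rule ccontr)
        assume *: "\<not> norm z \<le> 1 / e"
        then have "norm z > 1 / e" by simp
        moreover have "1 / e > 0" using e by simp
        ultimately have z: "norm z > 0" by linarith
        have "norm (1 / z) < e" using * e(1) z by (simp add: norm_divide field_simps)
        then have "sph None (1 / z) \<in> W" using e(2) by auto
        then show False using that z by (simp add: sph_None)
      qed
      then have "bounded ?C" unfolding bounded_iff by blast
      moreover have "closed ?C" using W by (simp add: closed_Compl)
      ultimately show ?thesis by (simp add: compact_eq_bounded_closed)
    qed
    ultimately show ?thesis
      unfolding riemann_sphere_def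
      by (auto simp: openin_Alexandroff_compactification Compl_eq_Diff_UNIV[symmetric] compact_imp_closed
          intro!: exI[of _ ?C])
  qed
qed

lemma open_sph_vimage:
  assumes "openin (surface_top riemann_sphere) W"
  shows "open (sph p -` W)"
proof (cases p)
  case None
  then show ?thesis using assms by (simp add: openin_sphere_iff)
next
  case (Some a)
  have "sph p -` W = (\<lambda>s. a + s) -` (Some -` W)" by (auto simp: Some)
  moreover have "open ((\<lambda>s. a + s) -` (Some -` W))"
    using assms by (intro open_vimage continuous_intros) (simp add: openin_sphere_iff)
  ultimately show ?thesis by simp
qed

lemma openin_sph_image:
  assumes "open V"
  shows "openin (surface_top riemann_sphere) (sph p ` V)"
  unfolding openin_sphere_iff
proof (cases p)
  case None
  have "Some -` (sph p ` V) = {z. z \<noteq> 0 \<and> 1 / z + 0 \<in> V}"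
    by (auto simp: None sph_None split: if_splits) (force simp: image_iff sph_None)
  moreover have "sph None -` (sph p ` V) = V" by (auto simp: None)
  ultimately show "open (Some -` (sph p ` V)) \<and> open (sph None -` (sph p ` V))"
    using assms open_inverse_image[of V 0] by simp
next
  case (Some a)
  have "Some -` (sph p ` V) = (\<lambda>z. z - a) -` V" by (force simp: Some image_iff)
  moreover have "open ((\<lambda>z. z - a) -` V)" using assms by (intro open_vimage continuous_intros)
  moreover have "sph None -` (sph p ` V) = {z. z \<noteq> 0 \<and> 1 / z + (- a) \<in> V}"
    by (force simp: Some sph_None image_iff split: if_splits)
  ultimately show "open (Some -` (sph p ` V)) \<and> open (sph None -` (sph p ` V))"
    using open_inverse_image[OF assms, of "- a"] by simp
qed

lemma inv_into_sph_inv [simp]: "inv_into (range (sph p)) (sph_inv p) s = sph p s"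
proof -
  have "inj_on (sph_inv p) (range (sph p))" by (rule inj_onI) auto
  then show ?thesis using inv_into_f_f[of "sph_inv p" "range (sph p)" "sph p s"] by simp
qed

lemma sph_transition_holomorphic: "(sph_inv q \<circ> sph p) holomorphic_on sph p -` range (sph q)"
proof (cases p; cases q)
  fix a assume pq: "p = Some a" "q = None"
  have "(\<lambda>s. 1 / (a + s)) holomorphic_on sph p -` range (sph q)"
    by (intro holomorphic_intros) (auto simp: pq range_sph)
  then show ?thesis by (rule holomorphic_transform) (simp add: pq)
next
  fix b assume pq: "p = None" "q = Some b"
  have "(\<lambda>s. 1 / s - b) holomorphic_on sph p -` range (sph q)"
    by (intro holomorphic_intros) (auto simp: pq range_sph sph_None)
  then show ?thesis
    by (rule holomorphic_transform) (auto simp: pq range_sph sph_None)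
next
  fix a b assume pq: "p = Some a" "q = Some b"
  have "(\<lambda>s. a + s - b) holomorphic_on sph p -` range (sph q)"
    by (intro holomorphic_intros)
  then show ?thesis by (rule holomorphic_transform) (simp add: pq)
next
  assume pq: "p = None" "q = None"
  have "(\<lambda>s. s) holomorphic_on sph p -` range (sph q)"
    by (intro holomorphic_intros)
  then show ?thesis by (rule holomorphic_transform) (simp add: pq)
qed

lemma sph_inv_image: "W \<subseteq> range (sph p) \<Longrightarrow> sph_inv p ` W = sph p -` W"
  by (force simp: image_iff)

lemma complex_chart_sph: "complex_chart (surface_top riemann_sphere) (range (sph p)) (sph_inv p)"
proof (rule complex_chartI)
  show "openin (surface_top riemann_sphere) (range (sph p))" by (rule openin_sph_image) simp
  show "open (sph_inv p ` range (sph p))" by (simp add: sph_inv_image vimage_def)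
  show "inj_on (sph_inv p) (range (sph p))" by (rule inj_onI) auto
  show "openin (surface_top riemann_sphere) {x \<in> range (sph p). sph_inv p x \<in> V}" if "open V" for V
  proof -
    have "{x \<in> range (sph p). sph_inv p x \<in> V} = sph p ` V" by auto
    with openin_sph_image[OF that] show ?thesis by simp
  qed
  show "open (sph_inv p ` W)" if "openin (surface_top riemann_sphere) W" "W \<subseteq> range (sph p)" for W
    using that by (simp add: sph_inv_image open_sph_vimage)
qed

lemma holomorphic_transition_sph:
  "holomorphic_transition (range (sph p)) (sph_inv p) (range (sph q)) (sph_inv q)"
proof -
  have "inv_into (range (sph p)) (sph_inv p) = sph p" by auto
  moreover have "sph_inv p ` (range (sph p) \<inter> range (sph q)) = sph p -` range (sph q)"
    by (subst sph_inv_image) auto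
  ultimately show ?thesis
    unfolding holomorphic_transition_def using sph_transition_holomorphic by simp
qed

lemma riemann_surface_sphere: "riemann_surface riemann_sphere"
  unfolding riemann_surface_def
proof (intro conjI)
  show "Hausdorff_space (surface_top riemann_sphere)"
    by (simp add: riemann_sphere_def Hausdorff_space_Alexandroff_compactification
        locally_compact_space_euclidean)
  have "range (sph (Some 0)) \<union> range (sph None) = UNIV" by (auto simp: range_sph)
  then show "surface_points riemann_sphere = \<Union> (fst ` surface_atlas riemann_sphere)"
    by (simp add: sphere_atlas)
qed (simp_all only: sphere_atlas ball_simps prod.case complex_chart_sph holomorphic_transition_sph simp_thms)

lemma compatible_chart_sph: "compatible_chart riemann_sphere (range (sph p)) (sph_inv p)"
  unfolding compatible_chart_def
  by (simp only: sphere_atlas ball_simps prod.case complex_chart_sph holomorphic_transition_sph simp_thms)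

lemma hol_at_sph: "hol_at riemann_sphere (sph p) s"
proof -
  have "inv_into (range (sph p)) (sph_inv p) = sph p" by auto
  moreover have "s \<in> sph_inv p ` range (sph p)" by (force simp: image_iff)
  ultimately show ?thesis
    using hol_at_inv_chart[OF riemann_surface_sphere compatible_chart_sph, of s p] by simp
qed

lemma hol_at_const_sphere: "hol_at riemann_sphere (\<lambda>_. p) z"
  using hol_at_compose[OF riemann_surface_sphere, of "sph p" "\<lambda>_. 0" z] hol_at_sph by simp

text \<open>The plane is connected, so \<open>W\<close> or its complement lies within
  \<open>{None}\<close>, and \<open>{None}\<close> is not open.\<close>

lemma sphere_clopen:
  assumes "openin (surface_top riemann_sphere) W" "openin (surface_top riemann_sphere) (- W)" "W \<noteq> {}"
  shows "W = UNIV"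
proof -
  have no_point: "V \<noteq> {None}" if "openin (surface_top riemann_sphere) V" for V
  proof
    assume "V = {None}"
    then have "sph None -` V = {0}" by (auto simp: sph_None split: if_splits)
    then show False using that open_sph_vimage[of V None] not_open_singleton by metis
  qed
  have "open (Some -` W)" "open (Some -` (- W))" using assms by (simp_all add: openin_sphere_iff)
  then have "Some -` W = {} \<or> Some -` (- W) = {}"
    using connectedD[OF connected_UNIV, of "Some -` W" "Some -` (- W)"] by auto
  then have "W \<subseteq> {None} \<or> - W \<subseteq> {None}" by (auto simp: vimage_def) (metis option.exhaust)+
  then show ?thesis using no_point[of W] no_point[of "- W"] assms by blast
qed

section \<open>Local form of a branched covering\<close>

lemma compatible_chart_compose:
  assumes "riemann_surface M" "compatible_chart M U \<phi>" "open Y" "Y \<subseteq> \<phi> ` U" "\<eta> holomorphic_on Y" "inj_on \<eta> Y"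
  shows "compatible_chart M {y \<in> U. \<phi> y \<in> Y} (\<eta> \<circ> \<phi>)"
proof -
  let ?U = "{y \<in> U. \<phi> y \<in> Y}"
  note ch = complex_chartD[OF assms(2)[unfolded compatible_chart_def, THEN conjunct1]]
  obtain g where g: "g holomorphic_on \<eta> ` Y" "\<And>z. z \<in> Y \<Longrightarrow> g (\<eta> z) = z"
    using holomorphic_has_inverse[OF assms(5,3,6)] by metis
  have inj: "inj_on (\<eta> \<circ> \<phi>) ?U"
    using ch(3) assms(6) by (auto simp: inj_on_def)
  have im: "\<phi> ` ?U = Y" using assms(4) by auto
  show ?thesis
    unfolding compatible_chart_def holomorphic_transition_def
  proof (intro conjI ballI)
    show "complex_chart (surface_top M) ?U (\<eta> \<circ> \<phi>)"
    proof (rule complex_chartI)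
      show "openin (surface_top M) ?U" using assms(3) by (rule ch(5))
      show "open ((\<eta> \<circ> \<phi>) ` ?U)"
        unfolding image_comp[symmetric] im by (rule open_mapping_thm3[OF assms(5,3,6)])
      show "inj_on (\<eta> \<circ> \<phi>) ?U" by (rule inj)
      show "openin (surface_top M) {y \<in> ?U. (\<eta> \<circ> \<phi>) y \<in> V}" if "open V" for V
      proof -
        have "open (Y \<inter> \<eta> -` V)"
          using assms(3,5) that by (intro continuous_open_preimage holomorphic_on_imp_continuous_on)
        from ch(5)[OF this] show ?thesis by (rule back_subst[of "openin _"]) auto
      qed
      show "open ((\<eta> \<circ> \<phi>) ` W)" if "openin (surface_top M) W" "W \<subseteq> ?U" for W
      proof -
        have "open (\<phi> ` W)" "\<phi> ` W \<subseteq> Y" using that by (auto intro!: ch(6))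
        then have "open (\<eta> ` (\<phi> ` W))"
          using assms(5,6) by (intro open_mapping_thm3) (auto intro: holomorphic_on_subset inj_on_subset)
        then show ?thesis by (simp add: image_comp)
      qed
    qed
    fix V\<psi> assume V: "V\<psi> \<in> surface_atlas M"
    obtain V \<psi> where eq: "V\<psi> = (V, \<psi>)" by (cases V\<psi>)
    have t: "(\<psi> \<circ> inv_into U \<phi>) holomorphic_on \<phi> ` (U \<inter> V)" "(\<phi> \<circ> inv_into V \<psi>) holomorphic_on \<psi> ` (V \<inter> U)"
      using assms(2) V eq unfolding compatible_chart_def holomorphic_transition_def by auto
    have "((\<psi> \<circ> inv_into U \<phi>) \<circ> g) holomorphic_on (\<eta> \<circ> \<phi>) ` (?U \<inter> V)"
    proof (rule holomorphic_on_compose_gen[OF _ t(1)])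
      show "g holomorphic_on (\<eta> \<circ> \<phi>) ` (?U \<inter> V)" using g(1) by (rule holomorphic_on_subset) auto
      show "g ` (\<eta> \<circ> \<phi>) ` (?U \<inter> V) \<subseteq> \<phi> ` (U \<inter> V)" using g(2) by auto
    qed
    then have 1: "(\<psi> \<circ> inv_into ?U (\<eta> \<circ> \<phi>)) holomorphic_on (\<eta> \<circ> \<phi>) ` (?U \<inter> V)"
    proof (rule holomorphic_transform)
      fix z assume "z \<in> (\<eta> \<circ> \<phi>) ` (?U \<inter> V)"
      then obtain y where y: "y \<in> ?U" "y \<in> V" "z = (\<eta> \<circ> \<phi>) y" by blast
      then have "inv_into ?U (\<eta> \<circ> \<phi>) z = y" using inv_into_f_f[OF inj y(1)] by simp
      moreover have "inv_into U \<phi> (g z) = y" using y g(2) ch(3) by auto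
      ultimately show "((\<psi> \<circ> inv_into U \<phi>) \<circ> g) z = (\<psi> \<circ> inv_into ?U (\<eta> \<circ> \<phi>)) z" by simp
    qed
    have 2: "((\<eta> \<circ> \<phi>) \<circ> inv_into V \<psi>) holomorphic_on \<psi> ` (V \<inter> ?U)"
    proof -
      have "inj_on \<psi> V"
        using compatible_chart_atlas[OF assms(1)] V eq complex_chartD(3) unfolding compatible_chart_def by blast
      then have sub: "\<psi> ` (V \<inter> ?U) \<inter> {z. \<phi> (inv_into V \<psi> z) \<in> Y} = \<psi> ` (V \<inter> ?U)" by auto
      have "(\<eta> \<circ> (\<phi> \<circ> inv_into V \<psi>)) holomorphic_on \<psi> ` (V \<inter> ?U) \<inter> {z. \<phi> (inv_into V \<psi> z) \<in> Y}"
        by (rule holomorphic_on_compose_gen[OF _ assms(5)]) (use t(2) in \<open>auto intro: holomorphic_on_subset\<close>)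
      then show ?thesis unfolding sub by (simp add: o_assoc)
    qed
    show "case V\<psi> of (V, \<psi>) \<Rightarrow>
      (\<psi> \<circ> inv_into ?U (\<eta> \<circ> \<phi>)) holomorphic_on (\<eta> \<circ> \<phi>) ` (?U \<inter> V) \<and>
      ((\<eta> \<circ> \<phi>) \<circ> inv_into V \<psi>) holomorphic_on \<psi> ` (V \<inter> ?U)"
      using 1 2 eq by simp
  qed
qed

text \<open>The map \<open>\<theta>\<close> is the inverse of a coordinate centred at
  \<open>x\<close> in which \<open>f\<close> is the pure power \<open>\<zeta>^k\<close>, measured in
  the fixed coordinate \<open>sph (f x)\<close> of the sphere. As a parametrisation it can be
  composed directly with holomorphic functions of the plane, which is how the lifts are
  written.\<close>

definition disc_param ::
    "'a surface \<Rightarrow> ('a \<Rightarrow> complex option) \<Rightarrow> 'a \<Rightarrow> nat \<Rightarrow> (complex \<Rightarrow> 'a) \<Rightarrow> real \<Rightarrow> bool" where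
  "disc_param M f x k \<theta> r \<longleftrightarrow> 0 < r \<and> 0 < k \<and> \<theta> 0 = x \<and>
     (\<forall>\<zeta>\<in>ball 0 r. hol_at M \<theta> \<zeta> \<and> f (\<theta> \<zeta>) = sph (f x) (\<zeta> ^ k)) \<and>
     (\<exists>\<phi>. compatible_chart M (\<theta> ` ball 0 r) \<phi> \<and> (\<forall>\<zeta>\<in>ball 0 r. \<phi> (\<theta> \<zeta>) = \<zeta>))"

lemma disc_paramD:
  assumes "disc_param M f x k \<theta> r"
  shows "0 < r" "0 < k" "\<theta> 0 = x" "\<zeta> \<in> ball 0 r \<Longrightarrow> hol_at M \<theta> \<zeta>"
    "\<zeta> \<in> ball 0 r \<Longrightarrow> f (\<theta> \<zeta>) = sph (f x) (\<zeta> ^ k)" "inj_on \<theta> (ball 0 r)"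
    "openin (surface_top M) (\<theta> ` ball 0 r)"
proof -
  note d = assms[unfolded disc_param_def]
  show "0 < r" "0 < k" "\<theta> 0 = x" using d by auto
  show "\<zeta> \<in> ball 0 r \<Longrightarrow> hol_at M \<theta> \<zeta>" "\<zeta> \<in> ball 0 r \<Longrightarrow> f (\<theta> \<zeta>) = sph (f x) (\<zeta> ^ k)" using d by auto
  from d obtain \<phi> where \<phi>: "compatible_chart M (\<theta> ` ball 0 r) \<phi>" "\<forall>\<zeta>\<in>ball 0 r. \<phi> (\<theta> \<zeta>) = \<zeta>" by blast
  show "inj_on \<theta> (ball 0 r)" using \<phi>(2) by (metis inj_on_inverseI)
  show "openin (surface_top M) (\<theta> ` ball 0 r)"
    using \<phi>(1) complex_chartD(1) unfolding compatible_chart_def by blast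
qed

section \<open>Non-constant maps from a compact connected surface to the sphere: local form,
  surjectivity, fibres\<close>

locale branched_covering =
  fixes M :: "'a surface" and f :: "'a \<Rightarrow> complex option"
  assumes surf: "riemann_surface M" and compact: "compact_space (surface_top M)"
    and connected: "connected_space (surface_top M)"
    and holf: "holomorphic_map M riemann_sphere f"
    and nonconst: "\<not> f constant_on surface_points M"
begin

text \<open>The set \<open>A\<close> of points near which \<open>f\<close> has the constant value
  \<open>f x\<close> is open by definition and closed by the identity theorem; being non-empty it
  would be the whole connected surface.\<close>

lemma locally_nonconstant:
  assumes x: "x \<in> surface_points M" and W: "openin (surface_top M) W" "x \<in> W"
  shows "\<exists>y\<in>W. f y \<noteq> f x"
proof (rule ccontr)
  assume "\<not> ?thesis"
  then have fW: "\<And>y. y \<in> W \<Longrightarrow> f y = f x" by blast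
  define A where "A = {y \<in> surface_points M. \<exists>V. openin (surface_top M) V \<and> y \<in> V \<and> (\<forall>w\<in>V. f w = f x)}"
  have "openin (surface_top M) A"
  proof (subst openin_subopen, intro ballI)
    fix y assume "y \<in> A"
    then obtain V where V: "openin (surface_top M) V" "y \<in> V" "\<forall>w\<in>V. f w = f x" by (auto simp: A_def)
    then have "V \<subseteq> A" using openin_subset[OF V(1)] by (auto simp: A_def)
    with V show "\<exists>T. openin (surface_top M) T \<and> y \<in> T \<and> T \<subseteq> A" by blast
  qed
  moreover have "openin (surface_top M) (surface_points M - A)"
  proof (subst openin_subopen, intro ballI)
    fix y assume y: "y \<in> surface_points M - A"
    then obtain U \<phi> where U: "(U, \<phi>) \<in> surface_atlas M" "y \<in> U" using ex_chart[OF surf, of y] by blast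
    have cc: "compatible_chart M U \<phi>" using compatible_chart_atlas[OF surf U(1)] .
    note ch = complex_chartD[OF cc[unfolded compatible_chart_def, THEN conjunct1]]
    obtain r where r: "r > 0" "ball (\<phi> y) r \<subseteq> \<phi> ` U" using ch(2) U(2) openE by blast
    let ?c = "inv_into U \<phi>" and ?T = "{w \<in> U. \<phi> w \<in> ball (\<phi> y) r}"
    have T: "openin (surface_top M) ?T" by (rule ch(5)) simp
    \<comment> \<open>If a coordinate disc around \<open>y\<close> met \<open>A\<close>, then
      \<open>f\<close> would be constant on the whole disc, and \<open>y\<close> itself would belong
      to \<open>A\<close>.\<close>
    have "?T \<inter> A = {}"
    proof (rule ccontr)
      assume "?T \<inter> A \<noteq> {}"
      then obtain w where w: "w \<in> U" "\<phi> w \<in> ball (\<phi> y) r" "w \<in> A" by blast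
      then obtain V where V: "openin (surface_top M) V" "w \<in> V" "\<forall>w\<in>V. f w = f x" by (auto simp: A_def)
      have hc: "hol_at M ?c z" if "z \<in> ball (\<phi> y) r" for z
        using hol_at_inv_chart[OF surf cc] that r by blast
      have cw: "?c (\<phi> w) = w" using w ch(3) by simp
      obtain e where e: "e > 0" "?c ` ball (\<phi> w) e \<subseteq> V"
        using hol_at_preimage[OF surf hc[OF w(2)] V(1)] V(2) cw by auto
      have "\<forall>z\<in>ball (\<phi> y) r. f (?c z) = (\<lambda>_. f x) z"
      proof (rule hol_at_identity[OF riemann_surface_sphere])
        show "hol_at riemann_sphere (\<lambda>z. f (?c z)) z" if "z \<in> ball (\<phi> y) r" for z
          by (rule hol_at_map[OF surf hc[OF that] holf riemann_surface_sphere])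
        show "hol_at riemann_sphere (\<lambda>_. f x) z" for z by (rule hol_at_const_sphere)
        have "eventually (\<lambda>z. z \<in> ball (\<phi> w) e) (at (\<phi> w))"
          using e by (intro eventually_at_in_open') auto
        then have "eventually (\<lambda>z. f (?c z) = f x) (at (\<phi> w))"
          by eventually_elim (use e(2) V(3) in blast)
        then show "\<exists>\<^sub>F z in at (\<phi> w). f (?c z) = f x" by (intro eventually_frequently) auto
      qed (use w in auto)
      then have "f v = f x" if "v \<in> ?T" for v using that ch(3) by (metis (mono_tags, lifting) inv_into_f_f mem_Collect_eq)
      moreover have "y \<in> ?T" using U(2) r(1) by simp
      ultimately have "y \<in> A" using T y unfolding A_def by blast
      with y show False by blast
    qed
    then show "\<exists>T. openin (surface_top M) T \<and> y \<in> T \<and> T \<subseteq> surface_points M - A"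
      using T U(2) r(1) openin_subset[OF T] by (intro exI[of _ ?T]) auto
  qed
  moreover have "x \<in> A" unfolding A_def using x W fW by blast
  moreover have "A \<subseteq> surface_points M" by (auto simp: A_def)
  ultimately have "openin (surface_top M) A" "closedin (surface_top M) A" "A \<noteq> {}"
    by (auto simp: closedin_def)
  then have "A = surface_points M"
    using connected unfolding connected_space_clopen_in by blast
  then have "f w = f x" if "w \<in> surface_points M" for w using that by (auto simp: A_def)
  then show False using nonconst by (auto simp: constant_on_def)
qed

text \<open>In a chart of the source and the coordinate \<open>sph (f x)\<close> of the target,
  \<open>f\<close> is a non-constant function vanishing at the centre. By
  \<open>local_power_form\<close> it is \<open>\<eta>^k\<close> there, and the new coordinate is
  \<open>\<eta> \<circ> \<phi>\<close>, inverted by \<open>\<theta>\<close>.\<close>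

lemma ex_disc_param:
  assumes x: "x \<in> surface_points M"
  shows "\<exists>k \<theta> r. disc_param M f x k \<theta> r"
proof -
  obtain U \<phi> where U: "(U, \<phi>) \<in> surface_atlas M" "x \<in> U" using ex_chart[OF surf x] by blast
  have cc: "compatible_chart M U \<phi>" using compatible_chart_atlas[OF surf U(1)] .
  note ch = complex_chartD[OF cc[unfolded compatible_chart_def, THEN conjunct1]]
  define c z0 p where "c = inv_into U \<phi>" and "z0 = \<phi> x" and "p = f x"
  have z0: "z0 \<in> \<phi> ` U" using U by (simp add: z0_def)
  have cz0: "c z0 = x" using U ch(3) by (simp add: c_def z0_def)
  have hc: "hol_at M c z" if "z \<in> \<phi> ` U" for z
    unfolding c_def by (rule hol_at_inv_chart[OF surf cc that])
  obtain r0 where r0: "r0 > 0" "(\<lambda>z. f (c z)) ` ball z0 r0 \<subseteq> range (sph p)"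
    "(sph_inv p \<circ> (\<lambda>z. f (c z))) holomorphic_on ball z0 r0"
    using hol_at_in_chart[OF riemann_surface_sphere hol_at_map[OF surf hc[OF z0] holf riemann_surface_sphere]
        compatible_chart_sph[of p]] cz0 p_def by auto
  obtain r1 where r1: "r1 > 0" "ball z0 r1 \<subseteq> \<phi> ` U" using ch(2) z0 openE by blast
  let ?r = "min r0 r1"
  define F where "F = (\<lambda>z. sph_inv p (f (c z)))"
  have fc: "f (c z) = sph p (F z)" if "z \<in> ball z0 r0" for z
    using r0(2) that unfolding F_def by (intro sph_sph_inv[symmetric]) blast
  have F: "F holomorphic_on ball z0 ?r"
    using holomorphic_on_subset[OF r0(3) subset_ball[of ?r r0 z0]] by (simp add: F_def[abs_def] o_def)
  have F0: "F z0 = 0" by (simp add: F_def cz0 p_def)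
  have nc: "\<not> F constant_on ball z0 ?r"
  proof
    assume "F constant_on ball z0 ?r"
    moreover have "z0 \<in> ball z0 ?r" using r0 r1 by simp
    ultimately have 0: "F z = 0" if "z \<in> ball z0 ?r" for z using F0 that unfolding constant_on_def by metis
    let ?W = "{y \<in> U. \<phi> y \<in> ball z0 ?r}"
    have "openin (surface_top M) ?W" by (rule ch(5)) simp
    moreover have "x \<in> ?W" using U r0 r1 by (simp add: z0_def)
    ultimately obtain y where y: "y \<in> ?W" "f y \<noteq> f x" using locally_nonconstant[OF x] by blast
    then have "c (\<phi> y) = y" "\<phi> y \<in> ball z0 ?r" using ch(3) by (auto simp: c_def)
    then have "f y = sph p (F (\<phi> y))" using fc[of "\<phi> y"] by auto
    with 0 y \<open>\<phi> y \<in> ball z0 ?r\<close> show False by (simp add: p_def)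
  qed
  obtain k r2 \<eta> where \<eta>: "0 < k" "0 < r2" "ball z0 r2 \<subseteq> ball z0 ?r" "\<eta> holomorphic_on ball z0 r2"
    "\<eta> z0 = 0" "inj_on \<eta> (ball z0 r2)" "\<And>w. w \<in> ball z0 r2 \<Longrightarrow> F w = \<eta> w ^ k"
  proof -
    have "z0 \<in> ball z0 ?r" using r0 r1 by simp
    from F open_ball connected_ball this F0 nc show ?thesis
      by (rule local_power_form) (rule that, assumption+)
  qed
  obtain \<rho> \<sigma> where \<sigma>: "0 < \<rho>" "\<sigma> holomorphic_on ball 0 \<rho>" "\<sigma> ` ball 0 \<rho> \<subseteq> ball z0 r2"
    "inj_on \<sigma> (ball 0 \<rho>)" "\<sigma> 0 = z0" "\<And>\<zeta>. \<zeta> \<in> ball 0 \<rho> \<Longrightarrow> \<eta> (\<sigma> \<zeta>) = \<zeta>"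
    "\<And>w. w \<in> ball z0 r2 \<Longrightarrow> \<eta> w \<in> ball 0 \<rho> \<Longrightarrow> \<sigma> (\<eta> w) = w"
    using local_inverse[OF \<eta>(4,6,2,5)] by metis
  define \<theta> where "\<theta> = (\<lambda>\<zeta>. c (\<sigma> \<zeta>))"
  define Y where "Y = \<sigma> ` ball 0 \<rho>"
  have Y: "open Y" "Y \<subseteq> ball z0 r2" "Y \<subseteq> \<phi> ` U"
    using open_mapping_thm3[OF \<sigma>(2) open_ball \<sigma>(4)] \<sigma>(3) \<eta>(3) r1(2) unfolding Y_def by force+
  have \<phi>\<theta>: "\<phi> (\<theta> \<zeta>) = \<sigma> \<zeta>" "\<theta> \<zeta> \<in> U" if "\<zeta> \<in> ball 0 \<rho>" for \<zeta>
  proof -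
    have "\<sigma> \<zeta> \<in> \<phi> ` U" using Y(3) that by (auto simp: Y_def)
    then show "\<phi> (\<theta> \<zeta>) = \<sigma> \<zeta>" "\<theta> \<zeta> \<in> U"
      unfolding \<theta>_def c_def by (auto intro: f_inv_into_f inv_into_into)
  qed
  have im: "{y \<in> U. \<phi> y \<in> Y} = \<theta> ` ball 0 \<rho>"
  proof safe
    fix y assume "y \<in> U" "\<phi> y \<in> Y"
    then obtain \<zeta> where \<zeta>: "\<zeta> \<in> ball 0 \<rho>" "\<phi> y = \<sigma> \<zeta>" by (auto simp: Y_def)
    have "\<theta> \<zeta> = c (\<phi> y)" by (simp only: \<theta>_def \<zeta>(2))
    also have "\<dots> = y" unfolding c_def by (rule inv_into_f_f[OF ch(3) \<open>y \<in> U\<close>])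
    finally show "y \<in> \<theta> ` ball 0 \<rho>" using \<zeta>(1) by blast
  next
    fix \<zeta> :: complex assume \<zeta>: "\<zeta> \<in> ball 0 \<rho>"
    then show "\<theta> \<zeta> \<in> U" by (rule \<phi>\<theta>)
    show "\<phi> (\<theta> \<zeta>) \<in> Y" unfolding \<phi>\<theta>(1)[OF \<zeta>] Y_def using \<zeta> by blast
  qed
  have "compatible_chart M {y \<in> U. \<phi> y \<in> Y} (\<eta> \<circ> \<phi>)"
    by (rule compatible_chart_compose[OF surf cc])
       (use Y \<eta> in \<open>auto intro: holomorphic_on_subset inj_on_subset\<close>)
  then have "compatible_chart M (\<theta> ` ball 0 \<rho>) (\<eta> \<circ> \<phi>)" by (simp add: im)
  moreover have "(\<eta> \<circ> \<phi>) (\<theta> \<zeta>) = \<zeta>" if "\<zeta> \<in> ball 0 \<rho>" for \<zeta> using that \<phi>\<theta> \<sigma>(6) by simp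
  moreover have "hol_at M \<theta> \<zeta>" if "\<zeta> \<in> ball 0 \<rho>" for \<zeta>
    unfolding \<theta>_def
  proof (rule hol_at_compose[OF surf])
    show "hol_at M c (\<sigma> \<zeta>)" using that Y(3) by (intro hc) (auto simp: Y_def)
    show "\<sigma> analytic_on {\<zeta>}" using \<sigma>(2) that by (meson analytic_at open_ball)
  qed
  moreover have "f (\<theta> \<zeta>) = sph (f x) (\<zeta> ^ k)" if "\<zeta> \<in> ball 0 \<rho>" for \<zeta>
  proof -
    have "\<sigma> \<zeta> \<in> ball z0 r2" using that \<sigma>(3) by blast
    moreover from this have "\<sigma> \<zeta> \<in> ball z0 r0" using \<eta>(3) by auto
    ultimately show ?thesis using fc[of "\<sigma> \<zeta>"] \<eta>(7)[of "\<sigma> \<zeta>"] \<sigma>(6)[OF that] by (simp add: \<theta>_def p_def)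
  qed
  ultimately have "disc_param M f x k \<theta> \<rho>"
    unfolding disc_param_def using \<eta>(1) \<sigma>(1,5) cz0 by (auto simp: \<theta>_def simp del: mem_ball)
  then show ?thesis by blast
qed

lemma has_branching_order_disc:
  assumes "disc_param M f x k \<theta> r"
  shows "has_branching_order M riemann_sphere f x k"
proof -
  note d = disc_paramD[OF assms]
  obtain \<phi> where \<phi>: "compatible_chart M (\<theta> ` ball 0 r) \<phi>" "\<And>\<zeta>. \<zeta> \<in> ball 0 r \<Longrightarrow> \<phi> (\<theta> \<zeta>) = \<zeta>"
    using assms unfolding disc_param_def by blast
  have x: "x = \<theta> 0" "0 \<in> ball 0 r" using d by auto
  have "local_coordinate M x (\<theta> ` ball 0 r) \<phi>"
    unfolding local_coordinate_iff using \<phi> x by auto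
  moreover have "local_coordinate riemann_sphere (f x) (range (sph (f x))) (sph_inv (f x))"
    unfolding local_coordinate_iff using compatible_chart_sph by auto
  moreover have "f ` \<theta> ` ball 0 r \<subseteq> range (sph (f x))" using d(5) by auto
  moreover have "\<forall>y\<in>\<theta> ` ball 0 r. sph_inv (f x) (f y) = \<phi> y ^ k" using d(5) \<phi>(2) by auto
  ultimately show ?thesis unfolding has_branching_order_def using d(2) by force
qed

text \<open>Two normal forms of \<open>f\<close> at \<open>x\<close> differ by coordinate changes
  \<open>g\<close> of the source and \<open>G\<close> of the sphere with
  \<open>G (z^k) = g z ^ l\<close>. Both fix \<open>0\<close> and have non-zero derivative there, so
  dividing by the lower of the two powers of \<open>z\<close> would make a non-zero limit vanish
  unless \<open>k = l\<close>. This makes the definite description in \<open>branching_order\<close>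
  meaningful.\<close>

lemma has_branching_order_unique:
  assumes "disc_param M f x k \<theta> r" "has_branching_order M riemann_sphere f x l"
  shows "l = k"
proof -
  note d = disc_paramD[OF assms(1)]
  let ?p = "f x"
  obtain U \<phi> V \<psi> where *: "compatible_chart M U \<phi>" "x \<in> U" "\<phi> x = 0" "compatible_chart riemann_sphere V \<psi>"
    "?p \<in> V" "\<psi> ?p = 0" "f ` U \<subseteq> V" "\<forall>y \<in> U. \<psi> (f y) = \<phi> y ^ l" "1 \<le> l"
    using assms(2) unfolding has_branching_order_def local_coordinate_iff by blast
  have 0: "(0::complex) \<in> ball 0 r" using d(1) by simp
  obtain r1 where r1: "r1 > 0" "\<theta> ` ball 0 r1 \<subseteq> U" "(\<phi> \<circ> \<theta>) holomorphic_on ball 0 r1"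
    using hol_at_in_chart[OF surf d(4)[OF 0] *(1)] d(3) *(2) by auto
  obtain r2 where r2: "r2 > 0" "sph ?p ` ball 0 r2 \<subseteq> V" "(\<psi> \<circ> sph ?p) holomorphic_on ball 0 r2"
    using hol_at_in_chart[OF riemann_surface_sphere hol_at_sph *(4), of ?p 0] *(5) by auto
  define g G where "g = \<phi> \<circ> \<theta>" and "G = \<psi> \<circ> sph ?p"
  have inj: "inj_on \<phi> U" "inj_on \<psi> V"
    using *(1,4) complex_chartD(3) unfolding compatible_chart_def by blast+
  have injg: "inj_on g (ball 0 (min r r1))"
    unfolding g_def
    by (intro comp_inj_on inj_on_subset[OF d(6)] inj_on_subset[OF inj(1)]) (use r1(2) in auto)
  have injG: "inj_on G (ball 0 r2)"
    unfolding G_def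
    by (intro comp_inj_on inj_on_subset[OF inj_sph] inj_on_subset[OF inj(2)]) (use r2(2) in auto)
  have g': "deriv g 0 \<noteq> 0" "(g has_field_derivative deriv g 0) (at 0)"
  proof -
    have "g holomorphic_on ball 0 (min r r1)" unfolding g_def using r1(3) by (rule holomorphic_on_subset) auto
    then show "deriv g 0 \<noteq> 0" "(g has_field_derivative deriv g 0) (at 0)"
      using holomorphic_injective_imp_regular[OF _ open_ball injg] holomorphic_derivI[OF _ open_ball, of g _ _ 0] d(1) r1(1)
      by auto
  qed
  have G': "deriv G 0 \<noteq> 0" "(G has_field_derivative deriv G 0) (at 0)"
    using holomorphic_injective_imp_regular[OF r2(3)[folded G_def] open_ball injG]
      holomorphic_derivI[OF r2(3)[folded G_def] open_ball, of 0] r2(1) by auto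
  have g0: "g 0 = 0" "G 0 = 0" using *(3,6) d(3) by (auto simp: g_def G_def)
  have lim_g: "((\<lambda>z. g z / z) \<longlongrightarrow> deriv g 0) (at 0)"
    using g'(2) g0 by (simp add: has_field_derivative_iff)
  have lim_G: "((\<lambda>z. G z / z) \<longlongrightarrow> deriv G 0) (at 0)"
    using G'(2) g0 by (simp add: has_field_derivative_iff)
  have "filterlim (\<lambda>z::complex. z ^ k) (at 0) (at 0)"
  proof (rule filterlim_atI)
    have "((\<lambda>z::complex. z ^ k) \<longlongrightarrow> 0 ^ k) (at 0)" by (intro tendsto_intros)
    then show "((\<lambda>z::complex. z ^ k) \<longlongrightarrow> 0) (at 0)" using d(2) by (simp add: power_0_left)
    show "eventually (\<lambda>z::complex. z ^ k \<noteq> 0) (at 0)"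
      using eventually_neq_at_within[of "0::complex" 0 UNIV] by eventually_elim simp
  qed
  then have lim_Gk: "((\<lambda>z. G (z ^ k) / z ^ k) \<longlongrightarrow> deriv G 0) (at 0)"
    by (rule filterlim_compose[OF lim_G])
  have "eventually (\<lambda>z. z \<in> ball 0 (min r r1) - {0}) (at (0::complex))"
    using d(1) r1(1) by (intro eventually_at_in_open) auto
  then have eq: "eventually (\<lambda>z. z \<noteq> 0 \<and> G (z ^ k) = g z ^ l) (at 0)"
  proof eventually_elim
    case (elim z)
    then have z: "z \<in> ball 0 r" "z \<in> ball 0 r1" "z \<noteq> 0" by auto
    then have "\<theta> z \<in> U" using r1(2) by blast
    then have "\<psi> (f (\<theta> z)) = \<phi> (\<theta> z) ^ l" using *(8) by blast
    then show ?case using d(5)[OF z(1)] z(3) by (simp add: g_def G_def)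
  qed
  show ?thesis
  proof (rule linorder_cases[of l k])
    assume "k < l"
    have "((\<lambda>z. (g z / z) ^ l * z ^ (l - k)) \<longlongrightarrow> deriv g 0 ^ l * 0 ^ (l - k)) (at 0)"
      by (intro tendsto_intros lim_g)
    then have "((\<lambda>z. (g z / z) ^ l * z ^ (l - k)) \<longlongrightarrow> 0) (at 0)" using \<open>k < l\<close> by (simp add: power_0_left)
    moreover have "eventually (\<lambda>z. G (z ^ k) / z ^ k = (g z / z) ^ l * z ^ (l - k)) (at 0)"
      using eq
    proof eventually_elim
      case (elim z)
      moreover have "z ^ l = z ^ k * z ^ (l - k)" using \<open>k < l\<close> by (simp flip: power_add)
      ultimately show ?case by (simp add: power_divide field_simps)
    qed
    ultimately have "((\<lambda>z. G (z ^ k) / z ^ k) \<longlongrightarrow> 0) (at 0)"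
      by (simp only: tendsto_cong)
    with lim_Gk G'(1) show ?thesis using tendsto_unique[OF _ lim_Gk] by simp
  next
    assume "l < k"
    have "((\<lambda>z. G (z ^ k) / z ^ k * z ^ (k - l)) \<longlongrightarrow> deriv G 0 * 0 ^ (k - l)) (at 0)"
      by (intro tendsto_intros lim_Gk)
    then have "((\<lambda>z. G (z ^ k) / z ^ k * z ^ (k - l)) \<longlongrightarrow> 0) (at 0)" using \<open>l < k\<close> by (simp add: power_0_left)
    moreover have "eventually (\<lambda>z. (g z / z) ^ l = G (z ^ k) / z ^ k * z ^ (k - l)) (at 0)"
      using eq
    proof eventually_elim
      case (elim z)
      moreover have "z ^ k = z ^ l * z ^ (k - l)" using \<open>l < k\<close> by (simp flip: power_add)
      ultimately show ?case by (simp add: power_divide field_simps)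
    qed
    ultimately have "((\<lambda>z. (g z / z) ^ l) \<longlongrightarrow> 0) (at 0)"
      by (simp only: tendsto_cong)
    moreover have "((\<lambda>z. (g z / z) ^ l) \<longlongrightarrow> deriv g 0 ^ l) (at 0)" by (intro tendsto_intros lim_g)
    ultimately have "deriv g 0 ^ l = 0" by (intro tendsto_unique[of "at (0::complex)"]) auto
    with g'(1) show ?thesis by simp
  qed
qed

lemma branching_order_eq:
  "disc_param M f x k \<theta> r \<Longrightarrow> branching_order M riemann_sphere f x = k"
  unfolding branching_order_def
  using has_branching_order_disc has_branching_order_unique by (intro the_equality) blast+

lemma order_dvd_index:
  assumes "x \<in> surface_points M" "disc_param M f x k \<theta> r"
  shows "k dvd branching_index M riemann_sphere f (f x)"
  unfolding branching_index_def using assms branching_order_eq[OF assms(2)]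
  by (intro dvd_Lcm) auto

lemma index_noncritical:
  assumes "p \<notin> critical_values M riemann_sphere f"
  shows "branching_index M riemann_sphere f p = 1"
proof -
  have "branching_order M riemann_sphere f x = 1" if x: "x \<in> surface_points M" "f x = p" for x
  proof -
    obtain k \<theta> r where d: "disc_param M f x k \<theta> r" using ex_disc_param[OF x(1)] by blast
    have "\<not> 2 \<le> branching_order M riemann_sphere f x"
      using assms x unfolding critical_values_def by blast
    then show ?thesis using branching_order_eq[OF d] disc_paramD(2)[OF d] by simp
  qed
  then have "branching_order M riemann_sphere f ` {x \<in> surface_points M. f x = p} \<subseteq> {1}" by auto
  then show ?thesis unfolding branching_index_def by (metis Lcm_1_iff insert_iff singleton_iff subset_iff dvd_refl is_unit_gcd nat_dvd_1_iff_1)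
qed

lemma cont_f: "continuous_map (surface_top M) (surface_top riemann_sphere) f"
  using holf by (simp add: holomorphic_map_def)

text \<open>The image is closed by compactness, and open because \<open>\<zeta>^k\<close> maps a
  disc of radius \<open>r\<close> onto one of radius \<open>r^k\<close>; the sphere is
  connected.\<close>

lemma surj_f: "f ` surface_points M = UNIV"
proof (rule sphere_clopen)
  have ne: "surface_points M \<noteq> {}" using nonconst by (auto simp: constant_on_def)
  then show "f ` surface_points M \<noteq> {}" by simp
  have "closedin (surface_top riemann_sphere) (f ` surface_points M)"
    using continuous_imp_closed_map[OF cont_f compact] riemann_surface_sphere
    unfolding riemann_surface_def closed_map_def by blast
  then show "openin (surface_top riemann_sphere) (- f ` surface_points M)"
    unfolding closedin_def by (simp add: Compl_eq_Diff_UNIV)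
  show "openin (surface_top riemann_sphere) (f ` surface_points M)"
  proof (subst openin_subopen, intro ballI)
    fix p assume "p \<in> f ` surface_points M"
    then obtain x where x: "x \<in> surface_points M" "p = f x" by blast
    obtain k \<theta> r where "disc_param M f x k \<theta> r" using ex_disc_param[OF x(1)] by blast
    note d = disc_paramD[OF this]
    have "sph p ` ball 0 (r ^ k) \<subseteq> f ` surface_points M"
    proof
      fix q assume "q \<in> sph p ` ball 0 (r ^ k)"
      then obtain s where s: "norm s < r ^ k" "q = sph p s" by auto
      define t where "t = (if s = 0 then 0 else exp (Ln s / k))"
      have t: "t ^ k = s" using d(2) by (simp add: t_def power_0_left exp_of_nat_mult[symmetric])
      then have "norm t ^ k < r ^ k" using s(1) by (metis norm_power)
      then have "t \<in> ball 0 r" using d(1) power_less_imp_less_base[of "norm t" k r] by simp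
      then have "f (\<theta> t) = q" "\<theta> t \<in> surface_points M"
        using d(5) t s(2) x(2) hol_at_point[OF surf d(4)] by auto
      then show "q \<in> f ` surface_points M" by blast
    qed
    then show "\<exists>T. openin (surface_top riemann_sphere) T \<and> p \<in> T \<and> T \<subseteq> f ` surface_points M"
      using d(1) by (intro exI[of _ "sph p ` ball 0 (r ^ k)"]) (auto simp: openin_sph_image intro!: image_eqI[of _ _ 0])
  qed
qed

text \<open>A continuous map from a compact space to a Hausdorff space is closed: the image of the
  complement of all \<open>N x\<close> is a closed set that misses \<open>p\<close>.\<close>

lemma fibre_neighbourhood:
  assumes N: "\<And>x. x \<in> surface_points M \<Longrightarrow> f x = p \<Longrightarrow> openin (surface_top M) (N x) \<and> x \<in> N x"
  obtains \<delta> where "0 < \<delta>"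
    "\<And>y. y \<in> surface_points M \<Longrightarrow> f y \<in> sph p ` ball 0 \<delta> \<Longrightarrow> \<exists>x\<in>surface_points M. f x = p \<and> y \<in> N x"
proof -
  let ?U = "\<Union>x\<in>{x\<in>surface_points M. f x = p}. N x"
  have "openin (surface_top M) ?U" using N by (intro openin_Union) auto
  then have "closedin (surface_top M) (surface_points M - ?U)" by blast
  then have "closedin (surface_top riemann_sphere) (f ` (surface_points M - ?U))"
    using continuous_imp_closed_map[OF cont_f compact] riemann_surface_sphere
    unfolding riemann_surface_def closed_map_def by blast
  then have op: "openin (surface_top riemann_sphere) (- f ` (surface_points M - ?U))"
    unfolding closedin_def by (simp add: Compl_eq_Diff_UNIV)
  have p: "sph p 0 \<in> - f ` (surface_points M - ?U)" using N by auto
  obtain \<delta> where \<delta>: "\<delta> > 0" "sph p ` ball 0 \<delta> \<subseteq> - f ` (surface_points M - ?U)"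
    using hol_at_preimage[OF riemann_surface_sphere hol_at_sph op p] by metis
  show ?thesis by (rule that[OF \<delta>(1)]) (use \<delta>(2) in blast)
qed

text \<open>The fibre is compact, and a parametrised disc around one of its points \<open>x\<close>
  meets it in \<open>x\<close> alone, since \<open>\<zeta>^k = 0\<close> only for
  \<open>\<zeta> = 0\<close>. A finite subcover therefore enumerates it.\<close>

lemma finite_fibre: "finite {x \<in> surface_points M. f x = p}"
proof -
  let ?F = "{x \<in> surface_points M. f x = p}"
  obtain k \<theta> r where d: "\<And>x. x \<in> surface_points M \<Longrightarrow> disc_param M f x (k x) (\<theta> x) (r x)"
    using ex_disc_param by metis
  have "closedin (surface_top riemann_sphere) {p}"
    using riemann_surface_sphere Hausdorff_imp_t1_space unfolding riemann_surface_def
    by (metis t1_space_closedin_singleton surface_points_sphere UNIV_I)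
  from closedin_continuous_map_preimage[OF cont_f this] have "closedin (surface_top M) ?F" by simp
  then have F: "compactin (surface_top M) ?F" using compact closedin_compact_space by blast
  let ?N = "\<lambda>x. \<theta> x ` ball 0 (r x)"
  have "\<And>U. U \<in> ?N ` ?F \<Longrightarrow> openin (surface_top M) U" using disc_paramD(7)[OF d] by blast
  moreover have "?F \<subseteq> \<Union> (?N ` ?F)"
  proof
    fix x assume "x \<in> ?F"
    then show "x \<in> \<Union> (?N ` ?F)"
      using disc_paramD(1,3)[OF d, of x] by (intro UN_I[of x]) (auto intro!: image_eqI[of _ _ 0])
  qed
  ultimately obtain \<F> where \<F>: "finite \<F>" "\<F> \<subseteq> ?N ` ?F" "?F \<subseteq> \<Union>\<F>"
    using F unfolding compactin_def by (metis (no_types, lifting))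
  then obtain I where I: "finite I" "I \<subseteq> ?F" "\<F> = ?N ` I"
    using finite_subset_image[OF \<F>(1,2)] by blast
  have "?F \<subseteq> I"
  proof
    fix y assume y: "y \<in> ?F"
    then obtain x \<zeta> where x: "x \<in> I" "\<zeta> \<in> ball 0 (r x)" "y = \<theta> x \<zeta>" using \<F>(3) I(3) by auto
    then have xF: "x \<in> surface_points M" "f x = p" using I(2) by auto
    note dx = disc_paramD[OF d[OF xF(1)]]
    have "sph p (\<zeta> ^ k x) = sph p 0" using dx(5)[OF x(2)] x(3) y xF by simp
    then have "\<zeta> = 0" using dx(2) by (simp del: sph_simps(2))
    with x dx(3) show "y \<in> I" by simp
  qed
  then show ?thesis using I(1) finite_subset by blast
qed

end

section \<open>Lifting a map of the plane through a branched covering\<close>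

definition local_power :: "(complex option \<Rightarrow> nat) \<Rightarrow> (complex \<Rightarrow> complex option) \<Rightarrow> complex \<Rightarrow> bool" where
  "local_power n h y \<longleftrightarrow> (\<exists>r>0. \<exists>\<eta>. \<eta> holomorphic_on ball y r \<and>
     (\<forall>z\<in>ball y r. h z = sph (h y) (\<eta> z ^ n (h y))))"

context branched_covering
begin

text \<open>Around a point \<open>x\<close> of the fibre over \<open>p = h y0\<close> the covering
  is \<open>\<zeta>^k\<close> with \<open>k\<close> dividing \<open>n p\<close>, so
  \<open>\<theta> x (\<omega> * \<eta>^(n p div k))\<close> with \<open>\<omega>^k = 1\<close> is a
  lift of \<open>h\<close>. Conversely every germ of a lift near \<open>y0\<close> is one of these.
  Since they all live on the same disc, each germ extends over that whole disc; this is the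
  uniformity that continuation requires.\<close>

lemma local_lifts:
  assumes n: "\<And>p. 0 < n p" "\<And>p. branching_index M riemann_sphere f p dvd n p"
    and h: "local_power n h y0"
  shows "\<exists>\<rho>>0. (\<exists>c. \<forall>z\<in>ball y0 \<rho>. hol_at M c z \<and> f (c z) = h z) \<and>
    (\<forall>y\<in>ball y0 \<rho>. \<forall>c. eventually (\<lambda>z. hol_at M c z \<and> f (c z) = h z) (nhds y) \<longrightarrow>
      (\<exists>c'. (\<forall>z\<in>ball y0 \<rho>. hol_at M c' z \<and> f (c' z) = h z) \<and> eventually (\<lambda>z. c z = c' z) (nhds y)))"
proof -
  define p where "p = h y0"
  obtain r0 \<eta> where r0: "0 < r0" "\<eta> holomorphic_on ball y0 r0" "\<And>z. z \<in> ball y0 r0 \<Longrightarrow> h z = sph p (\<eta> z ^ n p)"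
    using h unfolding local_power_def p_def by blast
  have \<eta>0: "\<eta> y0 = 0"
  proof -
    have "sph p (\<eta> y0 ^ n p) = sph p 0" using r0(3)[of y0] r0(1) by (simp add: p_def)
    then show ?thesis using n(1)[of p] by (simp del: sph_simps(2))
  qed
  let ?F = "{x \<in> surface_points M. f x = p}"
  obtain k \<theta> r where d: "\<And>x. x \<in> surface_points M \<Longrightarrow> disc_param M f x (k x) (\<theta> x) (r x)"
    using ex_disc_param by metis
  have kn: "k x dvd n p" "0 < k x" "0 < r x" if "x \<in> ?F" for x
  proof -
    show "0 < k x" "0 < r x" using disc_paramD(1,2)[OF d, of x] that by auto
    have "k x dvd branching_index M riemann_sphere f p" using order_dvd_index[OF _ d, of x] that by auto
    then show "k x dvd n p" using n(2) dvd_trans by blast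
  qed
  let ?N = "\<lambda>x. \<theta> x ` ball 0 (r x)"
  have N: "openin (surface_top M) (?N x) \<and> x \<in> ?N x" if "x \<in> surface_points M" "f x = p" for x
    using disc_paramD(1,3,7)[OF d[OF that(1)]] by (auto intro!: image_eqI[of _ _ 0])
  obtain \<delta> where \<delta>: "0 < \<delta>"
    "\<And>y. y \<in> surface_points M \<Longrightarrow> f y \<in> sph p ` ball 0 \<delta> \<Longrightarrow> \<exists>x\<in>surface_points M. f x = p \<and> y \<in> ?N x"
    by (rule fibre_neighbourhood[of p ?N, OF N]) (assumption | rule that)+
  obtain x0 where x0: "x0 \<in> ?F" using surj_f by (metis (mono_tags, lifting) UNIV_I image_iff mem_Collect_eq)
  \<comment> \<open>Below \<open>\<delta>\<close> a point over the value lies in one of the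
    parametrised discs, and below \<open>r x ^ k x\<close> the \<open>k x\<close>-th roots of the
    value stay inside the parameter disc. The fibre is finite, so the minimum is positive.\<close>
  define \<epsilon> where "\<epsilon> = Min (insert \<delta> ((\<lambda>x. r x ^ k x) ` ?F))"
  have \<epsilon>: "0 < \<epsilon>" "\<epsilon> \<le> \<delta>" "\<And>x. x \<in> ?F \<Longrightarrow> \<epsilon> \<le> r x ^ k x"
    unfolding \<epsilon>_def using finite_fibre[of p] \<delta>(1) kn(3) by (auto simp: Min_gr_iff)
  have "continuous_on (ball y0 r0) (\<lambda>z. \<eta> z ^ n p)"
    using r0(2) by (intro continuous_intros holomorphic_on_imp_continuous_on)
  then have "open (ball y0 r0 \<inter> (\<lambda>z. \<eta> z ^ n p) -` ball 0 \<epsilon>)" by (intro continuous_open_preimage) auto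
  moreover have "y0 \<in> ball y0 r0 \<inter> (\<lambda>z. \<eta> z ^ n p) -` ball 0 \<epsilon>"
    using r0(1) \<epsilon>(1) \<eta>0 n(1)[of p] by (simp add: power_0_left)
  ultimately obtain \<rho> where \<rho>: "\<rho> > 0" "ball y0 \<rho> \<subseteq> ball y0 r0 \<inter> (\<lambda>z. \<eta> z ^ n p) -` ball 0 \<epsilon>"
    using openE by blast
  have \<rho>': "h z = sph p (\<eta> z ^ n p)" "norm (\<eta> z ^ n p) < \<epsilon>" if "z \<in> ball y0 \<rho>" for z
    using that \<rho>(2) r0(3) by auto
  define C where "C = (\<lambda>x \<omega> z. \<theta> x (\<omega> * \<eta> z ^ (n p div k x)))"
  have pow: "(\<omega> * \<eta> z ^ (n p div k x)) ^ k x = \<eta> z ^ n p" if "x \<in> ?F" "\<omega> ^ k x = 1" for x \<omega> z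
    using kn(1)[OF that(1)] that(2) by (simp add: power_mult_distrib dvd_div_mult_self flip: power_mult)
  have inball: "\<omega> * \<eta> z ^ (n p div k x) \<in> ball 0 (r x)" if "x \<in> ?F" "\<omega> ^ k x = 1" "z \<in> ball y0 \<rho>" for x \<omega> z
  proof -
    have "norm (\<omega> * \<eta> z ^ (n p div k x)) ^ k x < r x ^ k x"
      using pow[OF that(1,2), of z] \<rho>'(2)[OF that(3)] \<epsilon>(3)[OF that(1)] by (metis norm_power order_less_le_trans)
    then have "norm (\<omega> * \<eta> z ^ (n p div k x)) < r x"
      by (rule power_less_imp_less_base) (use kn(3)[OF that(1)] in simp)
    then show ?thesis by simp
  qed
  have C: "hol_at M (C x \<omega>) z \<and> f (C x \<omega> z) = h z" if x: "x \<in> ?F" "\<omega> ^ k x = 1" "z \<in> ball y0 \<rho>" for x \<omega> z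
  proof
    have dx: "disc_param M f x (k x) (\<theta> x) (r x)" using d x(1) by auto
    have "\<eta> analytic_on {z}" using r0(2) \<rho>(2) x(3) by (meson IntD1 analytic_at open_ball subsetD)
    then have "(\<lambda>z. \<omega> * \<eta> z ^ (n p div k x)) analytic_on {z}" by (intro analytic_intros)
    then show "hol_at M (C x \<omega>) z"
      unfolding C_def
      using hol_at_compose[OF surf, of "\<theta> x" "\<lambda>z. \<omega> * \<eta> z ^ (n p div k x)" z] disc_paramD(4)[OF dx inball[OF x]]
      by blast
    show "f (C x \<omega> z) = h z"
      unfolding C_def disc_paramD(5)[OF dx inball[OF x]] using pow[OF x(1,2)] \<rho>'(1)[OF x(3)] x(1) by simp
  qed
  have ext: "\<exists>c'. (\<forall>z\<in>ball y0 \<rho>. hol_at M c' z \<and> f (c' z) = h z) \<and> eventually (\<lambda>z. c z = c' z) (nhds y)"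
    if y: "y \<in> ball y0 \<rho>" and c: "eventually (\<lambda>z. hol_at M c z \<and> f (c z) = h z) (nhds y)" for y c
  proof -
    have cy: "hol_at M c y" "f (c y) = h y" using eventually_nhds_x_imp_x[OF c] by auto
    have "norm (\<eta> y ^ n p) < \<delta>" using \<rho>'(2)[OF y] \<epsilon>(2) by linarith
    then have "f (c y) \<in> sph p ` ball 0 \<delta>"
      unfolding cy(2) \<rho>'(1)[OF y] by (intro imageI) simp
    then obtain x where x: "x \<in> ?F" "c y \<in> ?N x" using \<delta>(2) hol_at_point[OF surf cy(1)] by blast
    then have dx: "disc_param M f x (k x) (\<theta> x) (r x)" using d by auto
    obtain \<phi> where \<phi>: "compatible_chart M (?N x) \<phi>" "\<forall>\<zeta>\<in>ball 0 (r x). \<phi> (\<theta> x \<zeta>) = \<zeta>"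
      using dx unfolding disc_param_def by blast
    obtain e1 where e1: "0 < e1" "c ` ball y e1 \<subseteq> ?N x" "(\<phi> \<circ> c) holomorphic_on ball y e1"
      using hol_at_in_chart[OF surf cy(1) \<phi>(1) x(2)] by blast
    have "eventually (\<lambda>z. z \<in> ball y0 \<rho> \<and> z \<in> ball y e1 \<and> hol_at M c z \<and> f (c z) = h z) (nhds y)"
      using y e1(1) by (intro eventually_conj[OF _ eventually_conj[OF _ c]] eventually_nhds_in_open) auto
    then obtain e where e: "0 < e"
      "\<And>z. z \<in> ball y e \<Longrightarrow> z \<in> ball y0 \<rho> \<and> z \<in> ball y e1 \<and> hol_at M c z \<and> f (c z) = h z"
      unfolding eventually_nhds_metric by (auto simp: dist_commute)
    have \<theta>c: "\<theta> x (\<phi> (c z)) = c z" "\<phi> (c z) \<in> ball 0 (r x)" if z: "z \<in> ball y e" for z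
    proof -
      obtain \<zeta> where "\<zeta> \<in> ball 0 (r x)" "c z = \<theta> x \<zeta>" using e(2)[OF z] e1(2) by blast
      then show "\<theta> x (\<phi> (c z)) = c z" "\<phi> (c z) \<in> ball 0 (r x)" using \<phi>(2) by auto
    qed
    have eq: "\<phi> (c z) ^ k x = (\<eta> z ^ (n p div k x)) ^ k x" if "z \<in> ball y e" for z
    proof -
      have "sph p (\<phi> (c z) ^ k x) = sph p (\<eta> z ^ n p)"
        using disc_paramD(5)[OF dx \<theta>c(2)[OF that]] \<theta>c(1)[OF that] e(2)[OF that] \<rho>'(1)[of z] x(1) by simp
      then show ?thesis using pow[OF x(1), of 1 z] by simp
    qed
    have sub: "ball y e \<subseteq> ball y e1" "ball y e \<subseteq> ball y0 r0" using e(2) \<rho>(2) by blast+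
    have hol1: "(\<lambda>z. \<phi> (c z)) holomorphic_on ball y e"
      using holomorphic_on_subset[OF e1(3) sub(1)] by (simp add: o_def)
    have hol2: "(\<lambda>z. \<eta> z ^ (n p div k x)) holomorphic_on ball y e"
      by (intro holomorphic_intros holomorphic_on_subset[OF r0(2) sub(2)])
    \<comment> \<open>In the coordinate \<open>\<phi>\<close> the given lift and
      \<open>\<eta>^(n p div k x)\<close> have equal \<open>k x\<close>-th powers, hence differ by a
      constant root of unity.\<close>
    obtain \<omega> where \<omega>: "\<omega> ^ k x = 1" "\<And>z. z \<in> ball y e \<Longrightarrow> \<phi> (c z) = \<omega> * \<eta> z ^ (n p div k x)"
      by (rule holomorphic_power_eq_imp_multiple[OF hol1 hol2 open_ball connected_ball kn(2)[OF x(1)] eq])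
        (assumption, rule that, assumption+)
    have "eventually (\<lambda>z. z \<in> ball y e) (nhds y)" using e(1) by (intro eventually_nhds_in_open) auto
    then have "eventually (\<lambda>z. c z = C x \<omega> z) (nhds y)"
    proof eventually_elim
      case (elim z)
      then show ?case unfolding C_def using \<theta>c(1)[OF elim] \<omega>(2)[OF elim] by simp
    qed
    with C[OF x(1) \<omega>(1)] show ?thesis by blast
  qed
  have "\<forall>z\<in>ball y0 \<rho>. hol_at M (C x0 1) z \<and> f (C x0 1 z) = h z" using C[OF x0, of 1] by simp
  with \<rho>(1) ext show ?thesis by blast
qed

lemma ex_lift:
  assumes n: "\<And>p. 0 < n p" "\<And>p. branching_index M riemann_sphere f p dvd n p"
    and h: "\<And>y. local_power n h y"
  obtains c where "\<And>y. hol_at M c y" "\<And>y. f (c y) = h y"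
proof -
  define Q where "Q = (\<lambda>y c. hol_at M c y \<and> f (c y) = h y)"
  obtain \<rho> c0 where c0: "\<rho> > 0" "\<And>z. z \<in> ball 0 \<rho> \<Longrightarrow> Q z c0"
    using local_lifts[OF n h, of 0] unfolding Q_def by blast
  have "\<exists>c. (\<forall>y. Q y c) \<and> eventually (\<lambda>z. c z = c0 z) (nhds 0)"
  proof (rule continuation_on_plane)
    show "Q y c'" if "Q y c" "eventually (\<lambda>z. c z = c' z) (nhds y)" for y c c'
      using that hol_at_cong eventually_nhds_x_imp_x[OF that(2)] unfolding Q_def by metis
    show "\<forall>y\<in>D. c1 y = c2 y"
      if "open D" "convex D" "a \<in> D" "\<And>y. y \<in> D \<Longrightarrow> Q y c1" "\<And>y. y \<in> D \<Longrightarrow> Q y c2"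
        "eventually (\<lambda>z. c1 z = c2 z) (nhds a)" for D c1 c2 a
    proof (rule hol_at_identity[OF surf that(1) convex_connected[OF that(2)] that(3)])
      have "eventually (\<lambda>z. c1 z = c2 z) (at a)" using that(6) by (simp add: eventually_nhds_conv_at)
      then show "\<exists>\<^sub>F z in at a. c1 z = c2 z" by (intro eventually_frequently) auto
    qed (use that(4,5) in \<open>auto simp: Q_def\<close>)
    show "\<exists>\<delta>>0. \<forall>y\<in>ball y0 \<delta>. \<forall>c. eventually (\<lambda>z. Q z c) (nhds y) \<longrightarrow>
        (\<exists>c'. (\<forall>z\<in>ball y0 \<delta>. Q z c') \<and> eventually (\<lambda>z. c z = c' z) (nhds y))" for y0
      using local_lifts[OF n h, of y0] unfolding Q_def by blast
    have "eventually (\<lambda>z. z \<in> ball 0 \<rho>) (nhds (0::complex))" using c0(1) by (intro eventually_nhds_in_open) auto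
    then show "eventually (\<lambda>z. Q z c0) (nhds 0)" by eventually_elim (rule c0(2))
  qed
  then obtain c where "\<And>y. Q y c" by blast
  then show ?thesis by (intro that[of c]) (auto simp: Q_def)
qed

text \<open>By the symmetry of \<open>h\<close>, the map \<open>t \<mapsto> c (1 / t)\<close> is
  again a lift of \<open>h\<close> itself on the punctured plane. Its germ at one point close to
  \<open>0\<close> extends over a full disc around \<open>0\<close> by \<open>local_lifts\<close>,
  and agrees with it on the connected punctured disc.\<close>

lemma lift_at_infinity:
  assumes n: "\<And>p. 0 < n p" "\<And>p. branching_index M riemann_sphere f p dvd n p"
    and h: "local_power n h 0" "\<And>t. t \<noteq> 0 \<Longrightarrow> h (1 / t) = h t"
    and c: "\<And>y. hol_at M c y" "\<And>y. f (c y) = h y"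
  obtains c' \<rho> where "0 < \<rho>" "hol_at M c' 0" "\<And>t. t \<in> ball 0 \<rho> - {0} \<Longrightarrow> c (1 / t) = c' t"
proof -
  define ci where "ci = (\<lambda>t. c (1 / t))"
  have ci: "hol_at M ci t \<and> f (ci t) = h t" if "t \<noteq> 0" for t
  proof
    show "hol_at M ci t" unfolding ci_def
      by (rule hol_at_compose[OF surf c(1)]) (use that in \<open>auto intro!: analytic_intros\<close>)
    show "f (ci t) = h t" unfolding ci_def using c(2) h(2)[OF that] by simp
  qed
  obtain \<rho> where \<rho>: "\<rho> > 0" "\<And>y c. y \<in> ball 0 \<rho> \<Longrightarrow> eventually (\<lambda>z. hol_at M c z \<and> f (c z) = h z) (nhds y) \<Longrightarrow>
      \<exists>c'. (\<forall>z\<in>ball 0 \<rho>. hol_at M c' z \<and> f (c' z) = h z) \<and> eventually (\<lambda>z. c z = c' z) (nhds y)"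
    using local_lifts[OF n h(1)] by blast
  define y where "y = complex_of_real (\<rho> / 2)"
  have y: "y \<in> ball 0 \<rho>" "y \<noteq> 0" using \<rho>(1) by (auto simp: y_def)
  have "eventually (\<lambda>z. z \<in> - {0}) (nhds y)" using y(2) by (intro eventually_nhds_in_open) auto
  then have "eventually (\<lambda>z. hol_at M ci z \<and> f (ci z) = h z) (nhds y)"
    by eventually_elim (use ci in auto)
  from \<rho>(2)[OF y(1) this] obtain c' where c': "\<And>z. z \<in> ball 0 \<rho> \<Longrightarrow> hol_at M c' z"
    "eventually (\<lambda>z. ci z = c' z) (nhds y)" by blast
  have "\<forall>z\<in>ball 0 \<rho> - {0}. ci z = c' z"
  proof (rule hol_at_identity[OF surf, of _ y])
    show "open (ball 0 \<rho> - {0 :: complex})" by (intro open_Diff) auto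
    show "Topological_Spaces.connected (ball 0 \<rho> - {0 :: complex})"
      by (intro connected_open_delete) auto
    have "eventually (\<lambda>z. ci z = c' z) (at y)" using c'(2) by (simp add: eventually_nhds_conv_at)
    then show "\<exists>\<^sub>F z in at y. ci z = c' z" by (intro eventually_frequently) auto
  qed (use y c'(1) ci in auto)
  then show ?thesis using \<rho>(1) c'(1)[of 0] by (intro that[of \<rho> c']) (auto simp: ci_def)
qed

end

section \<open>Meromorphic functions on a Riemann surface\<close>

text \<open>The value of a normalised function is read off from the punctured neighbourhood: it is
  the limit, or \<open>0\<close> at a pole.\<close>

lemma nicely_meromorphic_eq_at:
  assumes "f nicely_meromorphic_on {z}" "g nicely_meromorphic_on {z}" "eventually (\<lambda>w. f w = g w) (at z)"
  shows "f z = g z"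
proof -
  have f: "(is_pole f z \<and> f z = 0) \<or> f \<midarrow>z\<rightarrow> f z" and g: "(is_pole g z \<and> g z = 0) \<or> g \<midarrow>z\<rightarrow> g z"
    using assms(1,2) by (auto simp: nicely_meromorphic_on_def)
  have pole: "is_pole f z \<longleftrightarrow> is_pole g z" by (rule is_pole_cong) (use assms(3) in auto)
  have lim: "g \<midarrow>z\<rightarrow> f z" if "f \<midarrow>z\<rightarrow> f z" using that assms(3) by (simp only: tendsto_cong)
  show ?thesis
  proof (cases "is_pole g z")
    case True
    then show ?thesis using f g pole lim
      by (metis at_neq_bot is_pole_def not_tendsto_and_filterlim_at_infinity)
  next
    case False
    then show ?thesis using f g pole lim LIM_unique by blast
  qed
qed

lemma nicely_meromorphic_on_transform:
  assumes "f nicely_meromorphic_on A" "open A" "\<And>z. z \<in> A \<Longrightarrow> f z = g z"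
  shows "g nicely_meromorphic_on A"
proof -
  have ev: "eventually (\<lambda>w. f w = g w) (nhds z)" if "z \<in> A" for z
    using eventually_nhds_in_open[OF assms(2) that] by eventually_elim (rule assms(3))
  then have ev': "eventually (\<lambda>w. f w = g w) (at z)" if "z \<in> A" for z
    using that by (simp add: eventually_nhds_conv_at)
  have "f meromorphic_on A \<longleftrightarrow> g meromorphic_on A" by (rule meromorphic_on_cong) (use ev' in auto)
  moreover have "(is_pole f z \<longleftrightarrow> is_pole g z) \<and> (f \<midarrow>z\<rightarrow> f z \<longleftrightarrow> g \<midarrow>z\<rightarrow> g z)" if "z \<in> A" for z
    using is_pole_cong[OF ev'[OF that] refl] tendsto_cong[OF ev'[OF that]] assms(3)[OF that] by simp
  ultimately show ?thesis using assms(1,3) unfolding nicely_meromorphic_on_def by metis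
qed

text \<open>Injective holomorphic maps are open and so match the punctured neighbourhoods of a point
  and of its image. Limits, poles and \<open>remove_sings\<close> thereby commute with changes of
  coordinate.\<close>

lemma inj_holomorphic_filtermap_at:
  assumes "g holomorphic_on S" "open S" "inj_on g S" "z \<in> S"
  shows "filtermap g (at z) = at (g z)"
proof (rule filtermap_nhds_eq_imp_filtermap_at_eq)
  show "filtermap g (nhds z) = nhds (g z)"
  proof (rule filtermap_nhds_open_map'[where A = S])
    show "isCont g z" using assms by (meson continuous_on_eq_continuous_at holomorphic_on_imp_continuous_on)
    show "open (g ` T)" if "open T" "T \<subseteq> S" for T
      using that assms by (intro open_mapping_thm3) (auto intro: holomorphic_on_subset inj_on_subset)
  qed (use assms in auto)
  have "eventually (\<lambda>x. x \<in> S) (at z)" using assms by (intro eventually_at_in_open') auto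
  then show "eventually (\<lambda>x. g x = g z \<longrightarrow> x = z) (at z)"
    by eventually_elim (use assms in \<open>auto dest: inj_onD\<close>)
qed

section \<open>Normal forms of meromorphic functions on a surface, and their composition with maps
  of the plane\<close>

context
  fixes M :: "'a surface"
  assumes M: "riemann_surface M"
begin

lemma atlas_chartD:
  assumes "(U, \<phi>) \<in> surface_atlas M"
  shows "openin (surface_top M) U" "open (\<phi> ` U)" "inj_on \<phi> U" "U \<subseteq> surface_points M"
    "open V \<Longrightarrow> openin (surface_top M) {x \<in> U. \<phi> x \<in> V}"
    "openin (surface_top M) W \<Longrightarrow> W \<subseteq> U \<Longrightarrow> open (\<phi> ` W)"
  using complex_chartD[of "surface_top M" U \<phi>] compatible_chart_atlas[OF M assms]
  unfolding compatible_chart_def by blast+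

text \<open>The normal form is taken at each point by \<open>remove_sings\<close> in some chart. The
  result does not depend on the chart, because transition maps carry punctured neighbourhoods to
  punctured neighbourhoods.\<close>

lemma ex_meromorphic_normalization:
  assumes w: "\<And>U \<phi>. (U, \<phi>) \<in> surface_atlas M \<Longrightarrow> (w \<circ> inv_into U \<phi>) meromorphic_on \<phi> ` U"
  shows "\<exists>k. k \<in> meromorphic_functions M \<and> eq_off_discrete M k w"
proof -
  have "\<forall>x. \<exists>V. x \<in> surface_points M \<longrightarrow> V \<in> surface_atlas M \<and> x \<in> fst V"
    using ex_chart[OF M] by (metis fst_conv)
  then obtain ch where ch: "\<And>x. x \<in> surface_points M \<Longrightarrow> ch x \<in> surface_atlas M \<and> x \<in> fst (ch x)"
    by metis
  define k where "k = (\<lambda>x\<in>surface_points M. remove_sings (w \<circ> inv_into (fst (ch x)) (snd (ch x))) (snd (ch x) x))"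
  have k: "k x = remove_sings (w \<circ> inv_into V \<psi>) (\<psi> x)" if V: "(V, \<psi>) \<in> surface_atlas M" "x \<in> V" for V \<psi> x
  proof -
    have x: "x \<in> surface_points M" using atlas_chartD(4)[OF V(1)] V(2) by blast
    obtain U \<phi> where U: "ch x = (U, \<phi>)" "(U, \<phi>) \<in> surface_atlas M" "x \<in> U"
      using ch[OF x] by (metis prod.collapse)
    note cU = atlas_chartD[OF U(2)] and cV = atlas_chartD[OF V(1)]
    let ?S = "\<phi> ` (U \<inter> V)" and ?T = "\<psi> \<circ> inv_into U \<phi>"
    have S: "open ?S" using cU cV by (intro cU(6)) auto
    have T: "?T holomorphic_on ?S"
      using M U(2) V(1) unfolding riemann_surface_def holomorphic_transition_def by blast
    have TT: "?T (\<phi> y) = \<psi> y" if "y \<in> U" for y using that cU(3) by simp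
    have inj: "inj_on ?T ?S"
    proof (rule inj_onI)
      fix a b assume ab: "a \<in> ?S" "b \<in> ?S" "?T a = ?T b"
      from ab(1) obtain y where y: "y \<in> U" "y \<in> V" "a = \<phi> y" by blast
      from ab(2) obtain z where z: "z \<in> U" "z \<in> V" "b = \<phi> z" by blast
      have "\<psi> y = \<psi> z" using ab(3) TT[OF y(1)] TT[OF z(1)] unfolding y(3) z(3) by simp
      then show "a = b" using inj_onD[OF cV(3)] y z by blast
    qed
    have "filtermap ?T (at (\<phi> x)) = at (\<psi> x)"
      using inj_holomorphic_filtermap_at[OF T S inj, of "\<phi> x"] U(3) V(2) TT by auto
    from remove_sings_compose[OF this, of "w \<circ> inv_into V \<psi>"]
    have "remove_sings (w \<circ> inv_into V \<psi> \<circ> ?T) (\<phi> x) = remove_sings (w \<circ> inv_into V \<psi>) (\<psi> x)" .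
    moreover have "remove_sings (w \<circ> inv_into V \<psi> \<circ> ?T) (\<phi> x) = remove_sings (w \<circ> inv_into U \<phi>) (\<phi> x)"
    proof (rule remove_sings_cong)
      have "eventually (\<lambda>z. z \<in> ?S) (at (\<phi> x))"
        using S U(3) V(2) by (intro eventually_at_in_open') auto
      then show "eventually (\<lambda>z. (w \<circ> inv_into V \<psi> \<circ> ?T) z = (w \<circ> inv_into U \<phi>) z) (at (\<phi> x))"
      proof eventually_elim
        case (elim z)
        then obtain y where "y \<in> U" "y \<in> V" "z = \<phi> y" by blast
        then show ?case using cU(3) cV(3) by simp
      qed
    qed simp
    ultimately show ?thesis using x U(1) by (simp add: k_def)
  qed
  have "k \<in> meromorphic_functions M"
    unfolding meromorphic_functions_def
  proof (intro CollectI conjI, safe)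
    show "k \<in> extensional (surface_points M)" by (simp add: k_def)
    fix V \<psi> assume V: "(V, \<psi>) \<in> surface_atlas M"
    show "(k \<circ> inv_into V \<psi>) nicely_meromorphic_on \<psi> ` V"
    proof (rule nicely_meromorphic_on_transform[OF remove_sings_nicely_meromorphic[OF w[OF V]]])
      show "open (\<psi> ` V)" by (rule atlas_chartD(2)[OF V])
      show "remove_sings (w \<circ> inv_into V \<psi>) z = (k \<circ> inv_into V \<psi>) z" if "z \<in> \<psi> ` V" for z
        using k[OF V, of "inv_into V \<psi> z"] that by (simp add: inv_into_into f_inv_into_f)
    qed
  qed
  moreover have "eq_off_discrete M k w"
    unfolding eq_off_discrete_def
  proof (rule equals0I)
    fix x assume x: "x \<in> surface_top M derived_set_of {x \<in> surface_points M. k x \<noteq> w x}"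
    then have "x \<in> surface_points M" by (simp add: in_derived_set_of)
    then obtain V \<psi> where V: "(V, \<psi>) \<in> surface_atlas M" "x \<in> V" using ex_chart[OF M] by blast
    note cV = atlas_chartD[OF V(1)]
    have "isolated_singularity_at (w \<circ> inv_into V \<psi>) (\<psi> x)"
      using w[OF V(1)] V(2) by (auto simp: meromorphic_on_altdef)
    then have "eventually (\<lambda>z. remove_sings (w \<circ> inv_into V \<psi>) z = (w \<circ> inv_into V \<psi>) z) (at (\<psi> x))"
      by (rule eventually_remove_sings_eq_at)
    then obtain S where S: "open S" "\<psi> x \<in> S"
      "\<And>z. z \<in> S \<Longrightarrow> z \<noteq> \<psi> x \<Longrightarrow> remove_sings (w \<circ> inv_into V \<psi>) z = (w \<circ> inv_into V \<psi>) z"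
      unfolding eventually_at_topological by blast
    have "openin (surface_top M) {y \<in> V. \<psi> y \<in> S}" using S(1) by (rule cV(5))
    moreover have "x \<in> {y \<in> V. \<psi> y \<in> S}" using V(2) S(2) by simp
    ultimately have "\<exists>y. y \<noteq> x \<and> y \<in> {x \<in> surface_points M. k x \<noteq> w x} \<and> y \<in> {y \<in> V. \<psi> y \<in> S}"
      using x[unfolded in_derived_set_of, THEN conjunct2, rule_format, of "{y \<in> V. \<psi> y \<in> S}"] by simp
    then obtain y where y: "y \<noteq> x" "y \<in> V" "\<psi> y \<in> S" "k y \<noteq> w y" by blast
    then have "\<psi> y \<noteq> \<psi> x" using V(2) inj_onD[OF cV(3)] by blast
    then have "k y = w y" using S(3)[OF y(3)] k[OF V(1) y(2)] cV(3) y(2) by simp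
    with y(4) show False ..
  qed
  ultimately show ?thesis by blast
qed

lemma eq_off_discreteE:
  assumes "eq_off_discrete M g h" "x \<in> surface_points M"
  obtains W where "openin (surface_top M) W" "x \<in> W" "\<And>y. y \<in> W \<Longrightarrow> y \<noteq> x \<Longrightarrow> g y = h y"
proof -
  from assms obtain W where W: "openin (surface_top M) W" "x \<in> W"
    "\<not> (\<exists>y. y \<noteq> x \<and> y \<in> {x \<in> surface_points M. g x \<noteq> h x} \<and> y \<in> W)"
    unfolding eq_off_discrete_def by (auto simp: derived_set_of_def set_eq_iff)
  then show ?thesis using openin_subset[OF W(1)] by (intro that[of W]) blast+
qed

lemma meromorphic_normalization_unique:
  assumes "k \<in> meromorphic_functions M" "eq_off_discrete M k w"
    and "l \<in> meromorphic_functions M" "eq_off_discrete M l w"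
  shows "k = l"
proof (rule extensionalityI[of _ "surface_points M"])
  show "k \<in> extensional (surface_points M)" "l \<in> extensional (surface_points M)"
    using assms(1,3) by (auto simp: meromorphic_functions_def)
  fix x assume x: "x \<in> surface_points M"
  obtain W1 where W1: "openin (surface_top M) W1" "x \<in> W1" "\<And>y. y \<in> W1 \<Longrightarrow> y \<noteq> x \<Longrightarrow> k y = w y"
    using eq_off_discreteE[OF assms(2) x] by metis
  obtain W2 where W2: "openin (surface_top M) W2" "x \<in> W2" "\<And>y. y \<in> W2 \<Longrightarrow> y \<noteq> x \<Longrightarrow> l y = w y"
    using eq_off_discreteE[OF assms(4) x] by metis
  obtain U \<phi> where U: "(U, \<phi>) \<in> surface_atlas M" "x \<in> U" using ex_chart[OF M x] by blast
  note cU = atlas_chartD[OF U(1)]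
  let ?S = "\<phi> ` (U \<inter> W1 \<inter> W2)"
  have "open ?S" using cU(1) W1(1) W2(1) by (intro cU(6)) auto
  then have "eventually (\<lambda>z. z \<in> ?S - {\<phi> x}) (at (\<phi> x))"
    using U(2) W1(2) W2(2) by (intro eventually_at_in_open) auto
  then have "eventually (\<lambda>z. (k \<circ> inv_into U \<phi>) z = (l \<circ> inv_into U \<phi>) z) (at (\<phi> x))"
  proof eventually_elim
    case (elim z)
    then obtain y where "y \<in> U" "y \<in> W1" "y \<in> W2" "z = \<phi> y" "y \<noteq> x" by blast
    then show ?case using cU(3) W1(3) W2(3) by simp
  qed
  moreover have "(g \<circ> inv_into U \<phi>) nicely_meromorphic_on {\<phi> x}" if "g \<in> meromorphic_functions M" for g
    using that U by (auto simp: meromorphic_functions_def intro: nicely_meromorphic_on_subset)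
  ultimately have "(k \<circ> inv_into U \<phi>) (\<phi> x) = (l \<circ> inv_into U \<phi>) (\<phi> x)"
    using assms(1,3) nicely_meromorphic_eq_at[of "k \<circ> inv_into U \<phi>" "\<phi> x" "l \<circ> inv_into U \<phi>"] by blast
  then show "k x = l x" using U(2) cU(3) by simp
qed

text \<open>Existence and uniqueness of the normal form justify the definite descriptions by which
  \<open>meromorphic_field\<close> defines its sum and product.\<close>

lemma meromorphic_field_ops:
  assumes "g \<in> meromorphic_functions M" "h \<in> meromorphic_functions M"
  shows "eq_off_discrete M (g \<otimes>\<^bsub>meromorphic_field M\<^esub> h) (\<lambda>x. g x * h x)"
    "eq_off_discrete M (g \<oplus>\<^bsub>meromorphic_field M\<^esub> h) (\<lambda>x. g x + h x)"
    "g \<otimes>\<^bsub>meromorphic_field M\<^esub> h \<in> meromorphic_functions M"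
    "g \<oplus>\<^bsub>meromorphic_field M\<^esub> h \<in> meromorphic_functions M"
proof -
  have mero: "(u \<circ> inv_into U \<phi>) meromorphic_on \<phi> ` U"
    if "u \<in> meromorphic_functions M" "(U, \<phi>) \<in> surface_atlas M" for u U \<phi>
    using that by (auto simp: meromorphic_functions_def nicely_meromorphic_on_def)
  have "\<exists>!k. k \<in> meromorphic_functions M \<and> eq_off_discrete M k (\<lambda>x. g x * h x)"
    using ex_meromorphic_normalization[of "\<lambda>x. g x * h x"] meromorphic_normalization_unique
      meromorphic_on_mult[OF mero[OF assms(1)] mero[OF assms(2)]] by (auto simp: o_def)
  from theI'[OF this] show "eq_off_discrete M (g \<otimes>\<^bsub>meromorphic_field M\<^esub> h) (\<lambda>x. g x * h x)"
    "g \<otimes>\<^bsub>meromorphic_field M\<^esub> h \<in> meromorphic_functions M" by (auto simp: meromorphic_field_def)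
  have "\<exists>!k. k \<in> meromorphic_functions M \<and> eq_off_discrete M k (\<lambda>x. g x + h x)"
    using ex_meromorphic_normalization[of "\<lambda>x. g x + h x"] meromorphic_normalization_unique
      meromorphic_on_add[OF mero[OF assms(1)] mero[OF assms(2)]] by (auto simp: o_def)
  from theI'[OF this] show "eq_off_discrete M (g \<oplus>\<^bsub>meromorphic_field M\<^esub> h) (\<lambda>x. g x + h x)"
    "g \<oplus>\<^bsub>meromorphic_field M\<^esub> h \<in> meromorphic_functions M" by (auto simp: meromorphic_field_def)
qed

lemma meromorphic_compose_hol_at:
  assumes "u \<in> meromorphic_functions M" "hol_at M c y"
  shows "(\<lambda>z. u (c z)) meromorphic_on {y}"
proof -
  obtain U \<phi> r where c: "(U, \<phi>) \<in> surface_atlas M" "0 < r" "c ` ball y r \<subseteq> U" "(\<phi> \<circ> c) holomorphic_on ball y r"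
    using assms(2) by (rule hol_atE)
  have "(u \<circ> inv_into U \<phi>) meromorphic_on \<phi> ` U"
    using assms(1) c(1) by (auto simp: meromorphic_functions_def nicely_meromorphic_on_def)
  moreover have "(\<phi> \<circ> c) analytic_on {y}" using c(2,4) by (meson analytic_at centre_in_ball open_ball)
  moreover have "(\<phi> \<circ> c) ` {y} \<subseteq> \<phi> ` U" using c(2,3) by (auto simp: image_subset_iff)
  ultimately have "(\<lambda>z. (u \<circ> inv_into U \<phi>) ((\<phi> \<circ> c) z)) meromorphic_on {y}"
    by (rule meromorphic_on_compose)
  moreover have "eventually (\<lambda>z. z \<in> ball y r) (at y)" using c(2) by (intro eventually_at_in_open') auto
  then have "eventually (\<lambda>z. (u \<circ> inv_into U \<phi>) ((\<phi> \<circ> c) z) = u (c z)) (at y)"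
  proof eventually_elim
    case (elim z)
    then have "c z \<in> U" using c(3) by blast
    then show ?case using atlas_chartD(3)[OF c(1)] by simp
  qed
  ultimately show ?thesis by (subst (asm) meromorphic_on_cong[of "{y}"]) auto
qed

text \<open>The operations of the field agree with the pointwise ones off a discrete set. As
  \<open>c\<close> is nowhere locally constant, the preimage of that set is discrete in the plane,
  and \<open>mero_of\<close> does not see it.\<close>

lemma ring_hom_compose:
  assumes c: "\<And>y. hol_at M c y" "\<And>y. eventually (\<lambda>z. c z \<noteq> c y) (at y)"
    and u: "g \<in> meromorphic_functions M" "h \<in> meromorphic_functions M"
  shows "mero_of (\<lambda>z. (g \<otimes>\<^bsub>meromorphic_field M\<^esub> h) (c z)) = mero_of (\<lambda>z. g (c z)) * mero_of (\<lambda>z. h (c z))"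
    "mero_of (\<lambda>z. (g \<oplus>\<^bsub>meromorphic_field M\<^esub> h) (c z)) = mero_of (\<lambda>z. g (c z)) + mero_of (\<lambda>z. h (c z))"
    "mero_of (\<lambda>z. \<one>\<^bsub>meromorphic_field M\<^esub> (c z)) = 1"
proof -
  have mero: "(\<lambda>z. v (c z)) meromorphic_on UNIV" if "v \<in> meromorphic_functions M" for v
    using meromorphic_compose_hol_at[OF that c(1)] meromorphic_on_meromorphic_at[of _ UNIV] by blast
  have ev: "eventually (\<lambda>z. k (c z) = w (c z)) (at y)" if eq: "eq_off_discrete M k w" for k w y
  proof -
    obtain W where W: "openin (surface_top M) W" "c y \<in> W" "\<And>x. x \<in> W \<Longrightarrow> x \<noteq> c y \<Longrightarrow> k x = w x"
      using eq_off_discreteE[OF eq hol_at_point[OF M c(1)]] by metis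
    obtain r where r: "r > 0" "c ` ball y r \<subseteq> W" using hol_at_preimage[OF M c(1) W(1,2)] by blast
    have "eventually (\<lambda>z. z \<in> ball y r) (at y)" using r by (intro eventually_at_in_open') auto
    with c(2)[of y] show ?thesis
    proof eventually_elim
      case (elim z)
      then show ?case using r(2) by (intro W(3)) auto
    qed
  qed
  note ops = meromorphic_field_ops[OF u]
  have "mero_of (\<lambda>z. g (c z)) * mero_of (\<lambda>z. h (c z)) = mero_of (\<lambda>z. g (c z) * h (c z))"
    unfolding mero_of_def by (rule times_mero.abs_eq) (use mero u in \<open>auto intro: mero_eq_refl\<close>)
  then show "mero_of (\<lambda>z. (g \<otimes>\<^bsub>meromorphic_field M\<^esub> h) (c z)) = mero_of (\<lambda>z. g (c z)) * mero_of (\<lambda>z. h (c z))"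
    using ev[OF ops(1)] mero[OF ops(3)] mero[OF u(1)] mero[OF u(2)]
    by (simp add: mero_of_eq_iff meromorphic_on_mult)
  have "mero_of (\<lambda>z. g (c z)) + mero_of (\<lambda>z. h (c z)) = mero_of (\<lambda>z. g (c z) + h (c z))"
    unfolding mero_of_def by (rule plus_mero.abs_eq) (use mero u in \<open>auto intro: mero_eq_refl\<close>)
  then show "mero_of (\<lambda>z. (g \<oplus>\<^bsub>meromorphic_field M\<^esub> h) (c z)) = mero_of (\<lambda>z. g (c z)) + mero_of (\<lambda>z. h (c z))"
    using ev[OF ops(2)] mero[OF ops(4)] mero[OF u(1)] mero[OF u(2)]
    by (simp add: mero_of_eq_iff meromorphic_on_add)
  have "(\<lambda>z. \<one>\<^bsub>meromorphic_field M\<^esub> (c z)) = (\<lambda>_. 1)"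
    using hol_at_point[OF M c(1)] by (auto simp: meromorphic_field_def)
  then show "mero_of (\<lambda>z. \<one>\<^bsub>meromorphic_field M\<^esub> (c z)) = 1" by (simp add: mero_of_def one_mero.abs_eq)
qed

end

section \<open>Calculating in the field of meromorphic functions\<close>

lemma mero_of_arith:
  assumes "f meromorphic_on UNIV" "g meromorphic_on UNIV"
  shows "mero_of (\<lambda>z. f z + g z) = mero_of f + mero_of g" "mero_of (\<lambda>z. f z * g z) = mero_of f * mero_of g"
    "mero_of (\<lambda>z. f z - g z) = mero_of f - mero_of g" "mero_of (\<lambda>z. f z / g z) = mero_of f / mero_of g"
    "mero_of (\<lambda>z. - f z) = - mero_of f"
  unfolding mero_of_def using assms
  by (simp_all add: plus_mero.abs_eq times_mero.abs_eq minus_mero.abs_eq divide_mero.abs_eq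
      uminus_mero.abs_eq mero_eq_refl)

lemma mero_of_power: "f meromorphic_on UNIV \<Longrightarrow> mero_of (\<lambda>z. f z ^ n) = mero_of f ^ n"
proof (induction n)
  case 0
  then show ?case by (simp add: mero_of_def one_mero.abs_eq)
next
  case (Suc n)
  then show ?case using mero_of_arith(2)[of f "\<lambda>z. f z ^ n"] by (simp add: meromorphic_on_power)
qed

lemma mero_of_sum:
  "(\<And>i. i \<in> I \<Longrightarrow> f i meromorphic_on UNIV) \<Longrightarrow> mero_of (\<lambda>z. \<Sum>i\<in>I. f i z) = (\<Sum>i\<in>I. mero_of (f i))"
proof (induction I rule: infinite_finite_induct)
  case (insert i I)
  then show ?case using mero_of_arith(1)[of "f i" "\<lambda>z. \<Sum>i\<in>I. f i z"] by (simp add: meromorphic_on_sum)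
qed (simp_all add: mero_of_def zero_mero.abs_eq)

lemma mero_of_prod:
  "(\<And>i. i \<in> I \<Longrightarrow> f i meromorphic_on UNIV) \<Longrightarrow> mero_of (\<lambda>z. \<Prod>i\<in>I. f i z) = (\<Prod>i\<in>I. mero_of (f i))"
proof (induction I rule: infinite_finite_induct)
  case (insert i I)
  then show ?case using mero_of_arith(2)[of "f i" "\<lambda>z. \<Prod>i\<in>I. f i z"] by (simp add: meromorphic_on_prod)
qed (simp_all add: mero_of_def one_mero.abs_eq)

lemma mero_of_eqI: "f meromorphic_on UNIV \<Longrightarrow> (\<And>z. eventually (\<lambda>w. f w = g w) (at z)) \<Longrightarrow> mero_of f = mero_of g"
  by (metis meromorphic_on_cong mero_of_eq_iff)

lemma mero_of_entire_eq_0_iff: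
  assumes "f holomorphic_on UNIV"
  shows "mero_of f = 0 \<longleftrightarrow> (\<forall>z. f z = 0)"
proof -
  have f: "f analytic_on UNIV" using assms by (simp add: analytic_on_open)
  then have mero: "f meromorphic_on UNIV" by (rule analytic_on_imp_meromorphic_on)
  have "f z = 0" if "eventually (\<lambda>w. f w = 0) (at z)" for z
  proof -
    have "f \<midarrow>z\<rightarrow> f z" using f by (meson analytic_at_imp_isCont analytic_on_analytic_at isContD UNIV_I)
    moreover have "f \<midarrow>z\<rightarrow> 0" using that by (simp add: tendsto_eventually)
    ultimately show ?thesis by (rule LIM_unique)
  qed
  then show ?thesis
    using mero_of_eq_iff[OF mero meromorphic_on_const, of 0] by (auto simp: mero_of_def zero_mero.abs_eq)
qed

definition mero_const :: "complex \<Rightarrow> mero" where "mero_const a = mero_of (\<lambda>_. a)"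
definition mero_var :: mero where "mero_var = mero_of (\<lambda>z. z)"

lemma mero_const_hom:
  "mero_const (a + b) = mero_const a + mero_const b" "mero_const (a * b) = mero_const a * mero_const b"
  "mero_const (a - b) = mero_const a - mero_const b" "mero_const (a / b) = mero_const a / mero_const b"
  "mero_const (- a) = - mero_const a" "mero_const 0 = 0" "mero_const 1 = 1" "mero_const (a ^ n) = mero_const a ^ n"
proof -
  have c: "(\<lambda>_. x) meromorphic_on UNIV" for x :: complex by (rule meromorphic_on_const)
  note ar = mero_of_arith[OF c[of a] c[of b]]
  show "mero_const (a + b) = mero_const a + mero_const b" unfolding mero_const_def by (rule ar)
  show "mero_const (a * b) = mero_const a * mero_const b" unfolding mero_const_def by (rule ar)
  show "mero_const (a - b) = mero_const a - mero_const b" unfolding mero_const_def by (rule ar)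
  show "mero_const (a / b) = mero_const a / mero_const b" unfolding mero_const_def by (rule ar)
  show "mero_const (- a) = - mero_const a" unfolding mero_const_def by (rule ar)
  show "mero_const (a ^ n) = mero_const a ^ n" unfolding mero_const_def by (rule mero_of_power[OF c])
  show "mero_const 0 = 0" "mero_const 1 = 1"
    by (simp_all add: mero_const_def mero_of_def zero_mero.abs_eq one_mero.abs_eq)
qed

lemma mero_const_eq_iff [simp]: "mero_const a = mero_const b \<longleftrightarrow> a = b"
  unfolding mero_const_def by (subst mero_of_eq_iff) auto

lemma mero_const_eq_0_iff [simp]: "mero_const a = 0 \<longleftrightarrow> a = 0"
  using mero_const_eq_iff[of a 0] by (simp add: mero_const_hom)

lemma mero_const_numeral: "mero_const (numeral n) = numeral n"
proof -
  have "mero_const (of_nat m) = of_nat m" for m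
    by (induction m) (simp_all add: mero_const_hom)
  from this[of "numeral n"] show ?thesis by simp
qed

lemma ex_pole_bound:
  assumes "f meromorphic_on {p}"
  shows "\<exists>n l. ((\<lambda>z. (z - p) ^ n * f z) \<longlongrightarrow> l) (at p)"
proof (cases "\<exists>\<^sub>F w in at p. f w \<noteq> 0")
  case False
  then have "eventually (\<lambda>z. (z - p) ^ 0 * f z = 0) (at p)" by (simp add: not_frequently)
  then have "((\<lambda>z. (z - p) ^ 0 * f z) \<longlongrightarrow> 0) (at p)" by (rule tendsto_eventually)
  then show ?thesis by blast
next
  case True
  have "isolated_singularity_at f p" "not_essential f p" using assms by (auto simp: meromorphic_at_iff)
  from zorder_exist[OF this True] obtain r where r: "r > 0" "zor_poly f p holomorphic_on cball p r"
    "\<And>w. w \<in> cball p r - {p} \<Longrightarrow> f w = zor_poly f p w * (w - p) powi zorder f p" by blast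
  define n where "n = nat (- zorder f p)"
  have "zor_poly f p holomorphic_on ball p r" using r(2) ball_subset_cball by (rule holomorphic_on_subset)
  then have "zor_poly f p analytic_on {p}" using r(1) by (meson analytic_at centre_in_ball open_ball)
  then have "isCont (zor_poly f p) p" by (rule analytic_at_imp_isCont)
  then have "((\<lambda>z. zor_poly f p z * (z - p) ^ nat (int n + zorder f p)) \<longlongrightarrow>
      zor_poly f p p * (p - p) ^ nat (int n + zorder f p)) (at p)"
    by (intro tendsto_intros) (auto simp: isCont_def)
  moreover have "eventually (\<lambda>z. z \<in> ball p r - {p}) (at p)" using r(1) by (intro eventually_at_in_open) auto
  then have "eventually (\<lambda>z. (z - p) ^ n * f z = zor_poly f p z * (z - p) ^ nat (int n + zorder f p)) (at p)"
  proof eventually_elim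
    case (elim z)
    then have z: "z \<in> cball p r - {p}" "z - p \<noteq> 0" by auto
    have "(z - p) ^ n * (z - p) powi zorder f p = (z - p) powi (int n + zorder f p)"
      using z(2) by (simp add: power_int_add)
    also have "\<dots> = (z - p) ^ nat (int n + zorder f p)"
      by (simp add: n_def power_int_def)
    finally show ?case using r(3)[OF z(1)] by (simp add: algebra_simps)
  qed
  ultimately have "((\<lambda>z. (z - p) ^ n * f z) \<longlongrightarrow> zor_poly f p p * (p - p) ^ nat (int n + zorder f p)) (at p)"
    by (simp only: tendsto_cong)
  then show ?thesis by blast
qed

text \<open>A function meromorphic on the plane and at infinity is rational. It is analytic far out,
  so its set \<open>P\<close> of singular points is finite; a polynomial \<open>D\<close> clears the
  poles; and \<open>D * w\<close> then extends to an entire function of polynomial growth, hence to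
  a polynomial by Liouville. Rational functions belong to every field with \<open>mero_var\<close>
  and the constants.\<close>

lemma mero_of_rational:
  assumes w: "w meromorphic_on UNIV" and inf: "(\<lambda>t. w (1 / t)) meromorphic_on {0}"
    and S: "field_closed S" "mero_var \<in> S" "range mero_const \<subseteq> S"
  shows "mero_of w \<in> S"
proof -
  have "isolated_singularity_at (\<lambda>t. w (1 / t)) 0" using inf by (simp add: meromorphic_at_iff)
  then obtain r where r: "r > 0" "(\<lambda>t. w (1 / t)) analytic_on ball 0 r - {0}"
    by (auto simp: isolated_singularity_at_def)
  have an_out: "w analytic_on {z}" if z: "norm z > 1 / r" for z
  proof -
    have z0: "z \<noteq> 0" using z r(1) by (auto simp: not_less)
    have "1 / r > 0" using r(1) by simp
    then have "norm (1 / z) < r" using z r(1) z0 by (simp add: norm_divide field_simps)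
    then have "(\<lambda>t. w (1 / t)) analytic_on {1 / z}" using r(2) z0 by (auto intro: analytic_on_subset)
    moreover have "(\<lambda>z. 1 / z) analytic_on {z}" using z0 by (intro analytic_intros) auto
    ultimately have "((\<lambda>t. w (1 / t)) \<circ> (\<lambda>z. 1 / z)) analytic_on {z}" by (intro analytic_on_compose) auto
    then show ?thesis by (simp add: o_def)
  qed
  define P where "P = {z. \<not> w analytic_on {z}}"
  have finP: "finite P"
  proof -
    have "{z \<in> UNIV. \<not> w analytic_on {z}} sparse_in UNIV"
      using meromorphic_on_imp_sparse_singularities'[OF w] by simp
    then have "finite (cball 0 (1 / r) \<inter> P)"
      using sparse_in_compact_finite[of P "cball 0 (1 / r)"] sparse_in_subset[of P UNIV "cball 0 (1 / r)"]
      by (simp add: P_def)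
    moreover have "P \<subseteq> cball 0 (1 / r)" using an_out unfolding P_def by (auto simp: not_less[symmetric])
    ultimately show ?thesis by (simp add: inf.absorb2)
  qed
  have "\<forall>p. \<exists>n l. ((\<lambda>z. (z - p) ^ n * w z) \<longlongrightarrow> l) (at p)"
    using ex_pole_bound meromorphic_on_subset[OF w] by blast
  then obtain n where n: "\<And>p. \<exists>l. ((\<lambda>z. (z - p) ^ n p * w z) \<longlongrightarrow> l) (at p)" by metis
  define D where "D = (\<lambda>z. \<Prod>p\<in>P. (z - p) ^ n p)"
  define G where "G = (\<lambda>z. D z * w z)"
  have D_hol: "D analytic_on A" for A unfolding D_def by (intro analytic_intros)
  then have D_mero: "D meromorphic_on UNIV" by (rule analytic_on_imp_meromorphic_on)
  have G_mero: "G meromorphic_on UNIV" unfolding G_def by (intro meromorphic_intros D_mero w)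
  have lim: "\<exists>l. G \<midarrow>q\<rightarrow> l" for q
  proof (cases "q \<in> P")
    case False
    then have "G analytic_on {q}" unfolding G_def P_def by (auto intro!: analytic_intros D_hol)
    then show ?thesis using analytic_at_imp_isCont isContD by blast
  next
    case True
    obtain l where l: "((\<lambda>z. (z - q) ^ n q * w z) \<longlongrightarrow> l) (at q)" using n by blast
    have "((\<lambda>z. (\<Prod>p\<in>P - {q}. (z - p) ^ n p) * ((z - q) ^ n q * w z)) \<longlongrightarrow>
        (\<Prod>p\<in>P - {q}. (q - p) ^ n p) * l) (at q)"
      by (intro tendsto_intros l)
    moreover have "(\<lambda>z. (\<Prod>p\<in>P - {q}. (z - p) ^ n p) * ((z - q) ^ n q * w z)) = G"
      using finP True by (simp add: G_def D_def prod.remove[of P q] fun_eq_iff mult_ac)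
    ultimately show ?thesis by auto
  qed
  define g where "g = remove_sings G"
  have "g analytic_on {z}" for z
    unfolding g_def using lim[of z] G_mero meromorphic_on_isolated_singularity[of G z]
      meromorphic_on_subset[OF G_mero] remove_sings_analytic_at by (metis subset_UNIV)
  then have g_hol: "g holomorphic_on UNIV"
    using analytic_on_analytic_at analytic_imp_holomorphic by blast
  have gG: "mero_of G = mero_of g"
  proof (rule mero_of_eqI[OF G_mero])
    show "eventually (\<lambda>z. G z = g z) (at q)" for q
      using eventually_remove_sings_eq_at[of G q] meromorphic_on_isolated_singularity[of G q]
        meromorphic_on_subset[OF G_mero] unfolding g_def by (auto simp: eq_commute)
  qed
  obtain m l where ml: "((\<lambda>t. (t - 0) ^ m * w (1 / t)) \<longlongrightarrow> l) (at 0)"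
    using ex_pole_bound[OF inf] by blast
  \<comment> \<open>The degree of \<open>D\<close>: multiplying \<open>D (1 / t)\<close> by
    \<open>t^N\<close> gives the polynomial \<open>\<Prod>p\<in>P. (1 - t * p) ^ n p\<close>, which
    is harmless at \<open>t = 0\<close>.\<close>
  define N where "N = (\<Sum>p\<in>P. n p)"
  have "((\<lambda>t. (\<Prod>p\<in>P. (1 - t * p) ^ n p) * ((t - 0) ^ m * w (1 / t))) \<longlongrightarrow> (\<Prod>p\<in>P. (1 - 0 * p) ^ n p) * l) (at 0)"
    by (intro tendsto_intros ml)
  moreover have "eventually (\<lambda>t. (\<Prod>p\<in>P. (1 - t * p) ^ n p) * ((t - 0) ^ m * w (1 / t)) = t ^ (N + m) * G (1 / t)) (at 0)"
    using eventually_neq_at_within[of "0::complex" 0 UNIV]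
  proof eventually_elim
    case (elim t)
    have "(\<Prod>p\<in>P. (1 - t * p) ^ n p) = (\<Prod>p\<in>P. t ^ n p * (1 / t - p) ^ n p)"
      using elim by (intro prod.cong refl) (simp add: power_mult_distrib[symmetric] algebra_simps)
    also have "\<dots> = t ^ N * D (1 / t)"
      by (simp add: prod.distrib D_def N_def power_sum)
    finally show ?case by (simp add: G_def power_add mult_ac)
  qed
  ultimately have "((\<lambda>t. t ^ (N + m) * G (1 / t)) \<longlongrightarrow> (\<Prod>p\<in>P. (1 - 0 * p) ^ n p) * l) (at 0)"
    by (simp only: tendsto_cong)
  then have "((\<lambda>t. norm (t ^ (N + m) * G (1 / t))) \<longlongrightarrow> norm ((\<Prod>p\<in>P. (1 - 0 * p) ^ n p) * l)) (at 0)"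
    by (rule tendsto_norm)
  from order_tendstoD(2)[OF this less_add_one]
  obtain B where B: "eventually (\<lambda>t. norm (t ^ (N + m) * G (1 / t)) < B) (at 0)" by blast
  then obtain d where d: "d > 0" "\<And>t. t \<noteq> 0 \<Longrightarrow> norm t < d \<Longrightarrow> norm (t ^ (N + m) * G (1 / t)) < B"
    unfolding eventually_at by (auto simp: dist_norm)
  \<comment> \<open>Beyond \<open>1 / r\<close> the function \<open>w\<close> is analytic, so
    \<open>g\<close> and \<open>G\<close> coincide there; beyond \<open>1 / d\<close> the point
    \<open>1 / z\<close> is in the range of the estimate at infinity. The threshold exceeds both
    radii.\<close>
  have bound: "norm (g z) \<le> B * norm z ^ (N + m)" if z: "1 / r + 1 / d + 1 \<le> norm z" for z
  proof -
    have pos: "1 / r > 0" "1 / d > 0" using r(1) d(1) by auto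
    then have z': "norm z > 1 / r" "norm z > 1 / d" "norm z > 0" using z by linarith+
    then have "G analytic_on {z}" unfolding G_def by (intro analytic_intros D_hol an_out)
    then have gz: "g z = G z" unfolding g_def by simp
    have "norm (1 / z) < d" using z' d(1) by (simp add: norm_divide field_simps)
    then have "norm ((1 / z) ^ (N + m) * G z) \<le> B" using d(2)[of "1 / z"] z'(3) by fastforce
    then have "norm (G z) \<le> B * norm z ^ (N + m)"
      using z'(3) by (simp add: norm_mult norm_power norm_divide field_simps)
    then show ?thesis by (simp add: gz)
  qed
  define b where "b = (\<lambda>k. (deriv ^^ k) g 0 / fact k)"
  have "g = (\<lambda>z. \<Sum>k\<le>N + m. b k * z ^ k)"
    unfolding b_def by (rule ext) (rule Liouville_polynomial[OF g_hol bound])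
  then have "mero_of g = mero_of (\<lambda>z. \<Sum>k\<le>N + m. b k * z ^ k)"
    by (rule arg_cong)
  also have "\<dots> = (\<Sum>k\<le>N + m. mero_const (b k) * mero_var ^ k)"
  proof (subst mero_of_sum)
    have "(\<lambda>_. b k) meromorphic_on UNIV" "(\<lambda>z. z ^ k) meromorphic_on UNIV" for k
      by (intro meromorphic_intros)+
    then show "(\<lambda>z. b k * z ^ k) meromorphic_on UNIV" for k
      by (rule meromorphic_on_mult)
    show "(\<Sum>k\<le>N + m. mero_of (\<lambda>z. b k * z ^ k)) = (\<Sum>k\<le>N + m. mero_const (b k) * mero_var ^ k)"
    proof (rule sum.cong[OF refl])
      fix k
      have "mero_of (\<lambda>z. b k * z ^ k) = mero_of (\<lambda>_. b k) * mero_of (\<lambda>z. z ^ k)"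
        by (rule mero_of_arith(2)) (intro meromorphic_intros)+
      also have "mero_of (\<lambda>z. z ^ k) = mero_var ^ k"
        unfolding mero_var_def by (rule mero_of_power) (rule meromorphic_on_id)
      finally show "mero_of (\<lambda>z. b k * z ^ k) = mero_const (b k) * mero_var ^ k" by (simp only: mero_const_def)
    qed
  qed
  also have "\<dots> \<in> S"
    using S by (intro field_closed_sum field_closedD(4) field_closed_power) auto
  finally have "mero_of G \<in> S" by (simp add: gG)
  moreover have "mero_of G = mero_of D * mero_of w"
    unfolding G_def by (rule mero_of_arith(2)[OF D_mero w])
  moreover have DS: "mero_of D \<in> S"
  proof -
    have "mero_of D = (\<Prod>p\<in>P. (mero_var - mero_const p) ^ n p)"
      unfolding D_def
    proof (subst mero_of_prod)
      have lin: "(\<lambda>z. z - p) meromorphic_on UNIV" for p by (intro meromorphic_intros)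
      then show "(\<lambda>z. (z - p) ^ n p) meromorphic_on UNIV" for p by (rule meromorphic_on_power)
      have "mero_of (\<lambda>z. (z - p) ^ n p) = (mero_var - mero_const p) ^ n p" for p
        unfolding mero_of_power[OF lin] mero_var_def mero_const_def
        by (subst mero_of_arith(3)) (auto intro: meromorphic_on_id)
      then show "(\<Prod>p\<in>P. mero_of (\<lambda>z. (z - p) ^ n p)) = (\<Prod>p\<in>P. (mero_var - mero_const p) ^ n p)" by simp
    qed
    also have "\<dots> \<in> S"
      using finP by (induction P) (use S in \<open>auto intro!: field_closedD field_closed_power\<close>)
    finally show ?thesis .
  qed
  moreover have "mero_of D \<noteq> 0"
  proof
    assume "mero_of D = 0"
    moreover have "D holomorphic_on UNIV" using D_hol[of UNIV] by (rule analytic_imp_holomorphic)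
    ultimately have "D z = 0" for z using mero_of_entire_eq_0_iff by blast
    then have "z \<in> P" for z using finP by (fastforce simp: D_def)
    then have "P = UNIV" by auto
    then show False using finP infinite_UNIV_char_0 by metis
  qed
  ultimately show ?thesis using field_closedD(8)[OF S(1), of "mero_of G" "mero_of D"] by simp
qed

section \<open>Reduction to a tower of fields of meromorphic functions on the plane\<close>

lemma meromorphic_functions_sphere_iff:
  "v \<in> meromorphic_functions riemann_sphere \<longleftrightarrow>
     (\<lambda>s. v (Some s)) nicely_meromorphic_on UNIV \<and> (\<lambda>s. v (sph None s)) nicely_meromorphic_on UNIV"
proof -
  have im: "sph_inv p ` range (sph p) = UNIV" for p by (force simp: image_iff)
  have "v \<circ> inv_into (range (sph p)) (sph_inv p) = (\<lambda>s. v (sph p s))" for p by auto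
  then have "v \<in> meromorphic_functions riemann_sphere \<longleftrightarrow>
      (\<lambda>s. v (sph (Some 0) s)) nicely_meromorphic_on UNIV \<and> (\<lambda>s. v (sph None s)) nicely_meromorphic_on UNIV"
    unfolding meromorphic_functions_def
    by (simp only: sphere_atlas ball_simps prod.case im mem_Collect_eq) (simp add: extensional_def)
  then show ?thesis by simp
qed

text \<open>For a lift \<open>c\<close> with \<open>f \<circ> c = h\<close> this is the image of
  \<open>pullback_field\<close> under composition with \<open>c\<close>, hence the ground field of
  the towers inside \<open>mero\<close>.\<close>

definition sphere_pullback :: "(complex \<Rightarrow> complex option) \<Rightarrow> mero set" where
  "sphere_pullback h = (\<lambda>v. mero_of (\<lambda>z. v (h z))) ` meromorphic_functions riemann_sphere"

lemma mero_const_in_pullback: "mero_const a \<in> sphere_pullback h"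
  unfolding sphere_pullback_def mero_const_def
  by (rule image_eqI[of _ _ "\<lambda>_. a"]) (auto simp: meromorphic_functions_sphere_iff)

text \<open>A chart disc already has as many points as the plane:
  \<open>w \<mapsto> r * w / (1 + norm w)\<close> squeezes the plane into it injectively. The
  surjection allows functions of the plane to be encoded as functions on the surface.\<close>

lemma ex_surj_complex:
  fixes M :: "'a surface"
  assumes "riemann_surface M" "surface_points M \<noteq> {}"
  shows "\<exists>s :: 'a \<Rightarrow> complex. surj s"
proof -
  obtain x U \<phi> where U: "(U, \<phi>) \<in> surface_atlas M" "x \<in> U"
    using assms ex_chart[OF assms(1)] by (metis equals0I)
  note ch = atlas_chartD[OF assms(1) U(1)]
  obtain r where r: "r > 0" "ball (\<phi> x) r \<subseteq> \<phi> ` U" using ch(2) U(2) openE by blast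
  define e where "e = (\<lambda>w. \<phi> x + (r / (1 + norm w)) *\<^sub>R w)"
  have norm_e: "norm ((r / (1 + norm w)) *\<^sub>R w) = r * norm w / (1 + norm w)" "1 + norm w > 0" for w :: complex
    using r(1) norm_ge_zero[of w] by (auto simp del: norm_ge_zero)
  have "e w \<in> ball (\<phi> x) r" for w
  proof -
    have "r * norm w / (1 + norm w) < r" using r(1) norm_e(2)[of w] by (simp add: field_simps)
    then show ?thesis using norm_e(1)[of w] r(1) by (simp add: e_def dist_norm)
  qed
  then have \<phi>e: "\<phi> (inv_into U \<phi> (e w)) = e w" for w using r(2) by (intro f_inv_into_f) blast
  have "inj e"
  proof (rule injI)
    fix v w assume "e v = e w"
    then have eq: "(r / (1 + norm v)) *\<^sub>R v = (r / (1 + norm w)) *\<^sub>R w" by (simp add: e_def)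
    then have "r * norm v / (1 + norm v) = r * norm w / (1 + norm w)" using norm_e(1) by metis
    then have "norm v = norm w" using r(1) norm_e(2)[of v] norm_e(2)[of w] by (simp add: field_simps)
    moreover have "r / (1 + norm w) \<noteq> 0" using r(1) norm_e(2)[of w] by simp
    ultimately show "v = w" using eq by simp
  qed
  then have "inj (\<lambda>w. \<phi> (inv_into U \<phi> (e w)))" by (simp add: \<phi>e)
  then have "inj (\<lambda>w. inv_into U \<phi> (e w))" by (auto simp: inj_def)
  then have "surj (inv_into UNIV (\<lambda>w. inv_into U \<phi> (e w)))" by (rule inj_imp_surj_inv)
  then show ?thesis by blast
qed

section \<open>From a tower on the plane to the tower of the theorem\<close>

context branched_covering
begin

lemma lift_nonconstant:
  assumes "\<And>z. f (c z) = h z" "eventually (\<lambda>z. h z \<noteq> h y) (at y)"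
  shows "eventually (\<lambda>z. c z \<noteq> c y) (at y)"
  using assms(2) by eventually_elim (use assms(1) in metis)

text \<open>What remains for each branching type: a map \<open>h\<close> with a lift
  \<open>c\<close>, and a tower over \<open>sphere_pullback h\<close> inside \<open>mero\<close>
  whose top contains every \<open>u \<circ> c\<close>. The embedding \<open>\<iota>\<close> of the
  theorem is composition with \<open>c\<close> followed by the injection \<open>j\<close> into the
  prescribed type.\<close>

lemma contained_in_towerI:
  assumes c: "\<And>y. hol_at M c y" "\<And>y. f (c y) = h y" and h: "\<And>y. eventually (\<lambda>z. h z \<noteq> h y) (at y)"
    and tower: "root_tower q (sphere_pullback h) F"
    and F: "\<And>u. u \<in> meromorphic_functions M \<Longrightarrow> mero_of (\<lambda>z. u (c z)) \<in> F"
    and P: "\<And>L F u. radical_over L F u \<Longrightarrow> P L F u" "\<And>L F u. q \<Longrightarrow> quintic_root_over L F u \<Longrightarrow> P L F u"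
  shows "contained_in_tower P M riemann_sphere f"
proof -
  have "surface_points M \<noteq> {}" using hol_at_point[OF surf c(1)] by blast
  then obtain s :: "'a \<Rightarrow> complex" where s: "surj s" using ex_surj_complex[OF surf] by blast
  \<comment> \<open>Only the values in the surface's function type carry information: a
    representative of \<open>m\<close> is read through the surjection \<open>s\<close>, and the
    multiset argument is ignored.\<close>
  define j :: "mero \<Rightarrow> (('a \<Rightarrow> complex) list \<times> nat) multiset \<Rightarrow> 'a \<Rightarrow> complex"
    where "j = (\<lambda>m _ x. rep_mero m (s x))"
  have j: "inj j"
  proof (rule injI)
    fix a b assume "j a = j b"
    then have "rep_mero a (s x) = rep_mero b (s x)" for x unfolding j_def by metis
    then have "rep_mero a = rep_mero b" using s by (metis ext surjD)
    then show "a = b" using Quotient3_abs_rep[OF Quotient3_mero] by metis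
  qed
  define \<iota> where "\<iota> = (\<lambda>u. j (mero_of (\<lambda>z. u (c z))))"
  have nc: "eventually (\<lambda>z. c z \<noteq> c y) (at y)" for y by (rule lift_nonconstant[OF c(2) h])
  note ops = ring_hom_compose[OF surf c(1) nc]
  note ts = transport_simps[OF j]
  have "\<iota> \<in> ring_hom (meromorphic_field M) (transport_ring j)"
  proof (rule ring_hom_memI)
    show "\<iota> x \<in> carrier (transport_ring j)" for x by (simp add: \<iota>_def ts)
    have car: "carrier (meromorphic_field M) = meromorphic_functions M" by (simp add: meromorphic_field_def)
    show "\<iota> (x \<otimes>\<^bsub>meromorphic_field M\<^esub> y) = \<iota> x \<otimes>\<^bsub>transport_ring j\<^esub> \<iota> y"
      if "x \<in> carrier (meromorphic_field M)" "y \<in> carrier (meromorphic_field M)" for x y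
      using ops(1)[of x y] that by (simp add: \<iota>_def ts car)
    show "\<iota> (x \<oplus>\<^bsub>meromorphic_field M\<^esub> y) = \<iota> x \<oplus>\<^bsub>transport_ring j\<^esub> \<iota> y"
      if "x \<in> carrier (meromorphic_field M)" "y \<in> carrier (meromorphic_field M)" for x y
      using ops(2)[of x y] that by (simp add: \<iota>_def ts car)
    have one: "(\<lambda>x\<in>surface_points M. 1) \<in> meromorphic_functions M"
      unfolding meromorphic_functions_def
    proof (intro CollectI conjI, simp, safe)
      fix U \<phi> assume U: "(U, \<phi>) \<in> surface_atlas M"
      show "((\<lambda>x\<in>surface_points M. 1) \<circ> inv_into U \<phi>) nicely_meromorphic_on \<phi> ` U"
        by (rule nicely_meromorphic_on_transform[OF nicely_meromorphic_on_const[of 1]])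
           (use atlas_chartD[OF surf U] in \<open>auto\<close>)
    qed
    show "\<iota> \<one>\<^bsub>meromorphic_field M\<^esub> = \<one>\<^bsub>transport_ring j\<^esub>"
      using ops(3)[OF one one] by (simp add: \<iota>_def ts)
  qed
  moreover have "\<iota> ` pullback_field M riemann_sphere f = j ` sphere_pullback h"
  proof -
    have "\<iota> (compose (surface_points M) v f) = j (mero_of (\<lambda>z. v (h z)))" for v
      using hol_at_point[OF surf c(1)] c(2) by (simp add: \<iota>_def compose_def)
    then show ?thesis
      by (simp add: pullback_field_def sphere_pullback_def image_image meromorphic_field_def)
  qed
  moreover have "adjunction_tower (transport_ring j) (P (transport_ring j)) (j ` sphere_pullback h) (j ` F)"
  proof -
    have "1 \<in> sphere_pullback h" using mero_const_in_pullback[of 1 h] by (simp add: mero_const_hom)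
    from adjunction_tower_transport[OF j tower this, of "P (transport_ring j)"] P show ?thesis by blast
  qed
  moreover have "\<iota> ` carrier (meromorphic_field M) \<subseteq> j ` F"
    using F by (auto simp: \<iota>_def meromorphic_field_def)
  ultimately show ?thesis unfolding contained_in_tower_def
    using field_transport[OF j] by (intro exI[of _ "transport_ring j"] exI[of _ \<iota>] exI[of _ "j ` F"]) simp
qed

end

section \<open>Spherical branching types\<close>

subsection \<open>Homogeneous coordinates\<close>

text \<open>The point is written in homogeneous coordinates \<open>[hx p : hy p]\<close>, infinity
  being \<open>[1 : 0]\<close>. Branch points at infinity thereby cease to be a special case in the
  construction of \<open>h\<close>.\<close>

definition hx :: "complex option \<Rightarrow> complex" where "hx p = (case p of Some a \<Rightarrow> a | None \<Rightarrow> 1)"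
definition hy :: "complex option \<Rightarrow> complex" where "hy p = (case p of Some a \<Rightarrow> 1 | None \<Rightarrow> 0)"
definition hom :: "complex \<Rightarrow> complex \<Rightarrow> complex option" where "hom x y = (if y = 0 then None else Some (x / y))"

lemma cross_eq_0_iff: "hx p * hy q - hx q * hy p = 0 \<longleftrightarrow> p = q"
  by (auto simp: hx_def hy_def split: option.splits)

lemma hom_eq_iff: "x \<noteq> 0 \<or> y \<noteq> 0 \<Longrightarrow> hom x y = p \<longleftrightarrow> x * hy p - hx p * y = 0"
  by (auto simp: hom_def hx_def hy_def field_simps split: option.splits)

lemma hom_scale: "l \<noteq> 0 \<Longrightarrow> hom (l * x) (l * y) = hom x y"
  by (simp add: hom_def)

text \<open>The fraction is the coordinate of \<open>[x : y]\<close> centred at \<open>p\<close>. At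
  infinity the cross product is \<open>- y\<close>, whence the denominator
  \<open>- x\<close>.\<close>

lemma hom_eq_sph:
  assumes "(case p of Some _ \<Rightarrow> y | None \<Rightarrow> - x) \<noteq> 0"
  shows "hom x y = sph p ((x * hy p - hx p * y) / (case p of Some _ \<Rightarrow> y | None \<Rightarrow> - x))"
  using assms by (cases p) (auto simp: hom_def hx_def hy_def sph_None field_simps)

text \<open>The coordinate of \<open>h\<close> centred at \<open>p\<close> is the cross product
  \<open>\<kappa> * E^n\<close> divided by a function \<open>w\<close> with
  \<open>w z0 \<noteq> 0\<close>. On a small disc \<open>\<kappa> / w\<close> has an
  \<open>n\<close>-th root, which is absorbed into \<open>E\<close>.\<close>

lemma local_power_hom:
  assumes xy: "x holomorphic_on UNIV" "y holomorphic_on UNIV" "x z0 \<noteq> 0 \<or> y z0 \<noteq> 0"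
    and p: "p = hom (x z0) (y z0)" and "0 < n p" "\<kappa> \<noteq> 0" "E holomorphic_on UNIV"
    and E: "\<And>z. x z * hy p - hx p * y z = \<kappa> * E z ^ n p"
  shows "local_power n (\<lambda>z. hom (x z) (y z)) z0"
proof -
  define w where "w = (\<lambda>z. case p of Some _ \<Rightarrow> y z | None \<Rightarrow> - x z)"
  have w: "w holomorphic_on UNIV"
    unfolding w_def using xy(1,2) by (cases p) (auto intro: holomorphic_intros)
  have "w z0 \<noteq> 0" using p xy(3) by (auto simp: w_def hom_def split: option.splits if_splits)
  moreover have "open (w -` (- {0}))"
    using w by (intro open_vimage) (auto intro: holomorphic_on_imp_continuous_on)
  ultimately obtain r where r: "r > 0" "ball z0 r \<subseteq> w -` (- {0})" using openE[of "w -` (- {0})" z0] by blast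
  have hol: "(\<lambda>z. \<kappa> / w z) holomorphic_on ball z0 r"
    using r by (intro holomorphic_intros holomorphic_on_subset[OF w]) auto
  have nz: "\<kappa> / w z \<noteq> 0" if "z \<in> ball z0 r" for z using that r(2) \<open>\<kappa> \<noteq> 0\<close> by auto
  obtain g where g: "g holomorphic_on ball z0 r" "\<And>z. z \<in> ball z0 r \<Longrightarrow> g z ^ n p = \<kappa> / w z"
    by (rule holomorphic_nth_root[OF convex_ball open_ball hol nz \<open>0 < n p\<close>])
       (assumption, rule that, assumption+)
  have "(\<lambda>z. E z * g z) holomorphic_on ball z0 r"
    by (intro holomorphic_intros holomorphic_on_subset[OF \<open>E holomorphic_on UNIV\<close>] g(1)) auto
  moreover have "hom (x z) (y z) = sph p ((E z * g z) ^ n p)" if z: "z \<in> ball z0 r" for z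
  proof -
    have "w z \<noteq> 0" using z r(2) by auto
    then have "hom (x z) (y z) = sph p ((x z * hy p - hx p * y z) / w z)"
      unfolding w_def by (rule hom_eq_sph)
    then show ?thesis using E[of z] g(2)[OF z] by (simp add: power_mult_distrib)
  qed
  ultimately show ?thesis unfolding local_power_def p[symmetric] using r(1) by blast
qed

lemma nicely_meromorphic_moebius:
  assumes "a * d - b * c \<noteq> (0::complex)"
  shows "(\<lambda>z. (a * z + b) / (c * z + d)) nicely_meromorphic_on UNIV"
  unfolding nicely_meromorphic_on_def
proof (intro conjI ballI)
  show "(\<lambda>z. (a * z + b) / (c * z + d)) meromorphic_on UNIV" by (intro meromorphic_intros)
  fix z
  show "is_pole (\<lambda>z. (a * z + b) / (c * z + d)) z \<and> (a * z + b) / (c * z + d) = 0 \<or>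
      (\<lambda>z. (a * z + b) / (c * z + d)) \<midarrow>z\<rightarrow> (a * z + b) / (c * z + d)"
  proof (cases "c * z + d = 0")
    case False
    then have "(\<lambda>z. (a * z + b) / (c * z + d)) \<midarrow>z\<rightarrow> (a * z + b) / (c * z + d)" by (intro tendsto_intros)
    then show ?thesis ..
  next
    case True
    then have d: "d = - (c * z)" by (simp add: eq_neg_iff_add_eq_0 add.commute)
    have "c * (a * z + b) = - (a * d - b * c)" by (simp add: d algebra_simps)
    then have "c * (a * z + b) \<noteq> 0" using assms by simp
    then have num: "a * z + b \<noteq> 0" "c \<noteq> 0" by auto
    have "filterlim (\<lambda>w. c * w + d) (at 0) (at z)"
    proof (rule filterlim_atI)
      have "((\<lambda>w. c * w + d) \<longlongrightarrow> c * z + d) (at z)" by (intro tendsto_intros)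
      then show "((\<lambda>w. c * w + d) \<longlongrightarrow> 0) (at z)" by (simp add: True)
      have "eventually (\<lambda>w. w \<noteq> z) (at z)" by (rule eventually_neq_at_within)
      then show "eventually (\<lambda>w. c * w + d \<noteq> 0) (at z)" by eventually_elim (use num d in \<open>simp\<close>)
    qed
    then have "is_pole (\<lambda>z. (a * z + b) / (c * z + d)) z"
      using num(1) by (intro is_pole_divide) (auto intro!: continuous_intros)
    then show ?thesis using True by simp
  qed
qed

section \<open>The covering attached to three forms with one relation\<close>

context branched_covering
begin

text \<open>From a relation \<open>A^a = B^b + C^c\<close> a map \<open>h\<close> is built that
  sends the zeros of \<open>A\<close>, \<open>B\<close>, \<open>C\<close> to \<open>p1\<close>,
  \<open>p2\<close>, \<open>p3\<close> with orders divisible by \<open>a\<close>, \<open>b\<close>,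
  \<open>c\<close>: the cross products of \<open>h\<close> with the three points are multiples of
  the three powers. The hypothesis \<open>symm\<close> yields \<open>h (1 / t) = h t\<close>, so
  functions on the surface pull back to rational functions; and \<open>tower\<close> reaches
  \<open>z\<close> from the ratio of \<open>A^a\<close> and \<open>C^c\<close>, a coordinate of
  \<open>S\<close> composed with \<open>h\<close>.\<close>

lemma contained_in_tower_spherical:
  fixes A B C :: "complex \<Rightarrow> complex"
  assumes pd: "p1 \<noteq> p2" "p2 \<noteq> p3" "p1 \<noteq> p3"
    and idx: "\<And>p. p \<notin> {p1, p2, p3} \<Longrightarrow> branching_index M riemann_sphere f p = 1"
      "branching_index M riemann_sphere f p1 dvd a" "branching_index M riemann_sphere f p2 dvd b"
      "branching_index M riemann_sphere f p3 dvd c" "0 < a" "0 < b" "0 < c"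
    and hol: "A holomorphic_on UNIV" "B holomorphic_on UNIV" "C holomorphic_on UNIV"
    and id: "\<And>z. A z ^ a = B z ^ b + C z ^ c"
    and ncz: "\<And>z. \<not> (A z = 0 \<and> C z = 0)" and zA: "A zA = 0" and zC: "C zC = 0"
    and symm: "\<And>t. t \<noteq> 0 \<Longrightarrow> \<exists>l. l \<noteq> 0 \<and> A (1 / t) ^ a = l * A t ^ a \<and> C (1 / t) ^ c = l * C t ^ c"
    and tower: "\<And>K. range mero_const \<subseteq> K \<Longrightarrow> mero_of (\<lambda>z. A z ^ a / C z ^ c) \<in> K \<Longrightarrow>
        \<exists>F. root_tower q K F \<and> field_closed F \<and> mero_var \<in> F"
    and P: "\<And>L F u. radical_over L F u \<Longrightarrow> P L F u" "\<And>L F u. q \<Longrightarrow> quintic_root_over L F u \<Longrightarrow> P L F u"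
  shows "contained_in_tower P M riemann_sphere f"
proof -
  define cr where "cr = (\<lambda>p q. hx p * hy q - hx q * hy p)"
  have cr0: "cr p q = 0 \<longleftrightarrow> p = q" for p q unfolding cr_def by (rule cross_eq_0_iff)
  \<comment> \<open>With these weights the cross product with \<open>p2\<close> is a multiple of
    \<open>C^c - A^a = - (B^b)\<close>; without them only \<open>p1\<close> and \<open>p3\<close>
    would be hit with the right orders.\<close>
  define \<alpha> \<beta> where "\<alpha> = cr p2 p3" and "\<beta> = cr p1 p2"
  have \<alpha>\<beta>: "\<alpha> \<noteq> 0" "\<beta> \<noteq> 0" using pd by (auto simp: \<alpha>_def \<beta>_def cr0)
  define x where "x = (\<lambda>z. \<alpha> * hx p1 * C z ^ c + \<beta> * hx p3 * A z ^ a)"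
  define y where "y = (\<lambda>z. \<alpha> * hy p1 * C z ^ c + \<beta> * hy p3 * A z ^ a)"
  define h where "h = (\<lambda>z. hom (x z) (y z))"
  define n where "n = (\<lambda>p. if p = p1 then a else if p = p2 then b else if p = p3 then c else 1)"
  have n: "0 < n p" "branching_index M riemann_sphere f p dvd n p" for p
    using idx by (auto simp: n_def)
  have xy_hol: "x holomorphic_on UNIV" "y holomorphic_on UNIV"
    unfolding x_def y_def using hol by (auto intro!: holomorphic_intros)
  have det: "x z * hy p - hx p * y z = \<alpha> * C z ^ c * cr p1 p + \<beta> * A z ^ a * cr p3 p" for z p
    by (simp add: x_def y_def cr_def algebra_simps)
  have det1: "x z * hy p1 - hx p1 * y z = \<beta> * cr p3 p1 * A z ^ a" for z
    by (simp add: det cr_def)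
  have det3: "x z * hy p3 - hx p3 * y z = \<alpha> * cr p1 p3 * C z ^ c" for z
    by (simp add: det cr_def)
  have det2: "x z * hy p2 - hx p2 * y z = - \<alpha> * \<beta> * B z ^ b" for z
  proof -
    have "x z * hy p2 - hx p2 * y z = \<alpha> * \<beta> * (C z ^ c - A z ^ a)"
      unfolding det by (simp add: \<alpha>_def \<beta>_def cr_def algebra_simps)
    then show ?thesis using id[of z] by (simp add: algebra_simps)
  qed
  have pow0: "A z ^ a = 0 \<longleftrightarrow> A z = 0" "C z ^ c = 0 \<longleftrightarrow> C z = 0" for z using idx by simp_all
  have crne: "cr p3 p1 \<noteq> 0" "cr p1 p3 \<noteq> 0" using pd(3) by (auto simp: cr0)
  have xy0: "x z \<noteq> 0 \<or> y z \<noteq> 0" for z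
  proof (rule ccontr)
    assume "\<not> ?thesis"
    then have "\<beta> * cr p3 p1 * A z ^ a = 0" "\<alpha> * cr p1 p3 * C z ^ c = 0" using det1[of z] det3[of z] by simp_all
    then show False using \<alpha>\<beta> crne ncz[of z] pow0 by simp
  qed
  have lp: "local_power n h z0" for z0
  proof -
    define p where "p = hom (x z0) (y z0)"
    consider "p = p1" | "p = p2" | "p = p3" | "p \<notin> {p1, p2, p3}" by blast
    then show ?thesis
    proof cases
      case 1
      then show ?thesis unfolding h_def
        by (intro local_power_hom[OF xy_hol xy0 p_def n(1), of "\<beta> * cr p3 p1" A])
           (use hol \<alpha>\<beta> crne det1 in \<open>auto simp: n_def\<close>)
    next
      case 2
      then show ?thesis unfolding h_def
        by (intro local_power_hom[OF xy_hol xy0 p_def n(1), of "- \<alpha> * \<beta>" B])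
           (use hol \<alpha>\<beta> pd det2 in \<open>auto simp: n_def\<close>)
    next
      case 3
      then show ?thesis unfolding h_def
        by (intro local_power_hom[OF xy_hol xy0 p_def n(1), of "\<alpha> * cr p1 p3" C])
           (use hol \<alpha>\<beta> crne pd det3 in \<open>auto simp: n_def\<close>)
    next
      case 4
      then show ?thesis unfolding h_def
        by (intro local_power_hom[OF xy_hol xy0 p_def n(1), of 1 "\<lambda>z. x z * hy p - hx p * y z"])
           (use xy_hol in \<open>auto simp: n_def intro!: holomorphic_intros\<close>)
    qed
  qed
  have nonconst: "eventually (\<lambda>z. h z \<noteq> h z0) (at z0)" for z0
  proof -
    define p where "p = h z0"
    define d where "d = (\<lambda>z. x z * hy p - hx p * y z)"
    have d_hol: "d holomorphic_on UNIV" unfolding d_def using xy_hol by (intro holomorphic_intros)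
    \<comment> \<open>At a zero of \<open>A\<close> only the \<open>p1\<close> term of
      \<open>det\<close> survives, at a zero of \<open>C\<close> only the \<open>p3\<close> term. If
      the cross product with \<open>p\<close> vanished identically, \<open>p\<close> would equal
      both points.\<close>
    have "\<not> (\<forall>z. d z = 0)"
    proof
      assume 0: "\<forall>z. d z = 0"
      have "\<alpha> * C zA ^ c * cr p1 p = 0" "\<beta> * A zC ^ a * cr p3 p = 0"
        using 0[rule_format, of zA] 0[rule_format, of zC] zA zC idx by (simp_all add: d_def det power_0_left)
      moreover have "C zA \<noteq> 0" "A zC \<noteq> 0" using ncz zA zC by blast+
      ultimately have "cr p1 p = 0" "cr p3 p = 0" using \<alpha>\<beta> by simp_all
      then show False using pd(3) by (simp add: cr0)
    qed
    then have "mero_of d \<noteq> 0" using mero_of_entire_eq_0_iff[OF d_hol] by simp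
    moreover have d_mero: "d meromorphic_on UNIV"
      using d_hol by (simp add: analytic_on_imp_meromorphic_on analytic_on_open)
    ultimately have "\<not> mero_eq d (\<lambda>_. 0)"
      using mero_of_eq_iff[OF d_mero meromorphic_on_const, of 0] by (auto simp: mero_eq_def mero_of_def zero_mero.abs_eq)
    from mero_pole_or_nonzero[OF d_mero this, of z0] show ?thesis
      by eventually_elim (use hom_eq_iff[OF xy0] in \<open>auto simp: h_def d_def p_def\<close>)
  qed
  have inv: "h (1 / t) = h t" if t: "t \<noteq> 0" for t
  proof -
    obtain l where l: "l \<noteq> 0" "A (1 / t) ^ a = l * A t ^ a" "C (1 / t) ^ c = l * C t ^ c" using symm[OF t] by blast
    then have "x (1 / t) = l * x t" "y (1 / t) = l * y t" by (simp_all add: x_def y_def algebra_simps)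
    then show ?thesis using hom_scale[OF l(1)] by (simp add: h_def)
  qed
  have "\<exists>c. (\<forall>y. hol_at M c y) \<and> (\<forall>y. f (c y) = h y)" by (rule ex_lift[OF n lp]) blast
  then obtain cl where cl: "\<And>y. hol_at M cl y" "\<And>y. f (cl y) = h y" by blast
  have "\<exists>c' \<epsilon>. 0 < \<epsilon> \<and> hol_at M c' 0 \<and> (\<forall>t\<in>ball 0 \<epsilon> - {0}. cl (1 / t) = c' t)"
  proof (rule lift_at_infinity[OF n lp inv cl])
    fix c' and \<epsilon> :: real
    assume "0 < \<epsilon>" "hol_at M c' 0" "\<And>t. t \<in> ball 0 \<epsilon> - {0} \<Longrightarrow> cl (1 / t) = c' t"
    then show ?thesis by (intro exI[of _ c'] exI[of _ \<epsilon>]) auto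
  qed
  then obtain c' \<epsilon> where c': "0 < \<epsilon>" "hol_at M c' 0" "\<And>t. t \<in> ball 0 \<epsilon> - {0} \<Longrightarrow> cl (1 / t) = c' t"
    by blast
  \<comment> \<open>The Moebius coordinate of \<open>S\<close> with zero \<open>p1\<close>, pole
    \<open>p3\<close> and value \<open>1\<close> at \<open>p2\<close>; its composition with
    \<open>h\<close> is \<open>A^a / C^c\<close>.\<close>
  define v where "v = (\<lambda>q. - \<alpha> / \<beta> * ((hx q * hy p1 - hx p1 * hy q) / (hx q * hy p3 - hx p3 * hy q)))"
  have v: "v \<in> meromorphic_functions riemann_sphere"
    unfolding meromorphic_functions_sphere_iff
  proof
    have "(\<lambda>s. - \<alpha> / \<beta> * ((hy p1 * s + - hx p1) / (hy p3 * s + - hx p3))) nicely_meromorphic_on UNIV"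
      by (intro nicely_meromorphic_on_cmult_left nicely_meromorphic_moebius)
         (use crne in \<open>auto simp: cr_def algebra_simps\<close>)
    then show "(\<lambda>s. v (Some s)) nicely_meromorphic_on UNIV" by (simp add: v_def hx_def hy_def mult_ac)
    have "(\<lambda>s. - \<alpha> / \<beta> * ((- hx p1 * s + hy p1) / (- hx p3 * s + hy p3))) nicely_meromorphic_on UNIV"
      by (intro nicely_meromorphic_on_cmult_left nicely_meromorphic_moebius)
         (use crne in \<open>auto simp: cr_def algebra_simps\<close>)
    moreover have "v (sph None s) = - \<alpha> / \<beta> * ((- hx p1 * s + hy p1) / (- hx p3 * s + hy p3))" for s
    proof (cases "s = 0")
      case True
      then show ?thesis by (simp add: v_def hx_def[of None] hy_def[of None])
    next
      case False
      have "(1 / s * hy p1 - hx p1) / (1 / s * hy p3 - hx p3) =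
          (s * (1 / s * hy p1 - hx p1)) / (s * (1 / s * hy p3 - hx p3))"
        using False by simp
      also have "\<dots> = (- hx p1 * s + hy p1) / (- hx p3 * s + hy p3)"
        using False by (simp add: right_diff_distrib mult.commute)
      finally have eq: "(1 / s * hy p1 - hx p1) / (1 / s * hy p3 - hx p3) = (- hx p1 * s + hy p1) / (- hx p3 * s + hy p3)" .
      have "hx (sph None s) = 1 / s" "hy (sph None s) = 1" using False by (simp_all add: sph_None hx_def hy_def)
      then show ?thesis by (simp only: v_def mult_1_right eq)
    qed
    ultimately show "(\<lambda>s. v (sph None s)) nicely_meromorphic_on UNIV" by simp
  qed
  have vh: "v (h z) = A z ^ a / C z ^ c" for z
  proof -
    have hxy: "(hx (h z) * hy p1 - hx p1 * hy (h z)) / (hx (h z) * hy p3 - hx p3 * hy (h z)) =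
        (x z * hy p1 - hx p1 * y z) / (x z * hy p3 - hx p3 * y z)"
    proof (cases "y z = 0")
      case True
      then have "x z \<noteq> 0" using xy0 by blast
      then show ?thesis using True by (simp add: h_def hom_def hx_def[of None] hy_def[of None])
    next
      case False
      have "(x z * hy p1 - hx p1 * y z) / (x z * hy p3 - hx p3 * y z) =
          (y z * (x z / y z * hy p1 - hx p1)) / (y z * (x z / y z * hy p3 - hx p3))"
        using False by (simp add: right_diff_distrib mult.commute)
      then show ?thesis using False by (simp add: h_def hom_def hx_def[of "Some _"] hy_def[of "Some _"])
    qed
    have "cr p3 p1 = - cr p1 p3" by (simp add: cr_def)
    then show ?thesis unfolding v_def hxy det1 det3 using \<alpha>\<beta> crne by simp
  qed
  have inK: "mero_of (\<lambda>z. A z ^ a / C z ^ c) \<in> sphere_pullback h"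
    unfolding sphere_pullback_def using v vh by (intro image_eqI[of _ _ v]) auto
  have constK: "range mero_const \<subseteq> sphere_pullback h" by (rule image_subsetI) (rule mero_const_in_pullback)
  from tower[OF constK inK]
  obtain F where F: "root_tower q (sphere_pullback h) F" "field_closed F" "mero_var \<in> F" by metis
  have constF: "range mero_const \<subseteq> F" using constK root_tower_mono[OF F(1)] by (rule subset_trans)
  show ?thesis
  proof (rule contained_in_towerI[OF cl nonconst F(1) _ P])
    fix u assume u: "u \<in> meromorphic_functions M"
    show "mero_of (\<lambda>z. u (cl z)) \<in> F"
    proof (rule mero_of_rational[OF _ _ F(2,3) constF])
      show "(\<lambda>z. u (cl z)) meromorphic_on UNIV"
        using meromorphic_compose_hol_at[OF surf u cl(1)] meromorphic_on_meromorphic_at[of _ UNIV] by blast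
      have "eventually (\<lambda>t. t \<in> ball 0 \<epsilon> - {0}) (at (0::complex))" using c'(1) by (intro eventually_at_in_open) auto
      then have "eventually (\<lambda>t. u (cl (1 / t)) = u (c' t)) (at 0)" by eventually_elim (simp only: c'(3))
      moreover have "(\<lambda>t. u (c' t)) meromorphic_on {0}" by (rule meromorphic_compose_hol_at[OF surf u c'(2)])
      ultimately show "(\<lambda>t. u (cl (1 / t))) meromorphic_on {0}"
        by (subst meromorphic_on_cong[of "{0}"]) auto
    qed
  qed
qed

end

subsection \<open>The radical towers\<close>

lemmas mero_push = mero_of_arith mero_of_power meromorphic_on_add meromorphic_on_mult meromorphic_on_diff
  meromorphic_on_uminus meromorphic_on_divide meromorphic_on_power meromorphic_on_const meromorphic_on_id
  mero_const_def[symmetric] mero_var_def[symmetric] mero_const_numeral mero_const_hom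

lemma mero_of_nonzero: "f holomorphic_on UNIV \<Longrightarrow> f z \<noteq> 0 \<Longrightarrow> mero_of f \<noteq> 0"
  using mero_of_entire_eq_0_iff by blast

lemma mero_var_nonzero: "mero_var \<noteq> 0" "mero_var \<noteq> mero_const a"
proof -
  have "mero_of (\<lambda>z. z - b) \<noteq> 0" for b
    by (rule mero_of_nonzero[of _ "b + 1"]) (auto intro!: holomorphic_intros)
  then have "mero_var - mero_const b \<noteq> 0" for b by (simp add: mero_push)
  from this[of 0] this[of a] show "mero_var \<noteq> 0" "mero_var \<noteq> mero_const a" by (auto simp: mero_const_hom)
qed

lemma start_tower:
  assumes "range mero_const \<subseteq> K"
  obtains S where "root_tower q K S" "field_closed S" "K \<subseteq> S"
proof (rule adjoin_radical[OF root_tower.tower_refl, of 1 1 K q])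
  show "1 ^ 1 \<in> K" using assms mero_const_hom(7) by (metis power_one range_subsetD)
qed (auto intro: that)

text \<open>The Moebius map \<open>u = (z + 1) / (z - 1)\<close> is an \<open>n\<close>-th root of
  the given element, and being an involution it gives \<open>z\<close> back.\<close>

lemma cyclic_tower:
  assumes K: "range mero_const \<subseteq> K" and n: "0 < n"
    and x: "mero_of (\<lambda>z. (z + 1) ^ n / (z - 1) ^ n) \<in> K"
  shows "\<exists>F. root_tower q K F \<and> field_closed F \<and> mero_var \<in> F"
proof -
  obtain S where S: "root_tower q K S" "field_closed S" "K \<subseteq> S" using start_tower[OF K] by metis
  define u where "u = (mero_var + 1) / (mero_var - 1)"
  have X1: "mero_var \<noteq> 1" using mero_var_nonzero(2)[of 1] by (simp add: mero_const_hom)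
  have "u ^ n \<in> S" using x S(3) by (auto simp: mero_push u_def power_divide)
  then obtain T where T: "root_tower q K T" "field_closed T" "S \<subseteq> T" "u \<in> T"
    using adjoin_radical[OF S(1)] n by (metis One_nat_def Suc_leI)
  have "(2::mero) \<noteq> 0" using mero_const_eq_0_iff[of 2] by (simp add: mero_const_numeral)
  then have "u \<noteq> 1" "mero_var = (u + 1) / (u - 1)" using X1 by (auto simp: u_def field_simps)
  moreover have "(u + 1) / (u - 1) \<in> T" using T by (intro field_closedD) auto
  ultimately have "mero_var \<in> T" by simp
  with T show ?thesis by blast
qed

text \<open>The square of \<open>s = (z^n - 1) / (z^n + 1)\<close> is \<open>1 - 1 / x\<close> for
  the given element \<open>x\<close>. From the square root \<open>s\<close> one finds
  \<open>z^n\<close>, and \<open>z\<close> is an \<open>n\<close>-th root: the rotations form a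
  subgroup of index two in the dihedral group. The factor \<open>\<kappa>\<close> with
  \<open>\<kappa>^n = 4\<close> hides the \<open>4\<close> of \<open>4 * z^n\<close> in the
  power.\<close>

lemma dihedral_tower:
  assumes K: "range mero_const \<subseteq> K" and n: "0 < n"
    and x: "mero_of (\<lambda>z. (z ^ n + 1) ^ 2 / (\<kappa> * z) ^ n) \<in> K" and \<kappa>: "\<kappa> ^ n = 4"
  shows "\<exists>F. root_tower q K F \<and> field_closed F \<and> mero_var \<in> F"
proof -
  obtain S where S: "root_tower q K S" "field_closed S" "K \<subseteq> S" using start_tower[OF K] by metis
  define r where "r = mero_var ^ n"
  have two: "(2::mero) \<noteq> 0" using mero_const_eq_0_iff[of 2] by (simp add: mero_const_numeral)
  have "mero_of (\<lambda>z. z ^ n + 1) \<noteq> 0"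
    by (rule mero_of_nonzero[of _ 0]) (use n in \<open>auto intro!: holomorphic_intros simp: power_0_left\<close>)
  then have r1: "r + 1 \<noteq> 0" by (simp add: mero_push r_def)
  have r0: "r \<noteq> 0" using mero_var_nonzero by (simp add: r_def)
  have \<kappa>': "mero_const \<kappa> ^ n = 4" by (simp flip: mero_const_hom(8) add: \<kappa> mero_const_numeral)
  have x': "(r + 1) ^ 2 / (4 * r) \<in> S" using x S(3) \<kappa>' by (auto simp: mero_push r_def power_mult_distrib)
  define s where "s = (r - 1) / (r + 1)"
  have "(r - 1) ^ 2 = (r + 1) ^ 2 - 4 * r" by (simp add: power2_eq_square algebra_simps)
  then have "s ^ 2 = ((r + 1) ^ 2 - 4 * r) / (r + 1) ^ 2" by (simp only: s_def power_divide)
  also have "\<dots> = 1 - 1 / ((r + 1) ^ 2 / (4 * r))" using r1 by (simp add: diff_divide_distrib)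
  also have "\<dots> \<in> S"
    using field_closedD(2,7,8)[OF S(2)] x' by blast
  finally obtain T where T: "root_tower q K T" "field_closed T" "S \<subseteq> T" "s \<in> T"
    using adjoin_radical[OF S(1), of 2 s] by auto
  have "1 - s = 2 / (r + 1)" "1 + s = 2 * r / (r + 1)" using r1 by (simp_all add: s_def field_simps)
  then have "r = (1 + s) / (1 - s)" using r1 two by simp
  moreover have "(1 + s) / (1 - s) \<in> T" using T by (intro field_closedD) auto
  ultimately have "mero_var ^ n \<in> T" by (simp flip: r_def)
  then obtain T' where "root_tower q K T'" "field_closed T'" "T \<subseteq> T'" "mero_var \<in> T'"
    using adjoin_radical[OF T(1), of n] n by auto
  then show ?thesis by blast
qed

text \<open>Klein's invariant forms of the tetrahedral group.\<close>

definition \<rho> :: complex where "\<rho> = csqrt (- 3)"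
definition phi :: "complex \<Rightarrow> complex" where "phi z = z ^ 4 + 2 * \<rho> * z ^ 2 + 1"
definition psi :: "complex \<Rightarrow> complex" where "psi z = z ^ 4 - 2 * \<rho> * z ^ 2 + 1"
definition tee :: "complex \<Rightarrow> complex" where "tee z = z * (z ^ 4 - 1)"

lemma \<rho>_square: "\<rho> ^ 2 = - 3"
  unfolding \<rho>_def by (rule power2_csqrt)

lemma \<rho>_mult: "\<rho> * \<rho> = - 3" "\<rho> * (\<rho> * x) = - 3 * x"
  using \<rho>_square by (simp_all add: power2_eq_square flip: mult.assoc)

text \<open>The radicals follow the solvable series of the tetrahedral group. The cube root
  \<open>s\<close> belongs to the quotient by Klein's four-group, whose invariant
  \<open>m = z^2 + 1 / z^2\<close> is a Moebius transform of \<open>s\<close>; two square roots, of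
  \<open>m^2 - 4\<close> and of \<open>z^2\<close>, then resolve the four-group.\<close>

lemma tetrahedral_tower:
  assumes S: "root_tower q K S" "field_closed S" "range mero_const \<subseteq> S"
    and x: "mero_of phi ^ 3 / mero_of psi ^ 3 \<in> S"
  shows "\<exists>F. root_tower q K F \<and> field_closed F \<and> mero_var \<in> F"
proof -
  let ?X = mero_var and ?r = "mero_const \<rho>"
  have phi: "mero_of phi = ?X ^ 4 + 2 * ?r * ?X ^ 2 + 1" and psi: "mero_of psi = ?X ^ 4 - 2 * ?r * ?X ^ 2 + 1"
    by (simp_all add: phi_def[abs_def] psi_def[abs_def] mero_push)
  have psi0: "mero_of psi \<noteq> 0"
    by (rule mero_of_nonzero[of _ 0]) (auto simp: psi_def[abs_def] intro!: holomorphic_intros)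
  have X0: "?X \<noteq> 0" by (rule mero_var_nonzero)
  have c: "numeral k \<in> U" "?r \<in> U" if "S \<subseteq> U" for U k
    using S(3) that mero_const_numeral[of k] by (metis range_subsetD subsetD)+
  have two: "(2::mero) \<noteq> 0" using mero_const_eq_0_iff[of 2] by (simp add: mero_const_numeral)
  have "\<rho> \<noteq> 0" using \<rho>_square by auto
  then have r0: "?r \<noteq> 0" by simp
  define s where "s = mero_of phi / mero_of psi"
  have "s ^ 3 \<in> S" using x by (simp add: s_def power_divide)
  then obtain T where T: "root_tower q K T" "field_closed T" "S \<subseteq> T" "s \<in> T"
    using adjoin_radical[OF S(1), of 3 s] by auto
  \<comment> \<open>The invariant of the four-group generated by \<open>z \<mapsto> - z\<close> and
    \<open>z \<mapsto> 1 / z\<close>. Both quartics become linear in it after division by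
    \<open>z^2\<close>.\<close>
  define m where "m = (?X ^ 4 + 1) / ?X ^ 2"
  have sm: "s * mero_of psi = mero_of phi" using psi0 by (simp add: s_def)
  have phim: "mero_of phi = ?X ^ 2 * (m + 2 * ?r)" "mero_of psi = ?X ^ 2 * (m - 2 * ?r)"
    using X0 by (simp_all add: phi psi m_def field_simps)
  have "s * (m - 2 * ?r) = m + 2 * ?r" using sm X0 unfolding phim by simp
  then have m1: "m * (s - 1) = 2 * ?r * (s + 1)" by (simp add: algebra_simps)
  have s1: "s - 1 \<noteq> 0"
  proof
    assume "s - 1 = 0"
    then have "mero_of phi = mero_of psi" using sm by simp
    then have "4 * (?r * ?X ^ 2) = 0" unfolding phi psi by (simp add: algebra_simps)
    moreover have "(4::mero) \<noteq> 0" using mero_const_eq_0_iff[of 4] by (simp add: mero_const_numeral)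
    ultimately show False using r0 X0 by simp
  qed
  then have "m = 2 * ?r * (s + 1) / (s - 1)" using m1 by (simp add: field_simps)
  moreover have "2 * ?r * (s + 1) / (s - 1) \<in> T" using T c[OF T(3)] by (intro field_closedD) auto
  ultimately have mT: "m \<in> T" by simp
  define y where "y = (?X ^ 4 - 1) / ?X ^ 2"
  have X4: "?X ^ 4 = ?X ^ 2 * ?X ^ 2" by (simp flip: power_add)
  have ym: "y = ?X ^ 2 - 1 / ?X ^ 2" "m = ?X ^ 2 + 1 / ?X ^ 2"
  proof -
    have "?X ^ 4 / ?X ^ 2 = ?X ^ 2" unfolding X4 using X0 by (intro nonzero_mult_div_cancel_left) simp
    then show "y = ?X ^ 2 - 1 / ?X ^ 2" "m = ?X ^ 2 + 1 / ?X ^ 2"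
      by (simp_all add: y_def m_def add_divide_distrib diff_divide_distrib)
  qed
  then have "y ^ 2 = m ^ 2 - 4 * (?X ^ 2 * (1 / ?X ^ 2))" by (simp add: power2_sum power2_diff)
  then have "y ^ 2 = m ^ 2 - 4" using X0 by simp
  moreover have "m ^ 2 - 4 \<in> T" using T mT c[OF T(3)] by (intro field_closedD field_closed_power) auto
  ultimately have "y ^ 2 \<in> T" by simp
  then obtain U where U: "root_tower q K U" "field_closed U" "T \<subseteq> U" "y \<in> U"
    using adjoin_radical[OF T(1), of 2 y] by auto
  have "?X ^ 2 = (m + y) / 2"
  proof -
    have "m + y = 2 * ?X ^ 2" by (simp add: ym)
    then show ?thesis using two by simp
  qed
  also have "\<dots> \<in> U" using U mT c[of U] T(3) by (intro field_closedD) auto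
  finally obtain V where "root_tower q K V" "field_closed V" "U \<subseteq> V" "?X \<in> V"
    using adjoin_radical[OF U(1), of 2 ?X] by auto
  then show ?thesis by blast
qed

text \<open>In \<open>u = z^4 + 1\<close> and \<open>v = z^2\<close> the quartics are the conjugates
  \<open>u + 2 * \<rho> * v\<close> and \<open>u - 2 * \<rho> * v\<close>, so only odd powers of
  \<open>\<rho>\<close> survive in the difference of cubes. By \<open>\<rho>^2 = - 3\<close> the
  remaining factor is \<open>v * (u^2 - 4 * v^2)\<close>, the square of \<open>tee\<close>.\<close>

lemma phi_psi_cubes: "phi z ^ 3 - psi z ^ 3 = 12 * \<rho> * tee z ^ 2"
proof -
  define u v where "u = z ^ 4 + 1" and "v = z ^ 2"
  have "phi z = u + 2 * \<rho> * v" "psi z = u - 2 * \<rho> * v" by (simp_all add: phi_def psi_def u_def v_def)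
  moreover have "tee z ^ 2 = v * (u ^ 2 - 4 * v ^ 2)"
    by (simp add: tee_def u_def v_def power_mult_distrib power2_eq_square eval_nat_numeral algebra_simps)
  moreover have "(u + 2 * \<rho> * v) ^ 3 - (u - 2 * \<rho> * v) ^ 3 = 12 * \<rho> * u ^ 2 * v + 16 * \<rho> * \<rho> ^ 2 * v ^ 3"
    by (simp add: eval_nat_numeral algebra_simps)
  moreover have "12 * \<rho> * u ^ 2 * v + 16 * \<rho> * \<rho> ^ 2 * v ^ 3 = 12 * \<rho> * (v * (u ^ 2 - 4 * v ^ 2))"
    unfolding \<rho>_square by (simp add: eval_nat_numeral algebra_simps)
  ultimately show ?thesis by simp
qed

text \<open>Klein's octahedral form of degree 12. Its zeros are the edge midpoints of the octahedron
  whose vertices are the zeros of \<open>tee\<close> and infinity.\<close>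

definition kay :: "complex \<Rightarrow> complex" where "kay z = z ^ 12 - 33 * z ^ 8 - 33 * z ^ 4 + 1"

lemma phi_psi_kay:
  "phi z ^ 3 = kay z + 6 * \<rho> * tee z ^ 2" "psi z ^ 3 = kay z - 6 * \<rho> * tee z ^ 2"
proof -
  define u v where "u = z ^ 4 + 1" and "v = z ^ 2"
  have pp: "phi z = u + 2 * \<rho> * v" "psi z = u - 2 * \<rho> * v" by (simp_all add: phi_def psi_def u_def v_def)
  have "(u + 2 * \<rho> * v) ^ 3 + (u - 2 * \<rho> * v) ^ 3 = 2 * u ^ 3 + 24 * \<rho> ^ 2 * u * v ^ 2"
    by (simp add: eval_nat_numeral algebra_simps)
  then have "phi z ^ 3 + psi z ^ 3 = 2 * kay z"
    unfolding pp by (simp add: \<rho>_mult kay_def u_def v_def eval_nat_numeral algebra_simps)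
  moreover note phi_psi_cubes[of z]
  ultimately have "2 * phi z ^ 3 = 2 * (kay z + 6 * \<rho> * tee z ^ 2)" "2 * psi z ^ 3 = 2 * (kay z - 6 * \<rho> * tee z ^ 2)"
    by (simp_all add: algebra_simps)
  moreover have "x = y" if "2 * x = 2 * y" for x y :: complex using that by simp
  ultimately show "phi z ^ 3 = kay z + 6 * \<rho> * tee z ^ 2" "psi z ^ 3 = kay z - 6 * \<rho> * tee z ^ 2" by blast+
qed

text \<open>The cubes of \<open>phi\<close> and \<open>psi\<close> are the two conjugates
  \<open>kay + 6 * \<rho> * tee^2\<close> and \<open>kay - 6 * \<rho> * tee^2\<close>; the constant
  is \<open>108 = - 36 * \<rho>^2\<close>.\<close>

lemma octahedral_identity: "(phi z * psi z) ^ 3 = kay z ^ 2 + 108 * tee z ^ 4"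
proof -
  have "(phi z * psi z) ^ 3 = (kay z + 6 * \<rho> * tee z ^ 2) * (kay z - 6 * \<rho> * tee z ^ 2)"
    by (simp add: power_mult_distrib phi_psi_kay)
  also have "\<dots> = kay z ^ 2 - 36 * \<rho> ^ 2 * tee z ^ 4"
    by (simp add: eval_nat_numeral algebra_simps)
  finally show ?thesis by (simp add: \<rho>_square)
qed

lemma holomorphic_forms:
  "phi holomorphic_on UNIV" "psi holomorphic_on UNIV" "tee holomorphic_on UNIV" "kay holomorphic_on UNIV"
  by (auto simp: phi_def[abs_def] psi_def[abs_def] tee_def[abs_def] kay_def[abs_def] intro!: holomorphic_intros)

lemma meromorphic_forms:
  "phi meromorphic_on UNIV" "psi meromorphic_on UNIV" "tee meromorphic_on UNIV" "kay meromorphic_on UNIV"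
  using holomorphic_forms by (simp_all add: analytic_on_imp_meromorphic_on analytic_on_open)

lemma mero_forms_nonzero: "mero_of phi \<noteq> 0" "mero_of psi \<noteq> 0" "mero_of tee \<noteq> 0"
proof -
  show "mero_of phi \<noteq> 0" by (rule mero_of_nonzero[OF holomorphic_forms(1), of 0]) (simp add: phi_def)
  show "mero_of psi \<noteq> 0" by (rule mero_of_nonzero[OF holomorphic_forms(2), of 0]) (simp add: psi_def)
  show "mero_of tee \<noteq> 0" by (rule mero_of_nonzero[OF holomorphic_forms(3), of 2]) (simp add: tee_def)
qed

lemmas mero_forms_push = mero_push meromorphic_forms

text \<open>The tetrahedral group has index two in the octahedral one. The square root
  \<open>v = kay / tee^2\<close> makes
  \<open>phi^3 / psi^3 = (v + 6 * \<rho>) / (v - 6 * \<rho>)\<close> available, which is the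
  starting point of the tetrahedral tower.\<close>

lemma octahedral_tower:
  assumes K: "range mero_const \<subseteq> K" and x: "mero_of (\<lambda>z. (phi z * psi z) ^ 3 / (\<kappa> * tee z) ^ 4) \<in> K"
    and \<kappa>: "\<kappa> ^ 4 = 108"
  shows "\<exists>F. root_tower q K F \<and> field_closed F \<and> mero_var \<in> F"
proof -
  obtain S where S: "root_tower q K S" "field_closed S" "K \<subseteq> S" using start_tower[OF K] by metis
  have cS: "mero_const a \<in> S" for a using K S(3) by blast
  let ?t = "mero_of tee" and ?k = "mero_of kay"
  define v where "v = ?k / ?t ^ 2"
  have t0: "?t \<noteq> 0" by (rule mero_forms_nonzero)
  have "mero_of (\<lambda>z. (phi z * psi z) ^ 3 / (\<kappa> * tee z) ^ 4) = mero_of (\<lambda>z. (kay z ^ 2 + 108 * tee z ^ 4) / (108 * tee z ^ 4))"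
    by (simp only: octahedral_identity power_mult_distrib[of \<kappa> _ 4] \<kappa>)
  also have "\<dots> = (?k ^ 2 + 108 * ?t ^ 4) / (108 * ?t ^ 4)"
    by (simp add: mero_forms_push)
  finally have "(?k ^ 2 + 108 * ?t ^ 4) / (108 * ?t ^ 4) \<in> S" using x S(3) by auto
  moreover have "108 \<in> S" using cS[of 108] by (simp add: mero_const_numeral)
  ultimately have "108 * ((?k ^ 2 + 108 * ?t ^ 4) / (108 * ?t ^ 4)) - 108 \<in> S"
    using field_closedD(4,7)[OF S(2)] by blast
  moreover have "(108::mero) \<noteq> 0" using mero_const_eq_0_iff[of 108] by (simp add: mero_const_numeral)
  then have "108 * ((?k ^ 2 + 108 * ?t ^ 4) / (108 * ?t ^ 4)) - 108 = v ^ 2"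
    using t0 by (simp add: v_def add_divide_distrib distrib_left power_divide flip: power_mult)
  ultimately have "v ^ 2 \<in> S" by simp
  then obtain T where T: "root_tower q K T" "field_closed T" "S \<subseteq> T" "v \<in> T"
    using adjoin_radical[OF S(1), of 2 v] by auto
  let ?r = "mero_const (6 * \<rho>)"
  have "mero_of phi ^ 3 = ?t ^ 2 * (v + ?r)" "mero_of psi ^ 3 = ?t ^ 2 * (v - ?r)"
  proof -
    have "mero_of phi ^ 3 = mero_of (\<lambda>z. phi z ^ 3)" "mero_of psi ^ 3 = mero_of (\<lambda>z. psi z ^ 3)"
      by (simp_all add: mero_of_power meromorphic_forms)
    then show "mero_of phi ^ 3 = ?t ^ 2 * (v + ?r)" "mero_of psi ^ 3 = ?t ^ 2 * (v - ?r)"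
      using t0 by (simp_all add: phi_psi_kay mero_forms_push v_def distrib_left right_diff_distrib mult_ac)
  qed
  then have "mero_of phi ^ 3 / mero_of psi ^ 3 = (v + ?r) / (v - ?r)" using t0 by simp
  also have "\<dots> \<in> T" using T cS by (intro field_closedD) auto
  finally have "mero_of phi ^ 3 / mero_of psi ^ 3 \<in> T" .
  moreover have "range mero_const \<subseteq> T" using cS T(3) by blast
  ultimately show ?thesis using tetrahedral_tower[OF T(1,2)] by blast
qed

subsection \<open>The icosahedral case\<close>

text \<open>Klein's resolvent: \<open>(r - 3)\<^sup>3 (r\<^sup>2 - 11 r + 64) = r (r\<^sup>2 - 10 r + 45)\<^sup>2 - 1728\<close> exhibits the quotient of
  the sphere by the icosahedral group as a quintic of its quotient \<open>r\<close> by a tetrahedral subgroup. Here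
  \<open>r = em / de\<close>, a Moebius transform of \<open>(phi / psi)\<^sup>3\<close> which moves \<open>0, \<infinity>\<close> to the roots
  \<open>al, be\<close> of \<open>r\<^sup>2 - 11 r + 64\<close>.\<close>

definition al :: complex where "al = (11 + csqrt (- 135)) / 2"
definition be :: complex where "be = (11 - csqrt (- 135)) / 2"
definition em :: "complex \<Rightarrow> complex" where "em z = 64 * (psi z ^ 3 - phi z ^ 3)"
definition de :: "complex \<Rightarrow> complex" where "de z = be * psi z ^ 3 - al * phi z ^ 3"

lemma al_be: "al + be = 11" "al * be = 64" "(al - be) ^ 2 = - 135" "al \<noteq> be" "al \<noteq> 0" "be \<noteq> 0"
proof -
  have sq: "csqrt (- 135) ^ 2 = - 135" by (rule power2_csqrt)
  show "al + be = 11" by (simp add: al_def be_def field_simps)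
  have "al - be = csqrt (- 135)" unfolding al_def be_def by (simp only: diff_divide_distrib[symmetric]) simp
  then show sq': "(al - be) ^ 2 = - 135" using sq by simp
  have "4 * (al * be) = (al + be) ^ 2 - (al - be) ^ 2" by (simp add: power2_eq_square algebra_simps)
  then show ab: "al * be = 64" using \<open>al + be = 11\<close> sq' by simp
  show "al \<noteq> be" using sq' by auto
  show "al \<noteq> 0" "be \<noteq> 0" using ab by auto
qed

lemma em_de: "em z - al * de z = al * (al - be) * phi z ^ 3" "em z - be * de z = be * (al - be) * psi z ^ 3"
proof -
  have "em z = al * be * (psi z ^ 3 - phi z ^ 3)" by (simp add: em_def al_be(2))
  then show "em z - al * de z = al * (al - be) * phi z ^ 3" "em z - be * de z = be * (al - be) * psi z ^ 3"
    by (simp_all add: de_def algebra_simps)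
qed

text \<open>The homogeneous form of Klein's resolvent in \<open>em\<close> and \<open>de\<close>.
  Its quadratic factor splits at the roots \<open>al\<close>, \<open>be\<close> and is
  \<open>64 * (- 135) = - 8640\<close> times the cube of \<open>phi * psi\<close>, so the left side
  is a cube; and \<open>em = - 768 * \<rho> * tee^2\<close> turns the other product into a square.
  The three forms have degrees 20, 30 and 12, those of Klein's icosahedral forms.\<close>

lemma icosahedral_identity:
  "- 8640 * ((em z - 3 * de z) * phi z * psi z) ^ 3 =
     - 768 * \<rho> * (tee z * (em z ^ 2 - 10 * em z * de z + 45 * de z ^ 2)) ^ 2 - 1728 * de z ^ 5"
proof -
  define r d where "r = em z" and "d = de z"
  have "r ^ 2 - 11 * r * d + 64 * d ^ 2 = (r - al * d) * (r - be * d)"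
  proof -
    have "(r - al * d) * (r - be * d) = r ^ 2 - (al + be) * r * d + al * be * d ^ 2"
      by (simp add: power2_eq_square algebra_simps)
    then show ?thesis by (simp add: al_be)
  qed
  also have "\<dots> = (al * be) * (al - be) ^ 2 * (phi z * psi z) ^ 3"
    unfolding r_def d_def em_de by (simp add: power2_eq_square power_mult_distrib mult_ac)
  finally have quad: "r ^ 2 - 11 * r * d + 64 * d ^ 2 = - 8640 * (phi z * psi z) ^ 3" by (simp add: al_be)
  have r: "r = - 768 * \<rho> * tee z ^ 2"
    using phi_psi_cubes[of z] by (simp add: r_def em_def algebra_simps)
  have "(r - 3 * d) ^ 3 * (r ^ 2 - 11 * r * d + 64 * d ^ 2) = r * (r ^ 2 - 10 * r * d + 45 * d ^ 2) ^ 2 - 1728 * d ^ 5"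
    by (simp add: eval_nat_numeral algebra_simps)
  then have "- 8640 * ((r - 3 * d) * phi z * psi z) ^ 3 = r * (r ^ 2 - 10 * r * d + 45 * d ^ 2) ^ 2 - 1728 * d ^ 5"
    unfolding quad by (simp add: power_mult_distrib mult_ac)
  also have "r * (r ^ 2 - 10 * r * d + 45 * d ^ 2) ^ 2 = - 768 * \<rho> * (tee z * (r ^ 2 - 10 * r * d + 45 * d ^ 2)) ^ 2"
    by (subst (1) r) (simp add: power_mult_distrib)
  finally show ?thesis by (simp add: r_def d_def)
qed

lemma em_tee: "em z = - 768 * \<rho> * tee z ^ 2"
  using phi_psi_cubes[of z] by (simp add: em_def algebra_simps)

lemma klein_resolvent:
  "- 8640 * ((em z - 3 * de z) * phi z * psi z) ^ 3 =
     em z * (em z ^ 2 - 10 * em z * de z + 45 * de z ^ 2) ^ 2 - 1728 * de z ^ 5"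
  unfolding icosahedral_identity by (simp add: em_tee power_mult_distrib)

lemma de_nonzero: "mero_of de \<noteq> 0" "de holomorphic_on UNIV" "em holomorphic_on UNIV"
proof -
  show hol: "de holomorphic_on UNIV" "em holomorphic_on UNIV"
    unfolding de_def[abs_def] em_def[abs_def] by (intro holomorphic_intros holomorphic_forms)+
  show "mero_of de \<noteq> 0"
    by (rule mero_of_nonzero[OF hol(1), of 0]) (use al_be(4) in \<open>auto simp: de_def phi_def psi_def\<close>)
qed

text \<open>The resolvent says that \<open>w = em / de\<close> is a root of the quintic
  \<open>w * (w^2 - 10 * w + 45)^2 = 1728 * (1 - x0)\<close>, where \<open>x0\<close> is the given
  element. After adjoining \<open>w\<close>, the ratio \<open>phi^3 / psi^3\<close> is a Moebius
  transform of \<open>w\<close>, and the tetrahedral tower completes the way to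
  \<open>z\<close>.\<close>

lemma icosahedral_tower:
  assumes K: "range mero_const \<subseteq> K"
    and x: "mero_of (\<lambda>z. (\<kappa> * ((em z - 3 * de z) * phi z * psi z)) ^ 3 / (\<mu> * de z) ^ 5) \<in> K"
    and \<kappa>: "\<kappa> ^ 3 = - 8640" and \<mu>: "\<mu> ^ 5 = - 1728"
  shows "\<exists>F. root_tower True K F \<and> field_closed F \<and> mero_var \<in> F"
proof -
  obtain S where S: "root_tower True K S" "field_closed S" "K \<subseteq> S" using start_tower[OF K] by metis
  have cS: "mero_const a \<in> S" for a using K S(3) by blast
  let ?R = "mero_of em" and ?D = "mero_of de"
  have mero: "em meromorphic_on UNIV" "de meromorphic_on UNIV"
    using de_nonzero by (simp_all add: analytic_on_imp_meromorphic_on analytic_on_open)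
  define w where "w = ?R / ?D"
  have R: "?R = w * ?D" using de_nonzero(1) by (simp add: w_def)
  define x0 where "x0 = mero_of (\<lambda>z. (em z * (em z ^ 2 - 10 * em z * de z + 45 * de z ^ 2) ^ 2 - 1728 * de z ^ 5) / (- 1728 * de z ^ 5))"
  have "mero_of (\<lambda>z. (\<kappa> * ((em z - 3 * de z) * phi z * psi z)) ^ 3 / (\<mu> * de z) ^ 5) = x0"
    unfolding x0_def by (simp only: power_mult_distrib[of \<kappa> _ 3] power_mult_distrib[of \<mu> _ 5] \<kappa> \<mu> klein_resolvent)
  then have x0S: "x0 \<in> S" using x S(3) by auto
  have "x0 = (?R * (?R ^ 2 - 10 * ?R * ?D + 45 * ?D ^ 2) ^ 2 - 1728 * ?D ^ 5) / (- 1728 * ?D ^ 5)"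
    unfolding x0_def by (simp add: mero_push mero mero_of_arith(5)[OF _ meromorphic_on_id])
  also have "?R * (?R ^ 2 - 10 * ?R * ?D + 45 * ?D ^ 2) ^ 2 - 1728 * ?D ^ 5 = (w * (w ^ 2 - 10 * w + 45) ^ 2 - 1728) * ?D ^ 5"
    unfolding R by (simp add: eval_nat_numeral algebra_simps)
  also have "\<dots> / (- 1728 * ?D ^ 5) = - (w * (w ^ 2 - 10 * w + 45) ^ 2 - 1728) / 1728"
  proof -
    have "x * y / (- z * y) = - x / z" if "y \<noteq> 0" for x y z :: mero using that by simp
    then show ?thesis using de_nonzero(1) by (meson power_not_zero)
  qed
  finally have x0: "x0 = - (w * (w ^ 2 - 10 * w + 45) ^ 2 - 1728) / 1728" .
  have "(1728::mero) \<noteq> 0" using mero_const_eq_0_iff[of 1728] by (simp add: mero_const_numeral)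
  then have "1728 * x0 = - (w * (w ^ 2 - 10 * w + 45) ^ 2 - 1728)"
    unfolding x0 times_divide_eq_right by (rule nonzero_mult_div_cancel_left)
  then have "1728 * x0 - 1728 = - (w * (w ^ 2 - 10 * w + 45) ^ 2)" by simp
  then have eq: "w ^ 5 + (- 20) * w ^ 4 + 190 * w ^ 3 + (- 900) * w ^ 2 + 2025 * w + (1728 * x0 - 1728) = 0"
    by (simp add: eval_nat_numeral algebra_simps)
  have num: "numeral k \<in> S" for k using cS[of "numeral k"] by (simp add: mero_const_numeral)
  have coeffs: "{1728 * x0 - 1728, 2025, - 900, 190, - 20} \<subseteq> S"
  proof -
    have "1728 * x0 - 1728 \<in> S" by (rule field_closedD(7)[OF S(2) field_closedD(4)[OF S(2) num x0S] num])
    moreover have "- 900 \<in> S" "- 20 \<in> S" by (rule field_closedD(5)[OF S(2) num])+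
    ultimately show ?thesis by (simp only: insert_subset num empty_subsetI simp_thms)
  qed
  define T where "T = field_hull (insert w S)"
  have T: "root_tower True K T" "field_closed T" "S \<subseteq> T" "w \<in> T"
    using root_tower.tower_quintic[OF S(1) TrueI coeffs eq]
    by (auto simp: T_def field_closed_hull field_hull_incl)
  have "mero_of phi ^ 3 / mero_of psi ^ 3 = mero_const be * (w - mero_const al) / (mero_const al * (w - mero_const be))"
  proof -
    have 1: "(w - mero_const al) * ?D = mero_const (al * (al - be)) * mero_of phi ^ 3"
    proof -
      have "mero_of (\<lambda>z. em z - al * de z) = mero_of (\<lambda>z. al * (al - be) * phi z ^ 3)" by (simp only: em_de)
      then show ?thesis by (simp add: mero_forms_push mero R algebra_simps)
    qed
    have 2: "(w - mero_const be) * ?D = mero_const (be * (al - be)) * mero_of psi ^ 3"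
    proof -
      have "mero_of (\<lambda>z. em z - be * de z) = mero_of (\<lambda>z. be * (al - be) * psi z ^ 3)" by (simp only: em_de)
      then show ?thesis by (simp add: mero_forms_push mero R algebra_simps)
    qed
    have "mero_const be * (w - mero_const al) / (mero_const al * (w - mero_const be)) =
        mero_const be * ((w - mero_const al) * ?D) / (mero_const al * ((w - mero_const be) * ?D))"
      using de_nonzero(1) by simp
    also have "\<dots> = (mero_const be * mero_const al * mero_const (al - be)) * mero_of phi ^ 3 /
        ((mero_const be * mero_const al * mero_const (al - be)) * mero_of psi ^ 3)"
      unfolding 1 2 by (simp add: mero_const_hom(2) mult_ac)
    also have "\<dots> = mero_of phi ^ 3 / mero_of psi ^ 3"
      using al_be(4,5,6) by (intro mult_divide_mult_cancel_left) (simp flip: mero_const_hom(3))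
    finally show ?thesis ..
  qed
  also have "\<dots> \<in> T" using T cS by (intro field_closedD) auto
  finally have "mero_of phi ^ 3 / mero_of psi ^ 3 \<in> T" .
  moreover have "range mero_const \<subseteq> T" using cS T(3) by blast
  ultimately show ?thesis using tetrahedral_tower[OF T(1,2)] by blast
qed

subsection \<open>Application to coverings\<close>

lemma ex_quartic_root: "\<exists>z::complex. z ^ 4 + m * z ^ 2 + 1 = 0"
proof -
  define u where "u = (csqrt (m ^ 2 - 4) - m) / 2"
  have "csqrt (m ^ 2 - 4) ^ 2 = m ^ 2 - 4" by (rule power2_csqrt)
  moreover have "csqrt (m ^ 2 - 4) = 2 * u + m" by (simp add: u_def field_simps)
  ultimately have "4 * (u ^ 2 + m * u + 1) = 0" by (simp add: power2_eq_square algebra_simps)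
  then have "u ^ 2 + m * u + 1 = 0" by (metis mult_eq_0_iff zero_neq_numeral)
  moreover have "csqrt u ^ 4 = u ^ 2" using power2_csqrt[of u] by (metis mult_2_right numeral_Bit0 power_even_eq power_mult)
  ultimately show ?thesis using power2_csqrt[of u] by (intro exI[of _ "csqrt u"]) simp
qed

lemma ex_nth_root: "0 < n \<Longrightarrow> \<exists>w::complex. w ^ n = a"
  by (rule exI[of _ "if a = 0 then 0 else exp (Ln a / n)"]) (simp add: power_0_left exp_of_nat_mult[symmetric])

lemma forms_zero: "\<exists>z. phi z = 0" "\<exists>z. psi z = 0" "\<exists>z. de z = 0"
proof -
  show "\<exists>z. phi z = 0" using ex_quartic_root[of "2 * \<rho>"] by (simp add: phi_def)
  show "\<exists>z. psi z = 0" using ex_quartic_root[of "- (2 * \<rho>)"] by (simp add: psi_def)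
  \<comment> \<open>The form \<open>de\<close> vanishes where
    \<open>(phi / psi)^3 = be / al\<close>. With a cube root \<open>\<gamma>\<close> of this number,
    \<open>phi - \<gamma> * psi\<close> is up to the factor \<open>1 - \<gamma>\<close> again a
    quartic with unit outer coefficients.\<close>
  obtain \<gamma> where \<gamma>: "\<gamma> ^ 3 = be / al" using ex_nth_root[of 3] by auto
  have "\<gamma> \<noteq> 1" using \<gamma> al_be(4,5) by auto
  obtain z where z: "z ^ 4 + 2 * \<rho> * (1 + \<gamma>) / (1 - \<gamma>) * z ^ 2 + 1 = 0" using ex_quartic_root by blast
  have "phi z - \<gamma> * psi z = (1 - \<gamma>) * z ^ 4 + 2 * \<rho> * (1 + \<gamma>) * z ^ 2 + (1 - \<gamma>)"
    by (simp add: phi_def psi_def algebra_simps)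
  also have "\<dots> = (1 - \<gamma>) * (z ^ 4 + 2 * \<rho> * (1 + \<gamma>) / (1 - \<gamma>) * z ^ 2 + 1)"
    using \<open>\<gamma> \<noteq> 1\<close> by (simp add: distrib_left)
  finally have "phi z = \<gamma> * psi z" using z by simp
  then have "al * phi z ^ 3 = be * psi z ^ 3" using \<gamma> al_be(5) by (simp add: power_mult_distrib)
  then show "\<exists>z. de z = 0" by (intro exI[of _ z]) (simp add: de_def)
qed

text \<open>The forms are reciprocal up to sign, which yields the symmetry under
  \<open>t \<mapsto> 1 / t\<close> of the coverings built from them. The exponents are their degrees
  as binary forms: \<open>tee\<close> counts as a sextic, its sixth zero being infinity.\<close>

lemma forms_inverse:
  assumes "t \<noteq> 0"
  shows "phi (1 / t) = (1 / t) ^ 4 * phi t" "psi (1 / t) = (1 / t) ^ 4 * psi t" "tee (1 / t) = - ((1 / t) ^ 6 * tee t)"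
    "em (1 / t) = (1 / t) ^ 12 * em t" "de (1 / t) = (1 / t) ^ 12 * de t"
proof -
  have st: "(1 / t) * t = 1" using assms by simp
  define s where "s = 1 / t"
  have s4: "s ^ 4 * t ^ 4 = 1" "s ^ 4 * t ^ 2 = s ^ 2" "s ^ 6 * t = s ^ 5" "s ^ 6 * t ^ 5 = s"
    using assms by (simp_all add: s_def field_simps eval_nat_numeral)
  show phi: "phi (1 / t) = (1 / t) ^ 4 * phi t" and psi: "psi (1 / t) = (1 / t) ^ 4 * psi t"
    using s4(1,2) by (simp_all add: phi_def psi_def algebra_simps flip: s_def)
  have "s ^ 6 * tee t = s ^ 6 * t ^ 5 - s ^ 6 * t" by (simp add: tee_def algebra_simps eval_nat_numeral)
  then have "- (s ^ 6 * tee t) = s ^ 5 - s" using s4(3,4) by simp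
  also have "\<dots> = tee s" by (simp add: tee_def algebra_simps eval_nat_numeral)
  finally show "tee (1 / t) = - ((1 / t) ^ 6 * tee t)" by (simp add: s_def)
  have "(s ^ 4 * x) ^ 3 = s ^ 12 * x ^ 3" for x by (simp add: power_mult_distrib flip: power_mult)
  then show "em (1 / t) = (1 / t) ^ 12 * em t" "de (1 / t) = (1 / t) ^ 12 * de t"
    unfolding em_def de_def phi psi by (simp_all add: algebra_simps flip: s_def)
qed

lemma forms_coprime: "\<not> (phi z = 0 \<and> psi z = 0)" "\<not> (phi z * psi z = 0 \<and> tee z = 0)"
proof
  assume *: "phi z = 0 \<and> psi z = 0"
  then have "phi z + psi z = 0" "phi z - psi z = 0" by simp_all
  then have "2 * (z ^ 4 + 1) = 0" "4 * \<rho> * z ^ 2 = 0" by (simp_all add: phi_def psi_def algebra_simps)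
  moreover have "\<rho> \<noteq> 0" using \<rho>_square by auto
  ultimately have "z = 0" "2 * (z ^ 4 + 1) = 0" by auto
  then show False by simp
next
  show "\<not> (phi z * psi z = 0 \<and> tee z = 0)"
  proof
    assume *: "phi z * psi z = 0 \<and> tee z = 0"
    have "phi z * psi z = (z ^ 4 + 1) ^ 2 - 4 * \<rho> ^ 2 * z ^ 4"
      by (simp add: phi_def psi_def eval_nat_numeral algebra_simps)
    then have "(z ^ 4 + 1) ^ 2 + 12 * z ^ 4 = 0" using * by (simp add: \<rho>_square)
    moreover have "z = 0 \<or> z ^ 4 = 1" using * by (auto simp: tee_def)
    ultimately show False by auto
  qed
qed

lemma image_mset_set_eq_mset:
  assumes "finite S" "image_mset g (mset_set S) = mset xs"
  shows "\<exists>ps. distinct ps \<and> set ps = S \<and> map g ps = xs"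
  using assms
proof (induction xs arbitrary: S)
  case Nil
  then show ?case by (simp add: mset_set_empty_iff)
next
  case (Cons a xs)
  have "a \<in># image_mset g (mset_set S)" using Cons.prems(2) by simp
  then obtain p where p: "p \<in> S" "g p = a" using Cons.prems(1) by auto
  have "mset_set S = add_mset p (mset_set (S - {p}))" using Cons.prems(1) p(1) by (rule mset_set.remove)
  then have "image_mset g (mset_set (S - {p})) = mset xs" using Cons.prems(2) p(2) by simp
  then obtain ps where "distinct ps" "set ps = S - {p}" "map g ps = xs"
    using Cons.IH[of "S - {p}"] Cons.prems(1) by auto
  then show ?case using p by (intro exI[of _ "p # ps"]) auto
qed

context branched_covering
begin

lemma branching_type_list:
  assumes "branching_type M riemann_sphere f = mset xs" "xs \<noteq> []"
  obtains ps where "distinct ps" "set ps = critical_values M riemann_sphere f"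
    "map (branching_index M riemann_sphere f) ps = xs"
proof -
  \<comment> \<open>For an infinite set \<open>mset_set\<close> is empty, which the non-empty type
    excludes.\<close>
  have "finite (critical_values M riemann_sphere f)"
    using assms by (intro ccontr[of "finite _"]) (simp add: branching_type_def)
  from image_mset_set_eq_mset[OF this assms(1)[unfolded branching_type_def]] show ?thesis
    using that by blast
qed

text \<open>The covering is the power of \<open>(z + 1) / (z - 1)\<close>, a coordinate that changes
  only its sign under \<open>z \<mapsto> 1 / z\<close>. The exponent \<open>2 * n\<close> makes the
  power symmetric and is still a multiple of \<open>n\<close>. The point \<open>p2\<close> is a
  noncritical dummy with exponent \<open>1\<close>, so that the statement for three points
  applies.\<close>

lemma spherical_cyclic:
  assumes "branching_type M riemann_sphere f = {#n, n#}" "2 \<le> n"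
    and P: "\<And>L F u. radical_over L F u \<Longrightarrow> P L F u"
  shows "contained_in_tower P M riemann_sphere f"
proof -
  obtain ps where ps: "distinct ps" "set ps = critical_values M riemann_sphere f"
    "map (branching_index M riemann_sphere f) ps = [n, n]"
    using branching_type_list[of "[n, n]"] assms(1) by auto
  then obtain p1 p3 where p: "ps = [p1, p3]" by (auto simp: map_eq_Cons_conv)
  obtain p2 where p2: "p2 \<notin> {p1, p3}"
  proof -
    have "infinite (UNIV :: complex option set)"
      using infinite_UNIV_char_0[where ?'a = complex] finite_imageD[of Some UNIV] by (metis finite_subset inj_Some subset_UNIV)
    then show ?thesis using that finite.emptyI finite.insertI by (metis (full_types) UNIV_eq_I)
  qed
  have crit: "branching_index M riemann_sphere f p = 1" if "p \<notin> {p1, p3}" for p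
    using index_noncritical ps(2) that unfolding p by auto
  let ?n = "2 * n"
  show ?thesis
  proof (rule contained_in_tower_spherical[of p1 p2 p3 ?n 1 ?n "\<lambda>z. z + 1"
        "\<lambda>z. (z + 1) ^ ?n - (z - 1) ^ ?n" "\<lambda>z. z - 1" "-1" 1 False])
    show "\<exists>l. l \<noteq> 0 \<and> (1 / t + 1) ^ ?n = l * (t + 1) ^ ?n \<and> (1 / t - 1) ^ ?n = l * (t - 1) ^ ?n"
      if "t \<noteq> 0" for t :: complex
    proof -
      have "1 / t + 1 = (1 / t) * (t + 1)" "1 / t - 1 = - (1 / t) * (t - 1)" using that by (simp_all add: field_simps)
      then have "(1 / t + 1) ^ ?n = (1 / t) ^ ?n * (t + 1) ^ ?n" "(1 / t - 1) ^ ?n = (1 / t) ^ ?n * (t - 1) ^ ?n"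
        by (simp_all only: power_mult_distrib) (simp add: power_mult)
      then show ?thesis using that by (intro exI[of _ "(1 / t) ^ ?n"]) simp
    qed
    show "\<exists>F. root_tower False K F \<and> field_closed F \<and> mero_var \<in> F"
      if "range mero_const \<subseteq> K" "mero_of (\<lambda>z. (z + 1) ^ ?n / (z - 1) ^ ?n) \<in> K" for K
      by (rule cyclic_tower[OF that(1) _ that(2)]) (use assms(2) in simp)
  qed (use p2 ps crit assms(2) P in \<open>auto simp: p intro!: holomorphic_intros\<close>)
qed

lemma spherical_triple:
  assumes "branching_type M riemann_sphere f = {#a, b, c#}"
  obtains p1 p2 p3 where "p1 \<noteq> p2" "p2 \<noteq> p3" "p1 \<noteq> p3"
    "branching_index M riemann_sphere f p1 = a" "branching_index M riemann_sphere f p2 = b"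
    "branching_index M riemann_sphere f p3 = c"
    "\<And>p. p \<notin> {p1, p2, p3} \<Longrightarrow> branching_index M riemann_sphere f p = 1"
proof -
  obtain ps where ps: "distinct ps" "set ps = critical_values M riemann_sphere f"
    "map (branching_index M riemann_sphere f) ps = [a, b, c]"
    using branching_type_list[of "[a, b, c]"] assms(1) by auto
  then obtain p1 p2 p3 where p: "ps = [p1, p2, p3]" by (auto simp: map_eq_Cons_conv)
  show ?thesis
  proof (rule that[of p1 p2 p3])
    show "branching_index M riemann_sphere f p = 1" if "p \<notin> {p1, p2, p3}" for p
      using index_noncritical ps(2) that unfolding p by auto
  qed (use ps p in auto)
qed

text \<open>The relation is \<open>(z^n + 1)^2 = (z^n - 1)^2 + 4 * z^n\<close>, with
  \<open>4\<close> written as \<open>\<kappa>^n\<close>.\<close>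

lemma spherical_dihedral:
  assumes "branching_type M riemann_sphere f = {#2, 2, n#}" "2 \<le> n"
    and P: "\<And>L F u. radical_over L F u \<Longrightarrow> P L F u"
  shows "contained_in_tower P M riemann_sphere f"
proof -
  obtain p1 p2 p3 where p: "p1 \<noteq> p2" "p2 \<noteq> p3" "p1 \<noteq> p3"
    "branching_index M riemann_sphere f p1 = 2" "branching_index M riemann_sphere f p2 = 2"
    "branching_index M riemann_sphere f p3 = n"
    "\<And>p. p \<notin> {p1, p2, p3} \<Longrightarrow> branching_index M riemann_sphere f p = 1"
    by (rule spherical_triple[OF assms(1)]) metis
  obtain \<kappa> where \<kappa>: "\<kappa> ^ n = (4::complex)" using ex_nth_root[of n] assms(2) by auto
  obtain z0 where z0: "z0 ^ n = (- 1::complex)" using ex_nth_root[of n] assms(2) by auto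
  show ?thesis
  proof (rule contained_in_tower_spherical[OF p(1-3,7), of 2 2 n "\<lambda>z. z ^ n + 1" "\<lambda>z. z ^ n - 1" "\<lambda>z. \<kappa> * z" z0 0 False])
    show "(z ^ n + 1) ^ 2 = (z ^ n - 1) ^ 2 + (\<kappa> * z) ^ n" for z
      unfolding power_mult_distrib \<kappa> by (simp add: power2_eq_square algebra_simps)
    show "\<exists>l. l \<noteq> 0 \<and> ((1 / t) ^ n + 1) ^ 2 = l * (t ^ n + 1) ^ 2 \<and> (\<kappa> * (1 / t)) ^ n = l * (\<kappa> * t) ^ n"
      if "t \<noteq> 0" for t
    proof -
      have "(1 / t) ^ n + 1 = (1 / t) ^ n * (t ^ n + 1)" using that by (simp add: power_divide field_simps)
      moreover have "(\<kappa> * (1 / t)) ^ n = ((1 / t) ^ n) ^ 2 * (\<kappa> * t) ^ n"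
        using that by (simp add: power_divide power_mult_distrib power2_eq_square)
      ultimately show ?thesis using that by (intro exI[of _ "((1 / t) ^ n) ^ 2"]) (simp add: power_mult_distrib)
    qed
    show "\<exists>F. root_tower False K F \<and> field_closed F \<and> mero_var \<in> F"
      if "range mero_const \<subseteq> K" "mero_of (\<lambda>z. (z ^ n + 1) ^ 2 / (\<kappa> * z) ^ n) \<in> K" for K
      by (rule dihedral_tower[OF that(1) _ that(2) \<kappa>]) (use assms(2) in simp)
  qed (use p assms(2) P z0 \<kappa> in \<open>auto simp: power_0_left intro!: holomorphic_intros\<close>)
qed

lemma spherical_tetrahedral:
  assumes "branching_type M riemann_sphere f = {#2, 3, 3#}"
    and P: "\<And>L F u. radical_over L F u \<Longrightarrow> P L F u"
  shows "contained_in_tower P M riemann_sphere f"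
proof -
  \<comment> \<open>The tower starts from the ratio of the first and the third form, here the two
    cubes; the form occurring squared therefore takes the middle place.\<close>
  have "branching_type M riemann_sphere f = {#3, 2, 3#}" using assms(1) by (simp add: add_mset_commute)
  from spherical_triple[OF this]
  obtain p1 p2 p3 where p: "p1 \<noteq> p2" "p2 \<noteq> p3" "p1 \<noteq> p3"
    "branching_index M riemann_sphere f p1 = 3" "branching_index M riemann_sphere f p2 = 2"
    "branching_index M riemann_sphere f p3 = 3"
    "\<And>p. p \<notin> {p1, p2, p3} \<Longrightarrow> branching_index M riemann_sphere f p = 1" by metis
  define \<kappa> where "\<kappa> = csqrt (12 * \<rho>)"
  have \<kappa>: "\<kappa> ^ 2 = 12 * \<rho>" unfolding \<kappa>_def by (rule power2_csqrt)
  obtain z1 z3 where z: "phi z1 = 0" "psi z3 = 0" using forms_zero by blast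
  show ?thesis
  proof (rule contained_in_tower_spherical[OF p(1-3,7), of 3 2 3 phi "\<lambda>z. \<kappa> * tee z" psi z1 z3 False])
    show "phi z ^ 3 = (\<kappa> * tee z) ^ 2 + psi z ^ 3" for z
      using phi_psi_cubes[of z] by (simp add: power_mult_distrib \<kappa> algebra_simps)
    show "\<exists>l. l \<noteq> 0 \<and> phi (1 / t) ^ 3 = l * phi t ^ 3 \<and> psi (1 / t) ^ 3 = l * psi t ^ 3" if "t \<noteq> 0" for t
    proof -
      have "phi (1 / t) ^ 3 = ((1 / t) ^ 4) ^ 3 * phi t ^ 3" "psi (1 / t) ^ 3 = ((1 / t) ^ 4) ^ 3 * psi t ^ 3"
        unfolding forms_inverse[OF that] by (rule power_mult_distrib)+
      then show ?thesis using that by (intro exI[of _ "((1 / t) ^ 4) ^ 3"]) simp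
    qed
    show "\<exists>F. root_tower False K F \<and> field_closed F \<and> mero_var \<in> F"
      if K: "range mero_const \<subseteq> K" "mero_of (\<lambda>z. phi z ^ 3 / psi z ^ 3) \<in> K" for K
    proof -
      obtain S where S: "root_tower False K S" "field_closed S" "K \<subseteq> S" using start_tower[OF K(1)] by metis
      show ?thesis
        by (rule tetrahedral_tower[OF S(1,2)]) (use K S(3) in \<open>auto simp: mero_forms_push\<close>)
    qed
  qed (use p P z forms_coprime holomorphic_forms in \<open>auto intro!: holomorphic_intros\<close>)
qed

lemma spherical_octahedral:
  assumes "branching_type M riemann_sphere f = {#2, 3, 4#}"
    and P: "\<And>L F u. radical_over L F u \<Longrightarrow> P L F u"
  shows "contained_in_tower P M riemann_sphere f"
proof -
  have "branching_type M riemann_sphere f = {#3, 2, 4#}" using assms(1) by (simp add: add_mset_commute)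
  from spherical_triple[OF this]
  obtain p1 p2 p3 where p: "p1 \<noteq> p2" "p2 \<noteq> p3" "p1 \<noteq> p3"
    "branching_index M riemann_sphere f p1 = 3" "branching_index M riemann_sphere f p2 = 2"
    "branching_index M riemann_sphere f p3 = 4"
    "\<And>p. p \<notin> {p1, p2, p3} \<Longrightarrow> branching_index M riemann_sphere f p = 1" by metis
  obtain \<kappa> where \<kappa>: "\<kappa> ^ 4 = (108::complex)" using ex_nth_root[of 4] by auto
  obtain z1 where z1: "phi z1 = 0" using forms_zero by blast
  show ?thesis
  proof (rule contained_in_tower_spherical[OF p(1-3,7), of 3 2 4 "\<lambda>z. phi z * psi z" kay "\<lambda>z. \<kappa> * tee z" z1 0 False])
    show "(phi z * psi z) ^ 3 = kay z ^ 2 + (\<kappa> * tee z) ^ 4" for z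
      by (simp only: octahedral_identity power_mult_distrib[of \<kappa> _ 4] \<kappa>)
    show "\<exists>l. l \<noteq> 0 \<and> (phi (1 / t) * psi (1 / t)) ^ 3 = l * (phi t * psi t) ^ 3 \<and>
        (\<kappa> * tee (1 / t)) ^ 4 = l * (\<kappa> * tee t) ^ 4" if "t \<noteq> 0" for t
    proof -
      define s where "s = 1 / t"
      have inv: "phi s = s ^ 4 * phi t" "psi s = s ^ 4 * psi t" "tee s = - (s ^ 6 * tee t)"
        using forms_inverse[OF that] by (simp_all add: s_def)
      have "s ^ 8 = s ^ 4 * s ^ 4" by (simp flip: power_add)
      then have "phi s * psi s = s ^ 8 * (phi t * psi t)" unfolding inv by (simp add: mult_ac)
      then have "(phi s * psi s) ^ 3 = s ^ 24 * (phi t * psi t) ^ 3"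
        by (simp only: power_mult_distrib[of "s ^ 8"] flip: power_mult) simp
      moreover have "\<kappa> * tee s = - (s ^ 6 * (\<kappa> * tee t))" unfolding inv by simp
      then have "(\<kappa> * tee s) ^ 4 = (s ^ 6 * (\<kappa> * tee t)) ^ 4" by simp
      then have "(\<kappa> * tee s) ^ 4 = s ^ 24 * (\<kappa> * tee t) ^ 4"
        by (simp only: power_mult_distrib[of "s ^ 6"] flip: power_mult) simp
      ultimately show ?thesis using that unfolding s_def[symmetric] by (intro exI[of _ "s ^ 24"]) (simp add: s_def)
    qed
    show "\<exists>F. root_tower False K F \<and> field_closed F \<and> mero_var \<in> F"
      if K: "range mero_const \<subseteq> K" "mero_of (\<lambda>z. (phi z * psi z) ^ 3 / (\<kappa> * tee z) ^ 4) \<in> K" for K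
      by (rule octahedral_tower[OF K \<kappa>])
    show "\<not> (phi z * psi z = 0 \<and> \<kappa> * tee z = 0)" for z using forms_coprime(2)[of z] \<kappa> by auto
  qed (use p P z1 holomorphic_forms in \<open>auto simp: tee_def[of 0] intro!: holomorphic_intros\<close>)
qed

lemma spherical_icosahedral:
  assumes "branching_type M riemann_sphere f = {#2, 3, 5#}"
    and P: "\<And>L F u. radical_over L F u \<Longrightarrow> P L F u" "\<And>L F u. quintic_root_over L F u \<Longrightarrow> P L F u"
  shows "contained_in_tower P M riemann_sphere f"
proof -
  have "branching_type M riemann_sphere f = {#3, 2, 5#}" using assms(1) by (simp add: add_mset_commute)
  from spherical_triple[OF this]
  obtain p1 p2 p3 where p: "p1 \<noteq> p2" "p2 \<noteq> p3" "p1 \<noteq> p3"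
    "branching_index M riemann_sphere f p1 = 3" "branching_index M riemann_sphere f p2 = 2"
    "branching_index M riemann_sphere f p3 = 5"
    "\<And>p. p \<notin> {p1, p2, p3} \<Longrightarrow> branching_index M riemann_sphere f p = 1" by metis
  \<comment> \<open>Roots of the numerical coefficients bring Klein's identity into the shape
    \<open>A^3 = B^2 + C^5\<close>.\<close>
  obtain \<kappa> where \<kappa>: "\<kappa> ^ 3 = (- 8640::complex)" using ex_nth_root[of 3] by auto
  obtain \<mu> where \<mu>: "\<mu> ^ 5 = (- 1728::complex)" using ex_nth_root[of 5] by auto
  define \<nu> where "\<nu> = csqrt (- 768 * \<rho>)"
  have \<nu>: "\<nu> ^ 2 = - 768 * \<rho>" unfolding \<nu>_def by (rule power2_csqrt)
  have \<kappa>\<mu>0: "\<kappa> \<noteq> 0" "\<mu> \<noteq> 0" using \<kappa> \<mu> by auto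
  obtain z1 z3 where z: "phi z1 = 0" "de z3 = 0" using forms_zero by blast
  show ?thesis
  proof (rule contained_in_tower_spherical[OF p(1-3,7), of 3 2 5 "\<lambda>z. \<kappa> * ((em z - 3 * de z) * phi z * psi z)"
        "\<lambda>z. \<nu> * (tee z * (em z ^ 2 - 10 * em z * de z + 45 * de z ^ 2))" "\<lambda>z. \<mu> * de z" z1 z3 True])
    show "(\<kappa> * ((em z - 3 * de z) * phi z * psi z)) ^ 3 =
        (\<nu> * (tee z * (em z ^ 2 - 10 * em z * de z + 45 * de z ^ 2))) ^ 2 + (\<mu> * de z) ^ 5" for z
      by (simp only: power_mult_distrib[of \<kappa> _ 3] power_mult_distrib[of \<mu> _ 5] power_mult_distrib[of \<nu> _ 2] \<kappa> \<mu> \<nu>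
          icosahedral_identity) simp
    show "\<exists>l. l \<noteq> 0 \<and> (\<kappa> * ((em (1 / t) - 3 * de (1 / t)) * phi (1 / t) * psi (1 / t))) ^ 3 =
        l * (\<kappa> * ((em t - 3 * de t) * phi t * psi t)) ^ 3 \<and> (\<mu> * de (1 / t)) ^ 5 = l * (\<mu> * de t) ^ 5"
      if "t \<noteq> 0" for t
    proof -
      define s where "s = 1 / t"
      have inv: "em s = s ^ 12 * em t" "de s = s ^ 12 * de t" "phi s = s ^ 4 * phi t" "psi s = s ^ 4 * psi t"
        using forms_inverse[OF that] by (simp_all add: s_def)
      have "\<kappa> * ((em s - 3 * de s) * phi s * psi s) = s ^ 20 * (\<kappa> * ((em t - 3 * de t) * phi t * psi t))"
      proof -
        have "s ^ 20 = s ^ 12 * s ^ 4 * s ^ 4" by (simp flip: power_add)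
        then show ?thesis unfolding inv by (simp add: algebra_simps)
      qed
      then have "(\<kappa> * ((em s - 3 * de s) * phi s * psi s)) ^ 3 = s ^ 60 * (\<kappa> * ((em t - 3 * de t) * phi t * psi t)) ^ 3"
        by (simp only: power_mult_distrib[of "s ^ 20"] flip: power_mult) simp
      moreover have "(\<mu> * de s) ^ 5 = s ^ 60 * (\<mu> * de t) ^ 5"
        unfolding inv by (simp add: power_mult_distrib flip: power_mult)
      ultimately show ?thesis using that unfolding s_def[symmetric] by (intro exI[of _ "s ^ 60"]) (simp add: s_def)
    qed
    show "\<exists>F. root_tower True K F \<and> field_closed F \<and> mero_var \<in> F"
      if K: "range mero_const \<subseteq> K"
        "mero_of (\<lambda>z. (\<kappa> * ((em z - 3 * de z) * phi z * psi z)) ^ 3 / (\<mu> * de z) ^ 5) \<in> K" for K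
      by (rule icosahedral_tower[OF K \<kappa> \<mu>])
    show "\<not> (\<kappa> * ((em z - 3 * de z) * phi z * psi z) = 0 \<and> \<mu> * de z = 0)" for z
    proof
      assume *: "\<kappa> * ((em z - 3 * de z) * phi z * psi z) = 0 \<and> \<mu> * de z = 0"
      then have d: "be * psi z ^ 3 = al * phi z ^ 3" and "em z = 0 \<or> phi z = 0 \<or> psi z = 0"
        using \<kappa>\<mu>0 by (auto simp: de_def)
      then consider "psi z ^ 3 = phi z ^ 3" | "phi z = 0" | "psi z = 0" by (auto simp: em_def)
      then have "phi z = 0 \<and> psi z = 0"
      proof cases
        case 1
        then have "(be - al) * phi z ^ 3 = 0" using d by (simp add: algebra_simps)
        then show ?thesis using al_be(4) 1 by auto
      qed (use d al_be(5,6) in auto)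
      then show False using forms_coprime(1) by blast
    qed
  qed (use p P z de_nonzero holomorphic_forms in \<open>auto intro!: holomorphic_intros\<close>)
qed

end

section \<open>Euclidean branching types\<close>

text \<open>The universal covering \<open>h\<close> of the Euclidean orbifold with cone points \<open>p\<close> of order \<open>\<nu> p\<close> is found as
  a solution of \<open>h'\<^sup>e = \<Prod>p. (h - p) \<^bsup>e (1 - 1 / \<nu> p)\<^esup>\<close>. The flat metric that this equation defines is
  complete because the sphere is compact, whence the solutions extend to the whole plane.\<close>

locale euclidean_orbifold =
  fixes \<nu> :: "complex option \<Rightarrow> nat" and C :: "complex option set" and e :: nat
  assumes finite_C: "finite C" and \<nu>_pos: "\<And>p. 0 < \<nu> p" and \<nu>_off: "\<And>p. p \<notin> C \<Longrightarrow> \<nu> p = 1"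
    and \<nu>_dvd: "\<And>p. \<nu> p dvd e" and e_pos: "0 < e"
    and flat: "(\<Sum>p\<in>C. e - e div \<nu> p) = 2 * e"
begin

definition m :: "complex option \<Rightarrow> nat" where "m p = e - e div \<nu> p"

definition F :: "complex set" where "F = Some -` C"

text \<open>The right-hand side of the differential equation in the coordinate \<open>sph p\<close>.
  At infinity, \<open>s = 1 / h\<close> satisfies \<open>s' = - h' * s^2\<close>, which contributes
  \<open>(-1)^e * s^(2 * e)\<close>. The hypothesis \<open>flat\<close>, that is, vanishing orbifold
  Euler characteristic, leaves exactly \<open>s^(m None)\<close> of this after the finite factors
  are cleared, so infinity is a point like any other.\<close>

definition rhs :: "complex option \<Rightarrow> complex \<Rightarrow> complex" where
  "rhs p s = (case p of Some a \<Rightarrow> (\<Prod>b\<in>F. (a + s - b) ^ m (Some b))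
     | None \<Rightarrow> s ^ m None * (-1) ^ e * (\<Prod>b\<in>F. (1 - b * s) ^ m (Some b)))"

lemma finite_F: "finite F"
  unfolding F_def using finite_C by (rule finite_vimageI) simp

lemma m_eq: "\<nu> p * m p = e * (\<nu> p - 1)"
proof -
  obtain k where k: "e = \<nu> p * k" using \<nu>_dvd by blast
  then have "e div \<nu> p = k" using \<nu>_pos[of p] by simp
  then have "\<nu> p * m p = \<nu> p * e - \<nu> p * k" by (simp only: m_def diff_mult_distrib2)
  also have "\<dots> = e * \<nu> p - e" using k by (metis mult.commute)
  finally show ?thesis by (simp add: diff_mult_distrib2)
qed

lemma m_off: "p \<notin> C \<Longrightarrow> m p = 0"
  using \<nu>_off by (simp add: m_def)

lemma sum_m: "m None + (\<Sum>b\<in>F. m (Some b)) = 2 * e"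
proof -
  have C: "C = (C \<inter> {None}) \<union> Some ` F" by (auto simp: F_def image_iff; metis option.exhaust)
  have "(\<Sum>p\<in>C. m p) = (\<Sum>p\<in>C \<inter> {None}. m p) + (\<Sum>p\<in>Some ` F. m p)"
    by (subst C, rule sum.union_disjoint) (use finite_C finite_F in auto)
  also have "(\<Sum>p\<in>Some ` F. m p) = (\<Sum>b\<in>F. m (Some b))" by (simp add: sum.reindex)
  also have "(\<Sum>p\<in>C \<inter> {None}. m p) = m None" using m_off[of None] by (cases "None \<in> C") auto
  finally show ?thesis using flat by (simp add: m_def)
qed

lemma rhs_infinity:
  assumes "s \<noteq> 0"
  shows "rhs None s = (-1) ^ e * s ^ (2 * e) * rhs (Some 0) (1 / s)"
proof -
  have "(\<Prod>b\<in>F. (1 - b * s) ^ m (Some b)) = (\<Prod>b\<in>F. s ^ m (Some b) * (1 / s - b) ^ m (Some b))"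
    using assms by (intro prod.cong refl) (simp add: algebra_simps flip: power_mult_distrib)
  also have "\<dots> = s ^ (\<Sum>b\<in>F. m (Some b)) * (\<Prod>b\<in>F. (1 / s - b) ^ m (Some b))"
    by (simp add: prod.distrib power_sum)
  finally have "rhs None s = (-1) ^ e * (s ^ m None * s ^ (\<Sum>b\<in>F. m (Some b))) * rhs (Some 0) (1 / s)"
    by (simp add: rhs_def)
  also have "s ^ m None * s ^ (\<Sum>b\<in>F. m (Some b)) = s ^ (2 * e)" by (simp only: sum_m flip: power_add)
  finally show ?thesis .
qed

lemma rhs_factor:
  obtains U where "U holomorphic_on UNIV" "U 0 \<noteq> 0" "\<forall>s. rhs p s = s ^ m p * U s"
proof (cases p)
  case None
  show ?thesis
    by (rule that[of "\<lambda>s. (-1) ^ e * (\<Prod>b\<in>F. (1 - b * s) ^ m (Some b))"])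
       (auto simp: rhs_def None intro!: holomorphic_intros)
next
  case (Some a)
  show ?thesis
  proof (rule that[of "\<lambda>s. \<Prod>b\<in>F - {a}. (a + s - b) ^ m (Some b)"])
    show "(\<lambda>s. \<Prod>b\<in>F - {a}. (a + s - b) ^ m (Some b)) holomorphic_on UNIV" by (intro holomorphic_intros)
    show "(\<Prod>b\<in>F - {a}. (a + 0 - b) ^ m (Some b)) \<noteq> 0" using finite_F by auto
    have "rhs p s = s ^ m p * (\<Prod>b\<in>F - {a}. (a + s - b) ^ m (Some b))" for s
    proof (cases "a \<in> F")
      case True
      then show ?thesis using finite_F by (simp add: rhs_def Some prod.remove[of F a])
    next
      case False
      then show ?thesis using m_off[of "Some a"] by (simp add: rhs_def Some F_def)
    qed
    then show "\<forall>s. rhs p s = s ^ m p * (\<Prod>b\<in>F - {a}. (a + s - b) ^ m (Some b))" ..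
  qed
qed

definition sol_in :: "complex option \<Rightarrow> (complex \<Rightarrow> complex option) \<Rightarrow> complex \<Rightarrow> bool" where
  "sol_in p h y \<longleftrightarrow> (\<exists>r>0. \<exists>s s'. \<forall>z\<in>ball y r.
     h z = sph p (s z) \<and> (s has_field_derivative s' z) (at z) \<and> s' z ^ e = rhs p (s z))"

text \<open>Non-constancy is part of the notion because a constant map to a cone point of order at
  least two satisfies the equation: there the right-hand side vanishes. Such solutions would defeat
  the uniqueness up to isometry.\<close>

definition sol :: "(complex \<Rightarrow> complex option) \<Rightarrow> complex \<Rightarrow> bool" where
  "sol h y \<longleftrightarrow> \<not> eventually (\<lambda>z. h z = h y) (nhds y) \<and> (\<exists>p. sol_in p h y)"

lemma sol_inI:
  assumes "0 < r" "\<And>z. z \<in> ball y r \<Longrightarrow> h z = sph p (s z)"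
    "\<And>z. z \<in> ball y r \<Longrightarrow> (s has_field_derivative s' z) (at z)" "\<And>z. z \<in> ball y r \<Longrightarrow> s' z ^ e = rhs p (s z)"
  shows "sol_in p h y"
  unfolding sol_in_def using assms by blast

lemma sol_inE:
  assumes "sol_in p h y"
  obtains r s s' where "0 < r" "s holomorphic_on ball y r"
    "\<forall>z\<in>ball y r. h z = sph p (s z) \<and> (s has_field_derivative s' z) (at z) \<and> s' z ^ e = rhs p (s z)"
proof -
  obtain r s s' where *: "0 < r"
    "\<forall>z\<in>ball y r. h z = sph p (s z) \<and> (s has_field_derivative s' z) (at z) \<and> s' z ^ e = rhs p (s z)"
    using assms unfolding sol_in_def by blast
  then have "s holomorphic_on ball y r" by (auto simp: holomorphic_on_open)
  from that[OF *(1) this *(2)] show ?thesis .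
qed

text \<open>The equation describes one flat metric on the sphere, whence its independence of the
  coordinate. The passage through infinity rests on \<open>rhs_infinity\<close>.\<close>

lemma sol_in_change:
  assumes "sol_in p h y" "h y \<in> range (sph q)"
  shows "sol_in q h y"
proof -
  obtain r s s' where s0: "0 < r" "s holomorphic_on ball y r"
    "\<forall>z\<in>ball y r. h z = sph p (s z) \<and> (s has_field_derivative s' z) (at z) \<and> s' z ^ e = rhs p (s z)"
    using assms(1) by (rule sol_inE)
  note s = s0(1,2) s0(3)[THEN bspec, THEN conjunct1] s0(3)[THEN bspec, THEN conjunct2, THEN conjunct1]
    s0(3)[THEN bspec, THEN conjunct2, THEN conjunct2]
  have yr: "y \<in> ball y r" using s(1) by simp
  have shrink: "\<exists>r'>0. ball y r' \<subseteq> ball y r \<and> (\<forall>z\<in>ball y r'. a + s z \<noteq> 0)" if "a + s y \<noteq> 0" for a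
  proof -
    have "open (ball y r \<inter> (\<lambda>z. a + s z) -` (- {0}))"
      using s(2) by (intro continuous_open_preimage continuous_intros holomorphic_on_imp_continuous_on) auto
    moreover have "y \<in> ball y r \<inter> (\<lambda>z. a + s z) -` (- {0})" using yr that by auto
    ultimately obtain r' where "r' > 0" "ball y r' \<subseteq> ball y r \<inter> (\<lambda>z. a + s z) -` (- {0})" using openE by blast
    then show ?thesis by (intro exI[of _ r']) auto
  qed
  show ?thesis
  proof (cases p; cases q)
    fix a b assume pq: "p = Some a" "q = Some b"
    show ?thesis
    proof (rule sol_inI[OF s(1), of _ h q "\<lambda>z. a + s z - b" "s'"])
    qed (use s pq in \<open>auto simp: rhs_def intro!: derivative_eq_intros\<close>)
  next
    fix a assume pq: "p = Some a" "q = None"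
    have "a + s y \<noteq> 0" using assms(2) s(3)[OF yr] by (auto simp: pq range_sph)
    then obtain r' where r': "r' > 0" "ball y r' \<subseteq> ball y r" "\<And>z. z \<in> ball y r' \<Longrightarrow> a + s z \<noteq> 0"
      using shrink by blast
    show ?thesis
    proof (rule sol_inI[OF r'(1), of _ h q "\<lambda>z. 1 / (a + s z)" "\<lambda>z. - s' z / (a + s z) ^ 2"])
      fix z assume z: "z \<in> ball y r'"
      then have z': "z \<in> ball y r" "a + s z \<noteq> 0" using r' by auto
      show "h z = sph q (1 / (a + s z))" using s(3)[OF z'(1)] z'(2) by (simp add: pq sph_None)
      show "((\<lambda>z. 1 / (a + s z)) has_field_derivative - s' z / (a + s z) ^ 2) (at z)"
        using s(4)[OF z'(1)] z'(2) by (auto intro!: derivative_eq_intros simp: power2_eq_square)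
      have "(- s' z / (a + s z) ^ 2) ^ e = (-1) ^ e * s' z ^ e * (1 / (a + s z)) ^ (2 * e)"
        by (simp add: power_divide power_mult power_minus[of "s' z / _"] power_minus[of "s' z"])
      also have "s' z ^ e = rhs (Some 0) (1 / (1 / (a + s z)))"
        using s(5)[OF z'(1)] by (simp add: pq rhs_def)
      finally show "(- s' z / (a + s z) ^ 2) ^ e = rhs q (1 / (a + s z))"
        using rhs_infinity[of "1 / (a + s z)"] z'(2) by (simp add: pq mult_ac)
    qed
  next
    fix b assume pq: "p = None" "q = Some b"
    have "0 + s y \<noteq> 0" using assms(2) s(3)[OF yr] by (auto simp: pq range_sph sph_None)
    then obtain r' where r': "r' > 0" "ball y r' \<subseteq> ball y r" "\<And>z. z \<in> ball y r' \<Longrightarrow> 0 + s z \<noteq> 0"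
      using shrink by blast
    show ?thesis
    proof (rule sol_inI[OF r'(1), of _ h q "\<lambda>z. 1 / s z - b" "\<lambda>z. - s' z / s z ^ 2"])
      fix z assume z: "z \<in> ball y r'"
      then have z': "z \<in> ball y r" "s z \<noteq> 0" using r'(2) r'(3)[OF z] by auto
      show "h z = sph q (1 / s z - b)" using s(3)[OF z'(1)] z'(2) by (simp add: pq sph_None)
      show "((\<lambda>z. 1 / s z - b) has_field_derivative - s' z / s z ^ 2) (at z)"
        using s(4)[OF z'(1)] z'(2) by (auto intro!: derivative_eq_intros simp: power2_eq_square)
      have "(- s' z / s z ^ 2) ^ e = (-1) ^ e * (s' z ^ e) / s z ^ (2 * e)"
        by (simp add: power_divide power_mult power_minus[of "s' z / _"] power_minus[of "s' z"])
      also have "s' z ^ e = (-1) ^ e * s z ^ (2 * e) * rhs (Some 0) (1 / s z)"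
        using s(5)[OF z'(1)] rhs_infinity[OF z'(2)] by (simp add: pq)
      finally have "(- s' z / s z ^ 2) ^ e = ((-1) ^ e * (-1) ^ e) * rhs (Some 0) (1 / s z)"
        using z'(2) by simp
      then show "(- s' z / s z ^ 2) ^ e = rhs q (1 / s z - b)"
        by (simp add: pq rhs_def flip: power_add power_mult_distrib)
    qed
  qed (use assms(1) in auto)
qed

lemma sol_in_cong:
  assumes "sol_in p h y" "eventually (\<lambda>z. h z = h' z) (nhds y)"
  shows "sol_in p h' y"
proof -
  obtain r s s' where s0: "0 < r" "s holomorphic_on ball y r"
    "\<forall>z\<in>ball y r. h z = sph p (s z) \<and> (s has_field_derivative s' z) (at z) \<and> s' z ^ e = rhs p (s z)"
    using assms(1) by (rule sol_inE)
  note s = s0(1,2) s0(3)[THEN bspec, THEN conjunct1] s0(3)[THEN bspec, THEN conjunct2, THEN conjunct1]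
    s0(3)[THEN bspec, THEN conjunct2, THEN conjunct2]
  obtain d where d: "d > 0" "\<And>z. z \<in> ball y d \<Longrightarrow> h z = h' z"
    using assms(2) unfolding eventually_nhds_metric by (auto simp: dist_commute)
  show ?thesis
    by (rule sol_inI[of "min r d" y h' p s "s'"]) (use s d in \<open>auto simp flip: d(2)\<close>)
qed

lemma sol_cong:
  assumes "sol h y" "eventually (\<lambda>z. h z = h' z) (nhds y)"
  shows "sol h' y"
proof -
  have hy: "h y = h' y" using assms(2) by (rule eventually_nhds_x_imp_x)
  have "\<not> eventually (\<lambda>z. h' z = h' y) (nhds y)"
  proof
    assume "eventually (\<lambda>z. h' z = h' y) (nhds y)"
    with assms(2) have "eventually (\<lambda>z. h z = h y) (nhds y)" by eventually_elim (simp add: hy)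
    with assms(1) show False by (simp add: sol_def)
  qed
  then show ?thesis using assms sol_in_cong unfolding sol_def by blast
qed

lemma eventually_affine:
  fixes \<omega> b y :: complex
  assumes "eventually P (nhds (\<omega> * y + b))"
  shows "eventually (\<lambda>z. P (\<omega> * z + b)) (nhds y)"
proof -
  have "((\<lambda>z. \<omega> * z + b) \<longlongrightarrow> \<omega> * y + b) (nhds y)" by (intro tendsto_intros) (simp add: filterlim_ident)
  then show ?thesis using assms by (simp add: filterlim_iff)
qed

text \<open>The inner derivative is \<open>\<omega>\<close>, whose \<open>e\<close>-th power is
  \<open>1\<close>. These rotations and all translations are the symmetries of the equation.\<close>

lemma sol_affine:
  assumes "sol h (\<omega> * y + b)" "\<omega> ^ e = 1"
  shows "sol (\<lambda>z. h (\<omega> * z + b)) y"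
proof -
  have \<omega>: "\<omega> \<noteq> 0" using assms(2) e_pos by (auto simp: power_0_left)
  have "norm \<omega> ^ e = 1" using assms(2) by (metis norm_one norm_power)
  then have n\<omega>: "norm \<omega> = 1" using e_pos power_eq_imp_eq_base[of "norm \<omega>" e 1] by simp
  obtain p where p: "sol_in p h (\<omega> * y + b)" and nc: "\<not> eventually (\<lambda>z. h z = h (\<omega> * y + b)) (nhds (\<omega> * y + b))"
    using assms(1) by (auto simp: sol_def)
  obtain r s s' where s0: "0 < r" "s holomorphic_on ball (\<omega> * y + b) r"
    "\<forall>z\<in>ball (\<omega> * y + b) r. h z = sph p (s z) \<and> (s has_field_derivative s' z) (at z) \<and> s' z ^ e = rhs p (s z)"
    using p by (rule sol_inE)
  note s = s0(1,2) s0(3)[THEN bspec, THEN conjunct1] s0(3)[THEN bspec, THEN conjunct2, THEN conjunct1]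
    s0(3)[THEN bspec, THEN conjunct2, THEN conjunct2]
  have ball: "\<omega> * z + b \<in> ball (\<omega> * y + b) r" if "z \<in> ball y r" for z
    using that by (simp add: dist_norm norm_mult n\<omega> flip: right_diff_distrib)
  have "sol_in p (\<lambda>z. h (\<omega> * z + b)) y"
  proof (rule sol_inI[OF s(1), of _ _ _ "\<lambda>z. s (\<omega> * z + b)" "\<lambda>z. s' (\<omega> * z + b) * \<omega>"])
    fix z assume z: "z \<in> ball y r"
    show "h (\<omega> * z + b) = sph p (s (\<omega> * z + b))" by (rule s(3)[OF ball[OF z]])
    have "((\<lambda>z. \<omega> * z + b) has_field_derivative \<omega>) (at z)" by (auto intro!: derivative_eq_intros)
    from DERIV_chain2[OF s(4)[OF ball[OF z]] this]
    show "((\<lambda>z. s (\<omega> * z + b)) has_field_derivative s' (\<omega> * z + b) * \<omega>) (at z)" .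
    show "(s' (\<omega> * z + b) * \<omega>) ^ e = rhs p (s (\<omega> * z + b))"
      using s(5)[OF ball[OF z]] assms(2) by (simp add: power_mult_distrib)
  qed
  moreover have "\<not> eventually (\<lambda>z. h (\<omega> * z + b) = h (\<omega> * y + b)) (nhds y)"
  proof
    assume "eventually (\<lambda>z. h (\<omega> * z + b) = h (\<omega> * y + b)) (nhds y)"
    moreover have y: "y = (1 / \<omega>) * (\<omega> * y + b) + (- b / \<omega>)" using \<omega> by (simp add: field_simps)
    ultimately have "eventually (\<lambda>z. h (\<omega> * z + b) = h (\<omega> * y + b)) (nhds ((1 / \<omega>) * (\<omega> * y + b) + (- b / \<omega>)))" by simp
    from eventually_affine[OF this] have "eventually (\<lambda>z. h z = h (\<omega> * y + b)) (nhds (\<omega> * y + b))"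
      using \<omega> by (simp add: distrib_left right_diff_distrib)
    with nc show False ..
  qed
  ultimately show ?thesis unfolding sol_def by blast
qed

text \<open>With \<open>s = \<zeta>^n\<close> and \<open>n = \<nu> p\<close>, the relation
  \<open>n * m p = e * (n - 1)\<close> cancels the zero of the right-hand side, and the equation
  becomes \<open>\<zeta>'^e = V \<zeta>\<close> with \<open>V 0 \<noteq> 0\<close>. For an
  \<open>e\<close>-th root \<open>R\<close> of \<open>V\<close> this reads
  \<open>\<zeta>' = \<omega> * R \<zeta>\<close>, so the flat coordinate \<open>T\<close>, a
  primitive of \<open>1 / R\<close>, satisfies \<open>T (\<zeta> z) = \<omega> * z\<close> up to a
  constant. With \<open>Z\<close> the inverse of \<open>T\<close>, every solution with values near
  \<open>p\<close> is \<open>Z (\<omega> * (z - y) + t) ^ n\<close>, on a disc whose size depends on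
  \<open>p\<close> alone.\<close>

lemma local_solution:
  obtains \<epsilon> \<rho> Z where "0 < \<epsilon>" "0 < \<rho>" "Z holomorphic_on ball 0 (3 * \<epsilon>)" "inj_on Z (ball 0 (3 * \<epsilon>))" "Z 0 = 0"
    "\<forall>t\<in>ball 0 (3 * \<epsilon>). sol (\<lambda>t. sph p (Z t ^ \<nu> p)) t"
    "sph p ` ball 0 \<rho> \<subseteq> (\<lambda>t. sph p (Z t ^ \<nu> p)) ` ball 0 \<epsilon>"
    "\<forall>h y s. sol_in p h y \<and> h y = sph p s \<and> s \<in> ball 0 \<rho> \<and> s \<noteq> 0 \<longrightarrow>
       (\<exists>\<omega> t. \<omega> ^ e = 1 \<and> t \<in> ball 0 \<epsilon> \<and> eventually (\<lambda>z. h z = sph p (Z (\<omega> * (z - y) + t) ^ \<nu> p)) (nhds y))"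
proof -
  define n where "n = \<nu> p"
  have n: "0 < n" by (simp add: n_def \<nu>_pos)
  obtain U where U: "U holomorphic_on UNIV" "U 0 \<noteq> 0" "\<forall>s. rhs p s = s ^ m p * U s"
    by (rule rhs_factor[of p])
  define V where "V = (\<lambda>\<zeta>. U (\<zeta> ^ n) / of_nat n ^ e)"
  have holV: "V holomorphic_on UNIV"
  proof -
    have "(U \<circ> (\<lambda>\<zeta>. \<zeta> ^ n)) holomorphic_on UNIV"
      by (rule holomorphic_on_compose_gen[OF _ U(1)]) (auto intro!: holomorphic_intros)
    then show ?thesis using n unfolding V_def by (intro holomorphic_intros) (auto simp: o_def)
  qed
  have "open (V -` (- {0}))"
    using holomorphic_on_imp_continuous_on[OF holV] by (intro open_vimage) auto
  moreover have "0 \<in> V -` (- {0})" using U(2) n by (simp add: V_def power_0_left)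
  ultimately obtain r0 where r0: "0 < r0" "ball (0::complex) r0 \<subseteq> V -` (- {0})" using openE by blast
  have V0: "V \<zeta> \<noteq> 0" if "\<zeta> \<in> ball 0 r0" for \<zeta> using that r0(2) by blast
  obtain R where R: "R holomorphic_on ball 0 r0" "\<And>\<zeta>. \<zeta> \<in> ball 0 r0 \<Longrightarrow> R \<zeta> ^ e = V \<zeta>"
    using holomorphic_nth_root[OF convex_ball open_ball holomorphic_on_subset[OF holV subset_UNIV] V0 e_pos] by metis
  have R0: "R \<zeta> \<noteq> 0" if "\<zeta> \<in> ball 0 r0" for \<zeta> using R(2)[OF that] V0[OF that] e_pos by (auto simp: power_0_left)
  have rhs_pow: "rhs p (w ^ n) = (of_nat n * w ^ (n - 1)) ^ e * V w" for w
  proof -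
    have "(w ^ n) ^ m p = w ^ (e * (n - 1))" by (simp add: n_def m_eq flip: power_mult)
    also have "\<dots> = (w ^ (n - 1)) ^ e" by (simp add: mult.commute flip: power_mult)
    finally show ?thesis using n by (simp add: U(3)[rule_format] V_def power_mult_distrib)
  qed
  \<comment> \<open>The primitive of \<open>1 / R\<close> is the coordinate in which the metric is
    Euclidean.\<close>
  obtain T0 where T0: "\<And>\<zeta>. \<zeta> \<in> ball 0 r0 \<Longrightarrow> (T0 has_field_derivative 1 / R \<zeta>) (at \<zeta>)"
  proof (rule holomorphic_convex_primitive'[OF convex_ball open_ball, of "\<lambda>\<zeta>. 1 / R \<zeta>" 0 r0])
    show "(\<lambda>\<zeta>. 1 / R \<zeta>) holomorphic_on ball 0 r0" using R(1) R0 by (intro holomorphic_intros) auto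
  qed (use that in \<open>auto simp: at_within_open[OF _ open_ball]\<close>)
  define T where "T = (\<lambda>\<zeta>. T0 \<zeta> - T0 0)"
  have T: "(T has_field_derivative 1 / R \<zeta>) (at \<zeta>)" if "\<zeta> \<in> ball 0 r0" for \<zeta>
    unfolding T_def using DERIV_diff[OF T0[OF that] DERIV_const] by simp
  have holT: "T holomorphic_on ball 0 r0" unfolding holomorphic_on_open[OF open_ball] using T by blast
  have zero: "0 \<in> ball 0 r0" using r0(1) by simp
  have "deriv T 0 = 1 / R 0" by (rule DERIV_imp_deriv) (rule T[OF zero])
  with R0[OF zero] have dT: "deriv T 0 \<noteq> 0" by simp
  obtain r1 where r1: "0 < r1" "ball (0::complex) r1 \<subseteq> ball 0 r0" "inj_on T (ball 0 r1)"
    by (rule has_complex_derivative_locally_injective[OF holT zero open_ball dT]) (rule that, assumption+)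
  obtain \<rho>1 Z where Z: "0 < \<rho>1" "Z holomorphic_on ball 0 \<rho>1" "Z ` ball 0 \<rho>1 \<subseteq> ball 0 r1" "inj_on Z (ball 0 \<rho>1)"
    "Z 0 = 0" "\<And>t. t \<in> ball 0 \<rho>1 \<Longrightarrow> T (Z t) = t"
    "\<And>w. w \<in> ball 0 r1 \<Longrightarrow> T w \<in> ball 0 \<rho>1 \<Longrightarrow> Z (T w) = w"
    by (rule local_inverse[OF holomorphic_on_subset[OF holT r1(2)] r1(3,1)])
       (simp add: T_def, rule that, assumption+)
  \<comment> \<open>A third of the radius, so that an initial parameter below
    \<open>\<epsilon>\<close> leaves room for a displacement of \<open>2 * \<epsilon>\<close> inside
    the domain of \<open>Z\<close>.\<close>
  define \<epsilon> where "\<epsilon> = \<rho>1 / 3"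
  have \<epsilon>: "0 < \<epsilon>" "3 * \<epsilon> = \<rho>1" using Z(1) by (auto simp: \<epsilon>_def)
  have "isCont T 0" using T[OF zero] by (rule DERIV_isCont)
  then obtain \<delta>0 where \<delta>0: "0 < \<delta>0" "\<And>\<zeta>. norm \<zeta> < \<delta>0 \<Longrightarrow> norm (T \<zeta>) < \<epsilon>"
    using \<epsilon>(1) unfolding continuous_at_eps_delta by (auto simp: T_def dist_norm)
  define \<delta> where "\<delta> = min \<delta>0 r1"
  have \<delta>: "0 < \<delta>" and T\<epsilon>: "\<And>\<zeta>. norm \<zeta> < \<delta> \<Longrightarrow> norm (T \<zeta>) < \<epsilon>" and \<delta>r: "\<And>\<zeta>. norm \<zeta> < \<delta> \<Longrightarrow> \<zeta> \<in> ball 0 r1"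
    using \<delta>0 r1(1) by (auto simp: \<delta>_def)
  have root_small: "norm \<zeta> < \<delta>" if "norm (\<zeta> ^ n) < \<delta> ^ n" for \<zeta> :: complex
    using that \<delta> by (metis norm_power power_less_imp_less_base less_imp_le)
  have ZT: "Z (T \<zeta>) = \<zeta>" if "norm \<zeta> < \<delta>" for \<zeta>
    using Z(7)[OF \<delta>r[OF that]] T\<epsilon>[OF that] \<epsilon> by simp
  show ?thesis
  proof (rule that[of \<epsilon> "\<delta> ^ n" Z])
    show "sph p ` ball 0 (\<delta> ^ n) \<subseteq> (\<lambda>t. sph p (Z t ^ \<nu> p)) ` ball 0 \<epsilon>"
    proof
      fix q assume "q \<in> sph p ` ball 0 (\<delta> ^ n)"
      then obtain s where s: "q = sph p s" "norm s < \<delta> ^ n" by auto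
      obtain \<zeta> where \<zeta>: "s = \<zeta> ^ n" using ex_nth_root[OF n] by metis
      with s have "norm \<zeta> < \<delta>" using root_small by blast
      then show "q \<in> (\<lambda>t. sph p (Z t ^ \<nu> p)) ` ball 0 \<epsilon>"
        using T\<epsilon> ZT s(1) \<zeta> by (intro image_eqI[of _ _ "T \<zeta>"]) (auto simp: n_def)
    qed
  next
    show "\<forall>t\<in>ball 0 (3 * \<epsilon>). sol (\<lambda>t. sph p (Z t ^ \<nu> p)) t"
    proof
      fix t0 :: complex assume t0: "t0 \<in> ball 0 (3 * \<epsilon>)"
      obtain r where r: "0 < r" "ball t0 r \<subseteq> ball 0 \<rho>1" using t0 unfolding \<epsilon> by (meson open_ball openE)
      have "sol_in p (\<lambda>t. sph p (Z t ^ \<nu> p)) t0"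
      proof (rule sol_inI[OF r(1), of _ _ _ "\<lambda>t. Z t ^ n" "\<lambda>t. of_nat n * Z t ^ (n - 1) * R (Z t)"])
        fix t assume "t \<in> ball t0 r"
        then have t: "t \<in> ball 0 \<rho>1" using r(2) by blast
        then have Zt: "Z t \<in> ball 0 r0" using Z(3) r1(2) by blast
        have dZ: "(Z has_field_derivative deriv Z t) (at t)" by (rule holomorphic_derivI[OF Z(2) open_ball t])
        from DERIV_chain2[OF T[OF Zt] this] have "((\<lambda>t. T (Z t)) has_field_derivative 1 / R (Z t) * deriv Z t) (at t)" .
        moreover have "((\<lambda>t. T (Z t)) has_field_derivative 1) (at t)"
          by (rule has_field_derivative_transform_within_open[OF DERIV_ident open_ball t]) (simp add: Z(6))
        ultimately have "1 / R (Z t) * deriv Z t = 1" by (rule DERIV_unique)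
        then have "deriv Z t = R (Z t)" using R0[OF Zt] by (simp add: field_simps)
        with dZ have dZ: "(Z has_field_derivative R (Z t)) (at t)" by simp
        show "((\<lambda>t. Z t ^ n) has_field_derivative of_nat n * Z t ^ (n - 1) * R (Z t)) (at t)"
          using DERIV_power[OF dZ, of n] by (simp add: mult_ac)
        show "(of_nat n * Z t ^ (n - 1) * R (Z t)) ^ e = rhs p (Z t ^ n)"
          by (simp add: rhs_pow power_mult_distrib R(2)[OF Zt])
      qed (simp add: n_def)
      moreover have "\<not> eventually (\<lambda>t. sph p (Z t ^ \<nu> p) = sph p (Z t0 ^ \<nu> p)) (nhds t0)"
      proof
        assume "eventually (\<lambda>t. sph p (Z t ^ \<nu> p) = sph p (Z t0 ^ \<nu> p)) (nhds t0)"
        then obtain d where d: "d > 0" "\<And>t. t \<in> ball t0 d \<Longrightarrow> Z t ^ n = Z t0 ^ n"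
          unfolding eventually_nhds_metric n_def by (auto simp: dist_commute)
        let ?B = "ball t0 (min d r)"
        have "Z ` ?B \<subseteq> {z. z ^ n = Z t0 ^ n}" using d(2) by auto
        then have "finite (Z ` ?B)" using finite_nth_roots[OF n] finite_subset by blast
        moreover have "inj_on Z ?B" using Z(4) r(2) by (meson inj_on_subset subset_ball min.cobounded2 subset_trans)
        ultimately have "finite ?B" by (simp add: finite_image_iff)
        then show False using d(1) r(1) using uncountable_ball[of "min d r" t0] countable_finite by auto 
      qed
      ultimately show "sol (\<lambda>t. sph p (Z t ^ \<nu> p)) t0" unfolding sol_def by blast
    qed
  next
    show "\<forall>h y s. sol_in p h y \<and> h y = sph p s \<and> s \<in> ball 0 (\<delta> ^ n) \<and> s \<noteq> 0 \<longrightarrow>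
       (\<exists>\<omega> t. \<omega> ^ e = 1 \<and> t \<in> ball 0 \<epsilon> \<and> eventually (\<lambda>z. h z = sph p (Z (\<omega> * (z - y) + t) ^ \<nu> p)) (nhds y))"
    proof (intro allI impI, elim conjE)
      fix h y s1 assume h: "sol_in p h y" "h y = sph p s1" "s1 \<in> ball 0 (\<delta> ^ n)" "s1 \<noteq> 0"
      obtain r s s' where s0: "0 < r" "s holomorphic_on ball y r"
        "\<forall>z\<in>ball y r. h z = sph p (s z) \<and> (s has_field_derivative s' z) (at z) \<and> s' z ^ e = rhs p (s z)"
        using h(1) by (rule sol_inE)
      note s = s0(1,2) s0(3)[THEN bspec, THEN conjunct1] s0(3)[THEN bspec, THEN conjunct2, THEN conjunct1]
        s0(3)[THEN bspec, THEN conjunct2, THEN conjunct2]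
      have sy: "s y = s1" using s(3)[of y] s(1) h(2) by simp
      have "open (ball y r \<inter> s -` (ball 0 (\<delta> ^ n) - {0}))"
        using s(2) by (intro continuous_open_preimage holomorphic_on_imp_continuous_on) auto
      moreover have "y \<in> ball y r \<inter> s -` (ball 0 (\<delta> ^ n) - {0})" using s(1) sy h(3,4) by auto
      ultimately obtain r' where r': "r' > 0" "ball y r' \<subseteq> ball y r \<inter> s -` (ball 0 (\<delta> ^ n) - {0})" using openE by blast
      have s_ne: "s z \<noteq> 0" and s_lt: "norm (s z) < \<delta> ^ n" and z_r: "z \<in> ball y r" if "z \<in> ball y r'" for z
        using subsetD[OF r'(2) that] by auto
      have hols: "s holomorphic_on ball y r'" using s(2) z_r by (rule holomorphic_on_subset[OF _ subsetI])
      \<comment> \<open>This is where the value \<open>p\<close> itself must be excluded: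
        \<open>s\<close> has no zeros on the shrunken disc and hence a holomorphic
        \<open>n\<close>-th root. The value \<open>p\<close> is treated in
        \<open>local_sol_match\<close>.\<close>
      obtain \<zeta> where \<zeta>: "\<zeta> holomorphic_on ball y r'" "\<And>z. z \<in> ball y r' \<Longrightarrow> \<zeta> z ^ n = s z"
        using holomorphic_nth_root[OF convex_ball open_ball hols s_ne n] by metis
      have \<zeta>_lt: "norm (\<zeta> z) < \<delta>" if "z \<in> ball y r'" for z using \<zeta>(2)[OF that] s_lt[OF that] root_small by metis
      then have \<zeta>_r0: "\<zeta> z \<in> ball 0 r0" if "z \<in> ball y r'" for z using that \<delta>r r1(2) by blast
      have d\<zeta>: "(\<zeta> has_field_derivative deriv \<zeta> z) (at z)" if "z \<in> ball y r'" for z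
        by (rule holomorphic_derivI[OF \<zeta>(1) open_ball that])
      have "deriv \<zeta> z ^ e = R (\<zeta> z) ^ e" if z: "z \<in> ball y r'" for z
      proof -
        have "((\<lambda>z. \<zeta> z ^ n) has_field_derivative of_nat n * \<zeta> z ^ (n - 1) * deriv \<zeta> z) (at z)"
          using DERIV_power[OF d\<zeta>[OF z], of n] by (simp add: mult_ac)
        moreover have "((\<lambda>z. \<zeta> z ^ n) has_field_derivative s' z) (at z)"
          by (rule has_field_derivative_transform_within_open[OF s(4)[OF z_r[OF z]] open_ball z]) (simp add: \<zeta>(2))
        ultimately have "s' z = of_nat n * \<zeta> z ^ (n - 1) * deriv \<zeta> z" by (rule DERIV_unique[symmetric])
        then have "(of_nat n * \<zeta> z ^ (n - 1)) ^ e * deriv \<zeta> z ^ e = rhs p (\<zeta> z ^ n)"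
          using s(5)[OF z_r[OF z]] by (simp add: \<zeta>(2)[OF z] power_mult_distrib)
        then have "(of_nat n * \<zeta> z ^ (n - 1)) ^ e * deriv \<zeta> z ^ e = (of_nat n * \<zeta> z ^ (n - 1)) ^ e * V (\<zeta> z)"
          by (simp only: rhs_pow)
        moreover have "\<zeta> z \<noteq> 0" using \<zeta>(2)[OF z] s_ne[OF z] n by (auto simp: power_0_left)
        then have "(of_nat n * \<zeta> z ^ (n - 1)) ^ e \<noteq> 0" using n by simp
        ultimately show ?thesis using R(2)[OF \<zeta>_r0[OF z]] by (metis mult_left_cancel)
      qed
      moreover have "deriv \<zeta> holomorphic_on ball y r'" using \<zeta>(1) by (intro holomorphic_deriv) auto
      moreover have "(R \<circ> \<zeta>) holomorphic_on ball y r'"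
        by (rule holomorphic_on_compose_gen[OF \<zeta>(1) R(1)]) (use \<zeta>_r0 in blast)
      ultimately obtain \<omega> where \<omega>: "\<omega> ^ e = 1" "\<And>z. z \<in> ball y r' \<Longrightarrow> deriv \<zeta> z = \<omega> * R (\<zeta> z)"
        using holomorphic_power_eq_imp_multiple[OF _ _ open_ball connected_ball e_pos, of "deriv \<zeta>" y r' "R \<circ> \<zeta>"]
        by (metis comp_apply)
      \<comment> \<open>In the flat coordinate the solution has constant derivative
        \<open>\<omega>\<close>.\<close>
      have "T (\<zeta> z) - \<omega> * z = T (\<zeta> y) - \<omega> * y" if z: "z \<in> ball y r'" for z
      proof (rule has_field_derivative_zero_constant[OF convex_ball[of y r'], of "\<lambda>z. T (\<zeta> z) - \<omega> * z", THEN exE])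
        fix w assume w: "w \<in> ball y r'"
        have dT\<zeta>: "((\<lambda>z. T (\<zeta> z)) has_field_derivative 1 / R (\<zeta> w) * deriv \<zeta> w) (at w)"
          by (rule DERIV_chain2[OF T[OF \<zeta>_r0[OF w]] d\<zeta>[OF w]])
        have zero: "1 / R (\<zeta> w) * deriv \<zeta> w - \<omega> * 1 = 0" by (simp only: \<omega>(2)[OF w]) (use R0[OF \<zeta>_r0[OF w]] in simp)
        have "((\<lambda>z. T (\<zeta> z) - \<omega> * z) has_field_derivative 0) (at w)"
          using DERIV_diff[OF dT\<zeta> DERIV_cmult[OF DERIV_ident, of \<omega>]] unfolding zero .
        then show "((\<lambda>z. T (\<zeta> z) - \<omega> * z) has_field_derivative 0) (at w within ball y r')"
          by (rule has_field_derivative_at_within)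
      next
        fix c assume "\<forall>z\<in>ball y r'. T (\<zeta> z) - \<omega> * z = c"
        then show ?thesis using z r'(1) by (metis centre_in_ball)
      qed
      then have T\<zeta>: "T (\<zeta> z) = \<omega> * (z - y) + T (\<zeta> y)" if "z \<in> ball y r'" for z
        using that by (simp add: algebra_simps) 
      have "eventually (\<lambda>z. h z = sph p (Z (\<omega> * (z - y) + T (\<zeta> y)) ^ \<nu> p)) (nhds y)"
      proof -
        have "eventually (\<lambda>z. z \<in> ball y r') (nhds y)" using r'(1) by (intro eventually_nhds_in_open) auto
        then show ?thesis
        proof eventually_elim
          case (elim z)
          show ?case using s(3)[OF z_r[OF elim]] \<zeta>(2)[OF elim] ZT[OF \<zeta>_lt[OF elim]] T\<zeta>[OF elim] by (simp add: n_def)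
        qed
      qed
      moreover have "T (\<zeta> y) \<in> ball 0 \<epsilon>" using T\<epsilon> \<zeta>_lt r'(1) by simp
      ultimately show "\<exists>\<omega> t. \<omega> ^ e = 1 \<and> t \<in> ball 0 \<epsilon> \<and>
          eventually (\<lambda>z. h z = sph p (Z (\<omega> * (z - y) + t) ^ \<nu> p)) (nhds y)" using \<omega>(1) by blast
    qed
  qed (use \<epsilon> \<delta> Z in auto)
qed

end

section \<open>Continuation of the solutions, and the resulting map of the whole plane\<close>

context euclidean_orbifold
begin

lemma eventually_sol_in: "sol_in p h y \<Longrightarrow> eventually (sol_in p h) (nhds y)"
proof -
  assume "sol_in p h y"
  then obtain r s s' where s: "0 < r"
    "\<forall>z\<in>ball y r. h z = sph p (s z) \<and> (s has_field_derivative s' z) (at z) \<and> s' z ^ e = rhs p (s z)"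
    unfolding sol_in_def by blast
  have "eventually (\<lambda>z. z \<in> ball y r) (nhds y)" using s(1) by (intro eventually_nhds_in_open) auto
  then show ?thesis
  proof eventually_elim
    case (elim z)
    then obtain d where "0 < d" "ball z d \<subseteq> ball y r" by (meson open_ball openE)
    then show ?case using s(2) unfolding sol_in_def by blast
  qed
qed

lemma sol_in_hol_at: "sol_in p h y \<Longrightarrow> hol_at riemann_sphere h y"
proof -
  assume "sol_in p h y"
  then obtain r s s' where s0: "0 < r" "s holomorphic_on ball y r"
    "\<forall>z\<in>ball y r. h z = sph p (s z) \<and> (s has_field_derivative s' z) (at z) \<and> s' z ^ e = rhs p (s z)"
    by (rule sol_inE)
  have "s analytic_on {y}" using s0(1,2) by (meson analytic_at centre_in_ball open_ball)
  then have "hol_at riemann_sphere (\<lambda>z. sph p (s z)) y"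
    by (rule hol_at_compose[OF riemann_surface_sphere hol_at_sph])
  moreover have "eventually (\<lambda>z. z \<in> ball y r) (nhds y)" using s0(1) by (intro eventually_nhds_in_open) auto
  then have "eventually (\<lambda>z. sph p (s z) = h z) (nhds y)" by eventually_elim (simp add: s0(3))
  ultimately show ?thesis by (rule hol_at_cong)
qed

lemma sol_hol_at: "sol h y \<Longrightarrow> hol_at riemann_sphere h y"
  unfolding sol_def using sol_in_hol_at by blast

lemma sol_sol_in: "sol h y \<Longrightarrow> h y \<in> range (sph p) \<Longrightarrow> sol_in p h y"
  unfolding sol_def using sol_in_change by blast

lemma sol_ident:
  assumes "open D" "convex D" "a \<in> D" "\<And>y. y \<in> D \<Longrightarrow> hol_at riemann_sphere h1 y"
    "\<And>y. y \<in> D \<Longrightarrow> hol_at riemann_sphere h2 y" "eventually (\<lambda>z. h1 z = h2 z) (nhds a)"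
  shows "\<forall>y\<in>D. h1 y = h2 y"
proof (rule hol_at_identity[OF riemann_surface_sphere assms(1) convex_connected[OF assms(2)] assms(3,4,5)])
  have "eventually (\<lambda>z. h1 z = h2 z) (at a)" using assms(6) by (simp add: eventually_nhds_conv_at)
  then show "\<exists>\<^sub>F z in at a. h1 z = h2 z" by (rule eventually_frequently[OF at_neq_bot])
qed

lemma norm_root_of_unity: "\<omega> ^ e = 1 \<Longrightarrow> norm (\<omega> :: complex) = 1"
  using e_pos power_eq_imp_eq_base[of "norm \<omega>" e 1] by (simp flip: norm_power)

definition local_sol :: "complex option \<Rightarrow> real \<Rightarrow> real \<Rightarrow> (complex \<Rightarrow> complex) \<Rightarrow> bool" where
  "local_sol p \<epsilon> \<kappa> Z \<longleftrightarrow> 0 < \<epsilon> \<and> 0 < \<kappa> \<and> Z holomorphic_on ball 0 (3 * \<epsilon>) \<and> inj_on Z (ball 0 (3 * \<epsilon>)) \<and> Z 0 = 0 \<and>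
    (\<forall>t\<in>ball 0 (3 * \<epsilon>). sol (\<lambda>t. sph p (Z t ^ \<nu> p)) t) \<and>
    sph p ` ball 0 \<kappa> \<subseteq> (\<lambda>t. sph p (Z t ^ \<nu> p)) ` ball 0 \<epsilon> \<and>
    (\<forall>h y s. sol_in p h y \<and> h y = sph p s \<and> s \<in> ball 0 \<kappa> \<and> s \<noteq> 0 \<longrightarrow>
       (\<exists>\<omega> t. \<omega> ^ e = 1 \<and> t \<in> ball 0 \<epsilon> \<and> eventually (\<lambda>z. h z = sph p (Z (\<omega> * (z - y) + t) ^ \<nu> p)) (nhds y)))"

lemma ex_local_sol: "\<exists>\<epsilon> \<kappa> Z. local_sol p \<epsilon> \<kappa> Z"
  by (rule local_solution[of p]) (unfold local_sol_def, blast)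

text \<open>This includes the case \<open>h y = p\<close>, left open by the local solution: a point
  \<open>z1\<close> near \<open>y\<close> with another value is matched first, the identity theorem
  carries the formula back to \<open>y\<close>, and injectivity of \<open>Z\<close> forces the
  parameter at \<open>y\<close> to be \<open>0\<close>.\<close>

lemma local_sol_match:
  assumes L: "local_sol p \<epsilon> \<kappa> Z" and h: "sol h y" "h y \<in> sph p ` ball 0 \<kappa>"
  shows "\<exists>\<omega> t. \<omega> ^ e = 1 \<and> t \<in> ball 0 \<epsilon> \<and> eventually (\<lambda>z. h z = sph p (Z (\<omega> * (z - y) + t) ^ \<nu> p)) (nhds y)"
proof -
  note l = L[unfolded local_sol_def]
  have \<epsilon>: "0 < \<epsilon>" "0 < \<kappa>" and Z: "inj_on Z (ball 0 (3 * \<epsilon>))" "Z 0 = 0"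
    and S: "\<And>t. t \<in> ball 0 (3 * \<epsilon>) \<Longrightarrow> sol (\<lambda>t. sph p (Z t ^ \<nu> p)) t" using l by blast+
  have match: "\<exists>\<omega> t. \<omega> ^ e = 1 \<and> t \<in> ball 0 \<epsilon> \<and> eventually (\<lambda>z. h z = sph p (Z (\<omega> * (z - x) + t) ^ \<nu> p)) (nhds x)"
    if "sol_in p h x" "h x \<in> sph p ` ball 0 \<kappa>" "h x \<noteq> p" for x
  proof -
    obtain s where s: "h x = sph p s" "s \<in> ball 0 \<kappa>" using \<open>h x \<in> sph p ` ball 0 \<kappa>\<close> by blast
    then have "s \<noteq> 0" using \<open>h x \<noteq> p\<close> by auto
    then show ?thesis using l s \<open>sol_in p h x\<close> by blast
  qed
  have hy: "sol_in p h y" using sol_sol_in[OF h(1)] h(2) by blast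
  show ?thesis
  proof (cases "h y = p")
    case False
    then show ?thesis using match[OF hy h(2)] by blast
  next
    case True
    have ev: "eventually (sol_in p h) (nhds y)" by (rule eventually_sol_in[OF hy])
    then obtain d where d: "0 < d" "\<And>z. z \<in> ball y d \<Longrightarrow> sol_in p h z"
      unfolding eventually_nhds_metric by (auto simp: dist_commute)
    obtain d' where d': "0 < d'" "h ` ball y d' \<subseteq> sph p ` ball 0 \<kappa>"
      using hol_at_preimage[OF riemann_surface_sphere sol_hol_at[OF h(1)] openin_sph_image[OF open_ball] h(2)] by blast
    \<comment> \<open>Two points of \<open>D\<close> are less than \<open>2 * \<epsilon>\<close>
      apart, which keeps the argument of \<open>Z\<close> within \<open>3 * \<epsilon>\<close>; the
      other radii ensure that \<open>h\<close> solves the equation on \<open>D\<close> and has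
      values near \<open>p\<close>.\<close>
    define D where "D = ball y (min \<epsilon> (min d d'))"
    have D: "open D" "convex D" "y \<in> D" using \<epsilon> d(1) d'(1) by (auto simp: D_def)
    have "\<exists>z1\<in>D. h z1 \<noteq> p"
    proof (rule ccontr)
      assume "\<not> ?thesis"
      moreover have "eventually (\<lambda>z. z \<in> D) (nhds y)" by (rule eventually_nhds_in_open[OF D(1,3)])
      ultimately have "eventually (\<lambda>z. h z = h y) (nhds y)" using True by (simp add: eventually_mono)
      then show False using h(1) by (simp add: sol_def)
    qed
    then obtain z1 where z1: "z1 \<in> D" "h z1 \<noteq> p" by blast
    have z1': "sol_in p h z1" "h z1 \<in> sph p ` ball 0 \<kappa>"
      using z1(1) d(2) d'(2) by (auto simp: D_def)
    obtain \<omega> t where \<omega>: "\<omega> ^ e = 1" "t \<in> ball 0 \<epsilon>"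
      "eventually (\<lambda>z. h z = sph p (Z (\<omega> * (z - z1) + t) ^ \<nu> p)) (nhds z1)"
      using match[OF z1' z1(2)] by blast
    have arg: "\<omega> * (z - z1) + t \<in> ball 0 (3 * \<epsilon>)" if "z \<in> D" for z
    proof -
      have "norm (\<omega> * (z - z1) + t) \<le> norm (z - z1) + norm t"
        using norm_triangle_ineq[of "\<omega> * (z - z1)" t] by (simp add: norm_mult norm_root_of_unity[OF \<omega>(1)])
      also have "norm (z - z1) \<le> dist y z + dist y z1" by (metis dist_commute dist_norm dist_triangle)
      finally show ?thesis using that z1(1) \<omega>(2) by (simp add: D_def)
    qed
    have "\<forall>z\<in>D. h z = sph p (Z (\<omega> * (z - z1) + t) ^ \<nu> p)"
    proof (rule sol_ident[OF D(1,2) z1(1) _ _ \<omega>(3)])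
      fix z assume z: "z \<in> D"
      show "hol_at riemann_sphere h z" using z d(2) by (auto simp: D_def intro: sol_in_hol_at)
      show "hol_at riemann_sphere (\<lambda>z. sph p (Z (\<omega> * (z - z1) + t) ^ \<nu> p)) z"
        by (rule hol_at_compose[where g = "\<lambda>z. \<omega> * (z - z1) + t", OF riemann_surface_sphere sol_hol_at[OF S[OF arg[OF z]]]])
           (auto intro!: analytic_intros)
    qed
    note eq = this
    have "Z (\<omega> * (y - z1) + t) ^ \<nu> p = 0"
      using eq D(3) True by (metis sph_eq_iff sph_simps(2))
    then have "Z (\<omega> * (y - z1) + t) = Z 0" using Z(2) by simp
    then have t: "\<omega> * (y - z1) + t = 0" using Z(1) arg[OF D(3)] \<epsilon>(1) by (auto dest: inj_onD)
    have "eventually (\<lambda>z. z \<in> D) (nhds y)" by (rule eventually_nhds_in_open[OF D(1,3)])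
    then have "eventually (\<lambda>z. h z = sph p (Z (\<omega> * (z - y) + 0) ^ \<nu> p)) (nhds y)"
    proof eventually_elim
      case (elim z)
      have "\<omega> * (z - z1) + t = \<omega> * (z - y) + (\<omega> * (y - z1) + t)" by (simp add: algebra_simps)
      with t have "\<omega> * (z - z1) + t = \<omega> * (z - y) + 0" by simp
      then show ?case using eq elim by metis
    qed
    then show ?thesis using \<omega>(1) \<epsilon>(1) by (intro exI[of _ \<omega>] exI[of _ 0]) auto
  qed
qed

lemma sol_shifted:
  assumes "local_sol p \<epsilon> \<kappa> Z" "\<omega> ^ e = 1" "norm (z - y) + norm t < 3 * \<epsilon>"
  shows "sol (\<lambda>z. sph p (Z (\<omega> * (z - y) + t) ^ \<nu> p)) z"
proof -
  have "norm (\<omega> * (z - y) + t) \<le> norm (z - y) + norm t"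
    using norm_triangle_ineq[of "\<omega> * (z - y)" t] by (simp add: norm_mult norm_root_of_unity[OF assms(2)])
  then have "sol (\<lambda>t. sph p (Z t ^ \<nu> p)) (\<omega> * z + (t - \<omega> * y))"
    using assms(1,3) by (simp add: local_sol_def algebra_simps)
  from sol_affine[OF this assms(2)] show ?thesis by (simp add: algebra_simps)
qed

lemma local_sol_near:
  assumes L: "local_sol p \<epsilon> \<kappa> Z" and h: "\<And>y. sol h y" "h y \<in> sph p ` ball 0 \<kappa>"
  shows "\<exists>\<omega> t. \<omega> ^ e = 1 \<and> t \<in> ball 0 \<epsilon> \<and> (\<forall>z\<in>ball y (2 * \<epsilon>). h z = sph p (Z (\<omega> * (z - y) + t) ^ \<nu> p))"
proof -
  have \<epsilon>: "0 < \<epsilon>" using L by (simp add: local_sol_def)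
  obtain \<omega> t where \<omega>: "\<omega> ^ e = 1" "t \<in> ball 0 \<epsilon>"
    "eventually (\<lambda>z. h z = sph p (Z (\<omega> * (z - y) + t) ^ \<nu> p)) (nhds y)"
    using local_sol_match[OF L h] by blast
  have "\<forall>z\<in>ball y (2 * \<epsilon>). h z = sph p (Z (\<omega> * (z - y) + t) ^ \<nu> p)"
  proof (rule sol_ident[OF open_ball convex_ball _ _ _ \<omega>(3)])
    fix z assume "z \<in> ball y (2 * \<epsilon>)"
    then have "norm (z - y) + norm t < 3 * \<epsilon>" using \<omega>(2) by (simp add: dist_norm norm_minus_commute)
    then show "hol_at riemann_sphere (\<lambda>z. sph p (Z (\<omega> * (z - y) + t) ^ \<nu> p)) z"
      by (rule sol_hol_at[OF sol_shifted[OF L \<omega>(1)]])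
  qed (use \<epsilon> h(1) sol_hol_at in auto)
  with \<omega> show ?thesis by blast
qed

text \<open>Finitely many of the neighbourhoods of \<open>ex_local_sol\<close> cover the compact
  sphere. The least of their radii is a step by which any germ can be continued, wherever it is and
  whatever its value: this is the completeness of the metric.\<close>

lemma ex_global_sol: "\<exists>h. \<forall>y. sol h y"
proof -
  have "\<forall>p. \<exists>x. local_sol p (fst x) (fst (snd x)) (snd (snd x))" using ex_local_sol by fastforce
  then obtain par where par: "\<And>p. local_sol p (fst (par p)) (fst (snd (par p))) (snd (snd (par p)))" by metis
  define E \<kappa> Z where "E = (\<lambda>p. fst (par p))" and "\<kappa> = (\<lambda>p. fst (snd (par p)))" and "Z = (\<lambda>p. snd (snd (par p)))"
  have L: "local_sol p (E p) (\<kappa> p) (Z p)" for p using par by (simp add: E_def \<kappa>_def Z_def)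
  have pos: "0 < E p" "0 < \<kappa> p" for p using L[of p] by (auto simp: local_sol_def)
  have in_nbhd: "p \<in> sph p ` ball 0 (\<kappa> p)" for p
    using pos(2)[of p] by (intro image_eqI[of _ _ 0]) auto
  obtain P where P: "finite P" "(\<Union>p\<in>P. sph p ` ball 0 (\<kappa> p)) = UNIV"
  proof -
    have "compact_space (surface_top riemann_sphere)"
      by (simp add: riemann_sphere_def compact_space_Alexandroff_compactification)
    moreover have "\<forall>U\<in>range (\<lambda>p. sph p ` ball 0 (\<kappa> p)). openin (surface_top riemann_sphere) U"
      by (auto intro: openin_sph_image)
    moreover have "\<Union> (range (\<lambda>p. sph p ` ball 0 (\<kappa> p))) = surface_points riemann_sphere"
      using in_nbhd by auto
    ultimately obtain \<F> where F: "finite \<F>" "\<F> \<subseteq> range (\<lambda>p. sph p ` ball 0 (\<kappa> p))" "\<Union> \<F> = surface_points riemann_sphere"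
      unfolding compact_space by meson
    obtain P where "finite P" "\<F> = (\<lambda>p. sph p ` ball 0 (\<kappa> p)) ` P" using finite_subset_image[OF F(1,2)] by auto
    with F(3) that show ?thesis by auto
  qed
  have "P \<noteq> {}" using P(2) by auto
  define \<delta> where "\<delta> = Min (E ` P)"
  have \<delta>: "0 < \<delta>" "\<And>p. p \<in> P \<Longrightarrow> \<delta> \<le> E p"
    using P(1) \<open>P \<noteq> {}\<close> pos(1) by (auto simp: \<delta>_def)
  have "\<exists>h. (\<forall>y. sol h y) \<and> eventually (\<lambda>z. h z = sph None (Z None z ^ \<nu> None)) (nhds 0)"
  proof (rule continuation_on_plane[where Q = "\<lambda>y h. sol h y"])
    show "\<And>y c c'. sol c y \<Longrightarrow> eventually (\<lambda>z. c z = c' z) (nhds y) \<Longrightarrow> sol c' y" by (rule sol_cong)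
    show "\<forall>y\<in>D. c1 y = c2 y" if "open D" "convex D" "a \<in> D" "\<And>y. y \<in> D \<Longrightarrow> sol c1 y" "\<And>y. y \<in> D \<Longrightarrow> sol c2 y"
      "eventually (\<lambda>z. c1 z = c2 z) (nhds a)" for D c1 c2 a
      by (rule sol_ident[OF that(1-3) _ _ that(6)]) (auto intro: sol_hol_at that)
    show "\<exists>\<delta>>0. \<forall>y\<in>ball y0 \<delta>. \<forall>c. eventually (\<lambda>z. sol c z) (nhds y) \<longrightarrow>
        (\<exists>c'. (\<forall>z\<in>ball y0 \<delta>. sol c' z) \<and> eventually (\<lambda>z. c z = c' z) (nhds y))" for y0
    proof (intro exI[of _ \<delta>] conjI \<delta>(1) ballI allI impI)
      fix y c assume y: "y \<in> ball y0 \<delta>" and "eventually (\<lambda>z. sol c z) (nhds y)"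
      then have c: "sol c y" by (auto dest: eventually_nhds_x_imp_x)
      obtain p where p: "p \<in> P" "c y \<in> sph p ` ball 0 (\<kappa> p)" using P(2) by blast
      obtain \<omega> t where \<omega>: "\<omega> ^ e = 1" "t \<in> ball 0 (E p)"
        "eventually (\<lambda>z. c z = sph p (Z p (\<omega> * (z - y) + t) ^ \<nu> p)) (nhds y)"
        using local_sol_match[OF L c p(2)] by blast
      have "sol (\<lambda>z. sph p (Z p (\<omega> * (z - y) + t) ^ \<nu> p)) z" if z: "z \<in> ball y0 \<delta>" for z
      proof (rule sol_shifted[OF L \<omega>(1)])
        have "norm (z - y) \<le> dist y0 z + dist y0 y" by (metis dist_commute dist_norm dist_triangle)
        then show "norm (z - y) + norm t < 3 * E p" using z y \<omega>(2) \<delta>(2)[OF p(1)] by simp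
      qed
      with \<omega>(3) show "\<exists>c'. (\<forall>z\<in>ball y0 \<delta>. sol c' z) \<and> eventually (\<lambda>z. c z = c' z) (nhds y)" by blast
    qed
    \<comment> \<open>The initial germ is the local solution centred at infinity.\<close>
    have "eventually (\<lambda>z. z \<in> ball 0 (3 * E None)) (nhds 0)" using pos(1)[of None] by (intro eventually_nhds_in_open) auto
    then show "eventually (\<lambda>z. sol (\<lambda>z. sph None (Z None z ^ \<nu> None)) z) (nhds 0)"
      by eventually_elim (use L[of None] in \<open>simp add: local_sol_def\<close>)
  qed
  then show ?thesis by blast
qed

text \<open>At two points of one fibre the local normal form is the same function \<open>Z\<close>
  up to rotation, so some affine map takes one germ of \<open>h\<close> to the other and, by the
  identity theorem, preserves \<open>h\<close> everywhere. Thus the isometries act transitively on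
  the fibres. The last clause provides a local parameter \<open>\<tau>\<close> over every value, for
  the descent of functions along \<open>h\<close>.\<close>

theorem euclidean_map:
  shows "\<exists>h. (\<forall>y. local_power \<nu> h y) \<and> (\<forall>y. hol_at riemann_sphere h y) \<and> (\<forall>y. eventually (\<lambda>z. h z \<noteq> h y) (at y)) \<and>
    (\<forall>t1 t2. h t1 = h t2 \<longrightarrow> (\<exists>\<omega> b. \<omega> ^ e = 1 \<and> \<omega> * t1 + b = t2 \<and> (\<forall>t. h (\<omega> * t + b) = h t))) \<and>
    (\<forall>p. \<exists>r>0. \<exists>\<tau>. \<tau> holomorphic_on ball 0 r \<and> inj_on \<tau> (ball 0 r) \<and> (\<forall>\<zeta>\<in>ball 0 r. h (\<tau> \<zeta>) = sph p (\<zeta> ^ \<nu> p)))"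
proof -
  obtain h where h: "\<And>y. sol h y" using ex_global_sol by blast
  have near: "\<exists>\<epsilon> Z \<omega>. 0 < \<epsilon> \<and> Z holomorphic_on ball 0 (2 * \<epsilon>) \<and> inj_on Z (ball 0 (2 * \<epsilon>)) \<and> Z 0 = 0 \<and> \<omega> ^ e = 1 \<and>
      (\<forall>z\<in>ball y (2 * \<epsilon>). h z = sph (h y) (Z (\<omega> * (z - y)) ^ \<nu> (h y)))" for y
  proof -
    define p where "p = h y"
    obtain \<epsilon> \<kappa> Z where L: "local_sol p \<epsilon> \<kappa> Z" using ex_local_sol by blast
    then have \<epsilon>: "0 < \<epsilon>" "0 < \<kappa>" and Z: "Z holomorphic_on ball 0 (3 * \<epsilon>)" "inj_on Z (ball 0 (3 * \<epsilon>))" "Z 0 = 0"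
      unfolding local_sol_def by blast+
    have "h y \<in> sph p ` ball 0 \<kappa>" using \<epsilon>(2) by (intro image_eqI[of _ _ 0]) (auto simp: p_def)
    from local_sol_near[OF L h this] obtain \<omega> t where \<omega>: "\<omega> ^ e = 1" "t \<in> ball 0 \<epsilon>"
      "\<forall>z\<in>ball y (2 * \<epsilon>). h z = sph p (Z (\<omega> * (z - y) + t) ^ \<nu> p)" by blast
    have "p = sph p (Z t ^ \<nu> p)" using \<omega>(3)[THEN bspec, of y] \<epsilon>(1) by (simp add: p_def)
    then have "Z t ^ \<nu> p = 0" by (metis sph_eq_iff sph_simps(2))
    then have "Z t = Z 0" using Z(3) by simp
    then have "t = 0" using Z(2) \<omega>(2) \<epsilon>(1) by (auto dest: inj_onD)
    with \<omega> have "\<forall>z\<in>ball y (2 * \<epsilon>). h z = sph p (Z (\<omega> * (z - y)) ^ \<nu> p)" by simp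
    moreover have "ball (0::complex) (2 * \<epsilon>) \<subseteq> ball 0 (3 * \<epsilon>)" using \<epsilon>(1) by (intro subset_ball) simp
    then have "Z holomorphic_on ball 0 (2 * \<epsilon>)" "inj_on Z (ball 0 (2 * \<epsilon>))"
      using Z holomorphic_on_subset inj_on_subset by blast+
    ultimately show ?thesis using \<epsilon>(1) Z(3) \<omega>(1) unfolding p_def by blast
  qed
  have rot: "\<omega> * (z - y) \<in> ball 0 r" if "\<omega> ^ e = 1" "z \<in> ball y r" for \<omega> z y :: complex and r
    using that by (simp add: norm_mult norm_root_of_unity dist_norm norm_minus_commute)
  have power: "local_power \<nu> h y" for y
  proof -
    obtain \<epsilon> Z \<omega> where n: "0 < \<epsilon>" "Z holomorphic_on ball 0 (2 * \<epsilon>)" "inj_on Z (ball 0 (2 * \<epsilon>))" "Z 0 = 0" "\<omega> ^ e = 1"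
      "\<forall>z\<in>ball y (2 * \<epsilon>). h z = sph (h y) (Z (\<omega> * (z - y)) ^ \<nu> (h y))" using near by blast
    have "(Z \<circ> (\<lambda>z. \<omega> * (z - y))) holomorphic_on ball y (2 * \<epsilon>)"
      by (rule holomorphic_on_compose_gen[OF _ n(2)]) (use rot n(5) in \<open>auto intro!: holomorphic_intros simp: image_subset_iff\<close>)
    moreover have "0 < 2 * \<epsilon>" using n(1) by simp
    moreover have "\<forall>z\<in>ball y (2 * \<epsilon>). h z = sph (h y) ((Z \<circ> (\<lambda>z. \<omega> * (z - y))) z ^ \<nu> (h y))"
      using n(6) unfolding o_def .
    ultimately show ?thesis unfolding local_power_def by blast
  qed
  have nonconst: "eventually (\<lambda>z. h z \<noteq> h y) (at y)" for y
  proof -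
    obtain \<epsilon> Z \<omega> where n: "0 < \<epsilon>" "Z holomorphic_on ball 0 (2 * \<epsilon>)" "inj_on Z (ball 0 (2 * \<epsilon>))" "Z 0 = 0" "\<omega> ^ e = 1"
      "\<forall>z\<in>ball y (2 * \<epsilon>). h z = sph (h y) (Z (\<omega> * (z - y)) ^ \<nu> (h y))" using near by blast
    have "eventually (\<lambda>z. z \<in> ball y (2 * \<epsilon>) - {y}) (at y)" using n(1) by (intro eventually_at_in_open) auto
    then show ?thesis
    proof eventually_elim
      case (elim z)
      then have z: "\<omega> * (z - y) \<in> ball 0 (2 * \<epsilon>)" using rot[OF n(5)] by blast
      have "\<omega> \<noteq> 0" using n(5) e_pos by (auto simp: power_0_left)
      then have "\<omega> * (z - y) \<noteq> 0" using elim by simp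
      then have "Z (\<omega> * (z - y)) \<noteq> Z 0" using n(3) z n(1) by (auto dest!: inj_onD)
      then have "Z (\<omega> * (z - y)) ^ \<nu> (h y) \<noteq> 0" using n(4) by simp
      then show ?case using n(6) elim by (metis DiffD1 sph_eq_iff sph_simps(2))
    qed
  qed
  have trans: "\<exists>\<omega> b. \<omega> ^ e = 1 \<and> \<omega> * t1 + b = t2 \<and> (\<forall>t. h (\<omega> * t + b) = h t)" if eq: "h t1 = h t2" for t1 t2
  proof -
    define p where "p = h t1"
    obtain \<epsilon> \<kappa> Z where L: "local_sol p \<epsilon> \<kappa> Z" using ex_local_sol by blast
    then have \<epsilon>: "0 < \<epsilon>" "0 < \<kappa>" and Z: "inj_on Z (ball 0 (3 * \<epsilon>))" "Z 0 = 0"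
      unfolding local_sol_def by blast+
    have *: "\<exists>\<omega>. \<omega> ^ e = 1 \<and> (\<forall>z\<in>ball y (2 * \<epsilon>). h z = sph p (Z (\<omega> * (z - y)) ^ \<nu> p))" if y: "h y = p" for y
    proof -
      have "h y \<in> sph p ` ball 0 \<kappa>" using \<epsilon>(2) y by (intro image_eqI[of _ _ 0]) auto
      from local_sol_near[OF L h this] obtain \<omega> t where \<omega>: "\<omega> ^ e = 1" "t \<in> ball 0 \<epsilon>"
        "\<forall>z\<in>ball y (2 * \<epsilon>). h z = sph p (Z (\<omega> * (z - y) + t) ^ \<nu> p)" by blast
      have "p = sph p (Z t ^ \<nu> p)" using \<omega>(3)[THEN bspec, of y] \<epsilon>(1) y by simp
      then have "Z t ^ \<nu> p = 0" by (metis sph_eq_iff sph_simps(2))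
      then have "Z t = Z 0" using Z(2) by simp
      then have "t = 0" using Z(1) \<omega>(2) \<epsilon>(1) by (auto dest: inj_onD)
      with \<omega> show ?thesis by auto
    qed
    obtain \<omega>1 where \<omega>1: "\<omega>1 ^ e = 1" "\<forall>z\<in>ball t1 (2 * \<epsilon>). h z = sph p (Z (\<omega>1 * (z - t1)) ^ \<nu> p)"
      using *[of t1] p_def by blast
    obtain \<omega>2 where \<omega>2: "\<omega>2 ^ e = 1" "\<forall>z\<in>ball t2 (2 * \<epsilon>). h z = sph p (Z (\<omega>2 * (z - t2)) ^ \<nu> p)"
      using *[of t2] p_def eq by metis
    have ne: "\<omega>2 \<noteq> 0" using \<omega>2(1) e_pos by (auto simp: power_0_left)
    \<comment> \<open>Chosen to match the normal forms:
      \<open>\<omega>2 * (\<omega> * t + b - t2) = \<omega>1 * (t - t1)\<close>.\<close>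
    define \<omega> b where "\<omega> = \<omega>1 / \<omega>2" and "b = t2 - \<omega> * t1"
    have \<omega>: "\<omega> ^ e = 1" using \<omega>1(1) \<omega>2(1) by (simp add: \<omega>_def power_divide)
    have "\<forall>t\<in>UNIV. h (\<omega> * t + b) = h t"
    proof (rule sol_ident[of UNIV t1 "\<lambda>t. h (\<omega> * t + b)" h])
      show "hol_at riemann_sphere (\<lambda>t. h (\<omega> * t + b)) y" for y
        by (rule sol_hol_at[OF sol_affine[OF h \<omega>]])
      show "hol_at riemann_sphere h y" for y by (rule sol_hol_at[OF h])
      have "eventually (\<lambda>z. z \<in> ball t1 (2 * \<epsilon>)) (nhds t1)" using \<epsilon>(1) by (intro eventually_nhds_in_open) auto
      then show "eventually (\<lambda>t. h (\<omega> * t + b) = h t) (nhds t1)"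
      proof eventually_elim
        case (elim t)
        have d: "\<omega> * t + b - t2 = \<omega> * (t - t1)" by (simp add: b_def algebra_simps)
        then have "\<omega> * t + b \<in> ball t2 (2 * \<epsilon>)"
          using rot[OF \<omega> elim] by (metis dist_commute dist_norm mem_ball mem_ball_0)
        then have "h (\<omega> * t + b) = sph p (Z (\<omega>2 * (\<omega> * t + b - t2)) ^ \<nu> p)" using \<omega>2(2) by blast
        also have "\<omega>2 * (\<omega> * t + b - t2) = \<omega>1 * (t - t1)" unfolding d using ne by (simp add: \<omega>_def)
        finally show ?case using \<omega>1(2) elim by simp
      qed
    qed auto
    then show ?thesis using \<omega> by (intro exI[of _ \<omega>] exI[of _ b]) (simp add: b_def)
  qed
  have surj: "range h = UNIV"
  proof (rule sphere_clopen)
    \<comment> \<open>As soon as one value of \<open>h\<close> falls into the disc around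
      \<open>p\<close>, the normal form on a disc of radius \<open>2 * \<epsilon>\<close> passes
      through all parameters below \<open>\<epsilon>\<close> and fills that disc. Hence the range
      and its complement are both open.\<close>
    have fill: "\<exists>\<kappa>>0. \<forall>y. h y \<in> sph p ` ball 0 \<kappa> \<longrightarrow> sph p ` ball 0 \<kappa> \<subseteq> range h" for p
    proof -
      obtain \<epsilon> \<kappa> Z where L: "local_sol p \<epsilon> \<kappa> Z" using ex_local_sol by blast
      then have \<kappa>: "0 < \<kappa>" "sph p ` ball 0 \<kappa> \<subseteq> (\<lambda>t. sph p (Z t ^ \<nu> p)) ` ball 0 \<epsilon>"
        unfolding local_sol_def by blast+
      have "sph p ` ball 0 \<kappa> \<subseteq> range h" if y: "h y \<in> sph p ` ball 0 \<kappa>" for y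
      proof -
        obtain \<omega> t where \<omega>: "\<omega> ^ e = 1" "t \<in> ball 0 \<epsilon>"
          "\<forall>z\<in>ball y (2 * \<epsilon>). h z = sph p (Z (\<omega> * (z - y) + t) ^ \<nu> p)"
          using local_sol_near[OF L h y] by blast
        have ne: "\<omega> \<noteq> 0" using \<omega>(1) e_pos by (auto simp: power_0_left)
        have "sph p (Z t' ^ \<nu> p) \<in> range h" if t': "t' \<in> ball 0 \<epsilon>" for t'
        proof -
          define z where "z = y + (t' - t) / \<omega>"
          have "norm (z - y) \<le> norm t' + norm t"
            using norm_triangle_ineq4[of t' t] by (simp add: z_def norm_divide norm_root_of_unity[OF \<omega>(1)])
          then have "z \<in> ball y (2 * \<epsilon>)" using t' \<omega>(2) by (simp add: dist_norm norm_minus_commute)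
          moreover have "\<omega> * (z - y) + t = t'" using ne by (simp add: z_def)
          ultimately have "h z = sph p (Z t' ^ \<nu> p)" using \<omega>(3) by metis
          then show ?thesis by (metis rangeI)
        qed
        then have "(\<lambda>t. sph p (Z t ^ \<nu> p)) ` ball 0 \<epsilon> \<subseteq> range h" by (rule image_subsetI)
        with \<kappa>(2) show ?thesis by (rule subset_trans)
      qed
      with \<kappa>(1) show ?thesis by (intro exI[of _ \<kappa>]) simp
    qed
    have self: "p \<in> sph p ` ball 0 \<kappa>" if "0 < \<kappa>" for p \<kappa> using that by (intro image_eqI[of _ _ 0]) auto
    show "openin (surface_top riemann_sphere) (range h)"
    proof (subst openin_subopen, intro ballI)
      fix p assume "p \<in> range h"
      then obtain y where y: "p = h y" by blast
      obtain \<kappa> where \<kappa>: "0 < \<kappa>" "\<forall>y. h y \<in> sph p ` ball 0 \<kappa> \<longrightarrow> sph p ` ball 0 \<kappa> \<subseteq> range h" using fill by blast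
      then show "\<exists>T. openin (surface_top riemann_sphere) T \<and> p \<in> T \<and> T \<subseteq> range h"
        using self[OF \<kappa>(1), of p] y by (intro exI[of _ "sph p ` ball 0 \<kappa>"]) (auto intro: openin_sph_image)
    qed
    show "openin (surface_top riemann_sphere) (- range h)"
    proof (subst openin_subopen, intro ballI)
      fix p assume "p \<in> - range h"
      obtain \<kappa> where \<kappa>: "0 < \<kappa>" "\<forall>y. h y \<in> sph p ` ball 0 \<kappa> \<longrightarrow> sph p ` ball 0 \<kappa> \<subseteq> range h" using fill by blast
      have "sph p ` ball 0 \<kappa> \<subseteq> - range h"
      proof
        fix q assume q: "q \<in> sph p ` ball 0 \<kappa>"
        show "q \<in> - range h"
        proof
          assume "q \<in> range h"
          then have "sph p ` ball 0 \<kappa> \<subseteq> range h" using \<kappa>(2) q by (metis imageE)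
          then show False using self[OF \<kappa>(1), of p] \<open>p \<in> - range h\<close> by blast
        qed
      qed
      then show "\<exists>T. openin (surface_top riemann_sphere) T \<and> p \<in> T \<and> T \<subseteq> - range h"
        using self[OF \<kappa>(1), of p] by (intro exI[of _ "sph p ` ball 0 \<kappa>"]) (simp add: openin_sph_image)
    qed
  qed simp
  have sec: "\<exists>r>0. \<exists>\<tau>. \<tau> holomorphic_on ball 0 r \<and> inj_on \<tau> (ball 0 r) \<and> (\<forall>\<zeta>\<in>ball 0 r. h (\<tau> \<zeta>) = sph p (\<zeta> ^ \<nu> p))" for p
  proof -
    have "p \<in> range h" using surj by blast
    then obtain y where y: "p = h y" by blast
    obtain \<epsilon> Z \<omega> where n: "0 < \<epsilon>" "Z holomorphic_on ball 0 (2 * \<epsilon>)" "inj_on Z (ball 0 (2 * \<epsilon>))" "Z 0 = 0" "\<omega> ^ e = 1"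
      "\<forall>z\<in>ball y (2 * \<epsilon>). h z = sph (h y) (Z (\<omega> * (z - y)) ^ \<nu> (h y))" using near by blast
    have ne: "\<omega> \<noteq> 0" using n(5) e_pos by (auto simp: power_0_left)
    have "0 < 2 * \<epsilon>" using n(1) by simp
    obtain r \<sigma> where \<sigma>: "0 < r" "\<sigma> holomorphic_on ball 0 r" "\<sigma> ` ball 0 r \<subseteq> ball 0 (2 * \<epsilon>)" "inj_on \<sigma> (ball 0 r)"
      "\<forall>\<zeta>\<in>ball 0 r. Z (\<sigma> \<zeta>) = \<zeta>"
      by (rule local_inverse[OF n(2,3) \<open>0 < 2 * \<epsilon>\<close> n(4)]) (rule that, auto)
    define \<tau> where "\<tau> = (\<lambda>\<zeta>. y + \<sigma> \<zeta> / \<omega>)"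
    have "\<tau> holomorphic_on ball 0 r" unfolding \<tau>_def using ne \<sigma>(2) by (intro holomorphic_intros) auto
    moreover have "inj_on \<tau> (ball 0 r)" using \<sigma>(4) ne by (auto simp: inj_on_def \<tau>_def)
    moreover have "h (\<tau> \<zeta>) = sph p (\<zeta> ^ \<nu> p)" if \<zeta>: "\<zeta> \<in> ball 0 r" for \<zeta>
    proof -
      have "norm (\<sigma> \<zeta>) < 2 * \<epsilon>" using \<sigma>(3) \<zeta> by (simp add: image_subset_iff)
      then have "\<tau> \<zeta> \<in> ball y (2 * \<epsilon>)" by (simp add: \<tau>_def dist_norm norm_divide norm_root_of_unity[OF n(5)])
      then have "h (\<tau> \<zeta>) = sph p (Z (\<omega> * (\<tau> \<zeta> - y)) ^ \<nu> p)" using n(6) y by blast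
      then show ?thesis using \<sigma>(5) \<zeta> ne by (simp add: \<tau>_def)
    qed
    ultimately show ?thesis using \<sigma>(1) by blast
  qed
  show ?thesis using power nonconst trans sec sol_hol_at[OF h] by (intro exI[of _ h]) blast
qed

end

section \<open>Kummer theory and affine automorphisms\<close>

definition mero_hom :: "(mero \<Rightarrow> mero) \<Rightarrow> bool" where
  "mero_hom \<sigma> \<longleftrightarrow> (\<forall>x y. \<sigma> (x + y) = \<sigma> x + \<sigma> y) \<and> (\<forall>x y. \<sigma> (x * y) = \<sigma> x * \<sigma> y) \<and> (\<forall>a. \<sigma> (mero_const a) = mero_const a)"

lemma mero_homD:
  assumes "mero_hom \<sigma>"
  shows "\<sigma> (x + y) = \<sigma> x + \<sigma> y" "\<sigma> (x * y) = \<sigma> x * \<sigma> y" "\<sigma> (mero_const a) = mero_const a"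
    "\<sigma> 0 = 0" "\<sigma> 1 = 1" "\<sigma> (- x) = - \<sigma> x" "\<sigma> (inverse x) = inverse (\<sigma> x)" "\<sigma> (x ^ n) = \<sigma> x ^ n"
proof -
  show add: "\<sigma> (x + y) = \<sigma> x + \<sigma> y" and mult: "\<sigma> (x * y) = \<sigma> x * \<sigma> y" for x y
    using assms by (auto simp: mero_hom_def)
  show const: "\<sigma> (mero_const a) = mero_const a" for a using assms by (simp add: mero_hom_def)
  show zero: "\<sigma> 0 = 0" and one: "\<sigma> 1 = 1" using const[of 0] const[of 1] by (simp_all add: mero_const_hom)
  show "\<sigma> (- x) = - \<sigma> x" using add[of x "- x"] zero by (simp add: eq_neg_iff_add_eq_0 add.commute)
  show "\<sigma> (inverse x) = inverse (\<sigma> x)"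
  proof (cases "x = 0")
    case False
    then have "\<sigma> x * \<sigma> (inverse x) = 1" using mult[of x "inverse x"] one by simp
    then show ?thesis by (metis inverse_unique)
  qed (simp add: zero)
  show "\<sigma> (x ^ n) = \<sigma> x ^ n" by (induction n) (simp_all add: one mult)
qed

lemma mero_hom_sum: "mero_hom \<sigma> \<Longrightarrow> \<sigma> (\<Sum>i\<in>I. g i) = (\<Sum>i\<in>I. \<sigma> (g i))"
  by (induction I rule: infinite_finite_induct) (simp_all add: mero_homD)

lemma fixed_field:
  assumes "mero_hom \<sigma>" "field_closed V"
  shows "field_closed {u \<in> V. \<sigma> u = u}"
  using assms(2) mero_homD(1,2,4-7)[OF assms(1)] unfolding field_closed_def by simp

lemma mero_const_sum: "mero_const (\<Sum>i\<in>I. g i) = (\<Sum>i\<in>I. mero_const (g i))"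
  by (induction I rule: infinite_finite_induct) (simp_all add: mero_const_hom)

lemma root_of_unity_orthogonality:
  assumes "0 < p"
  obtains w :: complex where "w ^ p = 1" "\<forall>j<p. (\<Sum>k<p. w ^ (j * k)) = (if j = 0 then of_nat p else 0)"
proof -
  define w :: complex where "w = exp (2 * of_real pi * \<i> / of_nat p)"
  have pow: "w ^ j = exp (2 * of_real pi * \<i> * of_nat j / of_nat p)" for j
    by (simp add: w_def field_simps flip: exp_of_nat_mult)
  have one: "w ^ p = 1" using assms by (simp add: pow)
  have "(\<Sum>k<p. w ^ (j * k)) = 0" if "j < p" "j \<noteq> 0" for j
  proof -
    have "w ^ j \<noteq> 1" unfolding pow using that assms by (subst complex_root_unity_eq_1) (auto dest: dvd_imp_le)
    then have "(\<Sum>k<p. (w ^ j) ^ k) = ((w ^ j) ^ p - 1) / (w ^ j - 1)" by (rule geometric_sum)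
    also have "(w ^ j) ^ p = 1" using one by (metis power_commutes power_mult power_one mult.commute)
    finally show ?thesis by (simp add: power_mult)
  qed
  then show ?thesis by (intro that[of w] one) auto
qed

text \<open>The eigenspaces of an automorphism of order \<open>p\<close> span, and each is a line over the fixed field whose
  elements have their \<open>p\<close>-th powers in the fixed field.\<close>

lemma kummer_step:
  assumes \<sigma>: "mero_hom \<sigma>" and V: "field_closed V" "range mero_const \<subseteq> V" "\<And>u. u \<in> V \<Longrightarrow> \<sigma> u \<in> V"
    and p: "0 < p" "\<And>u. u \<in> V \<Longrightarrow> (\<sigma> ^^ p) u = u"
    and T: "root_tower q K F" "field_closed F" "{u \<in> V. \<sigma> u = u} \<subseteq> F"
  shows "\<exists>F'. root_tower q K F' \<and> field_closed F' \<and> F \<subseteq> F' \<and> V \<subseteq> F'"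
proof -
  obtain w :: complex where w: "w ^ p = 1" "\<forall>j<p. (\<Sum>k<p. w ^ (j * k)) = (if j = 0 then of_nat p else 0)"
    using p(1) by (rule root_of_unity_orthogonality)
  \<comment> \<open>The eigenspace for the eigenvalue \<open>w^(-k)\<close>, written without
    inverses; \<open>v k\<close> will be a non-zero element of it, or \<open>0\<close> if there is
    none.\<close>
  define E where "E = (\<lambda>k. {u \<in> V. mero_const (w ^ k) * \<sigma> u = u})"
  define v where "v = (\<lambda>k. if \<exists>x\<in>E k. x \<noteq> 0 then SOME x. x \<in> E k \<and> x \<noteq> 0 else 0)"
  have v: "v k \<in> E k \<and> v k \<noteq> 0" if "x \<in> E k" "x \<noteq> 0" for x k
    using someI[of "\<lambda>x. x \<in> E k \<and> x \<noteq> 0" x] that unfolding v_def by auto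
  have zero: "0 \<in> E k" for k using V(1) field_closedD(1) by (auto simp: E_def mero_homD(4)[OF \<sigma>])
  have vE: "v k \<in> E k" for k
  proof (cases "\<exists>x\<in>E k. x \<noteq> 0")
    case True
    then show ?thesis using v by blast
  next
    case False
    then show ?thesis using zero by (simp add: v_def)
  qed
  note hom = mero_homD[OF \<sigma>]
  have vp: "v k ^ p \<in> F" for k
  proof -
    have "v k ^ p = (mero_const (w ^ k) * \<sigma> (v k)) ^ p" using vE[of k] by (simp add: E_def)
    also have "\<dots> = mero_const ((w ^ k) ^ p) * \<sigma> (v k ^ p)" by (simp only: power_mult_distrib hom mero_const_hom)
    also have "(w ^ k) ^ p = 1" using w(1) by (metis mult.commute power_mult power_one)
    finally have "\<sigma> (v k ^ p) = v k ^ p" by (simp add: mero_const_hom)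
    moreover have "v k ^ p \<in> V" using V(1) vE[of k] by (intro field_closed_power) (auto simp: E_def)
    ultimately show ?thesis using T(3) by blast
  qed
  obtain F' where F': "root_tower q K F'" "field_closed F'" "F \<subseteq> F'" "v ` {..<p} \<subseteq> F'"
    using adjoin_radicals[OF T(1,2), of "{..<p}" "\<lambda>_. p" v] p(1) vp by auto
  have E_F': "E k \<subseteq> F'" if k: "k < p" for k
  proof
    fix u assume u: "u \<in> E k"
    show "u \<in> F'"
    proof (cases "u = 0")
      case True
      then show ?thesis using F'(2) field_closedD(1) by blast
    next
      case False
      have v: "v k \<in> E k" "v k \<noteq> 0" using v[OF u False] by auto
      define c where "c = mero_const (w ^ k)"
      have c: "c * \<sigma> u = u" "c * \<sigma> (v k) = v k" using u v(1) by (auto simp: E_def c_def)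
      have "w ^ k \<noteq> 0" using w(1) p(1) by (auto simp: power_0_left)
      then have "c \<noteq> 0" by (simp add: c_def)
      then have "\<sigma> u * inverse (\<sigma> (v k)) = (c * \<sigma> u) * inverse (c * \<sigma> (v k))"
        by (cases "\<sigma> (v k) = 0") (simp_all add: field_simps)
      then have "\<sigma> (u * inverse (v k)) = u * inverse (v k)" unfolding c hom .
      moreover have "u * inverse (v k) \<in> V" using u v(1) V(1) by (auto simp: E_def intro: field_closedD)
      ultimately have "u * inverse (v k) \<in> F'" using T(3) F'(3) by blast
      moreover have "v k \<in> F'" using F'(4) k by blast
      ultimately have "u * inverse (v k) * v k \<in> F'" using F'(2) field_closedD(4) by blast
      then show ?thesis using v(2) by (simp add: mult.assoc)
    qed
  qed
  have "V \<subseteq> F'"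
  proof
    fix u assume u: "u \<in> V"
    have iter: "(\<sigma> ^^ j) u \<in> V" for j by (induction j) (simp_all add: u V(3))
    define c where "c = mero_const (1 / of_nat p)"
    \<comment> \<open>The Lagrange resolvents of \<open>u\<close> divided by \<open>p\<close> are
      its projections to the eigenspaces. Their sum is \<open>u\<close> by orthogonality of the
      roots of unity.\<close>
    define pr where "pr = (\<lambda>k. c * (\<Sum>j<p. mero_const (w ^ (j * k)) * (\<sigma> ^^ j) u))"
    have prV: "pr k \<in> V" for k
      unfolding pr_def c_def using V(1,2) iter
      by (intro field_closedD(4) field_closed_sum) auto
    have "pr k \<in> E k" for k
    proof -
      define t where "t = (\<lambda>j. mero_const (w ^ (j * k)) * (\<sigma> ^^ j) u)"
      have step: "mero_const (w ^ k) * \<sigma> (t j) = t (Suc j)" for j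
        by (simp add: t_def hom power_add mero_const_hom mult_ac)
      have "pr k = c * (\<Sum>j<p. t j)" by (simp add: pr_def t_def)
      then have "mero_const (w ^ k) * \<sigma> (pr k) = c * (\<Sum>j<p. mero_const (w ^ k) * \<sigma> (t j))"
        by (simp add: c_def hom(2,3) mero_hom_sum[OF \<sigma>] sum_distrib_left mult_ac)
      also have "\<dots> = c * (\<Sum>j<p. t (Suc j))" by (simp only: step)
      also have "(\<Sum>j<p. t (Suc j)) = (\<Sum>j<p. t j) + t p - t 0"
        using sum.lessThan_Suc_shift[of t p] by (simp add: algebra_simps)
      also have "t p = t 0" using w(1) p(2)[OF u] by (simp add: t_def power_mult)
      finally show ?thesis using prV by (simp add: E_def pr_def t_def)
    qed
    then have "(\<Sum>k<p. pr k) \<in> F'" using E_F' F'(2) by (intro field_closed_sum) auto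
    also have "(\<Sum>k<p. pr k) = c * (\<Sum>j<p. mero_const (\<Sum>k<p. w ^ (j * k)) * (\<sigma> ^^ j) u)"
      unfolding pr_def by (subst sum_distrib_left[symmetric], subst sum.swap) (simp add: mero_const_sum sum_distrib_right)
    also have "\<dots> = c * (\<Sum>j<p. if j = 0 then mero_const (of_nat p) * u else 0)"
      using w(2) by (intro arg_cong[where f = "(*) c"] sum.cong) (auto simp: mero_const_hom)
    also have "\<dots> = c * mero_const (of_nat p) * u" using p(1) by (simp add: mult.assoc)
    also have "c * mero_const (of_nat p) = 1" using p(1) unfolding c_def by (simp flip: mero_const_hom)
    finally show "u \<in> F'" by simp
  qed
  with F' show ?thesis by blast
qed

text \<open>One automorphism is removed at a time. Its fixed field is stable under the others
  because they commute with it, so the induction hypothesis reaches the fixed field, and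
  \<open>kummer_step\<close> goes from there to \<open>V\<close>.\<close>

lemma kummer:
  assumes "finite \<Sigma>" "\<And>\<sigma>. \<sigma> \<in> \<Sigma> \<Longrightarrow> mero_hom \<sigma>" "field_closed V" "range mero_const \<subseteq> V"
    "\<And>\<sigma> u. \<sigma> \<in> \<Sigma> \<Longrightarrow> u \<in> V \<Longrightarrow> \<sigma> u \<in> V" "\<And>\<sigma>. \<sigma> \<in> \<Sigma> \<Longrightarrow> \<exists>p>0. \<forall>u\<in>V. (\<sigma> ^^ p) u = u"
    "\<And>\<sigma> \<tau> u. \<sigma> \<in> \<Sigma> \<Longrightarrow> \<tau> \<in> \<Sigma> \<Longrightarrow> u \<in> V \<Longrightarrow> \<sigma> (\<tau> u) = \<tau> (\<sigma> u)"
    "root_tower q K F" "field_closed F" "{u \<in> V. \<forall>\<sigma>\<in>\<Sigma>. \<sigma> u = u} \<subseteq> F"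
  shows "\<exists>F'. root_tower q K F' \<and> field_closed F' \<and> F \<subseteq> F' \<and> V \<subseteq> F'"
  using assms
proof (induction \<Sigma> arbitrary: V rule: finite_induct)
  case empty
  then show ?case by auto
next
  case (insert \<sigma> \<Sigma>)
  note prems = insert.prems
  have \<sigma>: "mero_hom \<sigma>" using prems(1) by simp
  let ?W = "{u \<in> V. \<sigma> u = u}"
  have "\<exists>F1. root_tower q K F1 \<and> field_closed F1 \<and> F \<subseteq> F1 \<and> ?W \<subseteq> F1"
  proof (rule insert.IH)
    show "field_closed ?W" by (rule fixed_field[OF \<sigma> prems(2)])
    show "range mero_const \<subseteq> ?W" using prems(3) mero_homD(3)[OF \<sigma>] by auto
    show "\<tau> u \<in> ?W" if "\<tau> \<in> \<Sigma>" "u \<in> ?W" for \<tau> u using that prems(4)[of \<tau> u] prems(6)[of \<sigma> \<tau> u] by auto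
    show "\<exists>p>0. \<forall>u\<in>?W. (\<tau> ^^ p) u = u" if "\<tau> \<in> \<Sigma>" for \<tau> using prems(5)[of \<tau>] that by auto
    show "{u \<in> ?W. \<forall>\<sigma>\<in>\<Sigma>. \<sigma> u = u} \<subseteq> F" using prems(9) by auto
  qed (use prems in auto)
  then obtain F1 where F1: "root_tower q K F1" "field_closed F1" "F \<subseteq> F1" "?W \<subseteq> F1" by blast
  obtain p where p: "p > 0" "\<And>u. u \<in> V \<Longrightarrow> (\<sigma> ^^ p) u = u" using prems(5)[of \<sigma>] by auto
  have "\<exists>F'. root_tower q K F' \<and> field_closed F' \<and> F1 \<subseteq> F' \<and> V \<subseteq> F'"
    by (rule kummer_step[OF \<sigma> prems(2,3) _ p F1(1,2,4)]) (use prems(4) in auto)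
  with F1(3) show ?case by blast
qed

lemma affine_filtermap_at: "\<omega> \<noteq> 0 \<Longrightarrow> filtermap (\<lambda>z. \<omega> * z + b) (at z) = at (\<omega> * z + b :: complex)"
  by (rule inj_holomorphic_filtermap_at[of _ UNIV]) (auto intro!: holomorphic_intros inj_onI)

lemma affine_compose_meromorphic:
  assumes "f meromorphic_on UNIV"
  shows "(\<lambda>z. f (\<omega> * z + b)) meromorphic_on UNIV"
  by (rule meromorphic_on_compose[OF assms]) (auto intro!: analytic_intros)

text \<open>For \<open>\<omega> = 0\<close> the affine map is replaced by the identity, since composition with a constant is not
  well defined on meromorphic functions.\<close>

lift_definition mero_affine :: "complex \<Rightarrow> complex \<Rightarrow> mero \<Rightarrow> mero"
  is "\<lambda>\<omega> b f z. f (if \<omega> = 0 then z else \<omega> * z + b)"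
proof -
  fix \<omega> b f g assume fg: "mero_eq f g"
  show "mero_eq (\<lambda>z. f (if \<omega> = 0 then z else \<omega> * z + b)) (\<lambda>z. g (if \<omega> = 0 then z else \<omega> * z + b))"
  proof (cases "\<omega> = 0")
    case False
    have "eventually (\<lambda>w. f w = g w) (filtermap (\<lambda>z. \<omega> * z + b) (at z))" for z
      unfolding affine_filtermap_at[OF False] using fg by (simp add: mero_eq_def)
    then have "eventually (\<lambda>w. f (\<omega> * w + b) = g (\<omega> * w + b)) (at z)" for z
      by (simp add: eventually_filtermap)
    then show ?thesis using fg False by (simp add: mero_eq_def affine_compose_meromorphic)
  qed (use fg in simp)
qed

lemma mero_affine_of:
  "\<omega> \<noteq> 0 \<Longrightarrow> f meromorphic_on UNIV \<Longrightarrow> mero_affine \<omega> b (mero_of f) = mero_of (\<lambda>z. f (\<omega> * z + b))"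
  unfolding mero_of_def by (simp add: mero_affine.abs_eq mero_eq_refl)

lemma mero_affine_compose:
  assumes "\<omega> \<noteq> 0" "\<omega>' \<noteq> 0"
  shows "mero_affine \<omega> b (mero_affine \<omega>' b' x) = mero_affine (\<omega>' * \<omega>) (\<omega>' * b + b') x"
proof -
  obtain f where f: "f meromorphic_on UNIV" "x = mero_of f" by (rule mero_of_cases)
  then show ?thesis using assms
    by (simp add: mero_affine_of affine_compose_meromorphic) (simp add: algebra_simps)
qed

lemma mero_affine_id: "mero_affine 1 0 x = x"
proof -
  obtain f where f: "f meromorphic_on UNIV" "x = mero_of f" by (rule mero_of_cases)
  then show ?thesis by (simp add: mero_affine_of)
qed

lemma mero_affine_hom: "\<omega> \<noteq> 0 \<Longrightarrow> mero_hom (mero_affine \<omega> b)"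
proof -
  assume \<omega>: "\<omega> \<noteq> 0"
  have "mero_affine \<omega> b (x + y) = mero_affine \<omega> b x + mero_affine \<omega> b y \<and>
        mero_affine \<omega> b (x * y) = mero_affine \<omega> b x * mero_affine \<omega> b y" for x y
  proof -
    obtain f where f: "f meromorphic_on UNIV" "x = mero_of f" by (rule mero_of_cases)
    obtain g where g: "g meromorphic_on UNIV" "y = mero_of g" by (rule mero_of_cases)
    have fg: "(\<lambda>z. f z + g z) meromorphic_on UNIV" "(\<lambda>z. f z * g z) meromorphic_on UNIV"
      using f(1) g(1) by (auto intro: meromorphic_on_add meromorphic_on_mult)
    have "x + y = mero_of (\<lambda>z. f z + g z)" "x * y = mero_of (\<lambda>z. f z * g z)"
      by (simp_all only: f(2) g(2) mero_of_arith[OF f(1) g(1)])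
    then show ?thesis
      by (simp add: mero_affine_of[OF \<omega> fg(1)] mero_affine_of[OF \<omega> fg(2)])
         (simp add: f(2) g(2) mero_affine_of[OF \<omega> f(1)] mero_affine_of[OF \<omega> g(1)]
           mero_of_arith[OF affine_compose_meromorphic[OF f(1)] affine_compose_meromorphic[OF g(1)]])
  qed
  moreover have "mero_affine \<omega> b (mero_const a) = mero_const a" for a
    unfolding mero_const_def by (subst mero_affine_of[OF \<omega>]) (auto intro!: meromorphic_intros)
  ultimately show ?thesis unfolding mero_hom_def by blast
qed

section \<open>Descent of invariant functions\<close>

lemma nicely_meromorphic_compose:
  assumes f: "f nicely_meromorphic_on {g z}" and g: "g holomorphic_on S" "open S" "inj_on g S" "z \<in> S"
  shows "(\<lambda>w. f (g w)) nicely_meromorphic_on {z}"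
proof -
  have fm: "filtermap g (at z) = at (g z)" by (rule inj_holomorphic_filtermap_at[OF g])
  have lim: "filterlim (\<lambda>w. f (g w)) G (at z) \<longleftrightarrow> filterlim f G (at (g z))" for G
    by (simp add: filterlim_def filtermap_filtermap flip: fm)
  have an: "g analytic_on {z}" unfolding analytic_at using g(1,2,4) by blast
  have "f meromorphic_on {g z}" using f by (simp add: nicely_meromorphic_on_def)
  then have "(\<lambda>w. f (g w)) meromorphic_on {z}" by (rule meromorphic_on_compose[OF _ an]) simp
  moreover have "(is_pole (\<lambda>w. f (g w)) z \<and> f (g z) = 0) \<or> ((\<lambda>w. f (g w)) \<midarrow>z\<rightarrow> f (g z))"
    unfolding is_pole_def lim using f by (simp add: nicely_meromorphic_on_def is_pole_def)
  ultimately show ?thesis unfolding nicely_meromorphic_on_def by simp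
qed

lemma nicely_meromorphic_on_at: "f nicely_meromorphic_on A \<longleftrightarrow> (\<forall>z\<in>A. f nicely_meromorphic_on {z})"
  unfolding nicely_meromorphic_on_def by (subst meromorphic_on_meromorphic_at) auto

text \<open>The map \<open>\<zeta> \<mapsto> \<zeta>^n\<close> takes punctured neighbourhoods of
  \<open>0\<close> onto punctured neighbourhoods of \<open>0\<close>, so limits and poles descend
  from \<open>u\<close> to \<open>v\<close>. Off \<open>0\<close>, local \<open>n\<close>-th roots
  show that \<open>v\<close> is analytic.\<close>

lemma nicely_meromorphic_power_descend:
  fixes u v :: "complex \<Rightarrow> complex"
  assumes u: "u nicely_meromorphic_on {0}" and n: "0 < n" and r: "0 < r"
    and uv: "\<And>\<zeta>. \<zeta> \<in> ball 0 r \<Longrightarrow> v (\<zeta> ^ n) = u \<zeta>"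
  shows "v nicely_meromorphic_on {0}"
proof -
  have descend: "eventually Q (at 0)" if ev: "eventually (\<lambda>\<zeta>. Q (\<zeta> ^ n)) (at 0)" for Q :: "complex \<Rightarrow> bool"
  proof -
    obtain d where d: "d > 0" "\<And>\<zeta>. \<zeta> \<noteq> 0 \<Longrightarrow> norm \<zeta> < d \<Longrightarrow> Q (\<zeta> ^ n)"
      using ev unfolding eventually_at by (auto simp: dist_norm)
    have "Q s" if "s \<noteq> 0" "norm s < d ^ n" for s
    proof -
      obtain \<zeta> where \<zeta>: "\<zeta> ^ n = s" using ex_nth_root[OF n] by blast
      then have "norm \<zeta> < d" using that(2) d(1) by (metis norm_power power_less_imp_less_base less_imp_le)
      moreover have "\<zeta> \<noteq> 0" using \<zeta> that(1) n by (auto simp: power_0_left)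
      ultimately show ?thesis using d(2) \<zeta> by blast
    qed
    then show ?thesis unfolding eventually_at using d(1) by (intro exI[of _ "d ^ n"]) (auto simp: dist_norm)
  qed
  have ev_r: "eventually (\<lambda>\<zeta>. \<zeta> \<in> ball 0 r) (at 0)" using r by (intro eventually_at_in_open') auto
  have lim: "filterlim v G (at 0)" if lim: "filterlim u G (at 0)" for G
    unfolding filterlim_iff
  proof (intro allI impI)
    fix Q assume "eventually Q G"
    then have "eventually (\<lambda>\<zeta>. Q (u \<zeta>)) (at 0)" using lim by (simp add: filterlim_iff)
    with ev_r have "eventually (\<lambda>\<zeta>. Q (v (\<zeta> ^ n))) (at 0)" by eventually_elim (simp add: uv)
    then show "eventually (\<lambda>s. Q (v s)) (at 0)" by (rule descend)
  qed
  have v0: "v 0 = u 0" using uv[of 0] r n by (simp add: power_0_left)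
  have alt: "(is_pole v 0 \<and> v 0 = 0) \<or> v \<midarrow>0\<rightarrow> v 0"
    using u lim unfolding nicely_meromorphic_on_def is_pole_def v0 by auto
  then have "not_essential v 0" by (auto simp: not_essential_def)
  moreover have "isolated_singularity_at v 0"
  proof -
    have "isolated_singularity_at u 0"
      using u by (simp add: nicely_meromorphic_on_def meromorphic_at_iff)
    then obtain d where d: "d > 0" "u analytic_on ball 0 d - {0}" by (auto simp: isolated_singularity_at_def)
    have "v analytic_on {s}" if s: "s \<in> ball 0 (min d r ^ n) - {0}" for s
    proof -
      have "open (ball 0 (min d r ^ n) - {0 :: complex})" by auto
      then obtain \<delta> where \<delta>: "\<delta> > 0" "ball s \<delta> \<subseteq> ball 0 (min d r ^ n) - {0}" using s openE by blast
      have ne: "x \<noteq> 0" if "x \<in> ball s \<delta>" for x using that \<delta>(2) by blast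
      obtain g where g: "g holomorphic_on ball s \<delta>" "\<And>x. x \<in> ball s \<delta> \<Longrightarrow> g x ^ n = x"
        using holomorphic_nth_root[OF convex_ball open_ball holomorphic_on_ident ne n] by metis
      have g_in: "g x \<in> ball 0 (min d r) - {0}" if x: "x \<in> ball s \<delta>" for x
      proof -
        have "norm (g x) ^ n < min d r ^ n" using \<delta>(2) x g(2)[OF x] by (auto simp flip: norm_power)
        then have "norm (g x) < min d r" using d(1) r by (metis less_imp_le min_less_iff_conj power_less_imp_less_base)
        moreover have "g x \<noteq> 0" using g(2)[OF x] ne[OF x] n by (auto simp: power_0_left)
        ultimately show ?thesis by simp
      qed
      have "u holomorphic_on ball 0 d - {0}" using d(2) by (rule analytic_imp_holomorphic)
      then have "(u \<circ> g) holomorphic_on ball s \<delta>"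
        by (rule holomorphic_on_compose_gen[OF g(1)]) (use g_in in auto)
      then have "v holomorphic_on ball s \<delta>"
        by (rule holomorphic_transform) (metis DiffD1 comp_apply g(2) g_in mem_ball_0 min_less_iff_conj uv)
      then show ?thesis using \<delta>(1) by (meson analytic_at centre_in_ball open_ball)
    qed
    then have "v analytic_on ball 0 (min d r ^ n) - {0}" using analytic_on_analytic_at by blast
    then show ?thesis unfolding isolated_singularity_at_def using d(1) r by (intro exI[of _ "min d r ^ n"]) simp
  qed
  ultimately show ?thesis using alt by (simp add: nicely_meromorphic_on_def meromorphic_at_iff)
qed

text \<open>The normal form \<open>u\<close> of \<open>x\<close> is constant on the fibres of
  \<open>h\<close>, since the isometries act transitively there, so it factors as
  \<open>v \<circ> h\<close>. That \<open>v\<close> is meromorphic at \<open>p\<close> follows from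
  the parameter \<open>\<tau>\<close>, in which
  \<open>v (sph p (\<zeta>^(\<nu> p))) = u (\<tau> \<zeta>)\<close>.\<close>

lemma invariant_in_pullback:
  fixes h :: "complex \<Rightarrow> complex option"
  assumes e: "0 < e"
    and inv: "\<And>\<omega> b. \<omega> ^ e = 1 \<Longrightarrow> \<forall>t. h (\<omega> * t + b) = h t \<Longrightarrow> mero_affine \<omega> b x = x"
    and trans: "\<And>t1 t2. h t1 = h t2 \<Longrightarrow> \<exists>\<omega> b. \<omega> ^ e = 1 \<and> \<omega> * t1 + b = t2 \<and> (\<forall>t. h (\<omega> * t + b) = h t)"
    and sec: "\<And>p. \<exists>r>0. \<exists>\<tau>. \<tau> holomorphic_on ball 0 r \<and> inj_on \<tau> (ball 0 r) \<and> (\<forall>\<zeta>\<in>ball 0 r. h (\<tau> \<zeta>) = sph p (\<zeta> ^ \<nu> p))"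
    and \<nu>: "\<And>p. 0 < \<nu> p"
  shows "x \<in> sphere_pullback h"
proof -
  obtain f where f: "f meromorphic_on UNIV" "x = mero_of f" by (rule mero_of_cases)
  define u where "u = remove_sings f"
  have u: "u nicely_meromorphic_on UNIV" unfolding u_def by (rule remove_sings_nicely_meromorphic[OF f(1)])
  then have um: "u meromorphic_on UNIV" by (simp add: nicely_meromorphic_on_def)
  have at: "u nicely_meromorphic_on {z}" for z using u nicely_meromorphic_on_subset by blast
  have iso: "isolated_singularity_at f z" for z
    using f(1) by (simp add: meromorphic_on_altdef)
  have "eventually (\<lambda>w. f w = u w) (at z)" for z
    using eventually_remove_sings_eq_at[OF iso[of z]] unfolding u_def by (rule eventually_mono) simp
  then have "mero_of f = mero_of u" by (rule mero_of_eqI[OF f(1)])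
  with f(2) have x: "x = mero_of u" by simp
  have inv': "u (\<omega> * t + b) = u t" if \<omega>: "\<omega> ^ e = 1" "\<forall>t. h (\<omega> * t + b) = h t" for \<omega> b t
  proof (rule nicely_meromorphic_eq_at[OF _ at])
    have ne: "\<omega> \<noteq> 0" using \<omega>(1) e by (auto simp: power_0_left)
    show "(\<lambda>t. u (\<omega> * t + b)) nicely_meromorphic_on {t}"
      by (rule nicely_meromorphic_compose[OF at, where S = UNIV]) (use ne in \<open>auto intro!: holomorphic_intros inj_onI\<close>)
    have "mero_of (\<lambda>z. u (\<omega> * z + b)) = mero_of u"
      using inv[OF \<omega>] by (simp add: x mero_affine_of[OF ne um])
    then show "eventually (\<lambda>w. u (\<omega> * w + b) = u w) (at t)"
      by (simp add: mero_of_eq_iff[OF affine_compose_meromorphic[OF um] um])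
  qed
  have u_h: "u t1 = u t2" if eq: "h t1 = h t2" for t1 t2
  proof -
    obtain \<omega> b where "\<omega> ^ e = 1" "\<omega> * t1 + b = t2" "\<forall>t. h (\<omega> * t + b) = h t" using trans[OF eq] by blast
    with inv'[of \<omega> b t1] show ?thesis by simp
  qed
  define v where "v = (\<lambda>p. u (SOME t. h t = p))"
  have v: "v (h t) = u t" for t unfolding v_def by (rule u_h) (rule someI[of _ t], rule refl)
  have v0: "(\<lambda>s. v (sph p s)) nicely_meromorphic_on {0}" for p
  proof -
    obtain r \<tau> where \<tau>: "r > 0" "\<tau> holomorphic_on ball 0 r" "inj_on \<tau> (ball 0 r)"
      "\<forall>\<zeta>\<in>ball 0 r. h (\<tau> \<zeta>) = sph p (\<zeta> ^ \<nu> p)" using sec by blast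
    have "(\<lambda>\<zeta>. u (\<tau> \<zeta>)) nicely_meromorphic_on {0}"
      by (rule nicely_meromorphic_compose[OF at \<tau>(2) open_ball \<tau>(3)]) (use \<tau>(1) in simp)
    then show ?thesis
    proof (rule nicely_meromorphic_power_descend[OF _ \<nu>[of p] \<tau>(1)])
      fix \<zeta> :: complex assume "\<zeta> \<in> ball 0 r"
      then have "h (\<tau> \<zeta>) = sph p (\<zeta> ^ \<nu> p)" using \<tau>(4) by blast
      then show "v (sph p (\<zeta> ^ \<nu> p)) = u (\<tau> \<zeta>)" using v[of "\<tau> \<zeta>"] by simp
    qed
  qed
  have fin: "(\<lambda>s. v (Some s)) nicely_meromorphic_on {a}" for a
  proof -
    have "(\<lambda>s. (\<lambda>s. v (sph (Some a) s)) (s - a)) nicely_meromorphic_on {a}"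
      by (rule nicely_meromorphic_compose[where g = "\<lambda>s. s - a" and S = UNIV])
         (use v0[of "Some a"] in \<open>auto intro!: holomorphic_intros inj_onI\<close>)
    then show ?thesis by simp
  qed
  have inf: "(\<lambda>s. v (sph None s)) nicely_meromorphic_on {a}" for a
  proof (cases "a = 0")
    case True
    then show ?thesis using v0 by simp
  next
    case False
    have "(\<lambda>s. v (Some (1 / s))) nicely_meromorphic_on {a}" if "a \<in> - {0}" for a
      by (rule nicely_meromorphic_compose[where g = "\<lambda>s. 1 / s" and f = "\<lambda>s. v (Some s)" and S = "- {0}", OF fin])
         (use that in \<open>auto intro!: holomorphic_intros inj_onI\<close>)
    then have "(\<lambda>s. v (Some (1 / s))) nicely_meromorphic_on (- {0})" by (subst nicely_meromorphic_on_at) blast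
    then have "(\<lambda>s. v (sph None s)) nicely_meromorphic_on (- {0})"
      by (rule nicely_meromorphic_on_transform) (auto simp: sph_None)
    then show ?thesis by (rule nicely_meromorphic_on_subset) (use False in auto)
  qed
  have "v \<in> meromorphic_functions riemann_sphere"
    unfolding meromorphic_functions_sphere_iff
    by (intro conjI; subst nicely_meromorphic_on_at; intro ballI; rule fin inf)
  then show ?thesis unfolding sphere_pullback_def by (rule rev_image_eqI) (simp add: v x)
qed

section \<open>The tower of a Euclidean orbifold\<close>

definition invariants :: "(complex \<times> complex) set \<Rightarrow> mero set" where
  "invariants G = {x. \<forall>(\<omega>, b)\<in>G. mero_affine \<omega> b x = x}"

lemma invariants_field:
  assumes "\<And>\<omega> b. (\<omega>, b) \<in> G \<Longrightarrow> \<omega> \<noteq> 0"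
  shows "field_closed (invariants G)" "range mero_const \<subseteq> invariants G"
proof -
  have hom: "mero_hom (mero_affine \<omega> b)" if "(\<omega>, b) \<in> G" for \<omega> b using assms[OF that] by (rule mero_affine_hom)
  have "field_closed {x \<in> UNIV. mero_affine \<omega> b x = x}" if "(\<omega>, b) \<in> G" for \<omega> b
    by (rule fixed_field[OF hom[OF that]]) (simp add: field_closed_def)
  then show "field_closed (invariants G)" unfolding invariants_def field_closed_def by fast
  show "range mero_const \<subseteq> invariants G" using mero_homD(3)[OF hom] by (auto simp: invariants_def)
qed

definition shifts :: "complex set \<Rightarrow> (complex \<times> complex) set" where
  "shifts B = {1} \<times> B"

lemma invariants_shifts: "x \<in> invariants (shifts B) \<longleftrightarrow> (\<forall>b\<in>B. mero_affine 1 b x = x)"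
  by (auto simp: invariants_def shifts_def)

lemma field_closed_shifts: "field_closed (invariants (shifts B))" "range mero_const \<subseteq> invariants (shifts B)"
  by (rule invariants_field; auto simp: shifts_def)+

lemma translation_compose: "mero_affine 1 a (mero_affine 1 b x) = mero_affine 1 (a + b) x"
  using mero_affine_compose[of 1 1] by simp

text \<open>Here \<open>R\<close> represents the translations \<open>B\<close> modulo
  \<open>N\<close>. On functions with periods \<open>N\<close> the elements of \<open>R\<close> act
  as commuting automorphisms of finite order, and a function fixed by them has all periods in
  \<open>B\<close>, so \<open>kummer\<close> applies.\<close>

lemma translation_tower:
  assumes R: "finite R" "\<And>b. b \<in> B \<Longrightarrow> \<exists>a\<in>R. b - a \<in> N" and order: "\<And>a. a \<in> R \<Longrightarrow> \<exists>p>0. of_nat p * a \<in> N"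
    and T: "root_tower q K F" "field_closed F" "invariants (shifts B) \<subseteq> F"
  shows "\<exists>F'. root_tower q K F' \<and> field_closed F' \<and> F \<subseteq> F' \<and> invariants (shifts N) \<subseteq> F'"
proof (rule kummer[where \<Sigma> = "mero_affine 1 ` R"])
  show "mero_hom \<sigma>" if "\<sigma> \<in> mero_affine 1 ` R" for \<sigma> using that mero_affine_hom[of 1] by auto
  have comm: "mero_affine 1 a (mero_affine 1 b x) = mero_affine 1 b (mero_affine 1 a x)" for a b x
    by (simp add: translation_compose add.commute)
  show "\<sigma> x \<in> invariants (shifts N)" if "\<sigma> \<in> mero_affine 1 ` R" "x \<in> invariants (shifts N)" for \<sigma> x
  proof -
    obtain a where \<sigma>: "\<sigma> = mero_affine 1 a" using \<open>\<sigma> \<in> mero_affine 1 ` R\<close> by blast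
    have "mero_affine 1 b (mero_affine 1 a x) = mero_affine 1 a x" if "b \<in> N" for b
      using comm[of b a x] \<open>x \<in> _\<close> that by (simp add: invariants_shifts)
    then show ?thesis by (simp add: invariants_shifts \<sigma>)
  qed
  show "\<exists>p>0. \<forall>x\<in>invariants (shifts N). (\<sigma> ^^ p) x = x" if \<sigma>: "\<sigma> \<in> mero_affine 1 ` R" for \<sigma>
  proof -
    obtain a where a: "\<sigma> = mero_affine 1 a" "a \<in> R" using \<sigma> by blast
    obtain p where p: "p > 0" "of_nat p * a \<in> N" using order[OF a(2)] by blast
    have "(\<sigma> ^^ k) x = mero_affine 1 (of_nat k * a) x" for k x
      by (induction k) (simp_all add: a(1) mero_affine_id translation_compose algebra_simps)
    with p show ?thesis by (intro exI[of _ p]) (simp add: invariants_shifts)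
  qed
  show "\<sigma> (\<tau> x) = \<tau> (\<sigma> x)" if "\<sigma> \<in> mero_affine 1 ` R" "\<tau> \<in> mero_affine 1 ` R" for \<sigma> \<tau> x
    using that comm by auto
  have fixed_by_B: "mero_affine 1 b x = x"
    if x: "x \<in> invariants (shifts N)" "\<forall>\<sigma>\<in>mero_affine 1 ` R. \<sigma> x = x" and b: "b \<in> B" for x b
  proof -
    obtain a where a: "a \<in> R" "b - a \<in> N" using R(2)[OF b] by blast
    have "mero_affine 1 b x = mero_affine 1 (b - a) (mero_affine 1 a x)" by (simp add: translation_compose)
    then show ?thesis using a x by (simp add: invariants_shifts)
  qed
  have "{x \<in> invariants (shifts N). \<forall>\<sigma>\<in>mero_affine 1 ` R. \<sigma> x = x} \<subseteq> invariants (shifts B)"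
  proof
    fix x assume "x \<in> {x \<in> invariants (shifts N). \<forall>\<sigma>\<in>mero_affine 1 ` R. \<sigma> x = x}"
    then have x: "x \<in> invariants (shifts N)" "\<forall>\<sigma>\<in>mero_affine 1 ` R. \<sigma> x = x" by simp_all
    show "x \<in> invariants (shifts B)" unfolding invariants_shifts[of x B] by (rule ballI) (rule fixed_by_B[OF x])
  qed
  then show "{x \<in> invariants (shifts N). \<forall>\<sigma>\<in>mero_affine 1 ` R. \<sigma> x = x} \<subseteq> F" using T(3) by (rule subset_trans)
qed (use R T field_closed_shifts in auto)

text \<open>On functions with periods \<open>B\<close>, an isometry of \<open>G\<close> acts through
  its linear part \<open>\<omega>\<close> alone, because two isometries with the same
  \<open>\<omega>\<close> differ by a translation in \<open>B\<close>. The action thus factors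
  through a finite group of roots of unity, which is commutative although \<open>G\<close> need not
  be, and Kummer theory applies.\<close>

lemma rotation_tower:
  fixes h :: "complex \<Rightarrow> 'b" and e :: nat
  defines "G \<equiv> {(\<omega>, b). \<omega> ^ e = 1 \<and> (\<forall>t. h (\<omega> * t + b) = h t)}"
    and "B \<equiv> {b. \<forall>t. h (t + b) = h t}"
  assumes e: "0 < e" and T: "root_tower q K F" "field_closed F" "invariants G \<subseteq> F"
  shows "\<exists>F'. root_tower q K F' \<and> field_closed F' \<and> F \<subseteq> F' \<and> invariants (shifts B) \<subseteq> F'"
proof -
  let ?V = "invariants (shifts B)"
  have ne: "\<omega> \<noteq> 0" if "(\<omega>, b) \<in> G" for \<omega> b using that e by (auto simp: G_def power_0_left)
  have comp: "(\<omega>' * \<omega>, \<omega>' * b + b') \<in> G" if g: "(\<omega>, b) \<in> G" "(\<omega>', b') \<in> G" for \<omega> b \<omega>' b'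
  proof -
    have "h (\<omega>' * \<omega> * t + (\<omega>' * b + b')) = h (\<omega>' * (\<omega> * t + b) + b')" for t by (simp add: algebra_simps)
    then show ?thesis using g by (simp add: G_def power_mult_distrib)
  qed
  have shift: "h (s + (b' - b)) = h s" if g: "(\<omega>, b) \<in> G" "(\<omega>, b') \<in> G" for \<omega> b b' s
  proof -
    define t where "t = (s - b) / \<omega>"
    have t: "s = \<omega> * t + b" "s + (b' - b) = \<omega> * t + b'" using ne[OF g(1)] by (auto simp: t_def)
    have "h (\<omega> * t + b) = h t" "h (\<omega> * t + b') = h t" using g unfolding G_def by blast+
    then show ?thesis unfolding t by simp
  qed
  have same: "mero_affine \<omega> b' x = mero_affine \<omega> b x" if g: "(\<omega>, b) \<in> G" "(\<omega>, b') \<in> G" and x: "x \<in> ?V" for \<omega> b b' x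
  proof -
    have "b' - b \<in> B" using shift[OF g] by (simp add: B_def)
    then have "mero_affine \<omega> b x = mero_affine \<omega> b (mero_affine 1 (b' - b) x)"
      using x by (simp add: invariants_shifts)
    also have "\<dots> = mero_affine \<omega> b' x" using mero_affine_compose[OF ne[OF g(1)], of 1] by simp
    finally show ?thesis by simp
  qed
  define \<Omega> where "\<Omega> = {\<omega>. \<exists>b. (\<omega>, b) \<in> G}"
  define \<beta> where "\<beta> = (\<lambda>\<omega>. SOME b. (\<omega>, b) \<in> G)"
  have \<beta>: "(\<omega>, \<beta> \<omega>) \<in> G" if "\<omega> \<in> \<Omega>" for \<omega> using that unfolding \<Omega>_def \<beta>_def by (auto intro: someI)
  define s where "s = (\<lambda>\<omega>. mero_affine \<omega> (\<beta> \<omega>))"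
  have "\<Omega> \<subseteq> {\<omega>. \<omega> ^ e = 1}" by (auto simp: \<Omega>_def G_def)
  then have fin: "finite \<Omega>" using finite_nth_roots[OF e] finite_subset by blast
  have s: "s \<omega> x = mero_affine \<omega> b x" if "(\<omega>, b) \<in> G" "x \<in> ?V" for \<omega> b x
    unfolding s_def using that by (intro same \<beta>) (auto simp: \<Omega>_def)
  have s_V: "s \<omega> x \<in> ?V" if \<omega>: "\<omega> \<in> \<Omega>" and x: "x \<in> ?V" for \<omega> x
    unfolding invariants_shifts
  proof
    fix b assume b: "b \<in> B"
    have 1: "(1, b) \<in> G" using b by (simp add: G_def B_def add.commute)
    have "mero_affine 1 b (s \<omega> x) = mero_affine \<omega> (\<omega> * b + \<beta> \<omega>) x"
      using mero_affine_compose[of 1 \<omega>] ne[OF \<beta>[OF \<omega>]] by (simp add: s_def)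
    also have "\<dots> = s \<omega> x" using s[OF comp[OF 1 \<beta>[OF \<omega>]] _, of x] x by simp
    finally show "mero_affine 1 b (s \<omega> x) = s \<omega> x" .
  qed
  have s_comp: "s \<omega> (s \<omega>' x) = s (\<omega>' * \<omega>) x" if \<omega>: "\<omega> \<in> \<Omega>" "\<omega>' \<in> \<Omega>" and x: "x \<in> ?V" for \<omega> \<omega>' x
    using mero_affine_compose[OF ne[OF \<beta>[OF \<omega>(1)]] ne[OF \<beta>[OF \<omega>(2)]]] s[OF comp[OF \<beta>[OF \<omega>(1)] \<beta>[OF \<omega>(2)]] x]
    by (simp add: s_def)
  have one: "(1, 0) \<in> G" by (simp add: G_def)
  show ?thesis
  proof (rule kummer[where \<Sigma> = "s ` \<Omega>"])
    show "mero_hom \<sigma>" if "\<sigma> \<in> s ` \<Omega>" for \<sigma>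
      using that mero_affine_hom[OF ne[OF \<beta>]] by (auto simp: s_def)
    show "\<sigma> x \<in> ?V" if "\<sigma> \<in> s ` \<Omega>" "x \<in> ?V" for \<sigma> x using that s_V by auto
    show "\<exists>p>0. \<forall>x\<in>?V. (\<sigma> ^^ p) x = x" if \<sigma>: "\<sigma> \<in> s ` \<Omega>" for \<sigma>
    proof -
      obtain \<omega> where \<omega>: "\<sigma> = s \<omega>" "\<omega> \<in> \<Omega>" using \<sigma> by blast
      have \<Omega>k: "\<omega> ^ k \<in> \<Omega>" for k
      proof (induction k)
        case (Suc k)
        from comp[OF \<beta>[OF Suc] \<beta>[OF \<omega>(2)]] show ?case unfolding \<Omega>_def power_Suc by blast
      qed (use one in \<open>auto simp: \<Omega>_def\<close>)
      have "(\<sigma> ^^ k) x = s (\<omega> ^ k) x" if x: "x \<in> ?V" for k x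
      proof (induction k)
        case 0
        then show ?case using s[OF one x] by (simp add: mero_affine_id)
      next
        case (Suc k)
        then show ?case using s_comp[OF \<omega>(2) \<Omega>k x, of k] by (simp add: \<omega>(1) mult.commute)
      qed
      moreover have "s (\<omega> ^ e) x = x" if "x \<in> ?V" for x
      proof -
        have "\<omega> ^ e = 1" using \<beta>[OF \<omega>(2)] by (simp add: G_def)
        then show ?thesis using s[OF one that] by (simp add: mero_affine_id)
      qed
      ultimately show ?thesis using e by (intro exI[of _ e]) auto
    qed
    show "\<sigma> (\<tau> x) = \<tau> (\<sigma> x)" if "\<sigma> \<in> s ` \<Omega>" "\<tau> \<in> s ` \<Omega>" "x \<in> ?V" for \<sigma> \<tau> x
      using that s_comp by (auto simp: mult.commute)
    have fixed_by_G: "mero_affine \<omega> b x = x" if x: "x \<in> ?V" "\<forall>\<sigma>\<in>s ` \<Omega>. \<sigma> x = x" and g: "(\<omega>, b) \<in> G" for x \<omega> b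
    proof -
      have "\<omega> \<in> \<Omega>" using g by (auto simp: \<Omega>_def)
      then show ?thesis using s[OF g x(1)] x(2) by auto
    qed
    have "{x \<in> ?V. \<forall>\<sigma>\<in>s ` \<Omega>. \<sigma> x = x} \<subseteq> invariants G"
    proof
      fix x assume "x \<in> {x \<in> ?V. \<forall>\<sigma>\<in>s ` \<Omega>. \<sigma> x = x}"
      then have x: "x \<in> ?V" "\<forall>\<sigma>\<in>s ` \<Omega>. \<sigma> x = x" by simp_all
      show "x \<in> invariants G" unfolding invariants_def[of G] using fixed_by_G[OF x] by (intro CollectI) (rule ballI, clarify)
    qed
    then show "{x \<in> ?V. \<forall>\<sigma>\<in>s ` \<Omega>. \<sigma> x = x} \<subseteq> F" using T(3) by (rule subset_trans)
  qed (use fin T field_closed_shifts in auto)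
qed

section \<open>Coverings of Euclidean type\<close>

context branched_covering
begin

text \<open>Over a noncritical value the covering is locally injective, the order \<open>k\<close>
  being \<open>1\<close>. Lifts that meet at \<open>t0\<close> therefore coincide near
  \<open>t0\<close>, and then everywhere by the identity theorem. At a branch point a common value
  would not be enough.\<close>

lemma lifts_agree:
  assumes c1: "\<And>y. hol_at M c1 y" and c2: "\<And>y. hol_at M c2 y" and f: "\<And>y. f (c1 y) = f (c2 y)"
    and t0: "c1 t0 = c2 t0" "f (c1 t0) \<notin> critical_values M riemann_sphere f"
  shows "c1 y = c2 y"
proof -
  define x where "x = c1 t0"
  have x: "x \<in> surface_points M" unfolding x_def by (rule hol_at_point[OF surf c1])
  obtain k \<theta> r where d: "disc_param M f x k \<theta> r" using ex_disc_param[OF x] by blast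
  have "k = 1" using order_dvd_index[OF x d] index_noncritical[OF t0(2)] by (simp add: x_def)
  have r: "0 < r" "\<theta> 0 = x" using d by (auto simp: disc_param_def)
  have "x \<in> \<theta> ` ball 0 r" using r by (intro image_eqI[of _ _ 0]) auto
  obtain W where W: "openin (surface_top M) W" "x \<in> W" "W = \<theta> ` ball 0 r"
    using d \<open>x \<in> \<theta> ` ball 0 r\<close> by (auto simp: disc_param_def compatible_chart_def complex_chart_def)
  obtain r1 where r1: "0 < r1" "c1 ` ball t0 r1 \<subseteq> W"
    using hol_at_preimage[OF surf c1 W(1), of t0] W(2) by (auto simp: x_def)
  obtain r2 where r2: "0 < r2" "c2 ` ball t0 r2 \<subseteq> W"
    using hol_at_preimage[OF surf c2 W(1), of t0] W(2) t0(1) by (auto simp: x_def)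
  have "eventually (\<lambda>z. z \<in> ball t0 (min r1 r2)) (at t0)" using r1(1) r2(1) by (intro eventually_at_in_open') auto
  then have ev: "eventually (\<lambda>z. c1 z = c2 z) (at t0)"
  proof eventually_elim
    case (elim z)
    then have "c1 z \<in> W" "c2 z \<in> W" using r1(2) r2(2) by (auto simp: image_subset_iff)
    then obtain \<zeta>1 \<zeta>2 where \<zeta>: "\<zeta>1 \<in> ball 0 r" "c1 z = \<theta> \<zeta>1" "\<zeta>2 \<in> ball 0 r" "c2 z = \<theta> \<zeta>2" using W(3) by auto
    have f\<theta>: "f (\<theta> \<zeta>) = sph (f x) \<zeta>" if "\<zeta> \<in> ball 0 r" for \<zeta>
      using d that \<open>k = 1\<close> by (simp add: disc_param_def)
    have "sph (f x) \<zeta>1 = sph (f x) \<zeta>2" using f[of z] f\<theta>[OF \<zeta>(1)] f\<theta>[OF \<zeta>(3)] \<zeta>(2,4) by simp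
    then show ?case using \<zeta> by simp
  qed
  have "\<forall>y\<in>UNIV. c1 y = c2 y"
    by (rule hol_at_identity[OF surf open_UNIV connected_UNIV UNIV_I c1 c2 eventually_frequently[OF at_neq_bot ev]])
  then show ?thesis by simp
qed

text \<open>The pullback of the field of the sphere consists of the invariants of the whole isometry
  group \<open>G\<close> of \<open>h\<close>. The rotation tower leads to the functions with the
  periods \<open>B\<close> of \<open>h\<close>, and the translation tower to those with the periods
  \<open>N\<close> of the lift \<open>c\<close>, among which are all \<open>u \<circ> c\<close>. The
  index of \<open>N\<close> in \<open>B\<close> is finite because fibres of \<open>f\<close> are
  finite.\<close>

theorem euclidean:
  assumes e: "0 < e" and dvd: "\<And>p. branching_index M riemann_sphere f p dvd e"
    and fin: "finite (critical_values M riemann_sphere f)"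
    and flat: "(\<Sum>p\<in>critical_values M riemann_sphere f. e - e div branching_index M riemann_sphere f p) = 2 * e"
    and P: "\<And>L F u. radical_over L F u \<Longrightarrow> P L F u"
  shows "contained_in_tower P M riemann_sphere f"
proof -
  define \<nu> where "\<nu> = branching_index M riemann_sphere f"
  have \<nu>: "0 < \<nu> p" "\<nu> p dvd e" for p using dvd e by (auto simp: \<nu>_def intro: dvd_pos_nat)
  interpret E: euclidean_orbifold \<nu> "critical_values M riemann_sphere f" e
    by unfold_locales (use \<nu> fin e flat index_noncritical in \<open>auto simp: \<nu>_def\<close>)
  obtain h where h: "\<And>y. local_power \<nu> h y" "\<And>y. hol_at riemann_sphere h y" "\<And>y. eventually (\<lambda>z. h z \<noteq> h y) (at y)"
    "\<And>t1 t2. h t1 = h t2 \<Longrightarrow> \<exists>\<omega> b. \<omega> ^ e = 1 \<and> \<omega> * t1 + b = t2 \<and> (\<forall>t. h (\<omega> * t + b) = h t)"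
    "\<And>p. \<exists>r>0. \<exists>\<tau>. \<tau> holomorphic_on ball 0 r \<and> inj_on \<tau> (ball 0 r) \<and> (\<forall>\<zeta>\<in>ball 0 r. h (\<tau> \<zeta>) = sph p (\<zeta> ^ \<nu> p))"
    using E.euclidean_map by (elim exE conjE) (rule that, (erule spec | blast)+)
  have "\<exists>c. (\<forall>y. hol_at M c y) \<and> (\<forall>y. f (c y) = h y)"
    by (rule ex_lift[of \<nu> h]) (use \<nu> h(1) in \<open>auto simp: \<nu>_def\<close>)
  then obtain c where c: "\<And>y. hol_at M c y" "\<And>y. f (c y) = h y" by blast
  define B where "B = {b. \<forall>t. h (t + b) = h t}"
  define N where "N = {b. \<forall>t. c (t + b) = c t}"
  define G where "G = {(\<omega>, b). \<omega> ^ e = 1 \<and> (\<forall>t. h (\<omega> * t + b) = h t)}"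
  have root_ne: "\<omega> \<noteq> 0" if "\<omega> ^ e = 1" for \<omega> :: complex using that e by (auto simp: power_0_left)
  have pullback: "sphere_pullback h = invariants G"
  proof
    show "sphere_pullback h \<subseteq> invariants G"
    proof
      fix x assume "x \<in> sphere_pullback h"
      then obtain v where v: "v \<in> meromorphic_functions riemann_sphere" "x = mero_of (\<lambda>z. v (h z))"
        by (auto simp: sphere_pullback_def)
      have "(\<lambda>z. v (h z)) meromorphic_on UNIV"
        using meromorphic_compose_hol_at[OF riemann_surface_sphere v(1) h(2)]
        by (subst meromorphic_on_meromorphic_at) blast
      then show "x \<in> invariants G" by (auto simp: invariants_def G_def v(2) mero_affine_of[OF root_ne])
    qed
    show "invariants G \<subseteq> sphere_pullback h"
    proof
      fix x assume x: "x \<in> invariants G"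
      show "x \<in> sphere_pullback h"
      proof (rule invariant_in_pullback[where \<nu> = \<nu> and e = e])
        show "mero_affine \<omega> b x = x" if "\<omega> ^ e = 1" "\<forall>t. h (\<omega> * t + b) = h t" for \<omega> b
          using x that by (auto simp: invariants_def G_def)
      qed (fact e h(4) h(5) \<nu>(1))+
    qed
  qed
  have "field_closed (sphere_pullback h)"
    unfolding pullback by (rule invariants_field) (use root_ne in \<open>auto simp: G_def\<close>)
  from rotation_tower[OF e root_tower.tower_refl this, of h] pullback
  obtain F where F: "root_tower False (sphere_pullback h) F" "field_closed F" "invariants (shifts B) \<subseteq> F"
    unfolding G_def B_def by blast
  obtain p where p: "p \<notin> critical_values M riemann_sphere f"
    using fin finite_imageD[of Some UNIV] infinite_UNIV_char_0[where ?'a = complex]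
    by (metis UNIV_eq_I finite_subset inj_Some subset_UNIV)
  obtain t0 where t0: "h t0 = p"
  proof -
    obtain r \<tau> where "r > 0" "\<forall>\<zeta>\<in>ball 0 r. h (\<tau> \<zeta>) = sph p (\<zeta> ^ \<nu> p)" using h(5)[of p] by blast
    then have "h (\<tau> 0) = p" using \<nu>(1)[of p] by (simp add: power_0_left)
    then show ?thesis by (rule that)
  qed
  \<comment> \<open>Translations by \<open>B\<close> move \<open>c t0\<close> within the fibre over
    the noncritical value \<open>p\<close>. Two translations with the same image differ by a period
    of \<open>c\<close>, so the fibre bounds the number of classes modulo \<open>N\<close>.\<close>
  define \<kappa> where "\<kappa> = (\<lambda>b. c (t0 + b))"
  have period: "b - a \<in> N" if ab: "a \<in> B" "b \<in> B" "\<kappa> a = \<kappa> b" for a b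
  proof -
    have "c (t + b) = c (t + a)" for t
    proof (rule lifts_agree[where ?t0.0 = t0 and ?c1.0 = "\<lambda>t. c (t + b)" and ?c2.0 = "\<lambda>t. c (t + a)"])
      show "hol_at M (\<lambda>t. c (t + b)) y" "hol_at M (\<lambda>t. c (t + a)) y" for y
        by (rule hol_at_compose[where g = "\<lambda>t. t + b", OF surf c(1)], auto intro!: analytic_intros,
            rule hol_at_compose[where g = "\<lambda>t. t + a", OF surf c(1)], auto intro!: analytic_intros)
      show "f (c (y + b)) = f (c (y + a))" for y using ab by (simp add: c(2) B_def)
      show "c (t0 + b) = c (t0 + a)" using ab(3) by (simp add: \<kappa>_def)
      show "f (c (t0 + b)) \<notin> critical_values M riemann_sphere f" using ab(2) t0 p by (simp add: c(2) B_def)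
    qed
    note eq = this
    have "c (t + (b - a)) = c t" for t using eq[of "t - a"] by (simp add: algebra_simps)
    then show ?thesis by (simp add: N_def)
  qed
  have "\<kappa> ` B \<subseteq> {x \<in> surface_points M. f x = p}"
    using hol_at_point[OF surf c(1)] t0 by (auto simp: \<kappa>_def c(2) B_def)
  then have fin\<kappa>: "finite (\<kappa> ` B)" using finite_fibre finite_subset by blast
  obtain R where R: "R \<subseteq> B" "finite R" "\<kappa> ` B = \<kappa> ` R"
    using finite_subset_image[OF fin\<kappa> subset_refl] by blast
  have "\<exists>F'. root_tower False (sphere_pullback h) F' \<and> field_closed F' \<and> F \<subseteq> F' \<and> invariants (shifts N) \<subseteq> F'"
  proof (rule translation_tower[OF R(2) _ _ F])
    fix b assume b: "b \<in> B"
    then have "\<kappa> b \<in> \<kappa> ` R" using R(3) by blast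
    then obtain a where a: "a \<in> R" "\<kappa> a = \<kappa> b" by (metis imageE)
    then show "\<exists>a\<in>R. b - a \<in> N" using period[OF _ b a(2)] R(1) by blast
  next
    fix a assume "a \<in> R"
    then have a: "\<forall>t. h (t + a) = h t" using R(1) by (auto simp: B_def)
    have mult: "of_nat k * a \<in> B" for k
    proof (induction k)
      case (Suc k)
      have "h (t + of_nat (Suc k) * a) = h t" for t
      proof -
        have "h (t + of_nat (Suc k) * a) = h ((t + of_nat k * a) + a)" by (simp add: algebra_simps)
        also have "\<dots> = h (t + of_nat k * a)" using a by blast
        also have "\<dots> = h t" using Suc unfolding B_def by blast
        finally show ?thesis .
      qed
      then show ?case unfolding B_def by blast
    qed (simp add: B_def)
    \<comment> \<open>Pigeonhole: two multiples of \<open>a\<close> have the same image in the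
      finite fibre, and their difference is a positive multiple of \<open>a\<close> lying in
      \<open>N\<close>.\<close>
    then have "range (\<lambda>k::nat. \<kappa> (of_nat k * a)) \<subseteq> \<kappa> ` B" by blast
    then have "finite (range (\<lambda>k::nat. \<kappa> (of_nat k * a)))" using fin\<kappa> finite_subset by blast
    then have "\<not> inj (\<lambda>k::nat. \<kappa> (of_nat k * a))" using finite_imageD infinite_UNIV_nat by blast
    then obtain k l where kl: "k < l" "\<kappa> (of_nat k * a) = \<kappa> (of_nat l * a)"
      unfolding inj_def by (metis nat_neq_iff)
    have "of_nat l * a - of_nat k * a \<in> N" by (rule period[OF mult mult kl(2)])
    then show "\<exists>n>0. of_nat n * a \<in> N" using kl(1)
      by (intro exI[of _ "l - k"]) (simp add: of_nat_diff left_diff_distrib)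
  qed
  then obtain F' where F': "root_tower False (sphere_pullback h) F'" "invariants (shifts N) \<subseteq> F'" by blast
  show ?thesis
  proof (rule contained_in_towerI[where c = c and h = h, OF c h(3) F'(1)])
    fix u assume u: "u \<in> meromorphic_functions M"
    have "(\<lambda>z. u (c z)) meromorphic_on UNIV"
      using meromorphic_compose_hol_at[OF surf u c(1)] by (subst meromorphic_on_meromorphic_at) blast
    then have "mero_of (\<lambda>z. u (c z)) \<in> invariants (shifts N)"
      by (simp add: invariants_shifts mero_affine_of N_def)
    then show "mero_of (\<lambda>z. u (c z)) \<in> F'" using F'(2) by blast
  qed (use P in auto)
qed

lemma euclidean_type:
  assumes type: "branching_type M riemann_sphere f = mset xs" "xs \<noteq> []" and e: "0 < e"
    and dvd: "\<forall>n\<in>set xs. n dvd e" and flat: "sum_list (map (\<lambda>n. e - e div n) xs) = 2 * e"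
    and P: "\<And>L F u. radical_over L F u \<Longrightarrow> P L F u"
  shows "contained_in_tower P M riemann_sphere f"
proof -
  obtain ps where ps: "distinct ps" "set ps = critical_values M riemann_sphere f"
    "map (branching_index M riemann_sphere f) ps = xs"
    using type by (rule branching_type_list)
  show ?thesis
  proof (rule euclidean[OF e])
    show "branching_index M riemann_sphere f p dvd e" for p
    proof (cases "p \<in> critical_values M riemann_sphere f")
      case True
      then have "branching_index M riemann_sphere f p \<in> set xs" using ps(2,3) by (metis image_eqI list.set_map)
      then show ?thesis using dvd by blast
    next
      case False
      then show ?thesis by (simp add: index_noncritical)
    qed
    show "finite (critical_values M riemann_sphere f)" by (simp flip: ps(2))
    have "(\<Sum>p\<in>set ps. e - e div branching_index M riemann_sphere f p) =
        sum_list (map (\<lambda>p. e - e div branching_index M riemann_sphere f p) ps)"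
      by (rule sum.distinct_set_conv_list[OF ps(1)])
    also have "map (\<lambda>p. e - e div branching_index M riemann_sphere f p) ps = map (\<lambda>n. e - e div n) xs"
      by (simp flip: ps(3))
    finally show "(\<Sum>p\<in>critical_values M riemann_sphere f. e - e div branching_index M riemann_sphere f p) = 2 * e"
      by (simp only: ps(2) flat)
  qed (fact P)
qed

end

theorem mainTheorem8:
  fixes M :: "'a surface" and f :: "'a \<Rightarrow> complex option"
  assumes "riemann_surface M"
    and "compact_space (surface_top M)" and "connected_space (surface_top M)"
    and "holomorphic_map M riemann_sphere f"
    and "\<not> f constant_on surface_points M"
  shows
    "((\<exists>n\<ge>2. branching_type M riemann_sphere f \<in> {{#n, n#}, {#2, 2, n#}}) \<or>
      branching_type M riemann_sphere f \<in>
        {{#2, 3, 3#}, {#2, 3, 4#}, {#2, 3, 6#}, {#3, 3, 3#}, {#2, 4, 4#}, {#2, 2, 2, 2#}}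
      \<longrightarrow> representable_by_radicals M riemann_sphere f) \<and>
     (branching_type M riemann_sphere f = {#2, 3, 5#}
      \<longrightarrow> representable_by_radicals_and_quintics M riemann_sphere f)"
proof -
  interpret branched_covering M f using assms by unfold_locales
  let ?T = "branching_type M riemann_sphere f"
  let ?C = "contained_in_tower radical_over M riemann_sphere f"
  have spherical: "?C" if "2 \<le> n" "?T = {#n, n#} \<or> ?T = {#2, 2, n#}" for n
    using that spherical_cyclic[of n radical_over] spherical_dihedral[of n radical_over] by blast
  have polyhedral: "?C" if "?T = {#2, 3, 3#} \<or> ?T = {#2, 3, 4#}"
    using that spherical_tetrahedral[of radical_over] spherical_octahedral[of radical_over] by blast
  \<comment> \<open>In each Euclidean type \<open>e\<close> is the least common multiple of the
    entries, and the flatness condition is \<open>\<Sum> (1 - 1 / n) = 2\<close> multiplied by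
    \<open>e\<close>.\<close>
  have "?C" if "?T = {#2, 3, 6#}" by (rule euclidean_type[of "[2, 3, 6]" 6]) (use that in simp_all)
  moreover have "?C" if "?T = {#3, 3, 3#}" by (rule euclidean_type[of "[3, 3, 3]" 3]) (use that in simp_all)
  moreover have "?C" if "?T = {#2, 4, 4#}" by (rule euclidean_type[of "[2, 4, 4]" 4]) (use that in simp_all)
  moreover have "?C" if "?T = {#2, 2, 2, 2#}" by (rule euclidean_type[of "[2, 2, 2, 2]" 2]) (use that in simp_all)
  moreover have "contained_in_tower (\<lambda>L F u. radical_over L F u \<or> quintic_root_over L F u) M riemann_sphere f"
    if "?T = {#2, 3, 5#}"
    by (rule spherical_icosahedral[OF that]) blast+
  ultimately show ?thesis
    unfolding representable_by_radicals_def representable_by_radicals_and_quintics_def insert_iff empty_iff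
    using spherical polyhedral by blast
qed

end
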